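(* Let $K$ be a field. There exists a finite dimensional $K$-algebra $A$ such that $A$ and its opposite algebra $A^{op}$ have the same number of $\tau$-tilting modules (up to isomorphism), but a different number of basic tilting modules (up to isomorphism).
   Context: All modules are finite dimensional left modules. Let $A$ be a finite dimensional $K$-algebra with $n$ isomorphism classes of simple modules, and let $\tau$ be the Auslander-Reiten translation of $A$. A module $T$ is $\tau$-rigid if $\mathrm{Hom}_A(T,\tau(T))=0$. It is $\tau$-tilting if it is $\tau$-rigid and is the direct sum of $n$ pairwise non-isomorphic indecomposable modules. A module $T$ is partial tilting if its projective dimension is at most one and $\mathrm{Ext}^1_A(T,T)=0$. It is tilting if it is partial tilting and the number of isomorphism classes of its indecomposable summands equals $n$. A tilting module is basic if it is the direct sum of pairwise non-isomorphic indecomposable modules. *)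

theory Defs
  imports "HOL-Algebra.AbelCoset" "HOL-Algebra.Module" "HOL-Library.Extended_Nat" "HOL-Library.Equipollence"
begin

section \<open>Finite dimensional algebras and modules\<close>

text \<open>The records \<open>('k, 'a) module\<close> of HOL-Algebra serve both for algebras over a
  field (the ring operations of the record being those of the algebra) and, with irrelevant
  \<open>mult\<close> and \<open>one\<close> fields, for modules. The library locale
  \<open>module\<close> is only available over commutative rings.\<close>

locale left_module = R?: ring R + M?: abelian_group M
  for R :: "('a, 'z) ring_scheme" (structure) and M :: "('a, 'm) module" (structure) +
  assumes smult_closed:
      "\<lbrakk>a \<in> carrier R; x \<in> carrier M\<rbrakk> \<Longrightarrow> a \<odot>\<^bsub>M\<^esub> x \<in> carrier M"
    and smult_l_distr:
      "\<lbrakk>a \<in> carrier R; b \<in> carrier R; x \<in> carrier M\<rbrakk> \<Longrightarrow>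
        (a \<oplus> b) \<odot>\<^bsub>M\<^esub> x = a \<odot>\<^bsub>M\<^esub> x \<oplus>\<^bsub>M\<^esub> b \<odot>\<^bsub>M\<^esub> x"
    and smult_r_distr:
      "\<lbrakk>a \<in> carrier R; x \<in> carrier M; y \<in> carrier M\<rbrakk> \<Longrightarrow>
        a \<odot>\<^bsub>M\<^esub> (x \<oplus>\<^bsub>M\<^esub> y) = a \<odot>\<^bsub>M\<^esub> x \<oplus>\<^bsub>M\<^esub> a \<odot>\<^bsub>M\<^esub> y"
    and smult_assoc1:
      "\<lbrakk>a \<in> carrier R; b \<in> carrier R; x \<in> carrier M\<rbrakk> \<Longrightarrow>
        (a \<otimes> b) \<odot>\<^bsub>M\<^esub> x = a \<odot>\<^bsub>M\<^esub> (b \<odot>\<^bsub>M\<^esub> x)"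
    and smult_one:
      "x \<in> carrier M \<Longrightarrow> \<one> \<odot>\<^bsub>M\<^esub> x = x"

definition finite_dimensional :: "'k ring \<Rightarrow> ('k, 'v) module \<Rightarrow> bool" where
  "finite_dimensional K V \<longleftrightarrow> Module.module K V \<and>
    (\<exists>B. finite B \<and> B \<subseteq> carrier V \<and>
      (\<forall>v\<in>carrier V. \<exists>c\<in>B \<rightarrow> carrier K. v = (\<Oplus>\<^bsub>V\<^esub>b\<in>B. c b \<odot>\<^bsub>V\<^esub> b)))"

definition fd_algebra :: "'k ring \<Rightarrow> ('k, 'a) module \<Rightarrow> bool" where
  "fd_algebra K A \<longleftrightarrow> field K \<and> ring A \<and> finite_dimensional K A \<and>
    (\<forall>c\<in>carrier K. \<forall>x\<in>carrier A. \<forall>y\<in>carrier A.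
      c \<odot>\<^bsub>A\<^esub> (x \<otimes>\<^bsub>A\<^esub> y) = (c \<odot>\<^bsub>A\<^esub> x) \<otimes>\<^bsub>A\<^esub> y \<and>
      c \<odot>\<^bsub>A\<^esub> (x \<otimes>\<^bsub>A\<^esub> y) = x \<otimes>\<^bsub>A\<^esub> (c \<odot>\<^bsub>A\<^esub> y))"

definition opposite :: "('k, 'a) module \<Rightarrow> ('k, 'a) module" where
  "opposite A = A\<lparr>monoid.mult := \<lambda>x y. y \<otimes>\<^bsub>A\<^esub> x\<rparr>"

text \<open>The vector space over the ground field underlying a module over the algebra \<open>A\<close>.\<close>

definition restrict_scalars :: "('k, 'a) module \<Rightarrow> ('a, 'm) module \<Rightarrow> ('k, 'm) module" where
  "restrict_scalars A M =
    \<lparr>carrier = carrier M, monoid.mult = monoid.mult M, one = one M,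
     ring.zero = ring.zero M, add = add M,
     smult = (\<lambda>c x. (c \<odot>\<^bsub>A\<^esub> \<one>\<^bsub>A\<^esub>) \<odot>\<^bsub>M\<^esub> x)\<rparr>"

definition fd_module :: "'k ring \<Rightarrow> ('k, 'a) module \<Rightarrow> ('a, 'm) module \<Rightarrow> bool" where
  "fd_module K A M \<longleftrightarrow> left_module A M \<and> finite_dimensional K (restrict_scalars A M)"

text \<open>Modules with carrier in \<open>nat \<Rightarrow> 'k\<close>, the type over which all quantifiers over modules
  range. Every \<open>d\<close>-dimensional module is isomorphic to one whose carrier consists of the
  coordinate vectors supported on \<open>{..<d}\<close>, so every finite dimensional module
  occurs here up to isomorphism.\<close>

type_synonym ('k, 'a) fmod = "('a, nat \<Rightarrow> 'k) module"

section \<open>Homomorphisms and constructions\<close>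

definition module_Hom ::
    "('a, 'z) ring_scheme \<Rightarrow> ('a, 'm) module \<Rightarrow> ('a, 'n) module \<Rightarrow> ('m \<Rightarrow> 'n) set" where
  "module_Hom R M N = {f \<in> carrier M \<rightarrow>\<^sub>E carrier N.
    (\<forall>x\<in>carrier M. \<forall>y\<in>carrier M. f (x \<oplus>\<^bsub>M\<^esub> y) = f x \<oplus>\<^bsub>N\<^esub> f y) \<and>
    (\<forall>a\<in>carrier R. \<forall>x\<in>carrier M. f (a \<odot>\<^bsub>M\<^esub> x) = a \<odot>\<^bsub>N\<^esub> f x)}"

definition Hom_vanishes ::
    "('a, 'z) ring_scheme \<Rightarrow> ('a, 'm) module \<Rightarrow> ('a, 'n) module \<Rightarrow> bool" where
  "Hom_vanishes R M N \<longleftrightarrow> module_Hom R M N = {\<lambda>x\<in>carrier M. \<zero>\<^bsub>N\<^esub>}"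

definition module_iso ::
    "('a, 'z) ring_scheme \<Rightarrow> ('a, 'm) module \<Rightarrow> ('a, 'n) module \<Rightarrow> bool" where
  "module_iso R M N \<longleftrightarrow> (\<exists>f\<in>module_Hom R M N. bij_betw f (carrier M) (carrier N))"

definition iso_classes ::
    "('a, 'z) ring_scheme \<Rightarrow> ('a, 'm) module set \<Rightarrow> ('a, 'm) module set set" where
  "iso_classes R S = S // {(M, N). M \<in> S \<and> N \<in> S \<and> module_iso R M N}"

definition zero_module :: "('a, 'm) module \<Rightarrow> bool" where
  "zero_module M \<longleftrightarrow> carrier M = {\<zero>\<^bsub>M\<^esub>}"

definition regular :: "('a, 'z) ring_scheme \<Rightarrow> ('a, 'a) module" where
  "regular R = \<lparr>carrier = carrier R, monoid.mult = monoid.mult R, one = one R,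
     ring.zero = ring.zero R, add = add R, smult = monoid.mult R\<rparr>"

definition binary_sum :: "('a, 'm) module \<Rightarrow> ('a, 'n) module \<Rightarrow> ('a, 'm \<times> 'n) module" where
  "binary_sum M N =
    \<lparr>carrier = carrier M \<times> carrier N, monoid.mult = undefined, one = undefined,
     ring.zero = (\<zero>\<^bsub>M\<^esub>, \<zero>\<^bsub>N\<^esub>),
     add = (\<lambda>(x, y) (x', y'). (x \<oplus>\<^bsub>M\<^esub> x', y \<oplus>\<^bsub>N\<^esub> y')),
     smult = (\<lambda>a (x, y). (a \<odot>\<^bsub>M\<^esub> x, a \<odot>\<^bsub>N\<^esub> y))\<rparr>"

definition family_sum :: "'i set \<Rightarrow> ('i \<Rightarrow> ('a, 'm) module) \<Rightarrow> ('a, 'i \<Rightarrow> 'm) module" where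
  "family_sum I F =
    \<lparr>carrier = (\<Pi>\<^sub>E i\<in>I. carrier (F i)), monoid.mult = undefined, one = undefined,
     ring.zero = (\<lambda>i\<in>I. \<zero>\<^bsub>F i\<^esub>),
     add = (\<lambda>f g. \<lambda>i\<in>I. f i \<oplus>\<^bsub>F i\<^esub> g i),
     smult = (\<lambda>a f. \<lambda>i\<in>I. a \<odot>\<^bsub>F i\<^esub> f i)\<rparr>"

definition quotient_module :: "('a, 'm) module \<Rightarrow> 'm set \<Rightarrow> ('a, 'm set) module" where
  "quotient_module M U =
    \<lparr>carrier = a_rcosets\<^bsub>M\<^esub> U, monoid.mult = undefined, one = undefined, ring.zero = U,
     add = set_add M, smult = (\<lambda>a C. \<Union>x\<in>C. U +>\<^bsub>M\<^esub> (a \<odot>\<^bsub>M\<^esub> x))\<rparr>"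

text \<open>Right modules over \<open>A\<close> are treated as left modules over \<open>opposite A\<close>. The
  following is the right module of homomorphisms from a left module to \<open>A\<close>.\<close>

definition ring_dual :: "('k, 'a) module \<Rightarrow> ('a, 'm) module \<Rightarrow> ('a, 'm \<Rightarrow> 'a) module" where
  "ring_dual A M =
    \<lparr>carrier = module_Hom A M (regular A), monoid.mult = undefined, one = undefined,
     ring.zero = (\<lambda>x\<in>carrier M. \<zero>\<^bsub>A\<^esub>),
     add = (\<lambda>f g. \<lambda>x\<in>carrier M. f x \<oplus>\<^bsub>A\<^esub> g x),
     smult = (\<lambda>a f. \<lambda>x\<in>carrier M. f x \<otimes>\<^bsub>A\<^esub> a)\<rparr>"

text \<open>The \<open>K\<close>-dual of a left \<open>B\<close>-module, a left module over \<open>opposite B\<close>.\<close>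

definition field_dual ::
    "'k ring \<Rightarrow> ('k, 'a) module \<Rightarrow> ('a, 'm) module \<Rightarrow> ('a, 'm \<Rightarrow> 'k) module" where
  "field_dual K B M =
    \<lparr>carrier = module_Hom K (restrict_scalars B M) (regular K),
     monoid.mult = undefined, one = undefined, ring.zero = (\<lambda>x\<in>carrier M. \<zero>\<^bsub>K\<^esub>),
     add = (\<lambda>f g. \<lambda>x\<in>carrier M. f x \<oplus>\<^bsub>K\<^esub> g x),
     smult = (\<lambda>a f. \<lambda>x\<in>carrier M. f (a \<odot>\<^bsub>M\<^esub> x))\<rparr>"

section \<open>Simple, indecomposable and projective modules\<close>

definition simple_module :: "'k ring \<Rightarrow> ('k, 'a) module \<Rightarrow> ('k, 'a) fmod \<Rightarrow> bool" where
  "simple_module K A S \<longleftrightarrow> fd_module K A S \<and> \<not> zero_module S \<and>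
    (\<forall>U. submodule U A S \<longrightarrow> U = {\<zero>\<^bsub>S\<^esub>} \<or> U = carrier S)"

definition num_simples :: "'k ring \<Rightarrow> ('k, 'a) module \<Rightarrow> nat" where
  "num_simples K A = card (iso_classes A {S. simple_module K A S})"

definition direct_summand ::
    "'k ring \<Rightarrow> ('k, 'a) module \<Rightarrow> ('k, 'a) fmod \<Rightarrow> ('k, 'a) fmod \<Rightarrow> bool" where
  "direct_summand K A N M \<longleftrightarrow> fd_module K A N \<and>
    (\<exists>L :: ('k, 'a) fmod. fd_module K A L \<and> module_iso A M (binary_sum N L))"

definition indecomposable :: "'k ring \<Rightarrow> ('k, 'a) module \<Rightarrow> ('k, 'a) fmod \<Rightarrow> bool" where
  "indecomposable K A M \<longleftrightarrow> fd_module K A M \<and> \<not> zero_module M \<and>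
    (\<forall>(N :: ('k, 'a) fmod) (L :: ('k, 'a) fmod). fd_module K A N \<and> fd_module K A L \<and>
      module_iso A M (binary_sum N L) \<longrightarrow> zero_module N \<or> zero_module L)"

definition sum_of_distinct_indecomposables ::
    "'k ring \<Rightarrow> ('k, 'a) module \<Rightarrow> nat \<Rightarrow> ('k, 'a) fmod \<Rightarrow> bool" where
  "sum_of_distinct_indecomposables K A m M \<longleftrightarrow>
    (\<exists>F :: nat \<Rightarrow> ('k, 'a) fmod. (\<forall>i<m. indecomposable K A (F i)) \<and>
      (\<forall>i<m. \<forall>j<m. i \<noteq> j \<longrightarrow> \<not> module_iso A (F i) (F j)) \<and>
      module_iso A M (family_sum {..<m} F))"

definition projective :: "'k ring \<Rightarrow> ('k, 'a) module \<Rightarrow> ('k, 'a) fmod \<Rightarrow> bool" where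
  "projective K A P \<longleftrightarrow> fd_module K A P \<and>
    (\<forall>(M :: ('k, 'a) fmod) (N :: ('k, 'a) fmod).
      fd_module K A M \<and> fd_module K A N \<longrightarrow>
      (\<forall>g\<in>module_Hom A M N. \<forall>f\<in>module_Hom A P N. g ` carrier M = carrier N \<longrightarrow>
        (\<exists>h\<in>module_Hom A P M. \<forall>x\<in>carrier P. g (h x) = f x)))"

definition projective_resolution ::
    "'k ring \<Rightarrow> ('k, 'a) module \<Rightarrow> ('k, 'a) fmod \<Rightarrow> (nat \<Rightarrow> ('k, 'a) fmod) \<Rightarrow>
      (nat \<Rightarrow> (nat \<Rightarrow> 'k) \<Rightarrow> nat \<Rightarrow> 'k) \<Rightarrow> ((nat \<Rightarrow> 'k) \<Rightarrow> nat \<Rightarrow> 'k) \<Rightarrow> bool" where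
  "projective_resolution K A M P d e \<longleftrightarrow>
    (\<forall>i. projective K A (P i)) \<and>
    e \<in> module_Hom A (P 0) M \<and> e ` carrier (P 0) = carrier M \<and>
    (\<forall>i. d i \<in> module_Hom A (P (Suc i)) (P i)) \<and>
    d 0 ` carrier (P 1) = a_kernel (P 0) M e \<and>
    (\<forall>i. d (Suc i) ` carrier (P (Suc (Suc i))) = a_kernel (P (Suc i)) (P i) (d i))"

text \<open>The infimum of the empty set is \<open>\<infinity>\<close>.\<close>

definition projective_dimension ::
    "'k ring \<Rightarrow> ('k, 'a) module \<Rightarrow> ('k, 'a) fmod \<Rightarrow> enat" where
  "projective_dimension K A M =
    Inf {enat m | m. \<exists>P d e. projective_resolution K A M P d e \<and> (\<forall>i>m. zero_module (P i))}"

section \<open>Extensions\<close>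

definition extension ::
    "'k ring \<Rightarrow> ('k, 'a) module \<Rightarrow> ('k, 'a) fmod \<Rightarrow> ('k, 'a) fmod \<Rightarrow> ('k, 'a) fmod \<Rightarrow>
      ((nat \<Rightarrow> 'k) \<Rightarrow> nat \<Rightarrow> 'k) \<Rightarrow> ((nat \<Rightarrow> 'k) \<Rightarrow> nat \<Rightarrow> 'k) \<Rightarrow> bool" where
  "extension K A M N E i p \<longleftrightarrow> fd_module K A E \<and>
    i \<in> module_Hom A N E \<and> inj_on i (carrier N) \<and>
    p \<in> module_Hom A E M \<and> p ` carrier E = carrier M \<and>
    i ` carrier N = a_kernel E M p"

text \<open>\<open>Ext\<^sup>1(M, N)\<close> is the Yoneda group of extensions \<open>0 \<rightarrow> N \<rightarrow> E \<rightarrow> M \<rightarrow> 0\<close> up to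
  equivalence; its zero element is the class of \<open>0 \<rightarrow> N \<rightarrow> N \<oplus> M \<rightarrow> M \<rightarrow> 0\<close>.\<close>

definition Ext1_vanishes ::
    "'k ring \<Rightarrow> ('k, 'a) module \<Rightarrow> ('k, 'a) fmod \<Rightarrow> ('k, 'a) fmod \<Rightarrow> bool" where
  "Ext1_vanishes K A M N \<longleftrightarrow>
    (\<forall>E i p. extension K A M N E i p \<longrightarrow>
      (\<exists>h\<in>module_Hom A E (binary_sum N M). bij_betw h (carrier E) (carrier N \<times> carrier M) \<and>
        (\<forall>x\<in>carrier N. h (i x) = (x, \<zero>\<^bsub>M\<^esub>)) \<and>
        (\<forall>y\<in>carrier E. snd (h y) = p y)))"

section \<open>The Auslander-Reiten translation\<close>

text \<open>A projective cover is an epimorphism from a projective module with superfluous kernel.\<close>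

definition projective_cover ::
    "'k ring \<Rightarrow> ('k, 'a) module \<Rightarrow> ('k, 'a) fmod \<Rightarrow> ('k, 'a) fmod \<Rightarrow>
      ((nat \<Rightarrow> 'k) \<Rightarrow> nat \<Rightarrow> 'k) \<Rightarrow> bool" where
  "projective_cover K A M P p \<longleftrightarrow> projective K A P \<and>
    p \<in> module_Hom A P M \<and> p ` carrier P = carrier M \<and>
    (\<forall>U. submodule U A P \<and> U <+>\<^bsub>P\<^esub> a_kernel P M p = carrier P \<longrightarrow> U = carrier P)"

text \<open>A minimal projective presentation \<open>P1 \<rightarrow> P0 \<rightarrow> M \<rightarrow> 0\<close>, with maps \<open>f\<close> and \<open>p\<close>.\<close>

definition minimal_presentation ::
    "'k ring \<Rightarrow> ('k, 'a) module \<Rightarrow> ('k, 'a) fmod \<Rightarrow> ('k, 'a) fmod \<Rightarrow>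
      ((nat \<Rightarrow> 'k) \<Rightarrow> nat \<Rightarrow> 'k) \<Rightarrow> ('k, 'a) fmod \<Rightarrow> ((nat \<Rightarrow> 'k) \<Rightarrow> nat \<Rightarrow> 'k) \<Rightarrow> bool" where
  "minimal_presentation K A M P1 f P0 p \<longleftrightarrow>
    projective_cover K A M P0 p \<and>
    projective_cover K A (P0\<lparr>carrier := a_kernel P0 M p\<rparr>) P1 f"

text \<open>The cokernel of \<open>Hom(f, A) : Hom(P0, A) \<rightarrow> Hom(P1, A)\<close>, a left module over
  \<open>opposite A\<close>.\<close>

definition transpose_of ::
    "('k, 'a) module \<Rightarrow> ('a, 'm) module \<Rightarrow> ('m \<Rightarrow> 'm) \<Rightarrow> ('a, 'm) module \<Rightarrow>
      ('a, ('m \<Rightarrow> 'a) set) module" where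
  "transpose_of A P1 f P0 =
    quotient_module (ring_dual A P1)
      ((\<lambda>\<phi>. compose (carrier P1) \<phi> f) ` carrier (ring_dual A P0))"

text \<open>\<open>\<tau> M = D Tr M\<close>. Up to isomorphism it does not depend on the chosen minimal
  projective presentation.\<close>

definition tau ::
    "'k ring \<Rightarrow> ('k, 'a) module \<Rightarrow> ('k, 'a) fmod \<Rightarrow>
      ('a, ((nat \<Rightarrow> 'k) \<Rightarrow> 'a) set \<Rightarrow> 'k) module" where
  "tau K A M =
    (let (P1, f, P0) = (SOME (P1, f, P0). \<exists>p. minimal_presentation K A M P1 f P0 p)
     in field_dual K (opposite A) (transpose_of A P1 f P0))"

section \<open>Tilting and \<open>\<tau>\<close>-tilting modules\<close>

definition tau_rigid :: "'k ring \<Rightarrow> ('k, 'a) module \<Rightarrow> ('k, 'a) fmod \<Rightarrow> bool" where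
  "tau_rigid K A T \<longleftrightarrow> fd_module K A T \<and> Hom_vanishes A T (tau K A T)"

definition tau_tilting :: "'k ring \<Rightarrow> ('k, 'a) module \<Rightarrow> ('k, 'a) fmod \<Rightarrow> bool" where
  "tau_tilting K A T \<longleftrightarrow> tau_rigid K A T \<and>
    sum_of_distinct_indecomposables K A (num_simples K A) T"

definition partial_tilting :: "'k ring \<Rightarrow> ('k, 'a) module \<Rightarrow> ('k, 'a) fmod \<Rightarrow> bool" where
  "partial_tilting K A T \<longleftrightarrow> fd_module K A T \<and> projective_dimension K A T \<le> 1 \<and>
    Ext1_vanishes K A T T"

definition tilting :: "'k ring \<Rightarrow> ('k, 'a) module \<Rightarrow> ('k, 'a) fmod \<Rightarrow> bool" where
  "tilting K A T \<longleftrightarrow> partial_tilting K A T \<and>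
    card (iso_classes A {M. indecomposable K A M \<and> direct_summand K A M T}) = num_simples K A"

definition basic_tilting :: "'k ring \<Rightarrow> ('k, 'a) module \<Rightarrow> ('k, 'a) fmod \<Rightarrow> bool" where
  "basic_tilting K A T \<longleftrightarrow> tilting K A T \<and> (\<exists>m. sum_of_distinct_indecomposables K A m T)"

end

theory Submission
  imports Defs
begin

text \<open>Take the quiver with two vertices, a loop \<open>x\<close> at the first vertex and an arrow \<open>a\<close> from the first
  vertex to the second, modulo all paths of length two. The opposite algebra has the arrow reversed.
  For a minimal projective presentation \<open>P1 \<rightarrow> P0 \<rightarrow> T \<rightarrow> 0\<close>, the module \<open>T\<close> is \<open>\<tau>\<close>-rigid if and only if every
  homomorphism \<open>P1 \<rightarrow> T\<close> factors through \<open>P0\<close>. Choosing homomorphisms with prescribed values on top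
  elements of \<open>P1\<close> shows that elements of \<open>T\<close> annihilated by certain arrows are divisible by arrows. For either
  algebra this leaves only three indecomposable modules and exactly two \<open>\<tau>\<close>-tilting modules: the regular module
  and one more, which is \<open>P(1) \<oplus> K[x]/(x\<^sup>2)\<close> for the algebra and \<open>P(2) \<oplus> S(2)\<close> for its opposite.
  The module \<open>K[x]/(x\<^sup>2)\<close> is the quotient of \<open>P(1)\<close> by the projective module \<open>S(2)\<close>,
  so that both modules are tilting over the algebra. Over the opposite algebra, left multiplication by \<open>z = x + a\<close>
  has equal image and kernel on projective modules, hence on all modules of projective dimension
  at most one, but not on \<open>S(2)\<close>; there the regular module is the only basic tilting module.\<close>

section \<open>Left modules\<close>

text \<open>\<open>tau\<close> is built from a presentation fixed by choice and from two duals, so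
  it cannot be computed directly. The bridge is Hom(T, \<tau> T) = D(Tr T \<otimes> T), where Tr T
  \<otimes> T is the cokernel of Hom(P0, T) \<rightarrow> Hom(P1, T); dual bases and rank-one
  homomorphisms play the role of the tensor product. All distinctions between modules have one form,
  \<open>divisible_on\<close>: whatever certain elements annihilate is a multiple of another
  element. This form passes to retracts and direct sums, and for projective modules it is read off
  from the regular module. An indecomposable module is recognised by splitting off a cyclic model: a
  K-linear functional is expanded by hand into a homomorphism to the model, and an element of the
  module gives the map back. The definitions quantify over modules with carrier in
  \<open>nat \<Rightarrow> 'k\<close>; therefore direct sums are transported back to this type, and
  quotients of the algebra are realised inside the algebra.\<close>

context left_module
begin

lemmas scalar_closed [simp, intro] = smult_closed

lemmas scalar_one [simp] = smult_one

lemma scalar_zero_right [simp]: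
  assumes "a \<in> carrier R"
  shows "a \<odot>\<^bsub>M\<^esub> \<zero>\<^bsub>M\<^esub> = \<zero>\<^bsub>M\<^esub>"
proof -
  have "a \<odot>\<^bsub>M\<^esub> \<zero>\<^bsub>M\<^esub> = a \<odot>\<^bsub>M\<^esub> \<zero>\<^bsub>M\<^esub> \<oplus>\<^bsub>M\<^esub> a \<odot>\<^bsub>M\<^esub> \<zero>\<^bsub>M\<^esub>"
    using smult_r_distr[OF assms, of "\<zero>\<^bsub>M\<^esub>" "\<zero>\<^bsub>M\<^esub>"] by simp
  with assms show ?thesis
    by (metis M.add.r_cancel_one' M.zero_closed scalar_closed)
qed

lemma scalar_zero_left [simp]:
  assumes "m \<in> carrier M"
  shows "\<zero> \<odot>\<^bsub>M\<^esub> m = \<zero>\<^bsub>M\<^esub>"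
proof -
  have "\<zero> \<odot>\<^bsub>M\<^esub> m = \<zero> \<odot>\<^bsub>M\<^esub> m \<oplus>\<^bsub>M\<^esub> \<zero> \<odot>\<^bsub>M\<^esub> m"
    using smult_l_distr[OF _ _ assms, of \<zero> \<zero>] by simp
  with assms show ?thesis
    by (metis M.add.r_cancel_one' R.zero_closed scalar_closed)
qed

lemma scalar_minus_left:
  assumes "a \<in> carrier R" "m \<in> carrier M"
  shows "(\<ominus> a) \<odot>\<^bsub>M\<^esub> m = \<ominus>\<^bsub>M\<^esub> (a \<odot>\<^bsub>M\<^esub> m)"
proof -
  have "(\<ominus> a) \<odot>\<^bsub>M\<^esub> m \<oplus>\<^bsub>M\<^esub> a \<odot>\<^bsub>M\<^esub> m = \<zero>\<^bsub>M\<^esub>"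
    using smult_l_distr[of "\<ominus> a" a m] assms by (simp add: R.l_neg)
  then show ?thesis
    using assms M.minus_equality by simp
qed

lemma scalar_minus_right:
  assumes "a \<in> carrier R" "m \<in> carrier M"
  shows "a \<odot>\<^bsub>M\<^esub> (\<ominus>\<^bsub>M\<^esub> m) = \<ominus>\<^bsub>M\<^esub> (a \<odot>\<^bsub>M\<^esub> m)"
proof -
  have "a \<odot>\<^bsub>M\<^esub> (\<ominus>\<^bsub>M\<^esub> m) \<oplus>\<^bsub>M\<^esub> a \<odot>\<^bsub>M\<^esub> m = \<zero>\<^bsub>M\<^esub>"
    using smult_r_distr[of a "\<ominus>\<^bsub>M\<^esub> m" m] assms by (simp add: M.l_neg)
  then show ?thesis
    using assms M.minus_equality by simp
qed

lemma minus_eq_scalar: "m \<in> carrier M \<Longrightarrow> \<ominus>\<^bsub>M\<^esub> m = (\<ominus> \<one>) \<odot>\<^bsub>M\<^esub> m"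
  by (simp add: scalar_minus_left)

lemma scalar_diff:
  assumes "a \<in> carrier R" "m \<in> carrier M" "n \<in> carrier M"
  shows "a \<odot>\<^bsub>M\<^esub> (m \<ominus>\<^bsub>M\<^esub> n) = a \<odot>\<^bsub>M\<^esub> m \<ominus>\<^bsub>M\<^esub> a \<odot>\<^bsub>M\<^esub> n"
  using assms by (simp add: a_minus_def smult_r_distr scalar_minus_right)

lemma diff_eq_zero_iff:
  assumes "m \<in> carrier M" "n \<in> carrier M"
  shows "m \<ominus>\<^bsub>M\<^esub> n = \<zero>\<^bsub>M\<^esub> \<longleftrightarrow> m = n"
  using assms M.minus_equality[of m "\<ominus>\<^bsub>M\<^esub> n"] M.minus_minus M.r_neg
  by (auto simp: a_minus_def)

lemma diff_add_cancel:
  assumes "m \<in> carrier M" "n \<in> carrier M"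
  shows "(m \<ominus>\<^bsub>M\<^esub> n) \<oplus>\<^bsub>M\<^esub> n = m" "n \<oplus>\<^bsub>M\<^esub> (m \<ominus>\<^bsub>M\<^esub> n) = m" "(m \<oplus>\<^bsub>M\<^esub> n) \<ominus>\<^bsub>M\<^esub> n = m"
proof -
  show 1: "(m \<ominus>\<^bsub>M\<^esub> n) \<oplus>\<^bsub>M\<^esub> n = m" "(m \<oplus>\<^bsub>M\<^esub> n) \<ominus>\<^bsub>M\<^esub> n = m"
    using assms by (simp_all add: a_minus_def M.a_assoc M.l_neg M.r_neg)
  show "n \<oplus>\<^bsub>M\<^esub> (m \<ominus>\<^bsub>M\<^esub> n) = m"
    using 1(1) assms by (simp add: M.a_comm[of n])
qed

lemma submoduleI:
  assumes "U \<subseteq> carrier M" "\<zero>\<^bsub>M\<^esub> \<in> U"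
    and "\<And>m n. m \<in> U \<Longrightarrow> n \<in> U \<Longrightarrow> m \<oplus>\<^bsub>M\<^esub> n \<in> U"
    and "\<And>a m. a \<in> carrier R \<Longrightarrow> m \<in> U \<Longrightarrow> a \<odot>\<^bsub>M\<^esub> m \<in> U"
  shows "submodule U R M"
proof -
  have "\<ominus>\<^bsub>M\<^esub> m \<in> U" if "m \<in> U" for m
    using that assms(1,4) minus_eq_scalar by (metis R.a_inv_closed R.one_closed subsetD)
  then show ?thesis
    using assms by (intro submodule.intro subgroup.intro submodule_axioms.intro)
      (auto simp: a_inv_def)
qed

lemma submoduleD:
  assumes "submodule U R M"
  shows "U \<subseteq> carrier M" "\<zero>\<^bsub>M\<^esub> \<in> U"
    and "\<And>m n. m \<in> U \<Longrightarrow> n \<in> U \<Longrightarrow> m \<oplus>\<^bsub>M\<^esub> n \<in> U"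
    and "\<And>a m. a \<in> carrier R \<Longrightarrow> m \<in> U \<Longrightarrow> a \<odot>\<^bsub>M\<^esub> m \<in> U"
    and "\<And>m. m \<in> U \<Longrightarrow> \<ominus>\<^bsub>M\<^esub> m \<in> U"
    and "\<And>m n. m \<in> U \<Longrightarrow> n \<in> U \<Longrightarrow> m \<ominus>\<^bsub>M\<^esub> n \<in> U"
proof -
  interpret submodule U R M by fact
  interpret additive_subgroup U M
    by (rule additive_subgroupI) (rule subgroup_axioms)
  show "U \<subseteq> carrier M" "\<zero>\<^bsub>M\<^esub> \<in> U"
    and "\<And>m n. m \<in> U \<Longrightarrow> n \<in> U \<Longrightarrow> m \<oplus>\<^bsub>M\<^esub> n \<in> U"
    and "\<And>a m. a \<in> carrier R \<Longrightarrow> m \<in> U \<Longrightarrow> a \<odot>\<^bsub>M\<^esub> m \<in> U"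
    and "\<And>m. m \<in> U \<Longrightarrow> \<ominus>\<^bsub>M\<^esub> m \<in> U"
    and "\<And>m n. m \<in> U \<Longrightarrow> n \<in> U \<Longrightarrow> m \<ominus>\<^bsub>M\<^esub> n \<in> U"
    using a_subset by (auto simp: a_minus_def)
qed

end

text \<open>Additive inverses enter only through (-1) u + u = 0, so a concrete module can be
  verified without exhibiting an inverse operation.\<close>

lemma left_moduleI:
  fixes R (structure) and M (structure)
  assumes "ring R"
    and "\<And>u v. u \<in> carrier M \<Longrightarrow> v \<in> carrier M \<Longrightarrow> u \<oplus>\<^bsub>M\<^esub> v \<in> carrier M"
    and "\<zero>\<^bsub>M\<^esub> \<in> carrier M"
    and "\<And>u v w. u \<in> carrier M \<Longrightarrow> v \<in> carrier M \<Longrightarrow> w \<in> carrier M \<Longrightarrow>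
      (u \<oplus>\<^bsub>M\<^esub> v) \<oplus>\<^bsub>M\<^esub> w = u \<oplus>\<^bsub>M\<^esub> (v \<oplus>\<^bsub>M\<^esub> w)"
    and "\<And>u v. u \<in> carrier M \<Longrightarrow> v \<in> carrier M \<Longrightarrow> u \<oplus>\<^bsub>M\<^esub> v = v \<oplus>\<^bsub>M\<^esub> u"
    and "\<And>u. u \<in> carrier M \<Longrightarrow> \<zero>\<^bsub>M\<^esub> \<oplus>\<^bsub>M\<^esub> u = u"
    and "\<And>u. u \<in> carrier M \<Longrightarrow> (\<ominus> \<one>) \<odot>\<^bsub>M\<^esub> u \<oplus>\<^bsub>M\<^esub> u = \<zero>\<^bsub>M\<^esub>"
    and "\<And>a u. a \<in> carrier R \<Longrightarrow> u \<in> carrier M \<Longrightarrow> a \<odot>\<^bsub>M\<^esub> u \<in> carrier M"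
    and "\<And>a b u. a \<in> carrier R \<Longrightarrow> b \<in> carrier R \<Longrightarrow> u \<in> carrier M \<Longrightarrow>
        (a \<oplus> b) \<odot>\<^bsub>M\<^esub> u = a \<odot>\<^bsub>M\<^esub> u \<oplus>\<^bsub>M\<^esub> b \<odot>\<^bsub>M\<^esub> u"
    and "\<And>a u v. a \<in> carrier R \<Longrightarrow> u \<in> carrier M \<Longrightarrow> v \<in> carrier M \<Longrightarrow>
        a \<odot>\<^bsub>M\<^esub> (u \<oplus>\<^bsub>M\<^esub> v) = a \<odot>\<^bsub>M\<^esub> u \<oplus>\<^bsub>M\<^esub> a \<odot>\<^bsub>M\<^esub> v"
    and "\<And>a b u. a \<in> carrier R \<Longrightarrow> b \<in> carrier R \<Longrightarrow> u \<in> carrier M \<Longrightarrow>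
        (a \<otimes> b) \<odot>\<^bsub>M\<^esub> u = a \<odot>\<^bsub>M\<^esub> (b \<odot>\<^bsub>M\<^esub> u)"
    and "\<And>u. u \<in> carrier M \<Longrightarrow> \<one> \<odot>\<^bsub>M\<^esub> u = u"
  shows "left_module R M"
proof -
  interpret R: ring R by fact
  have "abelian_group M"
  proof (rule abelian_groupI)
    fix u assume "u \<in> carrier M"
    then show "\<exists>v\<in>carrier M. v \<oplus>\<^bsub>M\<^esub> u = \<zero>\<^bsub>M\<^esub>"
      using assms(7) assms(8)[OF R.a_inv_closed[OF R.one_closed]] by blast
  qed (use assms(2-6) in blast)+
  then show ?thesis
    using assms by (intro left_module.intro left_module_axioms.intro) auto
qed

lemma submodule_left_module:
  assumes "left_module R M" "submodule U R M"
  shows "left_module R (M\<lparr>carrier := U\<rparr>)"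
proof -
  interpret left_module R M by fact
  note U = submoduleD[OF assms(2)]
  have [simp]: "u \<in> carrier M" if "u \<in> U" for u using U(1) that by blast
  show ?thesis
    by (rule left_moduleI)
      (auto simp: U R.ring_axioms M.a_assoc M.l_neg smult_l_distr smult_r_distr smult_assoc1 scalar_minus_left
        intro: M.a_comm)
qed

lemma module_iff_left_module: "Module.module K V \<longleftrightarrow> cring K \<and> left_module K V"
  unfolding Module.module_def left_module_def module_axioms_def left_module_axioms_def cring_def
  by auto

subsection \<open>Homomorphisms\<close>

lemma module_HomD:
  assumes "f \<in> module_Hom R M N"
  shows "\<And>m. m \<in> carrier M \<Longrightarrow> f m \<in> carrier N"
    and "\<And>m n. m \<in> carrier M \<Longrightarrow> n \<in> carrier M \<Longrightarrow> f (m \<oplus>\<^bsub>M\<^esub> n) = f m \<oplus>\<^bsub>N\<^esub> f n"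
    and "\<And>a m. a \<in> carrier R \<Longrightarrow> m \<in> carrier M \<Longrightarrow> f (a \<odot>\<^bsub>M\<^esub> m) = a \<odot>\<^bsub>N\<^esub> f m"
    and "f \<in> extensional (carrier M)"
  using assms by (auto simp: module_Hom_def PiE_def)

lemma module_Hom_eqI:
  assumes "f \<in> module_Hom R M N" "g \<in> module_Hom R M N" "\<And>m. m \<in> carrier M \<Longrightarrow> f m = g m"
  shows "f = g"
  using assms module_HomD(4) by (metis extensionalityI)

lemma module_HomI:
  assumes "left_module R M"
    and "\<And>m. m \<in> carrier M \<Longrightarrow> f m \<in> carrier N"
    and "\<And>m n. m \<in> carrier M \<Longrightarrow> n \<in> carrier M \<Longrightarrow> f (m \<oplus>\<^bsub>M\<^esub> n) = f m \<oplus>\<^bsub>N\<^esub> f n"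
    and "\<And>a m. a \<in> carrier R \<Longrightarrow> m \<in> carrier M \<Longrightarrow> f (a \<odot>\<^bsub>M\<^esub> m) = a \<odot>\<^bsub>N\<^esub> f m"
  shows "restrict f (carrier M) \<in> module_Hom R M N"
proof -
  interpret left_module R M by fact
  show ?thesis
    using assms by (auto simp: module_Hom_def)
qed

lemma module_Hom_zero:
  assumes "left_module R M" "left_module R N" "f \<in> module_Hom R M N"
  shows "f \<zero>\<^bsub>M\<^esub> = \<zero>\<^bsub>N\<^esub>"
proof -
  interpret M: left_module R M by fact
  interpret N: left_module R N by fact
  note f = module_HomD[OF assms(3)]
  show ?thesis
    using f(3)[of "\<zero>\<^bsub>R\<^esub>" "\<zero>\<^bsub>M\<^esub>"] f(1)[of "\<zero>\<^bsub>M\<^esub>"] by simp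
qed

lemma module_Hom_diff:
  assumes "left_module R M" "left_module R N" "f \<in> module_Hom R M N"
    and "m \<in> carrier M" "n \<in> carrier M"
  shows "f (m \<ominus>\<^bsub>M\<^esub> n) = f m \<ominus>\<^bsub>N\<^esub> f n"
proof -
  interpret M: left_module R M by fact
  interpret N: left_module R N by fact
  note f = module_HomD[OF assms(3)]
  show ?thesis
    using assms(4,5) f by (simp add: a_minus_def M.minus_eq_scalar N.minus_eq_scalar)
qed

lemma module_Hom_compose:
  assumes "left_module R M" "f \<in> module_Hom R M N" "g \<in> module_Hom R N L"
  shows "restrict (\<lambda>m. g (f m)) (carrier M) \<in> module_Hom R M L"
  using module_HomD[OF assms(2)] module_HomD[OF assms(3)]
  by (intro module_HomI[OF assms(1)]) simp_all

lemma module_Hom_id: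
  assumes "left_module R M"
  shows "restrict (\<lambda>m. m) (carrier M) \<in> module_Hom R M M"
  by (intro module_HomI[OF assms]) simp_all

lemma module_Hom_add:
  assumes "left_module R M" "left_module R N" "f \<in> module_Hom R M N" "g \<in> module_Hom R M N"
  shows "(\<lambda>m\<in>carrier M. f m \<oplus>\<^bsub>N\<^esub> g m) \<in> module_Hom R M N"
proof -
  interpret N: left_module R N by fact
  note f = module_HomD[OF assms(3)] and g = module_HomD[OF assms(4)]
  show ?thesis
    by (rule module_HomI[OF assms(1)])
      (simp_all add: f g N.smult_r_distr N.M.a_ac)
qed

lemma module_Hom_zero_map:
  assumes "left_module R M" "left_module R N"
  shows "(\<lambda>m\<in>carrier M. \<zero>\<^bsub>N\<^esub>) \<in> module_Hom R M N"
proof -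
  interpret N: left_module R N by fact
  show ?thesis by (rule module_HomI[OF assms(1)]) simp_all
qed

lemma in_a_kernel_iff: "m \<in> a_kernel M N f \<longleftrightarrow> m \<in> carrier M \<and> f m = \<zero>\<^bsub>N\<^esub>"
  by (simp add: a_kernel_def kernel_def)

lemma submodule_a_kernel:
  assumes "left_module R M" "left_module R N" "f \<in> module_Hom R M N"
  shows "submodule (a_kernel M N f) R M"
proof -
  interpret M: left_module R M by fact
  interpret N: left_module R N by fact
  note f = module_HomD[OF assms(3)]
  show ?thesis
    by (rule M.submoduleI) (auto simp: in_a_kernel_iff f module_Hom_zero[OF assms])
qed

lemma submodule_image:
  assumes "left_module R M" "left_module R N" "f \<in> module_Hom R M N" "submodule U R M"
  shows "submodule (f ` U) R N"
proof -
  interpret M: left_module R M by fact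
  interpret N: left_module R N by fact
  note f = module_HomD[OF assms(3)] and U = M.submoduleD[OF assms(4)]
  have Uc: "u \<in> carrier M" if "u \<in> U" for u using that U by blast
  show ?thesis
  proof (rule N.submoduleI)
    show "\<zero>\<^bsub>N\<^esub> \<in> f ` U" using U(2) module_Hom_zero[OF assms(1-3)] by force
  next
    fix m n assume "m \<in> f ` U" "n \<in> f ` U"
    then show "m \<oplus>\<^bsub>N\<^esub> n \<in> f ` U"
      using U f(2) Uc by (auto simp flip: f(2))
  next
    fix a m assume "a \<in> carrier R" "m \<in> f ` U"
    then show "a \<odot>\<^bsub>N\<^esub> m \<in> f ` U"
      using U Uc by (auto simp flip: f(3))
  qed (use f Uc in auto)
qed

lemma submodule_preimage:
  assumes "left_module R M" "left_module R N" "f \<in> module_Hom R M N" "submodule U R N"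
  shows "submodule {m \<in> carrier M. f m \<in> U} R M"
proof -
  interpret M: left_module R M by fact
  interpret N: left_module R N by fact
  note f = module_HomD[OF assms(3)] and U = N.submoduleD[OF assms(4)]
  show ?thesis
    by (rule M.submoduleI) (auto simp: f U module_Hom_zero[OF assms(1-3)])
qed

lemma module_Hom_inclusion:
  assumes "left_module R M" "submodule U R M"
  shows "restrict (\<lambda>m. m) U \<in> module_Hom R (M\<lparr>carrier := U\<rparr>) M"
proof -
  interpret M: left_module R M by fact
  note U = M.submoduleD[OF assms(2)]
  show ?thesis
    using module_HomI[OF submodule_left_module[OF assms], of "\<lambda>m. m" M] U(1) by auto
qed

lemma module_Hom_from_submodule_codomain:
  assumes "f \<in> module_Hom R M (N\<lparr>carrier := U\<rparr>)" "U \<subseteq> carrier N"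
  shows "f \<in> module_Hom R M N"
  using assms by (auto simp: module_Hom_def PiE_def)

subsection \<open>Isomorphisms and retracts\<close>

lemma module_isoI:
  assumes "f \<in> module_Hom R M N" "g \<in> module_Hom R N M"
    and "\<And>m. m \<in> carrier M \<Longrightarrow> g (f m) = m" "\<And>n. n \<in> carrier N \<Longrightarrow> f (g n) = n"
  shows "module_iso R M N"
  unfolding module_iso_def
proof (rule bexI[OF _ assms(1)], rule bij_betw_byWitness[where f' = g])
  show "f ` carrier M \<subseteq> carrier N" "g ` carrier N \<subseteq> carrier M"
    using module_HomD(1)[OF assms(1)] module_HomD(1)[OF assms(2)] by auto
qed (use assms(3,4) in auto)

lemma module_isoE:
  assumes "module_iso R M N" "left_module R M" "left_module R N"
  obtains f g where "f \<in> module_Hom R M N" "g \<in> module_Hom R N M"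
    "\<And>m. m \<in> carrier M \<Longrightarrow> g (f m) = m" "\<And>n. n \<in> carrier N \<Longrightarrow> f (g n) = n"
proof -
  interpret M: left_module R M by fact
  interpret N: left_module R N by fact
  obtain f where f: "f \<in> module_Hom R M N" and b: "bij_betw f (carrier M) (carrier N)"
    using assms(1) by (auto simp: module_iso_def)
  define g where "g = restrict (the_inv_into (carrier M) f) (carrier N)"
  have gf: "g (f m) = m" if "m \<in> carrier M" for m
    using that b f module_HomD(1)[OF f]
    by (auto simp: g_def bij_betw_def the_inv_into_f_f)
  have fg: "f (g n) = n" and gc: "g n \<in> carrier M" if "n \<in> carrier N" for n
    using that b by (auto simp: g_def bij_betw_def f_the_inv_into_f the_inv_into_into)
  have inj: "m = m'" if "m \<in> carrier M" "m' \<in> carrier M" "f m = f m'" for m m'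
    using that b by (auto simp: bij_betw_def inj_on_def)
  have "restrict g (carrier N) \<in> module_Hom R N M"
    by (rule module_HomI[OF assms(3)]; (rule inj)?)
      (simp_all add: fg gc module_HomD[OF f])
  then have "g \<in> module_Hom R N M" by (simp add: g_def)
  then show thesis using that f gf fg by blast
qed

lemma module_iso_refl: "left_module R M \<Longrightarrow> module_iso R M M"
  by (rule module_isoI[OF module_Hom_id module_Hom_id]) auto

lemma module_iso_sym:
  assumes "module_iso R M N" "left_module R M" "left_module R N"
  shows "module_iso R N M"
  using module_isoE[OF assms] module_isoI by metis

lemma module_iso_trans:
  assumes "module_iso R M N" "module_iso R N L" "left_module R M"
  shows "module_iso R M L"
proof -
  obtain f g where f: "f \<in> module_Hom R M N" "bij_betw f (carrier M) (carrier N)"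
    and g: "g \<in> module_Hom R N L" "bij_betw g (carrier N) (carrier L)"
    using assms by (auto simp: module_iso_def)
  have "bij_betw (restrict (\<lambda>m. g (f m)) (carrier M)) (carrier M) (carrier L)"
    using bij_betw_trans[OF f(2) g(2)] by (simp add: o_def cong: bij_betw_cong)
  then show ?thesis
    unfolding module_iso_def using module_Hom_compose[OF assms(3) f(1) g(1)] by blast
qed

text \<open>A summand described by inclusion and projection, without choosing a complement. The
  carriers may have different types, so the notion also relates a module to a
  \<open>family_sum\<close> containing it.\<close>

definition retract_of ::
    "('a, 'z) ring_scheme \<Rightarrow> ('a, 'm) module \<Rightarrow> ('a, 'n) module \<Rightarrow> bool" where
  "retract_of R N M \<longleftrightarrow>
    (\<exists>i\<in>module_Hom R N M. \<exists>r\<in>module_Hom R M N. \<forall>n\<in>carrier N. r (i n) = n)"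

lemma retract_ofI:
  assumes "i \<in> module_Hom R N M" "r \<in> module_Hom R M N" "\<And>n. n \<in> carrier N \<Longrightarrow> r (i n) = n"
  shows "retract_of R N M"
  using assms by (auto simp: retract_of_def)

lemma module_iso_retract:
  assumes "module_iso R M N" "left_module R M" "left_module R N"
  shows "retract_of R M N" "retract_of R N M"
  using module_isoE[OF assms] retract_ofI by metis+

lemma retract_of_trans:
  assumes "retract_of R L N" "retract_of R N M" "left_module R L" "left_module R M"
  shows "retract_of R L M"
proof -
  obtain i r where i: "i \<in> module_Hom R L N" and r: "r \<in> module_Hom R N L"
    and ri: "\<forall>n\<in>carrier L. r (i n) = n"
    using assms(1) by (auto simp: retract_of_def)
  obtain i' r' where i': "i' \<in> module_Hom R N M" and r': "r' \<in> module_Hom R M N"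
    and ri': "\<forall>n\<in>carrier N. r' (i' n) = n"
    using assms(2) by (auto simp: retract_of_def)
  show ?thesis
    by (rule retract_ofI[OF module_Hom_compose[OF assms(3) i i'] module_Hom_compose[OF assms(4) r' r]])
      (use ri ri' module_HomD(1)[OF i] module_HomD(1)[OF i'] in simp)
qed

definition divisible_on :: "('a, 'm) module \<Rightarrow> 'a set \<Rightarrow> 'a \<Rightarrow> bool" where
  "divisible_on M L s \<longleftrightarrow> (\<forall>m\<in>carrier M. (\<forall>r\<in>L. r \<odot>\<^bsub>M\<^esub> m = \<zero>\<^bsub>M\<^esub>) \<longrightarrow>
    (\<exists>m'\<in>carrier M. m = s \<odot>\<^bsub>M\<^esub> m'))"

text \<open>The inclusion preserves annihilation, the division is done in the larger module, and the
  projection returns the quotient to the retract.\<close>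

lemma divisible_on_retract:
  assumes "retract_of R N M" "left_module R M" "left_module R N"
    and "divisible_on M L s" "L \<subseteq> carrier R" "s \<in> carrier R"
  shows "divisible_on N L s"
  unfolding divisible_on_def
proof (intro ballI impI)
  fix n assume n: "n \<in> carrier N" "\<forall>r\<in>L. r \<odot>\<^bsub>N\<^esub> n = \<zero>\<^bsub>N\<^esub>"
  obtain i r where i: "i \<in> module_Hom R N M" and r: "r \<in> module_Hom R M N"
    and ri: "\<forall>n\<in>carrier N. r (i n) = n"
    using assms(1) by (auto simp: retract_of_def)
  have "\<forall>q\<in>L. q \<odot>\<^bsub>M\<^esub> i n = \<zero>\<^bsub>M\<^esub>"
    using n assms(5) module_Hom_zero[OF assms(3,2) i] by (auto simp flip: module_HomD(3)[OF i])
  then obtain m where "m \<in> carrier M" "i n = s \<odot>\<^bsub>M\<^esub> m"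
    using assms(4) module_HomD(1)[OF i n(1)] by (auto simp: divisible_on_def)
  then have "n = s \<odot>\<^bsub>N\<^esub> r m"
    using ri n(1) assms(6) by (metis module_HomD(3)[OF r])
  then show "\<exists>m'\<in>carrier N. n = s \<odot>\<^bsub>N\<^esub> m'"
    using module_HomD(1)[OF r \<open>m \<in> carrier M\<close>] by blast
qed

lemma annihilated_retract:
  assumes "retract_of R N M" "left_module R M" "left_module R N"
    and "\<forall>m\<in>carrier M. s \<odot>\<^bsub>M\<^esub> m = \<zero>\<^bsub>M\<^esub>" "s \<in> carrier R" "n \<in> carrier N"
  shows "s \<odot>\<^bsub>N\<^esub> n = \<zero>\<^bsub>N\<^esub>"
proof -
  obtain i r where i: "i \<in> module_Hom R N M" and r: "r \<in> module_Hom R M N"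
    and ri: "\<forall>n\<in>carrier N. r (i n) = n"
    using assms(1) by (auto simp: retract_of_def)
  interpret N: left_module R N by fact
  have "s \<odot>\<^bsub>N\<^esub> n = r (i (s \<odot>\<^bsub>N\<^esub> n))"
    using ri assms by simp
  also have "\<dots> = r \<zero>\<^bsub>M\<^esub>"
    using assms module_HomD[OF i] by simp
  finally show ?thesis using module_Hom_zero[OF assms(2,3) r] by simp
qed

subsection \<open>Direct sums\<close>

lemma binary_sum_simps [simp]:
  "carrier (binary_sum M N) = carrier M \<times> carrier N"
  "\<zero>\<^bsub>binary_sum M N\<^esub> = (\<zero>\<^bsub>M\<^esub>, \<zero>\<^bsub>N\<^esub>)"
  "u \<oplus>\<^bsub>binary_sum M N\<^esub> v = (fst u \<oplus>\<^bsub>M\<^esub> fst v, snd u \<oplus>\<^bsub>N\<^esub> snd v)"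
  "a \<odot>\<^bsub>binary_sum M N\<^esub> u = (a \<odot>\<^bsub>M\<^esub> fst u, a \<odot>\<^bsub>N\<^esub> snd u)"
  by (auto simp: binary_sum_def split: prod.splits)

lemma left_module_binary_sum:
  assumes "left_module R M" "left_module R N"
  shows "left_module R (binary_sum M N)"
proof -
  interpret M: left_module R M by fact
  interpret N: left_module R N by fact
  show ?thesis
    by (rule left_moduleI)
      (auto simp: M.R.ring_axioms M.M.a_ac N.M.a_ac M.M.r_neg N.M.r_neg M.M.l_neg N.M.l_neg M.scalar_minus_left N.scalar_minus_left
        M.smult_l_distr N.smult_l_distr M.smult_r_distr N.smult_r_distr M.smult_assoc1 N.smult_assoc1)
qed

lemma binary_sum_homs:
  assumes "left_module R M" "left_module R N"
  shows "restrict fst (carrier (binary_sum M N)) \<in> module_Hom R (binary_sum M N) M"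
    and "restrict snd (carrier (binary_sum M N)) \<in> module_Hom R (binary_sum M N) N"
    and "(\<lambda>m\<in>carrier M. (m, \<zero>\<^bsub>N\<^esub>)) \<in> module_Hom R M (binary_sum M N)"
    and "(\<lambda>n\<in>carrier N. (\<zero>\<^bsub>M\<^esub>, n)) \<in> module_Hom R N (binary_sum M N)"
proof -
  interpret M: left_module R M by fact
  interpret N: left_module R N by fact
  note S = left_module_binary_sum[OF assms]
  show "restrict fst (carrier (binary_sum M N)) \<in> module_Hom R (binary_sum M N) M"
    by (rule module_HomI[OF S]) auto
  show "restrict snd (carrier (binary_sum M N)) \<in> module_Hom R (binary_sum M N) N"
    by (rule module_HomI[OF S]) auto
  show "(\<lambda>m\<in>carrier M. (m, \<zero>\<^bsub>N\<^esub>)) \<in> module_Hom R M (binary_sum M N)"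
    by (rule module_HomI[OF assms(1)]) auto
  show "(\<lambda>n\<in>carrier N. (\<zero>\<^bsub>M\<^esub>, n)) \<in> module_Hom R N (binary_sum M N)"
    by (rule module_HomI[OF assms(2)]) auto
qed

lemma retract_of_binary_sum:
  assumes "left_module R M" "left_module R N"
  shows "retract_of R M (binary_sum M N)" "retract_of R N (binary_sum M N)"
proof -
  interpret M: left_module R M by fact
  interpret N: left_module R N by fact
  show "retract_of R M (binary_sum M N)"
    by (rule retract_ofI[OF binary_sum_homs(3,1)[OF assms]]) auto
  show "retract_of R N (binary_sum M N)"
    by (rule retract_ofI[OF binary_sum_homs(4,2)[OF assms]]) auto
qed

lemma divisible_on_binary_sum:
  assumes "divisible_on M L s" "divisible_on N L s"
  shows "divisible_on (binary_sum M N) L s"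
  unfolding divisible_on_def
proof (intro ballI impI)
  fix u assume u: "u \<in> carrier (binary_sum M N)"
    "\<forall>r\<in>L. r \<odot>\<^bsub>binary_sum M N\<^esub> u = \<zero>\<^bsub>binary_sum M N\<^esub>"
  obtain m where "m \<in> carrier M" "fst u = s \<odot>\<^bsub>M\<^esub> m"
    using assms(1) u unfolding divisible_on_def by (metis binary_sum_simps mem_Times_iff prod.inject)
  moreover obtain n where "n \<in> carrier N" "snd u = s \<odot>\<^bsub>N\<^esub> n"
    using assms(2) u unfolding divisible_on_def by (metis binary_sum_simps mem_Times_iff prod.inject)
  ultimately show "\<exists>v\<in>carrier (binary_sum M N). u = s \<odot>\<^bsub>binary_sum M N\<^esub> v"
    by (intro bexI[of _ "(m, n)"]) (auto simp: prod_eq_iff)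
qed

lemma module_iso_binary_sum_cong:
  assumes "module_iso R M M'" "module_iso R N N'"
    and "left_module R M" "left_module R M'" "left_module R N" "left_module R N'"
  shows "module_iso R (binary_sum M N) (binary_sum M' N')"
proof -
  obtain f f' where f: "f \<in> module_Hom R M M'" "f' \<in> module_Hom R M' M"
    "\<And>m. m \<in> carrier M \<Longrightarrow> f' (f m) = m" "\<And>n. n \<in> carrier M' \<Longrightarrow> f (f' n) = n"
    using module_isoE[OF assms(1,3,4)] by metis
  obtain g g' where g: "g \<in> module_Hom R N N'" "g' \<in> module_Hom R N' N"
    "\<And>m. m \<in> carrier N \<Longrightarrow> g' (g m) = m" "\<And>n. n \<in> carrier N' \<Longrightarrow> g (g' n) = n"
    using module_isoE[OF assms(2,5,6)] by metis
  note h = module_HomD[OF f(1)] module_HomD[OF f(2)] module_HomD[OF g(1)] module_HomD[OF g(2)]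
  have "restrict (\<lambda>u. (f (fst u), g (snd u))) (carrier (binary_sum M N))
      \<in> module_Hom R (binary_sum M N) (binary_sum M' N')"
    by (rule module_HomI[OF left_module_binary_sum]) (use assms in \<open>auto simp: h\<close>)
  moreover have "restrict (\<lambda>u. (f' (fst u), g' (snd u))) (carrier (binary_sum M' N'))
      \<in> module_Hom R (binary_sum M' N') (binary_sum M N)"
    by (rule module_HomI[OF left_module_binary_sum]) (use assms in \<open>auto simp: h\<close>)
  ultimately show ?thesis
    by (rule module_isoI) (auto simp: h f g)
qed

lemma module_iso_binary_sum_swap:
  assumes "left_module R M" "left_module R N"
  shows "module_iso R (binary_sum M N) (binary_sum N M)"
proof -
  have "restrict prod.swap (carrier (binary_sum M N)) \<in> module_Hom R (binary_sum M N) (binary_sum N M)"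
    by (rule module_HomI[OF left_module_binary_sum]) (use assms in auto)
  moreover have "restrict prod.swap (carrier (binary_sum N M)) \<in> module_Hom R (binary_sum N M) (binary_sum M N)"
    by (rule module_HomI[OF left_module_binary_sum]) (use assms in auto)
  ultimately show ?thesis
    by (rule module_isoI) auto
qed

lemma left_module_family_sum:
  assumes "ring R" "\<And>i. i \<in> I \<Longrightarrow> left_module R (F i)"
  shows "left_module R (family_sum I F)"
proof -
  interpret R: ring R by fact
  note m = left_module.axioms(2)[OF assms(2)]
  have neg: "\<And>i u. i \<in> I \<Longrightarrow> u \<in> carrier (F i) \<Longrightarrow>
      (\<ominus>\<^bsub>R\<^esub> \<one>\<^bsub>R\<^esub>) \<odot>\<^bsub>F i\<^esub> u \<oplus>\<^bsub>F i\<^esub> u = \<zero>\<^bsub>F i\<^esub>"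
    using left_module.minus_eq_scalar[OF assms(2)] abelian_group.l_neg[OF m] by metis
  note s = abelian_groupE(1,2,3)[OF m] abelian_groupE(5)[OF m] left_module.smult_closed[OF assms(2)] neg
    left_module.smult_l_distr[OF assms(2)] left_module.smult_r_distr[OF assms(2)]
    left_module.smult_assoc1[OF assms(2)] left_module.smult_one[OF assms(2)]
  have c: "\<And>i u v. i \<in> I \<Longrightarrow> u \<in> carrier (F i) \<Longrightarrow> v \<in> carrier (F i) \<Longrightarrow> u \<oplus>\<^bsub>F i\<^esub> v = v \<oplus>\<^bsub>F i\<^esub> u"
    using abelian_groupE(4)[OF m] by blast
  show ?thesis
    by (rule left_moduleI)
      (auto simp: family_sum_def PiE_iff extensional_def fun_eq_iff assms(1) s restrict_def intro: c)
qed

lemma retract_of_family_sum: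
  assumes "ring R" "\<And>i. i \<in> I \<Longrightarrow> left_module R (F i)" "j \<in> I"
  shows "retract_of R (F j) (family_sum I F)"
proof -
  note S = left_module_family_sum[OF assms(1,2)]
  note z = abelian_group.axioms(1)[OF left_module.axioms(2)[OF assms(2)]]
  have l0: "\<And>i. i \<in> I \<Longrightarrow> \<zero>\<^bsub>F i\<^esub> \<oplus>\<^bsub>F i\<^esub> \<zero>\<^bsub>F i\<^esub> = \<zero>\<^bsub>F i\<^esub>" "\<And>i. i \<in> I \<Longrightarrow> \<zero>\<^bsub>F i\<^esub> \<in> carrier (F i)"
    using abelian_monoid.l_zero[OF z] abelian_monoid.zero_closed[OF z] by auto
  have "restrict (\<lambda>m. \<lambda>i\<in>I. if i = j then m else \<zero>\<^bsub>F i\<^esub>) (carrier (F j))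
    \<in> module_Hom R (F j) (family_sum I F)"
    by (rule module_HomI[OF assms(2)[OF assms(3)]])
      (use assms(3) l0 left_module.scalar_zero_right[OF assms(2)] in
        \<open>auto simp: family_sum_def restrict_def fun_eq_iff\<close>)
  moreover have "restrict (\<lambda>u. u j) (carrier (family_sum I F)) \<in> module_Hom R (family_sum I F) (F j)"
    by (rule module_HomI[OF S]) (use assms(3) in \<open>auto simp: family_sum_def\<close>)
  ultimately show ?thesis
    by (rule retract_ofI) (use assms(3) l0 in \<open>auto simp: family_sum_def\<close>)
qed

lemma module_iso_family_sum_two:
  assumes "ring R" "left_module R (F 0)" "left_module R (F 1)"
  shows "module_iso R (binary_sum (F 0) (F 1)) (family_sum {..<2::nat} F)"
proof -
  have lt: "i < 2 \<longleftrightarrow> i = 0 \<or> i = 1" for i :: nat by auto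
  have S: "left_module R (family_sum {..<2} F)"
    by (rule left_module_family_sum) (use assms in \<open>auto simp: lt\<close>)
  have B: "left_module R (binary_sum (F 0) (F 1))"
    by (rule left_module_binary_sum) (use assms in auto)
  have "restrict (\<lambda>u. \<lambda>i\<in>{..<2}. if i = 0 then fst u else snd u) (carrier (binary_sum (F 0) (F 1)))
    \<in> module_Hom R (binary_sum (F 0) (F 1)) (family_sum {..<2} F)"
    by (rule module_HomI[OF B]) (auto simp: family_sum_def fun_eq_iff lt)
  moreover have "restrict (\<lambda>f. (f 0, f 1)) (carrier (family_sum {..<2} F))
    \<in> module_Hom R (family_sum {..<2} F) (binary_sum (F 0) (F 1))"
    by (rule module_HomI[OF S]) (auto simp: family_sum_def PiE_iff lt)
  ultimately show ?thesis
    by (rule module_isoI) (auto simp: family_sum_def lt PiE_iff extensional_def fun_eq_iff)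
qed

lemma (in abelian_group) minus_eq_zero_iff:
  assumes "m \<in> carrier G" "n \<in> carrier G"
  shows "m \<ominus> n = \<zero> \<longleftrightarrow> m = n"
  using assms minus_equality[of m "\<ominus> n"] minus_minus r_neg
  by (auto simp: a_minus_def)

context left_module
begin

lemma add_add_swap:
  assumes "a \<in> carrier M" "b \<in> carrier M" "c \<in> carrier M" "d \<in> carrier M"
  shows "(a \<oplus>\<^bsub>M\<^esub> b) \<oplus>\<^bsub>M\<^esub> (c \<oplus>\<^bsub>M\<^esub> d) = (a \<oplus>\<^bsub>M\<^esub> c) \<oplus>\<^bsub>M\<^esub> (b \<oplus>\<^bsub>M\<^esub> d)"
  using assms by (simp add: M.a_ac)

lemma diff_eq_diff_swap:
  assumes "u \<in> carrier M" "v \<in> carrier M" "p \<in> carrier M" "q \<in> carrier M"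
    and "p \<ominus>\<^bsub>M\<^esub> q = u \<ominus>\<^bsub>M\<^esub> v"
  shows "u \<ominus>\<^bsub>M\<^esub> p = v \<ominus>\<^bsub>M\<^esub> q"
proof -
  have "u = (p \<ominus>\<^bsub>M\<^esub> q) \<oplus>\<^bsub>M\<^esub> v" using assms diff_add_cancel(1) by simp
  also have "\<dots> = (v \<ominus>\<^bsub>M\<^esub> q) \<oplus>\<^bsub>M\<^esub> p"
    using assms(1-4) by (simp add: a_minus_def M.a_ac)
  finally show ?thesis using assms(1-4) diff_add_cancel(3) by simp
qed

end

section \<open>Linear algebra\<close>

text \<open>Zorn yields a submodule W maximal among those meeting U only in zero. It is a
  complement: for v outside U + W the larger W + K v would still meet U only in zero. The projection
  is the U-component of the resulting unique decomposition.\<close>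

lemma exists_linear_projection:
  assumes "field K" "left_module K V" "submodule U K V"
  obtains \<pi> where "\<pi> \<in> module_Hom K V V" "\<And>v. v \<in> carrier V \<Longrightarrow> \<pi> v \<in> U" "\<And>u. u \<in> U \<Longrightarrow> \<pi> u = u"
proof -
  interpret K: field K by fact
  interpret V: left_module K V by fact
  note U = V.submoduleD[OF assms(3)]
  define \<W> where "\<W> = {W. submodule W K V \<and> W \<inter> U \<subseteq> {\<zero>\<^bsub>V\<^esub>}}"
  have ne: "\<W> \<noteq> {}"
  proof -
    have "submodule {\<zero>\<^bsub>V\<^esub>} K V" by (rule V.submoduleI) auto
    then show ?thesis by (auto simp: \<W>_def)
  qed
  have "\<exists>W\<in>\<W>. \<forall>X\<in>\<W>. W \<subseteq> X \<longrightarrow> X = W"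
  proof (rule subset_Zorn_nonempty[OF ne])
    fix C assume C: "C \<noteq> {}" "subset.chain \<W> C"
    have mem: "submodule W K V" "W \<inter> U \<subseteq> {\<zero>\<^bsub>V\<^esub>}" if "W \<in> C" for W
      using C(2) that by (auto simp: subset.chain_def \<W>_def)
    note S = V.submoduleD[OF mem(1)]
    have "submodule (\<Union>C) K V"
    proof (rule V.submoduleI)
      show "\<Union>C \<subseteq> carrier V" using S(1) by blast
      show "\<zero>\<^bsub>V\<^esub> \<in> \<Union>C" using S(2) C(1) by blast
      show "a \<odot>\<^bsub>V\<^esub> m \<in> \<Union>C" if "a \<in> carrier K" "m \<in> \<Union>C" for a m
        using that S(4) by blast
      fix m n assume "m \<in> \<Union>C" "n \<in> \<Union>C"
      then obtain W W' where "W \<in> C" "W' \<in> C" "m \<in> W" "n \<in> W'" by blast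
      moreover from this have "W \<subseteq> W' \<or> W' \<subseteq> W"
        using C(2) by (auto simp: subset_chain_def)
      ultimately show "m \<oplus>\<^bsub>V\<^esub> n \<in> \<Union>C" using S(3) by blast
    qed
    with mem(2) show "\<Union>C \<in> \<W>" by (auto simp: \<W>_def)
  qed
  then obtain W where W: "submodule W K V" "W \<inter> U \<subseteq> {\<zero>\<^bsub>V\<^esub>}"
    and max: "\<And>X. X \<in> \<W> \<Longrightarrow> W \<subseteq> X \<Longrightarrow> X = W"
    by (auto simp: \<W>_def)
  note S = V.submoduleD[OF W(1)]
  have car: "u \<in> carrier V" if "u \<in> U \<or> u \<in> W" for u using that U(1) S(1) by blast
  have dec: "\<exists>u\<in>U. \<exists>w\<in>W. v = u \<oplus>\<^bsub>V\<^esub> w" if v: "v \<in> carrier V" for v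
  proof (rule ccontr)
    assume no: "\<not> ?thesis"
    define W' where "W' = {w \<oplus>\<^bsub>V\<^esub> c \<odot>\<^bsub>V\<^esub> v |w c. w \<in> W \<and> c \<in> carrier K}"
    have I: "w \<oplus>\<^bsub>V\<^esub> c \<odot>\<^bsub>V\<^esub> v \<in> W'" if "w \<in> W" "c \<in> carrier K" for w c
      using that by (auto simp: W'_def)
    have sub: "W \<subseteq> W'"
      using I[OF _ K.zero_closed] v car by auto
    have "submodule W' K V"
    proof (rule V.submoduleI)
      show "W' \<subseteq> carrier V" using v car by (auto simp: W'_def)
      show "\<zero>\<^bsub>V\<^esub> \<in> W'" using sub S(2) by blast
      fix m n assume "m \<in> W'" "n \<in> W'"
      then obtain w c w' c' where *: "m = w \<oplus>\<^bsub>V\<^esub> c \<odot>\<^bsub>V\<^esub> v" "n = w' \<oplus>\<^bsub>V\<^esub> c' \<odot>\<^bsub>V\<^esub> v"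
        "w \<in> W" "w' \<in> W" "c \<in> carrier K" "c' \<in> carrier K" by (auto simp: W'_def)
      then have "m \<oplus>\<^bsub>V\<^esub> n = (w \<oplus>\<^bsub>V\<^esub> w') \<oplus>\<^bsub>V\<^esub> (c \<oplus>\<^bsub>K\<^esub> c') \<odot>\<^bsub>V\<^esub> v"
        using v car by (simp add: V.smult_l_distr V.M.a_ac)
      then show "m \<oplus>\<^bsub>V\<^esub> n \<in> W'" using I * S(3) by simp
    next
      fix d m assume d: "d \<in> carrier K" "m \<in> W'"
      then obtain w c where *: "m = w \<oplus>\<^bsub>V\<^esub> c \<odot>\<^bsub>V\<^esub> v" "w \<in> W" "c \<in> carrier K" by (auto simp: W'_def)
      then have "d \<odot>\<^bsub>V\<^esub> m = d \<odot>\<^bsub>V\<^esub> w \<oplus>\<^bsub>V\<^esub> (d \<otimes>\<^bsub>K\<^esub> c) \<odot>\<^bsub>V\<^esub> v"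
        using v car d by (simp add: V.smult_r_distr V.smult_assoc1)
      then show "d \<odot>\<^bsub>V\<^esub> m \<in> W'" using I * S(4) d by simp
    qed
    moreover have "u = \<zero>\<^bsub>V\<^esub>" if u: "u \<in> W'" "u \<in> U" for u
    proof -
      obtain w c where *: "u = w \<oplus>\<^bsub>V\<^esub> c \<odot>\<^bsub>V\<^esub> v" "w \<in> W" "c \<in> carrier K" using u by (auto simp: W'_def)
      show ?thesis
      proof (cases "c = \<zero>\<^bsub>K\<^esub>")
        case True
        then show ?thesis using * u W(2) v car by auto
      next
        \<comment> \<open>The coefficient \<open>c\<close> is invertible, so u = w + c v can be
          solved for v inside U + W, contrary to \<open>no\<close>.\<close>
        case False
        then have c: "inv\<^bsub>K\<^esub> c \<in> carrier K" "inv\<^bsub>K\<^esub> c \<otimes>\<^bsub>K\<^esub> c = \<one>\<^bsub>K\<^esub>"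
          using *(3) by (auto simp: K.field_Units intro!: K.Units_inv_closed K.Units_l_inv)
        have cv: "c \<odot>\<^bsub>V\<^esub> v = u \<oplus>\<^bsub>V\<^esub> (\<ominus>\<^bsub>V\<^esub> w)"
          using V.diff_add_cancel(3)[of "c \<odot>\<^bsub>V\<^esub> v" w] * v car by (simp add: a_minus_def V.M.a_comm[of w])
        then have "inv\<^bsub>K\<^esub> c \<odot>\<^bsub>V\<^esub> (c \<odot>\<^bsub>V\<^esub> v) = inv\<^bsub>K\<^esub> c \<odot>\<^bsub>V\<^esub> u \<oplus>\<^bsub>V\<^esub> inv\<^bsub>K\<^esub> c \<odot>\<^bsub>V\<^esub> (\<ominus>\<^bsub>V\<^esub> w)"
          unfolding cv using c(1) u(2) *(2) car by (intro V.smult_r_distr) auto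
        moreover have "inv\<^bsub>K\<^esub> c \<odot>\<^bsub>V\<^esub> (c \<odot>\<^bsub>V\<^esub> v) = v"
          using c *(3) v by (simp flip: V.smult_assoc1)
        ultimately show ?thesis using no U(4) S(4,5) c(1) u(2) *(2) by metis
      qed
    qed
    ultimately have "W' \<in> \<W>" by (auto simp: \<W>_def)
    then have "W' = W" using max sub by blast
    moreover have "v \<in> W'" using I[OF S(2) K.one_closed] v by simp
    ultimately show False using no U(2) v by (metis V.M.l_zero)
  qed
  then obtain pu pw where p: "\<And>v. v \<in> carrier V \<Longrightarrow> pu v \<in> U \<and> pw v \<in> W \<and> v = pu v \<oplus>\<^bsub>V\<^esub> pw v"
    by metis
  have uniq: "u = u'" if "u \<in> U" "u' \<in> U" "w \<in> W" "w' \<in> W" "u \<oplus>\<^bsub>V\<^esub> w = u' \<oplus>\<^bsub>V\<^esub> w'" for u u' w w'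
  proof -
    have c: "u \<in> carrier V" "u' \<in> carrier V" "w \<in> carrier V" "w' \<in> carrier V" using that car by auto
    have "u = u' \<oplus>\<^bsub>V\<^esub> (w' \<ominus>\<^bsub>V\<^esub> w)"
      using that(5) c by (metis V.diff_add_cancel(3) V.M.a_assoc V.M.a_inv_closed a_minus_def)
    then have "u \<ominus>\<^bsub>V\<^esub> u' = w' \<ominus>\<^bsub>V\<^esub> w"
      using c by (metis V.diff_add_cancel(3) V.M.a_comm V.M.minus_closed)
    moreover have "u \<ominus>\<^bsub>V\<^esub> u' \<in> U" "w' \<ominus>\<^bsub>V\<^esub> w \<in> W"
      using U(6) S(6) that by auto
    ultimately have "u \<ominus>\<^bsub>V\<^esub> u' = \<zero>\<^bsub>V\<^esub>" using W(2) by auto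
    then show ?thesis using V.diff_eq_zero_iff c by blast
  qed
  have pI: "pu v = u" if "u \<in> U" "w \<in> W" "v = u \<oplus>\<^bsub>V\<^esub> w" for v u w
    using that uniq p[of v] car by (metis V.M.a_closed)
  show thesis
  proof (rule that)
    show "restrict pu (carrier V) \<in> module_Hom K V V"
    proof (rule module_HomI[OF assms(2)])
      fix m n assume mn: "m \<in> carrier V" "n \<in> carrier V"
      have "m \<oplus>\<^bsub>V\<^esub> n = (pu m \<oplus>\<^bsub>V\<^esub> pw m) \<oplus>\<^bsub>V\<^esub> (pu n \<oplus>\<^bsub>V\<^esub> pw n)" using p mn by metis
      also have "\<dots> = (pu m \<oplus>\<^bsub>V\<^esub> pu n) \<oplus>\<^bsub>V\<^esub> (pw m \<oplus>\<^bsub>V\<^esub> pw n)"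
        using p[OF mn(1)] p[OF mn(2)] car by (intro V.add_add_swap) auto
      finally show "pu (m \<oplus>\<^bsub>V\<^esub> n) = pu m \<oplus>\<^bsub>V\<^esub> pu n"
        using p mn U(3) S(3) by (intro pI[of _ "pw m \<oplus>\<^bsub>V\<^esub> pw n"]) auto
    next
      fix a m assume am: "a \<in> carrier K" "m \<in> carrier V"
      have "a \<odot>\<^bsub>V\<^esub> m = a \<odot>\<^bsub>V\<^esub> (pu m \<oplus>\<^bsub>V\<^esub> pw m)" using p am by metis
      also have "\<dots> = a \<odot>\<^bsub>V\<^esub> pu m \<oplus>\<^bsub>V\<^esub> a \<odot>\<^bsub>V\<^esub> pw m"
        using p[OF am(2)] car am by (intro V.smult_r_distr) auto
      finally show "pu (a \<odot>\<^bsub>V\<^esub> m) = a \<odot>\<^bsub>V\<^esub> pu m"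
        using p am U(4) S(4) by (intro pI[of _ "a \<odot>\<^bsub>V\<^esub> pw m"]) auto
    qed (use p car in auto)
  next
    fix u assume "u \<in> U"
    then show "restrict pu (carrier V) u = u"
      using pI[of u "\<zero>\<^bsub>V\<^esub>" u] S(2) car by simp
  qed (use p in auto)
qed

text \<open>Subtracting a projection onto U kills U and sends \<open>v\<close> to some v' different
  from zero; a projection onto the line K v' followed by reading off the coefficient gives the
  functional.\<close>

lemma exists_linear_functional:
  assumes "field K" "left_module K V" "submodule U K V" "v \<in> carrier V" "v \<notin> U"
  obtains \<chi> where "\<chi> \<in> module_Hom K V (regular K)" "\<And>u. u \<in> U \<Longrightarrow> \<chi> u = \<zero>\<^bsub>K\<^esub>" "\<chi> v = \<one>\<^bsub>K\<^esub>"
proof -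
  interpret K: field K by fact
  interpret V: left_module K V by fact
  note U = V.submoduleD[OF assms(3)]
  obtain \<pi> where \<pi>: "\<pi> \<in> module_Hom K V V" "\<And>v. v \<in> carrier V \<Longrightarrow> \<pi> v \<in> U" "\<And>u. u \<in> U \<Longrightarrow> \<pi> u = u"
    using exists_linear_projection[OF assms(1-3)] by blast
  note p = module_HomD[OF \<pi>(1)]
  define v' where "v' = v \<ominus>\<^bsub>V\<^esub> \<pi> v"
  have "v \<noteq> \<pi> v" using \<pi>(2)[OF assms(4)] assms(5) by metis
  then have v': "v' \<in> carrier V" "v' \<noteq> \<zero>\<^bsub>V\<^esub>"
    using assms(4) p(1) V.diff_eq_zero_iff[of v "\<pi> v"] by (simp_all add: v'_def)
  have cancel: "c = d" if cd: "c \<in> carrier K" "d \<in> carrier K" "c \<odot>\<^bsub>V\<^esub> v' = d \<odot>\<^bsub>V\<^esub> v'" for c d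
  proof (rule ccontr)
    define e where "e = c \<ominus>\<^bsub>K\<^esub> d"
    assume "c \<noteq> d"
    then have e: "e \<in> carrier K" "e \<noteq> \<zero>\<^bsub>K\<^esub>" using cd K.minus_eq_zero_iff by (auto simp: e_def)
    then have "inv\<^bsub>K\<^esub> e \<in> carrier K" "inv\<^bsub>K\<^esub> e \<otimes>\<^bsub>K\<^esub> e = \<one>\<^bsub>K\<^esub>"
      by (auto simp: K.field_Units intro!: K.Units_inv_closed K.Units_l_inv)
    moreover have "e \<odot>\<^bsub>V\<^esub> v' = \<zero>\<^bsub>V\<^esub>"
      using cd v' by (simp add: e_def a_minus_def V.smult_l_distr V.scalar_minus_left V.M.r_neg)
    ultimately show False
      using v' e by (metis V.scalar_one V.scalar_zero_right V.smult_assoc1)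
  qed
  define L where "L = (\<lambda>c. c \<odot>\<^bsub>V\<^esub> v') ` carrier K"
  have "submodule L K V"
  proof (rule V.submoduleI)
    show "\<zero>\<^bsub>V\<^esub> \<in> L" using v' by (auto simp: L_def intro!: image_eqI[of _ _ "\<zero>\<^bsub>K\<^esub>"])
    show "m \<oplus>\<^bsub>V\<^esub> n \<in> L" if "m \<in> L" "n \<in> L" for m n
      using that v' by (auto simp: L_def simp flip: V.smult_l_distr)
    show "a \<odot>\<^bsub>V\<^esub> m \<in> L" if "a \<in> carrier K" "m \<in> L" for a m
      using that v' by (auto simp: L_def simp flip: V.smult_assoc1)
  qed (use v' in \<open>auto simp: L_def\<close>)
  then obtain \<rho> where \<rho>: "\<rho> \<in> module_Hom K V V" "\<And>v. v \<in> carrier V \<Longrightarrow> \<rho> v \<in> L" "\<And>u. u \<in> L \<Longrightarrow> \<rho> u = u"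
    using exists_linear_projection[OF assms(1,2)] by blast
  note r = module_HomD[OF \<rho>(1)]
  have "\<exists>c. c \<in> carrier K \<and> \<rho> (y \<ominus>\<^bsub>V\<^esub> \<pi> y) = c \<odot>\<^bsub>V\<^esub> v'" if "y \<in> carrier V" for y
    using \<rho>(2)[of "y \<ominus>\<^bsub>V\<^esub> \<pi> y"] that p(1) by (auto simp: L_def)
  then obtain l where l: "\<And>y. y \<in> carrier V \<Longrightarrow> l y \<in> carrier K \<and> \<rho> (y \<ominus>\<^bsub>V\<^esub> \<pi> y) = l y \<odot>\<^bsub>V\<^esub> v'"
    by metis
  have lI: "l y = c" if "y \<in> carrier V" "c \<in> carrier K" "\<rho> (y \<ominus>\<^bsub>V\<^esub> \<pi> y) = c \<odot>\<^bsub>V\<^esub> v'" for y c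
    using that l[of y] cancel by metis
  show thesis
  proof (rule that)
    show "restrict l (carrier V) \<in> module_Hom K V (regular K)"
    proof (rule module_HomI[OF assms(2)])
      fix m n assume mn: "m \<in> carrier V" "n \<in> carrier V"
      have "(m \<oplus>\<^bsub>V\<^esub> n) \<ominus>\<^bsub>V\<^esub> \<pi> (m \<oplus>\<^bsub>V\<^esub> n) = (m \<ominus>\<^bsub>V\<^esub> \<pi> m) \<oplus>\<^bsub>V\<^esub> (n \<ominus>\<^bsub>V\<^esub> \<pi> n)"
        using mn p by (simp add: a_minus_def V.M.minus_add V.M.a_ac)
      then have "\<rho> ((m \<oplus>\<^bsub>V\<^esub> n) \<ominus>\<^bsub>V\<^esub> \<pi> (m \<oplus>\<^bsub>V\<^esub> n)) = (l m \<oplus>\<^bsub>K\<^esub> l n) \<odot>\<^bsub>V\<^esub> v'"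
        using l[OF mn(1)] l[OF mn(2)] mn p r(2) v' by (simp add: V.smult_l_distr)
      then show "l (m \<oplus>\<^bsub>V\<^esub> n) = l m \<oplus>\<^bsub>regular K\<^esub> l n"
        using lI l mn by (auto simp: regular_def)
    next
      fix a m assume am: "a \<in> carrier K" "m \<in> carrier V"
      have "(a \<odot>\<^bsub>V\<^esub> m) \<ominus>\<^bsub>V\<^esub> \<pi> (a \<odot>\<^bsub>V\<^esub> m) = a \<odot>\<^bsub>V\<^esub> (m \<ominus>\<^bsub>V\<^esub> \<pi> m)"
        using am p by (simp add: V.scalar_diff)
      then have "\<rho> ((a \<odot>\<^bsub>V\<^esub> m) \<ominus>\<^bsub>V\<^esub> \<pi> (a \<odot>\<^bsub>V\<^esub> m)) = (a \<otimes>\<^bsub>K\<^esub> l m) \<odot>\<^bsub>V\<^esub> v'"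
        using l[OF am(2)] am p r(3) v' by (simp add: V.smult_assoc1)
      then show "l (a \<odot>\<^bsub>V\<^esub> m) = a \<odot>\<^bsub>regular K\<^esub> l m"
        using lI l am by (auto simp: regular_def)
    qed (use l in \<open>simp add: regular_def\<close>)
  next
    fix u assume u: "u \<in> U"
    then have uc: "u \<in> carrier V" using U(1) by blast
    then have "\<rho> (u \<ominus>\<^bsub>V\<^esub> \<pi> u) = \<zero>\<^bsub>K\<^esub> \<odot>\<^bsub>V\<^esub> v'"
      using \<pi>(3) u v' module_Hom_zero[OF assms(2,2) \<rho>(1)] by (simp add: a_minus_def V.M.r_neg)
    then show "restrict l (carrier V) u = \<zero>\<^bsub>K\<^esub>" using lI uc by simp
  next
    have "v' \<in> L" using v' by (auto simp: L_def intro!: image_eqI[of _ _ "\<one>\<^bsub>K\<^esub>"])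
    then have "\<rho> (v \<ominus>\<^bsub>V\<^esub> \<pi> v) = \<one>\<^bsub>K\<^esub> \<odot>\<^bsub>V\<^esub> v'"
      using \<rho>(3) v' by (simp add: v'_def)
    then show "restrict l (carrier V) v = \<one>\<^bsub>K\<^esub>" using lI assms(4) by simp
  qed
qed

text \<open>Project W onto the image of \<open>g\<close>, choose any preimage, and remove its
  component in the kernel of \<open>g\<close>. The last correction makes an arbitrary choice of
  preimages linear.\<close>

lemma exists_linear_generalized_inverse:
  assumes "field K" "left_module K V" "left_module K W" "g \<in> module_Hom K V W"
  obtains s where "s \<in> module_Hom K W V" "\<And>v. v \<in> carrier V \<Longrightarrow> g (s (g v)) = g v"
proof -
  interpret V: left_module K V by fact
  interpret W: left_module K W by fact
  note g = module_HomD[OF assms(4)]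
  obtain \<pi> where \<pi>: "\<pi> \<in> module_Hom K V V" "\<And>v. v \<in> carrier V \<Longrightarrow> \<pi> v \<in> a_kernel V W g"
    "\<And>u. u \<in> a_kernel V W g \<Longrightarrow> \<pi> u = u"
    using exists_linear_projection[OF assms(1,2) submodule_a_kernel[OF assms(2-4)]] by blast
  obtain \<rho> where \<rho>: "\<rho> \<in> module_Hom K W W" "\<And>v. v \<in> carrier W \<Longrightarrow> \<rho> v \<in> g ` carrier V"
    "\<And>u. u \<in> g ` carrier V \<Longrightarrow> \<rho> u = u"
    using exists_linear_projection[OF assms(1,3) submodule_image[OF assms(2-4)]]
      V.submoduleI[of "carrier V"] by auto
  note p = module_HomD[OF \<pi>(1)] and r = module_HomD[OF \<rho>(1)]
  have "\<exists>y. y \<in> carrier V \<and> \<rho> w = g y" if "w \<in> carrier W" for w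
    using \<rho>(2)[OF that] by blast
  then obtain y where y: "\<And>w. w \<in> carrier W \<Longrightarrow> y w \<in> carrier V \<and> \<rho> w = g (y w)"
    by metis
  \<comment> \<open>Two preimages of the same element differ by a kernel element, which
    \<open>\<pi>\<close> fixes, so the corrected preimages agree.\<close>
  have sI: "u \<ominus>\<^bsub>V\<^esub> \<pi> u = v \<ominus>\<^bsub>V\<^esub> \<pi> v" if "u \<in> carrier V" "v \<in> carrier V" "g u = g v" for u v
  proof -
    have "u \<ominus>\<^bsub>V\<^esub> v \<in> a_kernel V W g"
      using that module_Hom_diff[OF assms(2-4)] by (simp add: in_a_kernel_iff W.diff_eq_zero_iff g)
    then have "\<pi> u \<ominus>\<^bsub>V\<^esub> \<pi> v = u \<ominus>\<^bsub>V\<^esub> v"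
      using \<pi>(3) module_Hom_diff[OF assms(2,2) \<pi>(1)] that by metis
    with that p(1) show ?thesis by (auto intro!: V.diff_eq_diff_swap[of u v "\<pi> u" "\<pi> v"])
  qed
  have gy: "g (y w) = \<rho> w" if "w \<in> carrier W" for w
    using y[OF that] by simp
  define s where "s = (\<lambda>w. y w \<ominus>\<^bsub>V\<^esub> \<pi> (y w))"
  have gs: "g (s w) = \<rho> w" if "w \<in> carrier W" for w
    using y[OF that] module_Hom_diff[OF assms(2-4)] p(1) \<pi>(2)[of "y w"] g(1)
    by (simp add: s_def in_a_kernel_iff a_minus_def)
  show thesis
  proof (rule that)
    show "restrict s (carrier W) \<in> module_Hom K W V"
    proof (rule module_HomI[OF assms(3)])
      fix m n assume mn: "m \<in> carrier W" "n \<in> carrier W"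
      have "s (m \<oplus>\<^bsub>W\<^esub> n) = (y m \<oplus>\<^bsub>V\<^esub> y n) \<ominus>\<^bsub>V\<^esub> \<pi> (y m \<oplus>\<^bsub>V\<^esub> y n)"
        unfolding s_def using mn y by (intro sI) (simp_all add: gy g r)
      then show "s (m \<oplus>\<^bsub>W\<^esub> n) = s m \<oplus>\<^bsub>V\<^esub> s n"
        using mn y p by (simp add: s_def a_minus_def V.M.minus_add V.M.a_ac)
    next
      fix a m assume am: "a \<in> carrier K" "m \<in> carrier W"
      have "s (a \<odot>\<^bsub>W\<^esub> m) = (a \<odot>\<^bsub>V\<^esub> y m) \<ominus>\<^bsub>V\<^esub> \<pi> (a \<odot>\<^bsub>V\<^esub> y m)"
        unfolding s_def using am y by (intro sI) (simp_all add: gy g r)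
      then show "s (a \<odot>\<^bsub>W\<^esub> m) = a \<odot>\<^bsub>V\<^esub> s m"
        using am y p by (simp add: s_def V.scalar_diff)
    qed (use y p in \<open>simp add: s_def\<close>)
    show "g (restrict s (carrier W) (g v)) = g v" if "v \<in> carrier V" for v
      using gs g(1) \<rho>(3) that by simp
  qed
qed

text \<open>The factor is \<open>h\<close> composed with a generalized inverse of \<open>f\<close>;
  the kernel condition makes this independent of the preimage. That its values lie in the image of
  \<open>h\<close> is recorded because it later keeps the factor at one vertex.\<close>

lemma exists_linear_factorization:
  assumes "field K" "left_module K Q" "left_module K V" "left_module K T"
    and "f \<in> module_Hom K Q V" "h \<in> module_Hom K Q T"
    and "\<And>q. q \<in> carrier Q \<Longrightarrow> f q = \<zero>\<^bsub>V\<^esub> \<Longrightarrow> h q = \<zero>\<^bsub>T\<^esub>"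
  obtains g where "g \<in> module_Hom K V T" "\<And>q. q \<in> carrier Q \<Longrightarrow> g (f q) = h q"
    "\<And>v. v \<in> carrier V \<Longrightarrow> g v \<in> h ` carrier Q"
proof -
  interpret Q: left_module K Q by fact
  interpret V: left_module K V by fact
  interpret T: left_module K T by fact
  note f = module_HomD[OF assms(5)] and h = module_HomD[OF assms(6)]
  obtain s where s: "s \<in> module_Hom K V Q" "\<And>q. q \<in> carrier Q \<Longrightarrow> f (s (f q)) = f q"
    using exists_linear_generalized_inverse[OF assms(1-3,5)] by blast
  note sD = module_HomD[OF s(1)]
  show thesis
  proof (rule that[OF module_Hom_compose[OF assms(3) s(1) assms(6)]])
    fix q assume q: "q \<in> carrier Q"
    have "h (s (f q) \<ominus>\<^bsub>Q\<^esub> q) = \<zero>\<^bsub>T\<^esub>"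
      using q f sD s(2) module_Hom_diff[OF assms(2,3,5)]
      by (intro assms(7)) (simp_all add: V.diff_eq_zero_iff)
    then show "(\<lambda>v\<in>carrier V. h (s v)) (f q) = h q"
      using q f sD h module_Hom_diff[OF assms(2,4,6)] by (simp add: T.diff_eq_zero_iff)
  qed (use sD in simp)
qed

section \<open>Finite dimensional modules\<close>

lemma finsum_mem_submodule:
  assumes "left_module R V" "submodule U R V" "finite B" "\<And>b. b \<in> B \<Longrightarrow> f b \<in> U"
  shows "(\<Oplus>\<^bsub>V\<^esub>b\<in>B. f b) \<in> U"
proof -
  interpret V: left_module R V by fact
  note U = V.submoduleD[OF assms(2)]
  show ?thesis
    using assms(3,4)
  proof (induction B)
    case (insert b B)
    then have "f \<in> B \<rightarrow> carrier V" "f b \<in> carrier V" using U(1) by auto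
    with insert show ?case using U(3) by simp
  qed (simp add: U(2))
qed

text \<open>The linear combinations of B form the smallest submodule containing B. Spanning in terms
  of submodules passes to images and sums by preimage arguments, without manipulating
  coefficients.\<close>

lemma finite_dimensional_iff:
  assumes "cring K"
  shows "finite_dimensional K V \<longleftrightarrow> left_module K V \<and>
    (\<exists>B. finite B \<and> B \<subseteq> carrier V \<and> (\<forall>U. submodule U K V \<and> B \<subseteq> U \<longrightarrow> carrier V \<subseteq> U))"
    (is "_ \<longleftrightarrow> _ \<and> ?gen")
proof (cases "left_module K V")
  case True
  interpret K: cring K by fact
  interpret V: left_module K V by fact
  have VM: "Module.module K V" using True assms by (simp add: module_iff_left_module)
  have "finite_dimensional K V" if ?gen
  proof -
    from \<open>?gen\<close> obtain B where B: "finite B" "B \<subseteq> carrier V"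
      and gen: "\<forall>U. submodule U K V \<and> B \<subseteq> U \<longrightarrow> carrier V \<subseteq> U" by (elim exE conjE)
    define U where "U = {(\<Oplus>\<^bsub>V\<^esub>b\<in>B. c b \<odot>\<^bsub>V\<^esub> b) |c. c \<in> B \<rightarrow> carrier K}"
    have closed: "(\<lambda>b. c b \<odot>\<^bsub>V\<^esub> b) \<in> B \<rightarrow> carrier V" if "c \<in> B \<rightarrow> carrier K" for c
      using that B by auto
    have "submodule U K V"
    proof (rule V.submoduleI)
      show "U \<subseteq> carrier V" using closed by (auto simp: U_def intro!: V.M.finsum_closed)
      have "(\<Oplus>\<^bsub>V\<^esub>b\<in>B. \<zero>\<^bsub>K\<^esub> \<odot>\<^bsub>V\<^esub> b) = (\<Oplus>\<^bsub>V\<^esub>b\<in>B. \<zero>\<^bsub>V\<^esub>)"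
        using B by (intro V.M.finsum_cong') auto
      then show "\<zero>\<^bsub>V\<^esub> \<in> U" by (auto simp: U_def intro!: exI[of _ "\<lambda>_. \<zero>\<^bsub>K\<^esub>"])
    next
      fix m n assume "m \<in> U" "n \<in> U"
      then obtain c d where *: "m = (\<Oplus>\<^bsub>V\<^esub>b\<in>B. c b \<odot>\<^bsub>V\<^esub> b)" "n = (\<Oplus>\<^bsub>V\<^esub>b\<in>B. d b \<odot>\<^bsub>V\<^esub> b)"
        "c \<in> B \<rightarrow> carrier K" "d \<in> B \<rightarrow> carrier K" by (auto simp: U_def)
      have "m \<oplus>\<^bsub>V\<^esub> n = (\<Oplus>\<^bsub>V\<^esub>b\<in>B. c b \<odot>\<^bsub>V\<^esub> b \<oplus>\<^bsub>V\<^esub> d b \<odot>\<^bsub>V\<^esub> b)"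
        using * closed by (simp add: V.M.finsum_addf)
      also have "\<dots> = (\<Oplus>\<^bsub>V\<^esub>b\<in>B. (c b \<oplus>\<^bsub>K\<^esub> d b) \<odot>\<^bsub>V\<^esub> b)"
        using * B by (intro V.M.finsum_cong') (auto simp: V.smult_l_distr Pi_iff subset_eq)
      finally show "m \<oplus>\<^bsub>V\<^esub> n \<in> U"
        using * by (auto simp: U_def intro!: exI[of _ "\<lambda>b. c b \<oplus>\<^bsub>K\<^esub> d b"])
    next
      fix a m assume a: "a \<in> carrier K" "m \<in> U"
      then obtain c where *: "m = (\<Oplus>\<^bsub>V\<^esub>b\<in>B. c b \<odot>\<^bsub>V\<^esub> b)" "c \<in> B \<rightarrow> carrier K" by (auto simp: U_def)
      have "a \<odot>\<^bsub>V\<^esub> m = (\<Oplus>\<^bsub>V\<^esub>b\<in>B. a \<odot>\<^bsub>V\<^esub> (c b \<odot>\<^bsub>V\<^esub> b))"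
        unfolding *(1) by (rule module.finsum_smult_ldistr[OF VM B(1) a(1) closed[OF *(2)]])
      also have "\<dots> = (\<Oplus>\<^bsub>V\<^esub>b\<in>B. (a \<otimes>\<^bsub>K\<^esub> c b) \<odot>\<^bsub>V\<^esub> b)"
        using * B a by (intro V.M.finsum_cong') (auto simp: V.smult_assoc1 Pi_iff subset_eq)
      finally show "a \<odot>\<^bsub>V\<^esub> m \<in> U"
        using * a by (auto simp: U_def intro!: exI[of _ "\<lambda>b. a \<otimes>\<^bsub>K\<^esub> c b"])
    qed
    moreover have "B \<subseteq> U"
    proof
      fix b assume b: "b \<in> B"
      \<comment> \<open>Coefficient one at \<open>b\<close> and zero elsewhere exhibits each
        generator as a linear combination.\<close>
      have "b = (\<Oplus>\<^bsub>V\<^esub>x\<in>B. if b = x then x else \<zero>\<^bsub>V\<^esub>)"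
        using V.M.finsum_singleton[OF b B(1), of "\<lambda>x. x"] B(2) by (simp add: Pi_iff subset_eq)
      also have "\<dots> = (\<Oplus>\<^bsub>V\<^esub>x\<in>B. (\<lambda>x. if b = x then \<one>\<^bsub>K\<^esub> else \<zero>\<^bsub>K\<^esub>) x \<odot>\<^bsub>V\<^esub> x)"
        using B b by (intro V.M.finsum_cong') auto
      finally show "b \<in> U" unfolding U_def by fastforce
    qed
    ultimately have "carrier V \<subseteq> U" using gen by simp
    then show ?thesis
      unfolding finite_dimensional_def using VM B by (auto simp: U_def intro!: exI[of _ B])
  qed
  moreover have ?gen if fd: "finite_dimensional K V"
  proof -
    obtain B where B: "finite B" "B \<subseteq> carrier V"
      "\<And>v. v \<in> carrier V \<Longrightarrow> \<exists>c\<in>B \<rightarrow> carrier K. v = (\<Oplus>\<^bsub>V\<^esub>b\<in>B. c b \<odot>\<^bsub>V\<^esub> b)"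
      using fd unfolding finite_dimensional_def by blast
    have "carrier V \<subseteq> U" if U: "submodule U K V" "B \<subseteq> U" for U
    proof
      fix v assume "v \<in> carrier V"
      then obtain c where "c \<in> B \<rightarrow> carrier K" "v = (\<Oplus>\<^bsub>V\<^esub>b\<in>B. c b \<odot>\<^bsub>V\<^esub> b)" using B by blast
      then show "v \<in> U"
        using finsum_mem_submodule[OF True U(1) B(1)] V.submoduleD(4)[OF U(1)] U(2)
        by (auto simp: Pi_iff subset_eq)
    qed
    then show ?thesis using B(1,2) by (intro exI[of _ B] conjI allI impI) auto
  qed
  ultimately show ?thesis using True by blast
next
  case False
  then show ?thesis by (auto simp: finite_dimensional_def module_iff_left_module)
qed

text \<open>Stated for a bare additive map, so that it covers module homomorphisms, functionals, and
  evaluation of a sum of functions at a point alike.\<close>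

lemma additive_finsum:
  assumes "abelian_group G" "abelian_group H" "finite I"
    and "\<And>x. x \<in> carrier G \<Longrightarrow> F x \<in> carrier H"
    and "\<And>x y. x \<in> carrier G \<Longrightarrow> y \<in> carrier G \<Longrightarrow> F (x \<oplus>\<^bsub>G\<^esub> y) = F x \<oplus>\<^bsub>H\<^esub> F y"
    and "F \<zero>\<^bsub>G\<^esub> = \<zero>\<^bsub>H\<^esub>"
    and "\<And>i. i \<in> I \<Longrightarrow> v i \<in> carrier G"
  shows "F (\<Oplus>\<^bsub>G\<^esub>i\<in>I. v i) = (\<Oplus>\<^bsub>H\<^esub>i\<in>I. F (v i))"
proof -
  interpret G: abelian_group G by fact
  interpret H: abelian_group H by fact
  show ?thesis using assms(3,7)
  proof (induction I)
    case (insert i I)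
    then have "v \<in> I \<rightarrow> carrier G" "v i \<in> carrier G" by auto
    moreover from this have "(\<lambda>i. F (v i)) \<in> I \<rightarrow> carrier H" "F (v i) \<in> carrier H"
      using assms(4) by auto
    ultimately show ?case using insert by (simp add: assms(5))
  qed (simp add: assms(6))
qed

lemma regular_simps [simp]:
  "carrier (regular A) = carrier A" "\<zero>\<^bsub>regular A\<^esub> = \<zero>\<^bsub>A\<^esub>"
  "u \<oplus>\<^bsub>regular A\<^esub> v = u \<oplus>\<^bsub>A\<^esub> v" "u \<odot>\<^bsub>regular A\<^esub> v = u \<otimes>\<^bsub>A\<^esub> v"
  by (auto simp: regular_def)

lemma left_module_regular:
  assumes "ring A"
  shows "left_module A (regular A)"
proof -
  interpret ring A by fact
  show ?thesis
    by (rule left_moduleI) (auto simp: assms a_ac l_distr r_distr m_assoc l_minus r_neg)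
qed

lemma restrict_scalars_simps [simp]:
  "carrier (restrict_scalars A M) = carrier M" "\<zero>\<^bsub>restrict_scalars A M\<^esub> = \<zero>\<^bsub>M\<^esub>"
  "u \<oplus>\<^bsub>restrict_scalars A M\<^esub> v = u \<oplus>\<^bsub>M\<^esub> v"
  "c \<odot>\<^bsub>restrict_scalars A M\<^esub> v = (c \<odot>\<^bsub>A\<^esub> \<one>\<^bsub>A\<^esub>) \<odot>\<^bsub>M\<^esub> v"
  by (auto simp: restrict_scalars_def)

section \<open>Transport of structure\<close>

text \<open>The inverse is taken on the carrier only, so injectivity of \<open>\<phi>\<close> there
  makes \<open>\<phi>\<close> an isomorphism onto the transported module.\<close>

definition transport :: "('m \<Rightarrow> 'n) \<Rightarrow> ('a, 'm) module \<Rightarrow> ('a, 'n) module" where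
  "transport \<phi> M = (let \<psi> = inv_into (carrier M) \<phi> in
    \<lparr>carrier = \<phi> ` carrier M, monoid.mult = undefined, one = undefined,
     ring.zero = \<phi> \<zero>\<^bsub>M\<^esub>, add = (\<lambda>u v. \<phi> (\<psi> u \<oplus>\<^bsub>M\<^esub> \<psi> v)), smult = (\<lambda>a u. \<phi> (a \<odot>\<^bsub>M\<^esub> \<psi> u))\<rparr>)"

lemma transport_iso:
  assumes "left_module R M" "inj_on \<phi> (carrier M)"
  shows "left_module R (transport \<phi> M)" "module_iso R M (transport \<phi> M)"
proof -
  interpret left_module R M by fact
  have [simp]: "inv_into (carrier M) \<phi> (\<phi> u) = u" if "u \<in> carrier M" for u
    using that assms(2) by simp
  have T: "carrier (transport \<phi> M) = \<phi> ` carrier M" "\<zero>\<^bsub>transport \<phi> M\<^esub> = \<phi> \<zero>\<^bsub>M\<^esub>"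
    "\<And>u v. u \<in> carrier M \<Longrightarrow> v \<in> carrier M \<Longrightarrow> \<phi> u \<oplus>\<^bsub>transport \<phi> M\<^esub> \<phi> v = \<phi> (u \<oplus>\<^bsub>M\<^esub> v)"
    "\<And>a u. u \<in> carrier M \<Longrightarrow> a \<odot>\<^bsub>transport \<phi> M\<^esub> \<phi> u = \<phi> (a \<odot>\<^bsub>M\<^esub> u)"
    by (simp_all add: transport_def Let_def)
  show "left_module R (transport \<phi> M)"
    by (rule left_moduleI)
      (auto simp: T R.ring_axioms M.a_ac M.l_neg M.r_neg smult_l_distr smult_r_distr smult_assoc1 scalar_minus_left)
  show "module_iso R M (transport \<phi> M)"
    unfolding module_iso_def
  proof (rule bexI)
    show "restrict \<phi> (carrier M) \<in> module_Hom R M (transport \<phi> M)"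
      by (rule module_HomI[OF assms(1)]) (simp_all add: T)
    show "bij_betw (restrict \<phi> (carrier M)) (carrier M) (carrier (transport \<phi> M))"
      using assms(2) by (simp add: bij_betw_def T)
  qed
qed

definition interleave :: "(nat \<Rightarrow> 'k) \<times> (nat \<Rightarrow> 'k) \<Rightarrow> nat \<Rightarrow> 'k" where
  "interleave u n = (if even n then fst u (n div 2) else snd u (n div 2))"

lemma inj_interleave: "inj interleave"
proof (rule injI)
  fix u v :: "(nat \<Rightarrow> 'k) \<times> (nat \<Rightarrow> 'k)" assume *: "interleave u = interleave v"
  have "fst u n = fst v n" "snd u n = snd v n" for n
    using fun_cong[OF *, of "2 * n"] fun_cong[OF *, of "Suc (2 * n)"] by (simp_all add: interleave_def)
  then show "u = v" by (simp add: prod_eq_iff fun_eq_iff)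
qed

text \<open>Elements of \<open>binary_sum\<close> are pairs and thus leave the type over which
  \<open>projective\<close>, \<open>extension\<close> and \<open>indecomposable\<close> quantify.
  Interleaving two sequences gives an isomorphic copy inside that type.\<close>

definition direct_sum :: "('k, 'a) fmod \<Rightarrow> ('k, 'a) fmod \<Rightarrow> ('k, 'a) fmod" where
  "direct_sum M N = transport interleave (binary_sum M N)"

lemma direct_sum_iso:
  assumes "left_module R M" "left_module R N"
  shows "left_module R (direct_sum M N)" "module_iso R (binary_sum M N) (direct_sum M N)"
    "module_iso R (direct_sum M N) (binary_sum M N)"
proof -
  note * = transport_iso[OF left_module_binary_sum[OF assms], of interleave]
  have "inj_on interleave (carrier (binary_sum M N))"
    using inj_interleave by (rule inj_on_subset) simp
  then show 1: "left_module R (direct_sum M N)" and "module_iso R (binary_sum M N) (direct_sum M N)"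
    using * by (simp_all add: direct_sum_def)
  then show "module_iso R (direct_sum M N) (binary_sum M N)"
    using module_iso_sym left_module_binary_sum[OF assms] by blast
qed

text \<open>The biproduct data of the transported sum. Maps out of the sum are assembled from
  \<open>p1\<close> and \<open>p2\<close>, so the encoding stays hidden.\<close>

lemma direct_sum_maps:
  assumes "left_module R M" "left_module R N"
  obtains i1 i2 p1 p2 where
    "i1 \<in> module_Hom R M (direct_sum M N)" "i2 \<in> module_Hom R N (direct_sum M N)"
    "p1 \<in> module_Hom R (direct_sum M N) M" "p2 \<in> module_Hom R (direct_sum M N) N"
    "\<And>m. m \<in> carrier M \<Longrightarrow> p1 (i1 m) = m" "\<And>n. n \<in> carrier N \<Longrightarrow> p2 (i2 n) = n"
    "\<And>m. m \<in> carrier M \<Longrightarrow> p2 (i1 m) = \<zero>\<^bsub>N\<^esub>" "\<And>n. n \<in> carrier N \<Longrightarrow> p1 (i2 n) = \<zero>\<^bsub>M\<^esub>"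
    "\<And>u. u \<in> carrier (direct_sum M N) \<Longrightarrow> u = i1 (p1 u) \<oplus>\<^bsub>direct_sum M N\<^esub> i2 (p2 u)"
proof -
  interpret M: left_module R M by fact
  interpret N: left_module R N by fact
  note S = left_module_binary_sum[OF assms] and D = direct_sum_iso[OF assms]
  obtain f g where f: "f \<in> module_Hom R (binary_sum M N) (direct_sum M N)"
    and g: "g \<in> module_Hom R (direct_sum M N) (binary_sum M N)"
    and gf: "\<And>m. m \<in> carrier (binary_sum M N) \<Longrightarrow> g (f m) = m"
    and fg: "\<And>n. n \<in> carrier (direct_sum M N) \<Longrightarrow> f (g n) = n"
    using module_isoE[OF D(2) S D(1)] by metis
  note h = binary_sum_homs[OF assms] and fD = module_HomD[OF f] and gD = module_HomD[OF g]
  show thesis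
  proof (rule that[OF module_Hom_compose[OF assms(1) h(3) f] module_Hom_compose[OF assms(2) h(4) f]
        module_Hom_compose[OF D(1) g h(1)] module_Hom_compose[OF D(1) g h(2)]])
    fix u assume u: "u \<in> carrier (direct_sum M N)"
    then have gu: "fst (g u) \<in> carrier M" "snd (g u) \<in> carrier N" using gD(1)[OF u] by auto
    have "u = f ((fst (g u), \<zero>\<^bsub>N\<^esub>) \<oplus>\<^bsub>binary_sum M N\<^esub> (\<zero>\<^bsub>M\<^esub>, snd (g u)))"
      using fg[OF u] gu by simp
    also have "\<dots> = f (fst (g u), \<zero>\<^bsub>N\<^esub>) \<oplus>\<^bsub>direct_sum M N\<^esub> f (\<zero>\<^bsub>M\<^esub>, snd (g u))"
      using gu by (intro fD(2)) auto
    finally show "u = (\<lambda>m\<in>carrier M. f ((\<lambda>m\<in>carrier M. (m, \<zero>\<^bsub>N\<^esub>)) m))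
        ((\<lambda>m\<in>carrier (direct_sum M N). (restrict fst (carrier (binary_sum M N))) (g m)) u) \<oplus>\<^bsub>direct_sum M N\<^esub>
      (\<lambda>m\<in>carrier N. f ((\<lambda>n\<in>carrier N. (\<zero>\<^bsub>M\<^esub>, n)) m))
        ((\<lambda>m\<in>carrier (direct_sum M N). (restrict snd (carrier (binary_sum M N))) (g m)) u)"
      using u gu gD(1)[OF u] by simp
  qed (use gf fD(1) in auto)
qed

lemma module_Hom_direct_sum:
  assumes "left_module R M" "left_module R N" "left_module R L"
    and "f \<in> module_Hom R M L" "g \<in> module_Hom R N L"
    and "p1 \<in> module_Hom R (direct_sum M N) M" "p2 \<in> module_Hom R (direct_sum M N) N"
  shows "(\<lambda>u\<in>carrier (direct_sum M N). f (p1 u) \<oplus>\<^bsub>L\<^esub> g (p2 u)) \<in> module_Hom R (direct_sum M N) L"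
proof -
  interpret L: left_module R L by fact
  note h = module_HomD[OF assms(4)] module_HomD[OF assms(5)] module_HomD[OF assms(6)] module_HomD[OF assms(7)]
  show ?thesis
    by (rule module_HomI[OF direct_sum_iso(1)[OF assms(1,2)]])
      (simp_all add: h L.smult_r_distr L.M.a_ac)
qed

lemma direct_sum_retracts:
  assumes "left_module R M" "left_module R N"
  shows "retract_of R M (direct_sum M N)" "retract_of R N (direct_sum M N)"
  by (rule direct_sum_maps[OF assms]; blast intro: retract_ofI)+

lemma divisible_on_direct_sum:
  assumes "left_module R M" "left_module R N" "divisible_on M L s" "divisible_on N L s"
    and "L \<subseteq> carrier R" "s \<in> carrier R"
  shows "divisible_on (direct_sum M N) L s"
  using divisible_on_retract[OF module_iso_retract(2)] divisible_on_binary_sum assms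
    direct_sum_iso left_module_binary_sum by metis

section \<open>Modules over a finite dimensional algebra\<close>

text \<open>The algebra itself lives on \<open>nat \<Rightarrow> 'k\<close>, so that its regular
  module has the type of the modules under consideration.\<close>

locale fin_dim_algebra =
  fixes K :: "'k ring" and A :: "('k, nat \<Rightarrow> 'k) module" (structure)
  assumes fd_algebra: "fd_algebra K A"
begin

sublocale K: field K
  using fd_algebra by (simp add: fd_algebra_def)

sublocale A: ring A
  using fd_algebra by (simp add: fd_algebra_def)

sublocale KA: left_module K A
  using fd_algebra K.is_cring by (simp add: fd_algebra_def finite_dimensional_iff)

definition scal :: "'k \<Rightarrow> nat \<Rightarrow> 'k" where
  "scal c = c \<odot> \<one>"

lemma scal_closed [simp, intro]: "c \<in> carrier K \<Longrightarrow> scal c \<in> carrier A"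
  by (simp add: scal_def)

lemma scal_mult_left: "c \<in> carrier K \<Longrightarrow> r \<in> carrier A \<Longrightarrow> scal c \<otimes> r = c \<odot> r"
  using fd_algebra unfolding scal_def fd_algebra_def by (metis A.l_one A.one_closed)

lemma scal_mult_right: "c \<in> carrier K \<Longrightarrow> r \<in> carrier A \<Longrightarrow> r \<otimes> scal c = c \<odot> r"
  using fd_algebra unfolding scal_def fd_algebra_def by (metis A.r_one A.one_closed)

lemma scal_commute: "c \<in> carrier K \<Longrightarrow> r \<in> carrier A \<Longrightarrow> r \<otimes> scal c = scal c \<otimes> r"
  by (simp add: scal_mult_left scal_mult_right)

lemma scal_add: "c \<in> carrier K \<Longrightarrow> d \<in> carrier K \<Longrightarrow> scal (c \<oplus>\<^bsub>K\<^esub> d) = scal c \<oplus> scal d"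
  by (simp add: scal_def KA.smult_l_distr)

lemma scal_mult: "c \<in> carrier K \<Longrightarrow> d \<in> carrier K \<Longrightarrow> scal (c \<otimes>\<^bsub>K\<^esub> d) = scal c \<otimes> scal d"
  by (simp add: scal_mult_left) (simp add: scal_def KA.smult_assoc1)

lemma scal_one [simp]: "scal \<one>\<^bsub>K\<^esub> = \<one>"
  by (simp add: scal_def)

lemma scal_zero [simp]: "scal \<zero>\<^bsub>K\<^esub> = \<zero>"
  by (simp add: scal_def)

lemma scal_uminus: "c \<in> carrier K \<Longrightarrow> scal (\<ominus>\<^bsub>K\<^esub> c) = \<ominus> scal c"
  by (simp add: scal_def KA.scalar_minus_left)

abbreviation vec :: "(nat \<Rightarrow> 'k, 'm) module \<Rightarrow> ('k, 'm) module" where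
  "vec M \<equiv> restrict_scalars A M"

lemma vec_smult [simp]: "c \<odot>\<^bsub>vec M\<^esub> m = scal c \<odot>\<^bsub>M\<^esub> m"
  by (simp add: scal_def)

lemma left_module_vec:
  assumes "left_module A M"
  shows "left_module K (vec M)"
proof -
  interpret M: left_module A M by fact
  show ?thesis
    by (rule left_moduleI; (simp only: vec_smult restrict_scalars_simps(1-3))?)
      (auto simp: K.ring_axioms M.M.a_ac scal_uminus scal_add scal_mult M.scalar_minus_left M.M.r_neg
        M.smult_l_distr M.smult_r_distr M.smult_assoc1)
qed

lemma module_Hom_vec:
  assumes "f \<in> module_Hom A M N"
  shows "f \<in> module_Hom K (vec M) (vec N)"
  using assms by (auto simp: module_Hom_def simp flip: scal_def)

lemma submodule_vec:
  assumes "left_module A M" "submodule U A M"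
  shows "submodule U K (vec M)"
proof -
  interpret M: left_module A M by fact
  note U = M.submoduleD[OF assms(2)]
  show ?thesis
    by (rule left_module.submoduleI[OF left_module_vec[OF assms(1)]])
      (use U in \<open>auto simp flip: scal_def\<close>)
qed

lemma fd_module_iff:
  "fd_module K A M \<longleftrightarrow> left_module A M \<and> (\<exists>B. finite B \<and> B \<subseteq> carrier M \<and>
    (\<forall>U. submodule U K (vec M) \<and> B \<subseteq> U \<longrightarrow> carrier M \<subseteq> U))"
  using left_module_vec by (auto simp: fd_module_def finite_dimensional_iff[OF K.is_cring])

lemma fd_left_module: "fd_module K A M \<Longrightarrow> left_module A M"
  by (simp add: fd_module_def)

text \<open>Finite dimension only concerns the underlying vector space, hence a K-linear surjection
  is the right generality.\<close>

lemma fd_module_image_linear: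
  assumes "fd_module K A M" "left_module A N" "g \<in> module_Hom K (vec M) (vec N)"
    "carrier N \<subseteq> g ` carrier M"
  shows "fd_module K A N"
proof -
  obtain B where B: "finite B" "B \<subseteq> carrier M"
    and gen: "\<And>U. submodule U K (vec M) \<Longrightarrow> B \<subseteq> U \<Longrightarrow> carrier M \<subseteq> U"
    using assms(1) unfolding fd_module_iff by metis
  note M = left_module_vec[OF fd_left_module[OF assms(1)]] and N = left_module_vec[OF assms(2)]
  have "carrier N \<subseteq> U" if U: "submodule U K (vec N)" "g ` B \<subseteq> U" for U
  proof -
    have "carrier M \<subseteq> {m \<in> carrier (vec M). g m \<in> U}"
      using U(2) B(2) by (intro gen submodule_preimage[OF M N assms(3) U(1)]) auto
    then show ?thesis using assms(4) by auto
  qed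
  moreover have "finite (g ` B)" "g ` B \<subseteq> carrier N"
    using B module_HomD(1)[OF assms(3)] by auto
  ultimately show ?thesis
    unfolding fd_module_iff using assms(2) by (intro conjI exI[of _ "g ` B"] allI impI) auto
qed

lemma fd_module_image:
  assumes "fd_module K A M" "left_module A N" "g \<in> module_Hom A M N" "carrier N \<subseteq> g ` carrier M"
  shows "fd_module K A N"
  using fd_module_image_linear[OF assms(1,2) module_Hom_vec[OF assms(3)] assms(4)] .

lemma fd_module_iso:
  assumes "fd_module K A M" "left_module A N" "module_iso A M N"
  shows "fd_module K A N"
proof -
  obtain f where "f \<in> module_Hom A M N" "f ` carrier M = carrier N"
    using assms(3) by (auto simp: module_iso_def bij_betw_def)
  then show ?thesis by (intro fd_module_image[OF assms(1,2)]) auto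
qed

text \<open>A submodule is the image of the whole module under a K-linear projection, which in
  general is not A-linear.\<close>

lemma fd_module_submodule:
  assumes "fd_module K A M" "submodule U A M"
  shows "fd_module K A (M\<lparr>carrier := U\<rparr>)"
proof -
  note M = fd_left_module[OF assms(1)]
  obtain \<pi> where \<pi>: "\<pi> \<in> module_Hom K (vec M) (vec M)" "\<And>v. v \<in> carrier M \<Longrightarrow> \<pi> v \<in> U" "\<And>u. u \<in> U \<Longrightarrow> \<pi> u = u"
    using exists_linear_projection[OF K.field_axioms left_module_vec[OF M] submodule_vec[OF M assms(2)]]
    by (metis restrict_scalars_simps(1))
  have "\<pi> \<in> module_Hom K (vec M) (vec (M\<lparr>carrier := U\<rparr>))"
    using \<pi> by (auto simp: module_Hom_def PiE_iff)
  moreover have "U \<subseteq> \<pi> ` carrier M"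
    using left_module.submoduleD(1)[OF M assms(2)] \<pi>(3) by (metis image_eqI subsetD subsetI)
  ultimately show ?thesis
    using submodule_left_module[OF M assms(2)]
    by (intro fd_module_image_linear[OF assms(1)]) auto
qed

lemma fd_module_binary_sum:
  assumes "fd_module K A M" "fd_module K A N"
  shows "fd_module K A (binary_sum M N)"
proof -
  note M = fd_left_module[OF assms(1)] and N = fd_left_module[OF assms(2)]
  interpret M: left_module A M by fact
  interpret N: left_module A N by fact
  note S = left_module_binary_sum[OF M N]
  obtain B where B: "finite B" "B \<subseteq> carrier M"
    and genB: "\<And>U. submodule U K (vec M) \<Longrightarrow> B \<subseteq> U \<Longrightarrow> carrier M \<subseteq> U"
    using assms(1) unfolding fd_module_iff by metis
  obtain C where C: "finite C" "C \<subseteq> carrier N"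
    and genC: "\<And>U. submodule U K (vec N) \<Longrightarrow> C \<subseteq> U \<Longrightarrow> carrier N \<subseteq> U"
    using assms(2) unfolding fd_module_iff by metis
  define D where "D = (\<lambda>b. (b, \<zero>\<^bsub>N\<^esub>)) ` B \<union> (\<lambda>c. (\<zero>\<^bsub>M\<^esub>, c)) ` C"
  have "carrier (binary_sum M N) \<subseteq> U" if U: "submodule U K (vec (binary_sum M N))" "D \<subseteq> U" for U
  proof
    fix u assume u: "u \<in> carrier (binary_sum M N)"
    note h = binary_sum_homs(3,4)[OF M N, THEN module_Hom_vec]
    have "carrier M \<subseteq> {m \<in> carrier (vec M). (\<lambda>m\<in>carrier M. (m, \<zero>\<^bsub>N\<^esub>)) m \<in> U}"
      using U(2) B(2) submodule_preimage[OF left_module_vec[OF M] left_module_vec[OF S] h(1) U(1)]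
      by (intro genB) (auto simp: D_def)
    moreover have "carrier N \<subseteq> {m \<in> carrier (vec N). (\<lambda>m\<in>carrier N. (\<zero>\<^bsub>M\<^esub>, m)) m \<in> U}"
      using U(2) C(2) submodule_preimage[OF left_module_vec[OF N] left_module_vec[OF S] h(2) U(1)]
      by (intro genC) (auto simp: D_def)
    ultimately have "(fst u, \<zero>\<^bsub>N\<^esub>) \<in> U" "(\<zero>\<^bsub>M\<^esub>, snd u) \<in> U" using u by auto
    then have "(fst u, \<zero>\<^bsub>N\<^esub>) \<oplus>\<^bsub>vec (binary_sum M N)\<^esub> (\<zero>\<^bsub>M\<^esub>, snd u) \<in> U"
      using left_module.submoduleD(3)[OF left_module_vec[OF S] U(1)] by blast
    then show "u \<in> U" using u by auto
  qed
  moreover have "finite D" "D \<subseteq> carrier (binary_sum M N)"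
    using B C by (auto simp: D_def)
  ultimately show ?thesis
    unfolding fd_module_iff using S by (intro conjI exI[of _ D] allI impI) auto
qed

lemma fd_module_direct_sum:
  assumes "fd_module K A M" "fd_module K A N"
  shows "fd_module K A (direct_sum M N)"
  using fd_module_iso[OF fd_module_binary_sum[OF assms]
      direct_sum_iso(1,2)[OF assms[THEN fd_left_module]]] .

lemma fd_module_regular: "fd_module K A (regular A)"
proof -
  have "finite_dimensional K A" using fd_algebra by (simp add: fd_algebra_def)
  then obtain B where B: "finite B" "B \<subseteq> carrier A"
    and gen: "\<And>U. submodule U K A \<Longrightarrow> B \<subseteq> U \<Longrightarrow> carrier A \<subseteq> U"
    unfolding finite_dimensional_iff[OF K.is_cring] by metis
  note L = left_module_vec[OF left_module_regular[OF A.ring_axioms]]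
  have "submodule U K A" if U: "submodule U K (vec (regular A))" for U
  proof (rule KA.submoduleI)
    note U = left_module.submoduleD[OF L U]
    show sub: "U \<subseteq> carrier A" using U(1) by simp
    show "c \<odot> m \<in> U" if "c \<in> carrier K" "m \<in> U" for c m
      using U(4)[OF that] that sub by (simp add: scal_mult_left subset_iff flip: scal_def)
  qed (use left_module.submoduleD(2,3)[OF L U] in auto)
  with B gen show ?thesis
    unfolding fd_module_iff using left_module_regular[OF A.ring_axioms]
    by (intro conjI exI[of _ B] allI impI) auto
qed

lemma fd_module_generators:
  assumes "fd_module K A M"
  obtains B where "finite B" "B \<subseteq> carrier M" "\<And>U. submodule U A M \<Longrightarrow> B \<subseteq> U \<Longrightarrow> carrier M \<subseteq> U"
  using assms submodule_vec[OF fd_left_module[OF assms]] unfolding fd_module_iff by metis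

lemma fd_zero_submodule:
  assumes "fd_module K A M"
  shows "fd_module K A (M\<lparr>carrier := {\<zero>\<^bsub>M\<^esub>}\<rparr>)"
proof -
  interpret M: left_module A M using fd_left_module[OF assms] .
  show ?thesis
    by (intro fd_module_submodule[OF assms] M.submoduleI) auto
qed

end

lemma (in left_module) add_diff_cancel_left:
  assumes "m \<in> carrier M" "n \<in> carrier M"
  shows "(n \<oplus>\<^bsub>M\<^esub> m) \<ominus>\<^bsub>M\<^esub> n = m"
  using diff_add_cancel(3)[OF assms] assms by (simp add: M.a_comm)

section \<open>Isomorphism classes, direct summands and split extensions\<close>

lemma equiv_module_iso:
  assumes "\<And>M. M \<in> S \<Longrightarrow> left_module R M"
  shows "equiv S {(M, N). M \<in> S \<and> N \<in> S \<and> module_iso R M N}"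
  using assms
  by (intro equivI refl_onI symI transI)
    (auto intro: module_iso_refl module_iso_sym module_iso_trans)

lemma card_iso_classes_eq_2:
  assumes "\<And>M. M \<in> S \<Longrightarrow> left_module R M" "M \<in> S" "N \<in> S" "\<not> module_iso R M N"
    and "\<And>L. L \<in> S \<Longrightarrow> module_iso R L M \<or> module_iso R L N"
  shows "card (iso_classes R S) = 2"
proof -
  define r where "r = {(M, N). M \<in> S \<and> N \<in> S \<and> module_iso R M N}"
  have e: "equiv S r" unfolding r_def by (rule equiv_module_iso[OF assms(1)])
  have "r `` {L} = r `` {M} \<or> r `` {L} = r `` {N}" if "L \<in> S" for L
    using assms(2,3) assms(5)[OF that] that equiv_class_eq[OF e] by (auto simp: r_def)
  then have "S // r = {r `` {M}, r `` {N}}"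
    using assms(2,3) by (auto simp: quotient_def)
  moreover have "r `` {M} \<noteq> r `` {N}"
    using equiv_class_eq_iff[OF e, of M N] assms(2-4) by (auto simp: r_def)
  ultimately show ?thesis by (simp add: iso_classes_def r_def)
qed

lemma iso_classes_subset_singleton:
  assumes "\<And>M. M \<in> S \<Longrightarrow> left_module R M" "\<And>M. M \<in> S \<Longrightarrow> module_iso R M N" "left_module R N"
  shows "\<exists>C. iso_classes R S \<subseteq> {C}"
proof -
  define r where "r = {(M, N). M \<in> S \<and> N \<in> S \<and> module_iso R M N}"
  have e: "equiv S r" unfolding r_def by (rule equiv_module_iso[OF assms(1)])
  have "r `` {L} = r `` {M}" if "L \<in> S" "M \<in> S" for L M
  proof -
    have "module_iso R L M"
      using assms that module_iso_trans[OF assms(2) module_iso_sym[OF assms(2)]] by blast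
    then show ?thesis using equiv_class_eq[OF e] that by (auto simp: r_def)
  qed
  note eq = this
  have "X = Y" if "X \<in> S // r" "Y \<in> S // r" for X Y
  proof -
    obtain L M where "L \<in> S" "X = r `` {L}" "M \<in> S" "Y = r `` {M}"
      using \<open>X \<in> S // r\<close> \<open>Y \<in> S // r\<close> by (elim quotientE)
    then show ?thesis using eq by metis
  qed
  then show ?thesis unfolding iso_classes_def r_def[symmetric] by blast
qed

lemma direct_summand_retract:
  assumes "direct_summand K A N M" "left_module A M"
  shows "retract_of A N M"
proof -
  obtain L :: "('a, 'b) fmod" where "fd_module K A N" "fd_module K A L" "module_iso A M (binary_sum N L)"
    using assms(1) by (auto simp: direct_summand_def)
  then have "left_module A N" "left_module A L" by (auto simp: fd_module_def)
  then show ?thesis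
    using retract_of_trans[OF retract_of_binary_sum(1) module_iso_retract(2)]
      \<open>module_iso A M (binary_sum N L)\<close> assms(2) left_module_binary_sum by blast
qed

text \<open>A section s of p splits the extension by y \<mapsto> (n, p y), where n is the unique
  element with i n = y - s (p y).\<close>

lemma Ext1_vanishes_if_sections:
  assumes "left_module A M" "left_module A N"
    and "\<And>E i p. extension K A M N E i p \<Longrightarrow> \<exists>s\<in>module_Hom A M E. \<forall>m\<in>carrier M. p (s m) = m"
  shows "Ext1_vanishes K A M N"
  unfolding Ext1_vanishes_def
proof (intro allI impI)
  fix E i p assume ext: "extension K A M N E i p"
  then have E: "left_module A E" and i: "i \<in> module_Hom A N E" and p: "p \<in> module_Hom A E M"
    and inj: "inj_on i (carrier N)" and ex: "i ` carrier N = a_kernel E M p"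
    by (auto simp: extension_def fd_module_def)
  obtain s where s: "s \<in> module_Hom A M E" "\<And>m. m \<in> carrier M \<Longrightarrow> p (s m) = m"
    using assms(3)[OF ext] by blast
  interpret E: left_module A E by fact
  interpret M: left_module A M by fact
  interpret N: left_module A N by fact
  note iD = module_HomD[OF i] and pD = module_HomD[OF p] and sD = module_HomD[OF s(1)]
  have "\<exists>n. n \<in> carrier N \<and> i n = y \<ominus>\<^bsub>E\<^esub> s (p y)" if y: "y \<in> carrier E" for y
  proof -
    have "y \<ominus>\<^bsub>E\<^esub> s (p y) \<in> a_kernel E M p"
      using y pD sD s(2) module_Hom_diff[OF E assms(1) p] by (simp add: in_a_kernel_iff M.diff_eq_zero_iff)
    then show ?thesis using ex by (metis imageE)
  qed
  then obtain j where j: "\<And>y. y \<in> carrier E \<Longrightarrow> j y \<in> carrier N \<and> i (j y) = y \<ominus>\<^bsub>E\<^esub> s (p y)"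
    by metis
  have jI: "j y = n" if "y \<in> carrier E" "n \<in> carrier N" "y \<ominus>\<^bsub>E\<^esub> s (p y) = i n" for y n
    using that j[of y] inj by (simp add: inj_on_def)
  have ip: "p (i n) = \<zero>\<^bsub>M\<^esub>" if "n \<in> carrier N" for n
    using that ex by (auto simp: in_a_kernel_iff set_eq_iff)
  define h where "h = (\<lambda>y\<in>carrier E. (j y, p y))"
  have "h \<in> module_Hom A E (binary_sum N M)"
    unfolding h_def
  proof (rule module_HomI[OF E])
    fix u v assume uv: "u \<in> carrier E" "v \<in> carrier E"
    have "(u \<oplus>\<^bsub>E\<^esub> v) \<ominus>\<^bsub>E\<^esub> s (p (u \<oplus>\<^bsub>E\<^esub> v)) = (u \<ominus>\<^bsub>E\<^esub> s (p u)) \<oplus>\<^bsub>E\<^esub> (v \<ominus>\<^bsub>E\<^esub> s (p v))"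
      using uv pD sD by (simp add: a_minus_def E.M.minus_add E.M.a_ac)
    then have "j (u \<oplus>\<^bsub>E\<^esub> v) = j u \<oplus>\<^bsub>N\<^esub> j v"
      using uv j[OF uv(1)] j[OF uv(2)] iD(2) by (intro jI) auto
    then show "(j (u \<oplus>\<^bsub>E\<^esub> v), p (u \<oplus>\<^bsub>E\<^esub> v)) = (j u, p u) \<oplus>\<^bsub>binary_sum N M\<^esub> (j v, p v)"
      using uv pD by simp
  next
    fix r u assume ru: "r \<in> carrier A" "u \<in> carrier E"
    have "(r \<odot>\<^bsub>E\<^esub> u) \<ominus>\<^bsub>E\<^esub> s (p (r \<odot>\<^bsub>E\<^esub> u)) = r \<odot>\<^bsub>E\<^esub> (u \<ominus>\<^bsub>E\<^esub> s (p u))"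
      using ru pD sD by (simp add: E.scalar_diff)
    then have "j (r \<odot>\<^bsub>E\<^esub> u) = r \<odot>\<^bsub>N\<^esub> j u"
      using ru j[OF ru(2)] iD(3) by (intro jI) auto
    then show "(j (r \<odot>\<^bsub>E\<^esub> u), p (r \<odot>\<^bsub>E\<^esub> u)) = r \<odot>\<^bsub>binary_sum N M\<^esub> (j u, p u)"
      using ru pD by simp
  qed (use j pD in auto)
  moreover have "bij_betw h (carrier E) (carrier N \<times> carrier M)"
  proof (rule bij_betw_byWitness[where f' = "\<lambda>u. i (fst u) \<oplus>\<^bsub>E\<^esub> s (snd u)"])
    show "\<forall>a\<in>carrier E. i (fst (h a)) \<oplus>\<^bsub>E\<^esub> s (snd (h a)) = a"
      using j pD sD by (simp add: h_def E.diff_add_cancel)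
    show "\<forall>u\<in>carrier N \<times> carrier M. h (i (fst u) \<oplus>\<^bsub>E\<^esub> s (snd u)) = u"
    proof
      fix u assume "u \<in> carrier N \<times> carrier M"
      then have u: "fst u \<in> carrier N" "snd u \<in> carrier M" by auto
      then have pu: "p (i (fst u) \<oplus>\<^bsub>E\<^esub> s (snd u)) = snd u"
        using iD sD pD s(2) ip by simp
      have "j (i (fst u) \<oplus>\<^bsub>E\<^esub> s (snd u)) = fst u"
        using u iD sD pu by (intro jI) (simp_all add: E.diff_add_cancel)
      then show "h (i (fst u) \<oplus>\<^bsub>E\<^esub> s (snd u)) = u"
        using u iD sD pu by (simp add: h_def prod_eq_iff)
    qed
    show "h ` carrier E \<subseteq> carrier N \<times> carrier M" using j pD by (auto simp: h_def)
    show "(\<lambda>u. i (fst u) \<oplus>\<^bsub>E\<^esub> s (snd u)) ` (carrier N \<times> carrier M) \<subseteq> carrier E"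
      using iD sD by auto
  qed
  moreover have "h (i x) = (x, \<zero>\<^bsub>M\<^esub>)" if "x \<in> carrier N" for x
  proof -
    have "j (i x) = x"
      using that iD ip module_Hom_zero[OF assms(1) E s(1)]
      by (intro jI) (auto simp: a_minus_def)
    then show ?thesis using that iD ip by (simp add: h_def)
  qed
  moreover have "snd (h y) = p y" if "y \<in> carrier E" for y using that by (simp add: h_def)
  ultimately show "\<exists>h\<in>module_Hom A E (binary_sum N M). bij_betw h (carrier E) (carrier N \<times> carrier M) \<and>
        (\<forall>x\<in>carrier N. h (i x) = (x, \<zero>\<^bsub>M\<^esub>)) \<and> (\<forall>y\<in>carrier E. snd (h y) = p y)"
    by blast
qed

context fin_dim_algebra
begin

section \<open>Projective modules\<close>

lemma projective_fd: "projective K A P \<Longrightarrow> fd_module K A P"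
  by (simp add: projective_def)

lemma projective_left_module: "projective K A P \<Longrightarrow> left_module A P"
  using projective_fd fd_left_module by blast

lemma projective_lift:
  fixes M N :: "('k, nat \<Rightarrow> 'k) fmod"
  assumes "projective K A P" "fd_module K A M" "fd_module K A N"
    and "g \<in> module_Hom A M N" "f \<in> module_Hom A P N" "g ` carrier M = carrier N"
  obtains h where "h \<in> module_Hom A P M" "\<And>x. x \<in> carrier P \<Longrightarrow> g (h x) = f x"
proof -
  have "\<exists>h\<in>module_Hom A P M. \<forall>x\<in>carrier P. g (h x) = f x"
    using assms unfolding projective_def by blast
  then show thesis using that by blast
qed

lemma projective_section:
  fixes M :: "('k, nat \<Rightarrow> 'k) fmod"
  assumes "projective K A P" "fd_module K A M" "g \<in> module_Hom A M P" "g ` carrier M = carrier P"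
  obtains s where "s \<in> module_Hom A P M" "\<And>x. x \<in> carrier P \<Longrightarrow> g (s x) = x"
  using projective_lift[OF assms(1,2) projective_fd[OF assms(1)] assms(3)
      module_Hom_id[OF projective_left_module[OF assms(1)]] assms(4)] by auto

lemma projective_direct_sum:
  assumes "projective K A P" "projective K A Q"
  shows "projective K A (direct_sum P Q)"
  unfolding projective_def
proof (intro conjI allI impI ballI)
  show "fd_module K A (direct_sum P Q)"
    using fd_module_direct_sum projective_fd assms by blast
  fix M N :: "('k, nat \<Rightarrow> 'k) fmod" and g f
  assume MN: "fd_module K A M \<and> fd_module K A N" and g: "g \<in> module_Hom A M N" "g ` carrier M = carrier N"
    and f: "f \<in> module_Hom A (direct_sum P Q) N"
  note P = projective_left_module[OF assms(1)] and Q = projective_left_module[OF assms(2)]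
  note M = fd_left_module[OF MN[THEN conjunct1]]
  obtain i1 i2 p1 p2 where m: "i1 \<in> module_Hom A P (direct_sum P Q)" "i2 \<in> module_Hom A Q (direct_sum P Q)"
    "p1 \<in> module_Hom A (direct_sum P Q) P" "p2 \<in> module_Hom A (direct_sum P Q) Q"
    and dec: "\<And>u. u \<in> carrier (direct_sum P Q) \<Longrightarrow> u = i1 (p1 u) \<oplus>\<^bsub>direct_sum P Q\<^esub> i2 (p2 u)"
    by (rule direct_sum_maps[OF P Q]) (rule that)
  note mD = module_HomD[OF m(1)] module_HomD[OF m(2)] module_HomD[OF m(3)] module_HomD[OF m(4)]
  obtain h1 where h1: "h1 \<in> module_Hom A P M" "\<And>x. x \<in> carrier P \<Longrightarrow> g (h1 x) = f (i1 x)"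
    using projective_lift[OF assms(1) _ _ g(1) module_Hom_compose[OF P m(1) f] g(2)] MN by auto
  obtain h2 where h2: "h2 \<in> module_Hom A Q M" "\<And>x. x \<in> carrier Q \<Longrightarrow> g (h2 x) = f (i2 x)"
    using projective_lift[OF assms(2) _ _ g(1) module_Hom_compose[OF Q m(2) f] g(2)] MN by auto
  show "\<exists>h\<in>module_Hom A (direct_sum P Q) M. \<forall>x\<in>carrier (direct_sum P Q). g (h x) = f x"
  proof (rule bexI[OF _ module_Hom_direct_sum[OF P Q M h1(1) h2(1) m(3,4)]], intro ballI)
    fix u assume u: "u \<in> carrier (direct_sum P Q)"
    then have "g (h1 (p1 u) \<oplus>\<^bsub>M\<^esub> h2 (p2 u)) = f (i1 (p1 u)) \<oplus>\<^bsub>N\<^esub> f (i2 (p2 u))"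
      using mD module_HomD[OF h1(1)] module_HomD[OF h2(1)] module_HomD[OF g(1)] h1(2) h2(2) by simp
    also have "\<dots> = f (i1 (p1 u) \<oplus>\<^bsub>direct_sum P Q\<^esub> i2 (p2 u))"
      using u mD module_HomD(2)[OF f] by simp
    finally show "g ((\<lambda>u\<in>carrier (direct_sum P Q). h1 (p1 u) \<oplus>\<^bsub>M\<^esub> h2 (p2 u)) u) = f u"
      using u dec[OF u] by simp
  qed
qed

lemma projective_zero_module:
  assumes "fd_module K A Z" "zero_module Z"
  shows "projective K A Z"
  unfolding projective_def
proof (intro conjI allI impI ballI)
  fix M N :: "('k, nat \<Rightarrow> 'k) fmod" and g f
  assume MN: "fd_module K A M \<and> fd_module K A N" and g: "g \<in> module_Hom A M N" and f: "f \<in> module_Hom A Z N"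
  have "left_module A M" "left_module A N" "left_module A Z" using MN assms fd_left_module by auto
  moreover from this have "g \<zero>\<^bsub>M\<^esub> = \<zero>\<^bsub>N\<^esub>" "f \<zero>\<^bsub>Z\<^esub> = \<zero>\<^bsub>N\<^esub>"
    using module_Hom_zero g f by blast+
  ultimately show "\<exists>h\<in>module_Hom A Z M. \<forall>x\<in>carrier Z. g (h x) = f x"
    using assms(2) by (intro bexI[OF _ module_Hom_zero_map]) (auto simp: zero_module_def)
qed (rule assms)

text \<open>The induction adjoins one copy of the regular module for each generator of P and carries
  along the coordinate functionals of the growing free module. Since P is projective, the resulting
  surjection has a section, and the coordinates pulled back along it form the dual basis.\<close>

lemma dual_basis:
  assumes "projective K A P"
  obtains n :: nat and \<phi> b where
    "\<And>i. i < n \<Longrightarrow> \<phi> i \<in> module_Hom A P (regular A)" "\<And>i. i < n \<Longrightarrow> b i \<in> carrier P"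
    "\<And>p. p \<in> carrier P \<Longrightarrow> p = (\<Oplus>\<^bsub>P\<^esub>i\<in>{..<n}. \<phi> i p \<odot>\<^bsub>P\<^esub> b i)"
proof -
  note P = projective_left_module[OF assms]
  interpret P: left_module A P by fact
  note R = left_module_regular[OF A.ring_axioms]
  obtain B where B: "finite B" "B \<subseteq> carrier P"
    "\<And>U. submodule U A P \<Longrightarrow> B \<subseteq> U \<Longrightarrow> carrier P \<subseteq> U"
    using fd_module_generators[OF projective_fd[OF assms]] by metis
  have "\<exists>(G :: ('k, nat \<Rightarrow> 'k) fmod) g (n::nat) \<psi> b. fd_module K A G \<and> g \<in> module_Hom A G P \<and> C \<subseteq> g ` carrier G \<and>
      (\<forall>i<n. \<psi> i \<in> module_Hom A G (regular A) \<and> b i \<in> carrier P) \<and>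
      (\<forall>y\<in>carrier G. g y = (\<Oplus>\<^bsub>P\<^esub>i\<in>{..<n}. \<psi> i y \<odot>\<^bsub>P\<^esub> b i))"
    if "finite C" "C \<subseteq> carrier P" for C
    using that
  proof (induction C)
    case empty
    \<comment> \<open>The empty generating set is served by the zero module, with the empty sum as
      its coordinate expansion.\<close>
    let ?Z = "P\<lparr>carrier := {\<zero>\<^bsub>P\<^esub>}\<rparr>"
    have Z: "fd_module K A ?Z" using fd_zero_submodule projective_fd[OF assms] .
    show ?case
    proof (intro exI conjI)
      show "(\<lambda>m\<in>carrier ?Z. \<zero>\<^bsub>P\<^esub>) \<in> module_Hom A ?Z P"
        by (rule module_Hom_zero_map[OF fd_left_module[OF Z] P])
    qed (use Z in \<open>auto intro: exI[of _ "0::nat"]\<close>)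
  next
    case (insert c C)
    then obtain G :: "('k, nat \<Rightarrow> 'k) fmod" and g and n :: nat and \<psi> b where
      G: "fd_module K A G" "g \<in> module_Hom A G P" "C \<subseteq> g ` carrier G"
      and \<psi>: "\<And>i. i < n \<Longrightarrow> \<psi> i \<in> module_Hom A G (regular A)" "\<And>i. i < n \<Longrightarrow> b i \<in> carrier P"
      and g: "\<And>y. y \<in> carrier G \<Longrightarrow> g y = (\<Oplus>\<^bsub>P\<^esub>i\<in>{..<n}. \<psi> i y \<odot>\<^bsub>P\<^esub> b i)"
      by auto
    have c: "c \<in> carrier P" using insert by simp
    note GL = fd_left_module[OF G(1)]
    let ?D = "direct_sum G (regular A)"
    obtain i1 i2 p1 p2 where m: "i1 \<in> module_Hom A G ?D" "i2 \<in> module_Hom A (regular A) ?D"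
      "p1 \<in> module_Hom A ?D G" "p2 \<in> module_Hom A ?D (regular A)"
      and id: "\<And>m. m \<in> carrier G \<Longrightarrow> p1 (i1 m) = m" "\<And>n. n \<in> carrier (regular A) \<Longrightarrow> p2 (i2 n) = n"
        "\<And>m. m \<in> carrier G \<Longrightarrow> p2 (i1 m) = \<zero>\<^bsub>regular A\<^esub>" "\<And>n. n \<in> carrier (regular A) \<Longrightarrow> p1 (i2 n) = \<zero>\<^bsub>G\<^esub>"
      by (rule direct_sum_maps[OF GL R]) (rule that)
    note mD = module_HomD[OF m(1)] module_HomD[OF m(2)] module_HomD[OF m(3)] module_HomD[OF m(4)]
      module_HomD[OF G(2)]
    have D: "fd_module K A ?D" using fd_module_direct_sum[OF G(1) fd_module_regular] .
    have e: "restrict (\<lambda>r. r \<odot>\<^bsub>P\<^esub> c) (carrier (regular A)) \<in> module_Hom A (regular A) P"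
      by (rule module_HomI[OF R]) (use c in \<open>auto simp: P.smult_l_distr P.smult_assoc1\<close>)
    define g' where "g' = (\<lambda>u\<in>carrier ?D. g (p1 u) \<oplus>\<^bsub>P\<^esub> restrict (\<lambda>r. r \<odot>\<^bsub>P\<^esub> c) (carrier (regular A)) (p2 u))"
    have g': "g' \<in> module_Hom A ?D P"
      unfolding g'_def by (rule module_Hom_direct_sum[OF GL R P G(2) e m(3,4)])
    \<comment> \<open>The new coordinate gets the index \<open>n\<close>; the old ones are
      precomposed with the projection to \<open>G\<close>.\<close>
    define \<psi>' where "\<psi>' i = (if i = n then p2 else (\<lambda>u\<in>carrier ?D. \<psi> i (p1 u)))" for i
    define b' where "b' i = (if i = n then c else b i)" for i
    have "insert c C \<subseteq> g' ` carrier ?D"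
    proof -
      have "g' (i2 \<one>) = c"
        using id(2,4)[of \<one>] mD(1,5)[of \<one>] c module_Hom_zero[OF GL P G(2)] by (simp add: g'_def)
      moreover have "g' (i1 y) = g y" if "y \<in> carrier G" for y
        using that id(1,3)[OF that] mD c by (simp add: g'_def)
      moreover have "i2 \<one> \<in> carrier ?D" "\<And>y. y \<in> carrier G \<Longrightarrow> i1 y \<in> carrier ?D" using mD by auto
      ultimately have "c \<in> g' ` carrier ?D" "\<And>y. y \<in> carrier G \<Longrightarrow> g y \<in> g' ` carrier ?D"
        by (metis image_eqI)+
      then show ?thesis using G(3) by blast
    qed
    moreover have "\<psi>' i \<in> module_Hom A ?D (regular A) \<and> b' i \<in> carrier P" if "i < Suc n" for i
      using that \<psi> c m(4) module_Hom_compose[OF fd_left_module[OF D] m(3)]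
      by (auto simp: \<psi>'_def b'_def less_Suc_eq)
    moreover have "g' u = (\<Oplus>\<^bsub>P\<^esub>i\<in>{..<Suc n}. \<psi>' i u \<odot>\<^bsub>P\<^esub> b' i)" if u: "u \<in> carrier ?D" for u
    proof -
      have pu: "p1 u \<in> carrier G" "p2 u \<in> carrier A" using u mD by auto
      have cl: "\<psi> i (p1 u) \<odot>\<^bsub>P\<^esub> b i \<in> carrier P" if "i < n" for i
        using module_HomD(1)[OF \<psi>(1)[OF that] pu(1)] \<psi>(2)[OF that] by simp
      have "(\<Oplus>\<^bsub>P\<^esub>i\<in>{..<n}. \<psi>' i u \<odot>\<^bsub>P\<^esub> b' i) = (\<Oplus>\<^bsub>P\<^esub>i\<in>{..<n}. \<psi> i (p1 u) \<odot>\<^bsub>P\<^esub> b i)"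
        using cl u by (intro P.M.finsum_cong') (auto simp: \<psi>'_def b'_def)
      moreover have "(\<lambda>i. \<psi>' i u \<odot>\<^bsub>P\<^esub> b' i) \<in> {..<n} \<rightarrow> carrier P"
        using cl u by (auto simp: \<psi>'_def b'_def)
      moreover have "(\<lambda>i. \<psi> i (p1 u) \<odot>\<^bsub>P\<^esub> b i) \<in> {..<n} \<rightarrow> carrier P" using cl by auto
      ultimately show ?thesis
        using u pu c g by (simp add: lessThan_Suc g'_def \<psi>'_def b'_def P.M.a_comm)
    qed
    ultimately show ?case using D g' by blast
  qed
  from this[OF B(1,2)] obtain G :: "('k, nat \<Rightarrow> 'k) fmod" and g and n :: nat and \<psi> b where
    G: "fd_module K A G" "g \<in> module_Hom A G P" "B \<subseteq> g ` carrier G"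
    and \<psi>: "\<And>i. i < n \<Longrightarrow> \<psi> i \<in> module_Hom A G (regular A)" "\<And>i. i < n \<Longrightarrow> b i \<in> carrier P"
    and g: "\<And>y. y \<in> carrier G \<Longrightarrow> g y = (\<Oplus>\<^bsub>P\<^esub>i\<in>{..<n}. \<psi> i y \<odot>\<^bsub>P\<^esub> b i)"
    by auto
  note GL = fd_left_module[OF G(1)]
  have "carrier P \<subseteq> g ` carrier G"
    by (rule B(3)[OF submodule_image[OF GL P G(2)] G(3)])
      (rule left_module.submoduleI[OF GL], use left_module.smult_closed[OF GL] in
        \<open>auto intro: abelian_monoid.zero_closed abelian_monoid.a_closed
          abelian_group.axioms(1) left_module.axioms(2)[OF GL]\<close>)
  then have "g ` carrier G = carrier P" using module_HomD(1)[OF G(2)] by auto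
  then obtain s where s: "s \<in> module_Hom A P G" "\<And>x. x \<in> carrier P \<Longrightarrow> g (s x) = x"
    using projective_section[OF assms G(1,2)] by blast
  show thesis
  proof (rule that[of n "\<lambda>i. \<lambda>p\<in>carrier P. \<psi> i (s p)" b])
    show "(\<lambda>p\<in>carrier P. \<psi> i (s p)) \<in> module_Hom A P (regular A)" if "i < n" for i
      using module_Hom_compose[OF P s(1) \<psi>(1)[OF that]] .
    fix p assume p: "p \<in> carrier P"
    then have "p = (\<Oplus>\<^bsub>P\<^esub>i\<in>{..<n}. \<psi> i (s p) \<odot>\<^bsub>P\<^esub> b i)"
      using g s(2) module_HomD(1)[OF s(1)] by metis
    then show "p = (\<Oplus>\<^bsub>P\<^esub>i\<in>{..<n}. (\<lambda>p\<in>carrier P. \<psi> i (s p)) p \<odot>\<^bsub>P\<^esub> b i)"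
      using p by simp
  qed (use \<psi>(2) in auto)
qed

text \<open>The coordinates of p with respect to a dual basis are annihilated by \<open>L\<close>
  whenever p is. They are therefore multiples of \<open>s\<close> in the algebra, and
  \<open>s\<close> can be pulled out of the expansion of p.\<close>

lemma projective_divisible_on:
  assumes "projective K A P" "divisible_on (regular A) L s" "L \<subseteq> carrier A" "s \<in> carrier A"
  shows "divisible_on P L s"
  unfolding divisible_on_def
proof (intro ballI impI)
  fix p assume p: "p \<in> carrier P" "\<forall>r\<in>L. r \<odot>\<^bsub>P\<^esub> p = \<zero>\<^bsub>P\<^esub>"
  note P = projective_left_module[OF assms(1)]
  interpret P: left_module A P by fact
  obtain n :: nat and \<phi> b where \<phi>: "\<And>i. i < n \<Longrightarrow> \<phi> i \<in> module_Hom A P (regular A)"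
    and b: "\<And>i. i < n \<Longrightarrow> b i \<in> carrier P"
    and dual: "\<And>p. p \<in> carrier P \<Longrightarrow> p = (\<Oplus>\<^bsub>P\<^esub>i\<in>{..<n}. \<phi> i p \<odot>\<^bsub>P\<^esub> b i)"
    by (rule dual_basis[OF assms(1)]) blast
  have "\<exists>r. r \<in> carrier A \<and> \<phi> i p = s \<otimes> r" if "i < n" for i
  proof -
    have "\<forall>r\<in>L. r \<odot>\<^bsub>regular A\<^esub> \<phi> i p = \<zero>\<^bsub>regular A\<^esub>"
    proof
      fix r assume "r \<in> L"
      then show "r \<odot>\<^bsub>regular A\<^esub> \<phi> i p = \<zero>\<^bsub>regular A\<^esub>"
        using module_HomD(3)[OF \<phi>[OF that], of r p] p assms(3)
          module_Hom_zero[OF P left_module_regular[OF A.ring_axioms] \<phi>[OF that]] by auto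
    qed
    then show ?thesis
      using assms(2) module_HomD(1)[OF \<phi>[OF that] p(1)] unfolding divisible_on_def by auto
  qed
  then obtain r where r: "\<And>i. i < n \<Longrightarrow> r i \<in> carrier A \<and> \<phi> i p = s \<otimes> r i" by metis
  have "p = (\<Oplus>\<^bsub>P\<^esub>i\<in>{..<n}. \<phi> i p \<odot>\<^bsub>P\<^esub> b i)" by (rule dual[OF p(1)])
  also have "\<dots> = (\<Oplus>\<^bsub>P\<^esub>i\<in>{..<n}. s \<odot>\<^bsub>P\<^esub> (r i \<odot>\<^bsub>P\<^esub> b i))"
    using r b assms(4) by (intro P.M.finsum_cong') (auto simp: P.smult_assoc1)
  also have "\<dots> = s \<odot>\<^bsub>P\<^esub> (\<Oplus>\<^bsub>P\<^esub>i\<in>{..<n}. r i \<odot>\<^bsub>P\<^esub> b i)"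
    using r b assms(4)
    by (intro additive_finsum[OF P.M.abelian_group_axioms P.M.abelian_group_axioms, symmetric])
      (auto simp: P.smult_r_distr)
  finally show "\<exists>m'\<in>carrier P. p = s \<odot>\<^bsub>P\<^esub> m'"
    using r b by (intro bexI[of _ "\<Oplus>\<^bsub>P\<^esub>i\<in>{..<n}. r i \<odot>\<^bsub>P\<^esub> b i"]) auto
qed

subsection \<open>Projective dimension at most one\<close>

lemma projective_dimension_le_1I:
  assumes "projective K A P" "left_module A M" "e \<in> module_Hom A P M" "e ` carrier P = carrier M"
    and "projective K A (P\<lparr>carrier := a_kernel P M e\<rparr>)"
  shows "projective_dimension K A M \<le> 1"
proof -
  note P = projective_left_module[OF assms(1)]
  interpret P: left_module A P by fact
  define N where "N = P\<lparr>carrier := a_kernel P M e\<rparr>"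
  define Z where "Z = P\<lparr>carrier := {\<zero>\<^bsub>P\<^esub>}\<rparr>"
  \<comment> \<open>The resolution 0 \<rightarrow> Ker e \<rightarrow> P \<rightarrow> M
    \<rightarrow> 0, padded by zero modules from index two on.\<close>
  define Q where "Q i = (if i = 0 then P else if i = Suc 0 then N else Z)" for i :: nat
  define d where "d i = (if i = 0 then restrict (\<lambda>m. m) (carrier N) else (\<lambda>m\<in>{\<zero>\<^bsub>P\<^esub>}. \<zero>\<^bsub>P\<^esub>))" for i :: nat
  have S: "submodule (a_kernel P M e) A P" by (rule submodule_a_kernel[OF P assms(2,3)])
  have Zfd: "fd_module K A Z" unfolding Z_def using fd_zero_submodule projective_fd[OF assms(1)] .
  have Z: "projective K A Z" "zero_module Z"
    using projective_zero_module[OF Zfd] by (auto simp: zero_module_def Z_def)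
  have NL: "left_module A N" "left_module A Z"
    using submodule_left_module[OF P S] fd_left_module[OF Zfd] by (auto simp: N_def)
  have c: "carrier N = a_kernel P M e" "carrier Z = {\<zero>\<^bsub>P\<^esub>}" "\<zero>\<^bsub>N\<^esub> = \<zero>\<^bsub>P\<^esub>" "\<zero>\<^bsub>Z\<^esub> = \<zero>\<^bsub>P\<^esub>"
    by (auto simp: N_def Z_def)
  have "d i \<in> module_Hom A (Q (Suc i)) (Q i)" for i
    using module_Hom_inclusion[OF P S] module_Hom_zero_map[OF NL(2,1)] module_Hom_zero_map[OF NL(2,2)]
    by (auto simp: d_def Q_def c simp flip: N_def)
  moreover have "d (Suc i) ` carrier (Q (Suc (Suc i))) = a_kernel (Q (Suc i)) (Q i) (d i)" for i
    using P.submoduleD(2)[OF S] by (auto simp: d_def Q_def c in_a_kernel_iff)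
  ultimately have "projective_resolution K A M Q d e"
    unfolding projective_resolution_def using assms Z(1)
    by (auto simp: Q_def N_def d_def)
  moreover have "\<forall>i>1. zero_module (Q i)" using Z(2) by (auto simp: Q_def)
  ultimately have "enat 1 \<in> {enat m |m. \<exists>P d e. projective_resolution K A M P d e \<and> (\<forall>i>m. zero_module (P i))}"
    by blast
  then show ?thesis
    unfolding projective_dimension_def one_enat_def by (rule Inf_lower)
qed

lemma projective_dimension_le_1_projective:
  assumes "projective K A P"
  shows "projective_dimension K A P \<le> 1"
proof -
  note P = projective_left_module[OF assms]
  have "a_kernel P P (restrict (\<lambda>m. m) (carrier P)) = {\<zero>\<^bsub>P\<^esub>}"
    using abelian_monoid.zero_closed[OF abelian_group.axioms(1)[OF left_module.axioms(2)[OF P]]]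
    by (auto simp: in_a_kernel_iff)
  then show ?thesis
    using fd_zero_submodule[OF projective_fd[OF assms]]
    by (intro projective_dimension_le_1I[OF assms P module_Hom_id[OF P]])
      (auto intro!: projective_zero_module simp: zero_module_def)
qed

text \<open>The infimum of a nonempty set of extended naturals is attained. Whether it is zero or
  one, the term with index two vanishes, and exactness makes \<open>d 0\<close> injective.\<close>

lemma projective_dimension_le_1E:
  assumes "projective_dimension K A M \<le> 1" "left_module A M"
  obtains P0 P1 :: "('k, nat \<Rightarrow> 'k) fmod" and d e where "projective K A P0" "projective K A P1"
    "e \<in> module_Hom A P0 M" "e ` carrier P0 = carrier M" "d \<in> module_Hom A P1 P0"
    "d ` carrier P1 = a_kernel P0 M e" "\<And>q. q \<in> carrier P1 \<Longrightarrow> d q = \<zero>\<^bsub>P0\<^esub> \<Longrightarrow> q = \<zero>\<^bsub>P1\<^esub>"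
proof -
  define S where "S = {enat m |m. \<exists>P d e. projective_resolution K A M P d e \<and> (\<forall>i>m. zero_module (P i))}"
  have le: "Inf S \<le> 1" using assms(1) by (simp add: projective_dimension_def S_def)
  then have "S \<noteq> {}" by (auto simp: Inf_enat_def)
  then have "Inf S \<in> S" by (auto simp: Inf_enat_def intro: LeastI)
  then obtain m P d e where m: "Inf S = enat m" and res: "projective_resolution K A M P d e"
    and z: "\<And>i. i > m \<Longrightarrow> zero_module (P i)" unfolding S_def by blast
  have "m \<le> 1" using le m by (simp add: one_enat_def)
  then have "zero_module (P 2)" using z by simp
  moreover have "d 1 ` carrier (P 2) = a_kernel (P 1) (P 0) (d 0)" "d 1 \<in> module_Hom A (P 2) (P 1)"
    "left_module A (P 2)" "left_module A (P 1)"
    using res projective_left_module unfolding projective_resolution_def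
    by (auto simp: numeral_2_eq_2)
  ultimately have "a_kernel (P 1) (P 0) (d 0) = {\<zero>\<^bsub>P 1\<^esub>}"
    using module_Hom_zero[of A "P 2" "P 1" "d 1"] by (auto simp: zero_module_def)
  then show thesis
    using res that[of "P 0" "P 1" e "d 0"]
    by (auto simp: projective_resolution_def set_eq_iff in_a_kernel_iff)
qed

section \<open>Indecomposable modules\<close>

text \<open>The module N is the direct sum of Q and the kernel of the retraction. As Q is nonzero,
  indecomposability makes the kernel zero and the retraction an isomorphism.\<close>

lemma indecomposable_retract_iso:
  fixes Q :: "('k, nat \<Rightarrow> 'k) fmod"
  assumes "indecomposable K A N" "fd_module K A Q" "retract_of A Q N" "\<not> zero_module Q"
  shows "module_iso A N Q"
proof -
  have N: "left_module A N" and NF: "fd_module K A N"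
    using assms(1) fd_left_module by (auto simp: indecomposable_def)
  note Q = fd_left_module[OF assms(2)]
  interpret N: left_module A N by fact
  interpret Q: left_module A Q by fact
  obtain i r where i: "i \<in> module_Hom A Q N" and r: "r \<in> module_Hom A N Q"
    and ri: "\<And>n. n \<in> carrier Q \<Longrightarrow> r (i n) = n"
    using assms(3) by (auto simp: retract_of_def)
  note iD = module_HomD[OF i] and rD = module_HomD[OF r]
  define L where "L = N\<lparr>carrier := a_kernel N Q r\<rparr>"
  have L: "fd_module K A L"
    unfolding L_def using fd_module_submodule[OF NF submodule_a_kernel[OF N Q r]] .
  have Ls: "carrier L = a_kernel N Q r" "\<zero>\<^bsub>L\<^esub> = \<zero>\<^bsub>N\<^esub>" "\<And>u v. u \<oplus>\<^bsub>L\<^esub> v = u \<oplus>\<^bsub>N\<^esub> v"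
    "\<And>a v. a \<odot>\<^bsub>L\<^esub> v = a \<odot>\<^bsub>N\<^esub> v" by (auto simp: L_def)
  have k: "n \<ominus>\<^bsub>N\<^esub> i (r n) \<in> a_kernel N Q r" if "n \<in> carrier N" for n
    using that iD rD ri module_Hom_diff[OF N Q r] by (simp add: in_a_kernel_iff Q.diff_eq_zero_iff)
  have f: "(\<lambda>n\<in>carrier N. (r n, n \<ominus>\<^bsub>N\<^esub> i (r n))) \<in> module_Hom A N (binary_sum Q L)"
  proof (rule module_HomI[OF N])
    fix u v assume "u \<in> carrier N" "v \<in> carrier N"
    then show "(r (u \<oplus>\<^bsub>N\<^esub> v), (u \<oplus>\<^bsub>N\<^esub> v) \<ominus>\<^bsub>N\<^esub> i (r (u \<oplus>\<^bsub>N\<^esub> v))) =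
        (r u, u \<ominus>\<^bsub>N\<^esub> i (r u)) \<oplus>\<^bsub>binary_sum Q L\<^esub> (r v, v \<ominus>\<^bsub>N\<^esub> i (r v))"
      using iD rD by (simp add: Ls a_minus_def N.M.minus_add N.M.a_ac)
  qed (use iD rD k in \<open>auto simp: Ls N.scalar_diff\<close>)
  have g: "restrict (\<lambda>u. i (fst u) \<oplus>\<^bsub>N\<^esub> snd u) (carrier (binary_sum Q L)) \<in> module_Hom A (binary_sum Q L) N"
    by (rule module_HomI[OF left_module_binary_sum[OF Q fd_left_module[OF L]]])
      (auto simp: Ls in_a_kernel_iff iD N.smult_r_distr N.M.a_ac)
  have "module_iso A N (binary_sum Q L)"
    by (rule module_isoI[OF f g])
      (auto simp: Ls in_a_kernel_iff iD rD ri N.add_diff_cancel_left N.diff_add_cancel k[unfolded in_a_kernel_iff])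
  then have "zero_module L"
    using assms L unfolding indecomposable_def by blast
  then have "n = i (r n)" if "n \<in> carrier N" for n
    using k[OF that] that iD rD by (auto simp: zero_module_def Ls N.diff_eq_zero_iff)
  then show ?thesis
    by (intro module_isoI[OF r i]) (simp_all add: ri)
qed

definition generates :: "(nat \<Rightarrow> 'k, 'm) module \<Rightarrow> 'm \<Rightarrow> bool" where
  "generates M m \<longleftrightarrow> (\<forall>m'\<in>carrier M. \<exists>r\<in>carrier A. m' = r \<odot>\<^bsub>M\<^esub> m)"

text \<open>If M is N \<oplus> L, the generator e is the sum of its two components. By hypothesis
  one of them already generates M, so M lies inside that summand and the other summand is
  zero.\<close>

lemma indecomposable_if_local:
  assumes "fd_module K A M" "\<not> zero_module M" "e \<in> carrier M" "generates M e"
    and "\<And>m m'. m \<in> carrier M \<Longrightarrow> m' \<in> carrier M \<Longrightarrow> generates M (m \<oplus>\<^bsub>M\<^esub> m') \<Longrightarrow> generates M m \<or> generates M m'"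
  shows "indecomposable K A M"
  unfolding indecomposable_def
proof (intro conjI allI impI)
  fix N L :: "('k, nat \<Rightarrow> 'k) fmod"
  assume *: "fd_module K A N \<and> fd_module K A L \<and> module_iso A M (binary_sum N L)"
  have M: "left_module A M" and N: "left_module A N" and L: "left_module A L"
    using * assms(1) fd_left_module by auto
  interpret N: left_module A N by fact
  interpret L: left_module A L by fact
  note S = left_module_binary_sum[OF N L]
  obtain f g where f: "f \<in> module_Hom A M (binary_sum N L)" and g: "g \<in> module_Hom A (binary_sum N L) M"
    and gf: "\<And>m. m \<in> carrier M \<Longrightarrow> g (f m) = m"
    and fg: "\<And>u. u \<in> carrier (binary_sum N L) \<Longrightarrow> f (g u) = u"
    using module_isoE[OF _ M S] * by metis
  note fD = module_HomD[OF f] and gD = module_HomD[OF g]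
  have ginj: "u = v" if "u \<in> carrier (binary_sum N L)" "v \<in> carrier (binary_sum N L)" "g u = g v" for u v
    using that fg by metis
  obtain n l where nl: "f e = (n, l)" "n \<in> carrier N" "l \<in> carrier L"
    using fD(1)[OF assms(3)] by auto
  have "e = g ((n, \<zero>\<^bsub>L\<^esub>) \<oplus>\<^bsub>binary_sum N L\<^esub> (\<zero>\<^bsub>N\<^esub>, l))"
    using nl gf[OF assms(3)] by simp
  also have "\<dots> = g (n, \<zero>\<^bsub>L\<^esub>) \<oplus>\<^bsub>M\<^esub> g (\<zero>\<^bsub>N\<^esub>, l)"
    using nl by (intro gD(2)) auto
  finally have "generates M (g (n, \<zero>\<^bsub>L\<^esub>)) \<or> generates M (g (\<zero>\<^bsub>N\<^esub>, l))"
    using assms(4,5) gD(1) nl by simp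
  moreover have "zero_module L" if gen: "generates M (g (n, \<zero>\<^bsub>L\<^esub>))"
  proof -
    have "l' = \<zero>\<^bsub>L\<^esub>" if l': "l' \<in> carrier L" for l'
    proof -
      obtain r where "r \<in> carrier A" "g (\<zero>\<^bsub>N\<^esub>, l') = r \<odot>\<^bsub>M\<^esub> g (n, \<zero>\<^bsub>L\<^esub>)"
        using gen gD(1)[of "(\<zero>\<^bsub>N\<^esub>, l')"] l' unfolding generates_def by auto
      then have "g (\<zero>\<^bsub>N\<^esub>, l') = g (r \<odot>\<^bsub>N\<^esub> n, \<zero>\<^bsub>L\<^esub>)"
        using gD(3)[of r "(n, \<zero>\<^bsub>L\<^esub>)"] nl by simp
      then show ?thesis using ginj l' nl \<open>r \<in> carrier A\<close> by (metis N.scalar_closed L.M.zero_closed N.M.zero_closed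
            binary_sum_simps(1) mem_Sigma_iff prod.inject)
    qed
    then show ?thesis by (auto simp: zero_module_def)
  qed
  moreover have "zero_module N" if gen: "generates M (g (\<zero>\<^bsub>N\<^esub>, l))"
  proof -
    have "n' = \<zero>\<^bsub>N\<^esub>" if n': "n' \<in> carrier N" for n'
    proof -
      obtain r where "r \<in> carrier A" "g (n', \<zero>\<^bsub>L\<^esub>) = r \<odot>\<^bsub>M\<^esub> g (\<zero>\<^bsub>N\<^esub>, l)"
        using gen gD(1)[of "(n', \<zero>\<^bsub>L\<^esub>)"] n' unfolding generates_def by auto
      then have "g (n', \<zero>\<^bsub>L\<^esub>) = g (\<zero>\<^bsub>N\<^esub>, r \<odot>\<^bsub>L\<^esub> l)"
        using gD(3)[of r "(\<zero>\<^bsub>N\<^esub>, l)"] nl by simp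
      then show ?thesis using ginj n' nl \<open>r \<in> carrier A\<close> by (metis L.scalar_closed L.M.zero_closed N.M.zero_closed
            binary_sum_simps(1) mem_Sigma_iff prod.inject)
    qed
    then show ?thesis by (auto simp: zero_module_def)
  qed
  ultimately show "zero_module N \<or> zero_module L" by blast
qed (use assms in auto)

section \<open>Cyclic modules\<close>

text \<open>The quotient of the regular module by the left ideal \<open>{r. \<pi> r = 0}\<close>, realised on the
  image of the idempotent \<open>\<pi>\<close>, so that its carrier is again a set of elements of \<open>A\<close>.\<close>

definition cyclic :: "((nat \<Rightarrow> 'k) \<Rightarrow> nat \<Rightarrow> 'k) \<Rightarrow> ('k, nat \<Rightarrow> 'k) fmod" where
  "cyclic \<pi> = \<lparr>carrier = \<pi> ` carrier A, monoid.mult = undefined, one = undefined,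
    ring.zero = \<zero>, add = add A, smult = (\<lambda>r v. \<pi> (r \<otimes> v))\<rparr>"

lemma cyclic_simps [simp]:
  "carrier (cyclic \<pi>) = \<pi> ` carrier A" "\<zero>\<^bsub>cyclic \<pi>\<^esub> = \<zero>"
  "u \<oplus>\<^bsub>cyclic \<pi>\<^esub> v = u \<oplus> v" "r \<odot>\<^bsub>cyclic \<pi>\<^esub> v = \<pi> (r \<otimes> v)"
  by (auto simp: cyclic_def)

text \<open>For an additive idempotent map, the condition on \<open>r \<otimes> \<pi> s\<close> says
  exactly that the kernel of \<open>\<pi>\<close> is a left ideal. Each residue class then has a
  distinguished representative in the image of \<open>\<pi>\<close>.\<close>

definition cyclic_projection :: "((nat \<Rightarrow> 'k) \<Rightarrow> nat \<Rightarrow> 'k) \<Rightarrow> bool" where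
  "cyclic_projection \<pi> \<longleftrightarrow> (\<forall>r\<in>carrier A. \<pi> r \<in> carrier A \<and> \<pi> (\<pi> r) = \<pi> r) \<and>
    (\<forall>r\<in>carrier A. \<forall>s\<in>carrier A. \<pi> (r \<oplus> s) = \<pi> r \<oplus> \<pi> s \<and> \<pi> (r \<otimes> \<pi> s) = \<pi> (r \<otimes> s))"

context
  fixes \<pi> assumes \<pi>: "cyclic_projection \<pi>"
begin

lemma cyclic_projectionD:
  "r \<in> carrier A \<Longrightarrow> \<pi> r \<in> carrier A" "r \<in> carrier A \<Longrightarrow> \<pi> (\<pi> r) = \<pi> r"
  "r \<in> carrier A \<Longrightarrow> s \<in> carrier A \<Longrightarrow> \<pi> (r \<oplus> s) = \<pi> r \<oplus> \<pi> s"
  "r \<in> carrier A \<Longrightarrow> s \<in> carrier A \<Longrightarrow> \<pi> (r \<otimes> \<pi> s) = \<pi> (r \<otimes> s)"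
  using \<pi> by (auto simp: cyclic_projection_def)

lemma cyclic_projection_zero: "\<pi> \<zero> = \<zero>"
  using cyclic_projectionD(1)[of \<zero>] cyclic_projectionD(3)[of \<zero> \<zero>] by (metis A.add.r_cancel_one' A.l_zero A.zero_closed)

lemma cyclic_projection_diff:
  assumes "r \<in> carrier A" "s \<in> carrier A" "\<pi> r = \<pi> s"
  shows "\<pi> (r \<ominus> s) = \<zero>"
proof -
  have "\<pi> (r \<ominus> s) \<oplus> \<pi> s = \<pi> s"
    using cyclic_projectionD(3)[of "r \<ominus> s" s] assms
    by (simp add: a_minus_def A.a_assoc A.l_neg)
  then show ?thesis
    using KA.diff_add_cancel(3)[of "\<pi> (r \<ominus> s)" "\<pi> s"] cyclic_projectionD(1) assms
    by (simp add: KA.diff_eq_zero_iff)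
qed

lemma left_module_cyclic: "left_module A (cyclic \<pi>)"
proof (rule left_moduleI)
  note D = cyclic_projectionD
  show "ring A" by (rule A.ring_axioms)
  show "\<And>u v. u \<in> carrier (cyclic \<pi>) \<Longrightarrow> v \<in> carrier (cyclic \<pi>) \<Longrightarrow> u \<oplus>\<^bsub>cyclic \<pi>\<^esub> v \<in> carrier (cyclic \<pi>)"
    by (auto simp flip: D(3))
  show "\<zero>\<^bsub>cyclic \<pi>\<^esub> \<in> carrier (cyclic \<pi>)"
    using cyclic_projection_zero by (auto simp: image_iff intro!: bexI[of _ \<zero>])
  show "(\<ominus> \<one>) \<odot>\<^bsub>cyclic \<pi>\<^esub> u \<oplus>\<^bsub>cyclic \<pi>\<^esub> u = \<zero>\<^bsub>cyclic \<pi>\<^esub>" if "u \<in> carrier (cyclic \<pi>)" for u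
  proof -
    obtain r where r: "r \<in> carrier A" "u = \<pi> r" using \<open>u \<in> _\<close> by auto
    have "\<pi> (\<ominus> \<one> \<otimes> \<pi> r) \<oplus> \<pi> r = \<pi> (\<ominus> \<one> \<otimes> r \<oplus> r)"
      using r D by simp
    then show ?thesis using r by (simp add: A.l_minus A.l_neg cyclic_projection_zero)
  qed
  show "(a \<otimes> b) \<odot>\<^bsub>cyclic \<pi>\<^esub> u = a \<odot>\<^bsub>cyclic \<pi>\<^esub> (b \<odot>\<^bsub>cyclic \<pi>\<^esub> u)"
    if "a \<in> carrier A" "b \<in> carrier A" "u \<in> carrier (cyclic \<pi>)" for a b u
  proof -
    have "\<pi> (a \<otimes> (b \<otimes> \<pi> x)) = \<pi> (a \<otimes> (b \<otimes> x))" if "x \<in> carrier A" for x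
      using D(4)[of "a \<otimes> b" x] that \<open>a \<in> _\<close> \<open>b \<in> _\<close> by (simp add: A.m_assoc D(1))
    with that show ?thesis by (auto simp: D(1) D(4) A.m_assoc)
  qed
qed (auto simp: cyclic_projectionD A.a_ac A.l_distr A.r_distr)

lemma cyclic_projection_Hom: "restrict \<pi> (carrier A) \<in> module_Hom A (regular A) (cyclic \<pi>)"
  using module_HomI[OF left_module_regular[OF A.ring_axioms], of \<pi> "cyclic \<pi>"]
  by (simp add: cyclic_projectionD)

lemma fd_module_cyclic: "fd_module K A (cyclic \<pi>)"
  by (rule fd_module_image[OF fd_module_regular left_module_cyclic cyclic_projection_Hom]) auto

lemma cyclic_generator:
  assumes "v \<in> carrier (cyclic \<pi>)"
  shows "v = v \<odot>\<^bsub>cyclic \<pi>\<^esub> \<pi> \<one>"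
  using assms cyclic_projectionD by auto

text \<open>The product in \<open>cyclic \<pi>\<close> differs from the product in the algebra by an
  element of the left ideal, which annihilates \<open>m\<close>; hence v \<mapsto> v m is a
  homomorphism.\<close>

lemma cyclic_Hom:
  assumes "left_module A M" "m \<in> carrier M" "\<And>r. r \<in> carrier A \<Longrightarrow> \<pi> r = \<zero> \<Longrightarrow> r \<odot>\<^bsub>M\<^esub> m = \<zero>\<^bsub>M\<^esub>"
  shows "(\<lambda>v\<in>carrier (cyclic \<pi>). v \<odot>\<^bsub>M\<^esub> m) \<in> module_Hom A (cyclic \<pi>) M"
    and "\<pi> \<one> \<odot>\<^bsub>M\<^esub> m = m"
proof -
  interpret M: left_module A M by fact
  note D = cyclic_projectionD
  have eq: "r \<odot>\<^bsub>M\<^esub> m = s \<odot>\<^bsub>M\<^esub> m" if "r \<in> carrier A" "s \<in> carrier A" "\<pi> r = \<pi> s" for r s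
  proof -
    have "(r \<ominus> s) \<odot>\<^bsub>M\<^esub> m = \<zero>\<^bsub>M\<^esub>"
      using assms(3) cyclic_projection_diff that by simp
    then have "r \<odot>\<^bsub>M\<^esub> m \<ominus>\<^bsub>M\<^esub> s \<odot>\<^bsub>M\<^esub> m = \<zero>\<^bsub>M\<^esub>"
      using that assms(2) by (simp add: a_minus_def M.smult_l_distr M.scalar_minus_left)
    then show ?thesis using that assms(2) M.diff_eq_zero_iff by simp
  qed
  show "(\<lambda>v\<in>carrier (cyclic \<pi>). v \<odot>\<^bsub>M\<^esub> m) \<in> module_Hom A (cyclic \<pi>) M"
  proof (rule module_HomI[OF left_module_cyclic])
    fix a v assume av: "a \<in> carrier A" "v \<in> carrier (cyclic \<pi>)"
    then have v: "v \<in> carrier A" using D(1) by auto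
    have "\<pi> (a \<otimes> v) \<odot>\<^bsub>M\<^esub> m = (a \<otimes> v) \<odot>\<^bsub>M\<^esub> m"
      using av v D by (intro eq) auto
    then show "(a \<odot>\<^bsub>cyclic \<pi>\<^esub> v) \<odot>\<^bsub>M\<^esub> m = a \<odot>\<^bsub>M\<^esub> (v \<odot>\<^bsub>M\<^esub> m)"
      using av v assms(2) by (simp add: M.smult_assoc1)
  qed (use assms(2) in \<open>auto simp: D(1) M.smult_l_distr\<close>)
  show "\<pi> \<one> \<odot>\<^bsub>M\<^esub> m = m"
    using eq[of "\<pi> \<one>" \<one>] D assms(2) by simp
qed

text \<open>A homomorphism out of \<open>cyclic \<pi>\<close> is the same as an element annihilated
  by the kernel of \<open>\<pi>\<close>, so lifting homomorphisms amounts to lifting such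
  elements.\<close>

lemma projective_cyclicI:
  assumes "\<And>(M :: ('k, nat \<Rightarrow> 'k) fmod) (N :: ('k, nat \<Rightarrow> 'k) fmod) g n. left_module A M \<Longrightarrow> left_module A N \<Longrightarrow> g \<in> module_Hom A M N \<Longrightarrow>
      g ` carrier M = carrier N \<Longrightarrow> n \<in> carrier N \<Longrightarrow>
      (\<And>r. r \<in> carrier A \<Longrightarrow> \<pi> r = \<zero> \<Longrightarrow> r \<odot>\<^bsub>N\<^esub> n = \<zero>\<^bsub>N\<^esub>) \<Longrightarrow>
      \<exists>m\<in>carrier M. g m = n \<and> (\<forall>r\<in>carrier A. \<pi> r = \<zero> \<longrightarrow> r \<odot>\<^bsub>M\<^esub> m = \<zero>\<^bsub>M\<^esub>)"
  shows "projective K A (cyclic \<pi>)"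
  unfolding projective_def
proof (intro conjI allI impI ballI fd_module_cyclic)
  fix M N :: "('k, nat \<Rightarrow> 'k) fmod" and g f
  assume MN: "fd_module K A M \<and> fd_module K A N" and g: "g \<in> module_Hom A M N" "g ` carrier M = carrier N"
    and f: "f \<in> module_Hom A (cyclic \<pi>) N"
  have M: "left_module A M" and N: "left_module A N" using MN fd_left_module by auto
  note D = cyclic_projectionD and fD = module_HomD[OF f]
  have p1: "\<pi> \<one> \<in> carrier (cyclic \<pi>)" by simp
  have "r \<odot>\<^bsub>N\<^esub> f (\<pi> \<one>) = \<zero>\<^bsub>N\<^esub>" if "r \<in> carrier A" "\<pi> r = \<zero>" for r
    using fD(3)[OF that(1) p1] that D(4)[of r \<one>] module_Hom_zero[OF left_module_cyclic N f] by simp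
  then obtain m where m: "m \<in> carrier M" "g m = f (\<pi> \<one>)"
    "\<And>r. r \<in> carrier A \<Longrightarrow> \<pi> r = \<zero> \<Longrightarrow> r \<odot>\<^bsub>M\<^esub> m = \<zero>\<^bsub>M\<^esub>"
    using assms[OF M N g fD(1)[OF p1]] by metis
  show "\<exists>h\<in>module_Hom A (cyclic \<pi>) M. \<forall>x\<in>carrier (cyclic \<pi>). g (h x) = f x"
  proof (rule bexI[OF _ cyclic_Hom(1)[OF M m(1,3)]], intro ballI)
    fix v assume v: "v \<in> carrier (cyclic \<pi>)"
    then have vA: "v \<in> carrier A" using D(1) by auto
    have "g (v \<odot>\<^bsub>M\<^esub> m) = v \<odot>\<^bsub>N\<^esub> f (\<pi> \<one>)" using module_HomD(3)[OF g(1) vA m(1)] m(2) by simp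
    also have "\<dots> = f (v \<odot>\<^bsub>cyclic \<pi>\<^esub> \<pi> \<one>)" using fD(3)[OF vA p1] by simp
    also have "\<dots> = f v" using cyclic_generator[OF v] by simp
    finally show "g ((\<lambda>v\<in>carrier (cyclic \<pi>). v \<odot>\<^bsub>M\<^esub> m) v) = f v" using v by simp
  qed
qed

text \<open>The element \<open>m\<close> defines a homomorphism from \<open>cyclic \<pi>\<close> to
  N, and \<open>f\<close> is a left inverse of it because both compositions are determined by the
  generator. So \<open>cyclic \<pi>\<close> is a nonzero retract of an indecomposable module. Every
  identification of an indecomposable module below ends here.\<close>

lemma indecomposable_iso_cyclic:
  assumes "indecomposable K A N" "m \<in> carrier N"
    and "\<And>r. r \<in> carrier A \<Longrightarrow> \<pi> r = \<zero> \<Longrightarrow> r \<odot>\<^bsub>N\<^esub> m = \<zero>\<^bsub>N\<^esub>"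
    and "f \<in> module_Hom A N (cyclic \<pi>)" "f m = \<pi> \<one>" "\<pi> \<one> \<noteq> \<zero>"
  shows "module_iso A N (cyclic \<pi>)"
proof (rule indecomposable_retract_iso[OF assms(1) fd_module_cyclic])
  have N: "left_module A N"
    using assms(1) fd_left_module by (auto simp: indecomposable_def)
  show "\<not> zero_module (cyclic \<pi>)"
    using assms(6) by (auto simp: zero_module_def set_eq_iff)
  show "retract_of A (cyclic \<pi>) N"
  proof (rule retract_ofI[OF cyclic_Hom(1)[OF N assms(2,3)] assms(4)])
    fix v assume v: "v \<in> carrier (cyclic \<pi>)"
    then have vA: "v \<in> carrier A" using cyclic_projectionD(1) by auto
    show "f ((\<lambda>v\<in>carrier (cyclic \<pi>). v \<odot>\<^bsub>N\<^esub> m) v) = v"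
      using v vA module_HomD(3)[OF assms(4) vA assms(2)] assms(5) cyclic_generator[OF v] by simp
  qed
qed

end

end

section \<open>The opposite algebra and quotient modules\<close>

lemma opposite_simps [simp]:
  "carrier (opposite A) = carrier A" "\<zero>\<^bsub>opposite A\<^esub> = \<zero>\<^bsub>A\<^esub>" "\<one>\<^bsub>opposite A\<^esub> = \<one>\<^bsub>A\<^esub>"
  "add (opposite A) = add A" "smult (opposite A) = smult A" "u \<otimes>\<^bsub>opposite A\<^esub> v = v \<otimes>\<^bsub>A\<^esub> u"
  by (simp_all add: opposite_def)

lemma a_inv_opposite [simp]: "a_inv (opposite A) = a_inv A"
  by (simp add: a_inv_def)

lemma ring_opposite:
  assumes "ring A"
  shows "ring (opposite A)"
proof -
  interpret ring A by fact
  have "abelian_group (opposite A)"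
    using abelian_group_axioms by (simp add: abelian_group_def abelian_monoid_def abelian_group_axioms_def)
  moreover have "monoid (opposite A)"
    by (rule monoidI) (auto simp: m_assoc)
  ultimately show ?thesis
    by (rule ringI) (auto simp: l_distr r_distr)
qed

lemma left_module_cong_add:
  assumes "left_module K V" "carrier W = carrier V" "add W = add V" "\<zero>\<^bsub>W\<^esub> = \<zero>\<^bsub>V\<^esub>" "smult W = smult V"
  shows "left_module K W"
  using assms(1)
  unfolding left_module_def left_module_axioms_def abelian_group_def abelian_monoid_def abelian_group_axioms_def
    assms(2-5) by blast

lemma fd_algebra_opposite:
  assumes "fd_algebra K A"
  shows "fd_algebra K (opposite A)"
proof -
  have K: "cring K" using assms by (simp add: fd_algebra_def domain.axioms field.axioms)
  have "submodule U K (opposite A) = submodule U K A" for U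
    by (simp add: submodule_def submodule_axioms_def)
  then have "finite_dimensional K (opposite A)"
    using assms left_module_cong_add[of K A "opposite A"]
    by (simp add: fd_algebra_def finite_dimensional_iff[OF K])
  then show ?thesis
    using assms ring_opposite[of A] unfolding fd_algebra_def by simp metis
qed

context
  fixes R :: "('a, 'z) ring_scheme" and D :: "('a, 'm) module" and U
  assumes D: "left_module R D" and U: "submodule U R D"
begin

interpretation D: left_module R D by (rule D)

interpretation U: abelian_subgroup U D
  using D.M.abelian_group_axioms submodule.axioms(1)[OF U]
  by (intro abelian_subgroupI3 additive_subgroupI)

lemma quotient_module_carrier: "carrier (quotient_module D U) = (\<lambda>x. U +>\<^bsub>D\<^esub> x) ` carrier D"
  by (auto simp: quotient_module_def A_RCOSETS_def')

lemma quotient_module_add: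
  assumes "x \<in> carrier D" "y \<in> carrier D"
  shows "(U +>\<^bsub>D\<^esub> x) \<oplus>\<^bsub>quotient_module D U\<^esub> (U +>\<^bsub>D\<^esub> y) = U +>\<^bsub>D\<^esub> (x \<oplus>\<^bsub>D\<^esub> y)"
  using U.a_rcos_sum assms by (simp add: quotient_module_def)

lemma in_coset: "y \<in> U +>\<^bsub>D\<^esub> x \<longleftrightarrow> (\<exists>u\<in>U. y = u \<oplus>\<^bsub>D\<^esub> x)"
  by (auto simp: a_r_coset_def')

lemma coset_self: "x \<in> carrier D \<Longrightarrow> x \<in> U +>\<^bsub>D\<^esub> x"
  using U.a_rcos_self by simp

lemma coset_of_mem: "x \<in> U \<Longrightarrow> U +>\<^bsub>D\<^esub> x = U"
  using D.M.a_coset_join2 submodule.axioms(1)[OF U] D.submoduleD(1)[OF U] by blast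

text \<open>Representatives of a coset differ by elements of U, and a U is contained in U; hence all
  cosets in the defining union coincide.\<close>

lemma quotient_module_smult:
  assumes "a \<in> carrier R" "x \<in> carrier D"
  shows "a \<odot>\<^bsub>quotient_module D U\<^esub> (U +>\<^bsub>D\<^esub> x) = U +>\<^bsub>D\<^esub> (a \<odot>\<^bsub>D\<^esub> x)"
proof -
  note S = D.submoduleD[OF U]
  have "U +>\<^bsub>D\<^esub> (a \<odot>\<^bsub>D\<^esub> y) = U +>\<^bsub>D\<^esub> (a \<odot>\<^bsub>D\<^esub> x)" if y: "y \<in> U +>\<^bsub>D\<^esub> x" for y
  proof -
    obtain u where u: "u \<in> U" "y = u \<oplus>\<^bsub>D\<^esub> x" using y in_coset by blast
    then have "a \<odot>\<^bsub>D\<^esub> y = a \<odot>\<^bsub>D\<^esub> u \<oplus>\<^bsub>D\<^esub> a \<odot>\<^bsub>D\<^esub> x"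
      using assms S(1) by (auto intro!: D.smult_r_distr)
    then have "a \<odot>\<^bsub>D\<^esub> y \<in> U +>\<^bsub>D\<^esub> (a \<odot>\<^bsub>D\<^esub> x)"
      using in_coset S(4)[OF assms(1) u(1)] by blast
    then show ?thesis
      using D.M.a_repr_independence submodule.axioms(1)[OF U] assms by (metis D.scalar_closed)
  qed
  note eq = this
  have "a \<odot>\<^bsub>quotient_module D U\<^esub> (U +>\<^bsub>D\<^esub> x) = (\<Union>y\<in>U +>\<^bsub>D\<^esub> x. U +>\<^bsub>D\<^esub> (a \<odot>\<^bsub>D\<^esub> x))"
    using eq by (simp add: quotient_module_def)
  then show ?thesis using coset_self[OF assms(2)] by blast
qed

end

context fin_dim_algebra
begin

lemma ring_dual_simps:
  "carrier (ring_dual A P) = module_Hom A P (regular A)" "\<zero>\<^bsub>ring_dual A P\<^esub> = (\<lambda>x\<in>carrier P. \<zero>)"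
  "\<phi> \<oplus>\<^bsub>ring_dual A P\<^esub> \<theta> = (\<lambda>x\<in>carrier P. \<phi> x \<oplus> \<theta> x)"
  "a \<odot>\<^bsub>ring_dual A P\<^esub> \<phi> = (\<lambda>x\<in>carrier P. \<phi> x \<otimes> a)"
  by (simp_all add: ring_dual_def)

lemma left_module_ring_dual:
  assumes "left_module A P"
  shows "left_module (opposite A) (ring_dual A P)"
proof -
  interpret P: left_module A P by fact
  note R = left_module_regular[OF A.ring_axioms]
  have c: "\<phi> x \<in> carrier A" if "\<phi> \<in> module_Hom A P (regular A)" "x \<in> carrier P" for \<phi> x
    using module_HomD(1)[OF that] by simp
  have e: "\<phi> x = undefined" if "\<phi> \<in> module_Hom A P (regular A)" "x \<notin> carrier P" for \<phi> x
    using module_HomD(4)[OF that(1)] that(2) by (simp add: extensional_def)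
  show ?thesis
  proof (rule left_moduleI)
    show "a \<odot>\<^bsub>ring_dual A P\<^esub> \<phi> \<in> carrier (ring_dual A P)"
      if "a \<in> carrier (opposite A)" "\<phi> \<in> carrier (ring_dual A P)" for a \<phi>
      unfolding ring_dual_simps
      using that c module_HomD(2,3)[of \<phi> A P "regular A"]
      by (intro module_HomI[OF assms]) (auto simp: ring_dual_simps A.l_distr A.m_assoc)
    show "u \<oplus>\<^bsub>ring_dual A P\<^esub> v \<in> carrier (ring_dual A P)"
      if "u \<in> carrier (ring_dual A P)" "v \<in> carrier (ring_dual A P)" for u v
      using module_Hom_add[OF assms R] that by (simp add: ring_dual_simps)
    show "\<zero>\<^bsub>ring_dual A P\<^esub> \<in> carrier (ring_dual A P)"
      using module_Hom_zero_map[OF assms R] by (simp add: ring_dual_simps)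
  qed (auto simp: ring_dual_simps fun_eq_iff restrict_def c e A.a_ac A.l_distr A.r_distr A.m_assoc
      A.r_minus A.l_neg A.r_neg ring_opposite[OF A.ring_axioms])
qed

lemma submodule_ring_dual_image:
  assumes "left_module A P1" "left_module A P0" "f \<in> module_Hom A P1 P0"
  shows "submodule ((\<lambda>\<phi>. compose (carrier P1) \<phi> f) ` carrier (ring_dual A P0)) (opposite A) (ring_dual A P1)"
proof -
  note D1 = left_module_ring_dual[OF assms(1)] and D0 = left_module_ring_dual[OF assms(2)]
  note f = module_HomD[OF assms(3)]
  have "restrict (\<lambda>\<phi>. compose (carrier P1) \<phi> f) (carrier (ring_dual A P0))
      \<in> module_Hom (opposite A) (ring_dual A P0) (ring_dual A P1)"
  proof (rule module_HomI[OF D0])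
    show "compose (carrier P1) \<phi> f \<in> carrier (ring_dual A P1)" if "\<phi> \<in> carrier (ring_dual A P0)" for \<phi>
      using module_Hom_compose[OF assms(1,3)] that by (auto simp: ring_dual_simps compose_def)
  qed (auto simp: ring_dual_simps compose_def fun_eq_iff f)
  then have "submodule (restrict (\<lambda>\<phi>. compose (carrier P1) \<phi> f) (carrier (ring_dual A P0)) ` carrier (ring_dual A P0))
      (opposite A) (ring_dual A P1)"
    using submodule_image[OF D0 D1] left_module.submoduleI[OF D0, of "carrier (ring_dual A P0)"]
      left_module.smult_closed[OF D0] abelian_groupE(1,2)[OF left_module.axioms(2)[OF D0]] by blast
  then show ?thesis by simp
qed

section \<open>A criterion for tau-rigidity\<close>

text \<open>These maps stand for the pure tensors \<phi> \<otimes> m in Hom(P, A) \<otimes> T. For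
  projective P a dual basis writes every homomorphism P \<rightarrow> T as a sum of them.\<close>

lemma rank_one_Hom:
  assumes "left_module A P" "left_module A T" "\<phi> \<in> module_Hom A P (regular A)" "m \<in> carrier T"
  shows "(\<lambda>q\<in>carrier P. \<phi> q \<odot>\<^bsub>T\<^esub> m) \<in> module_Hom A P T"
proof -
  interpret T: left_module A T by fact
  note p = module_HomD[OF assms(3)]
  show ?thesis
    by (rule module_HomI[OF assms(1)]) (use p assms(4) in \<open>auto simp: T.smult_l_distr T.smult_assoc1\<close>)
qed

definition Hom_space :: "('k, nat \<Rightarrow> 'k) fmod \<Rightarrow> ('k, nat \<Rightarrow> 'k) fmod \<Rightarrow> ('k, (nat \<Rightarrow> 'k) \<Rightarrow> nat \<Rightarrow> 'k) module" where
  "Hom_space P T = \<lparr>carrier = module_Hom A P T, monoid.mult = undefined, one = undefined,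
    ring.zero = (\<lambda>q\<in>carrier P. \<zero>\<^bsub>T\<^esub>), add = (\<lambda>g h. \<lambda>q\<in>carrier P. g q \<oplus>\<^bsub>T\<^esub> h q),
    smult = (\<lambda>c h. \<lambda>q\<in>carrier P. scal c \<odot>\<^bsub>T\<^esub> h q)\<rparr>"

lemma Hom_space_simps:
  "carrier (Hom_space P T) = module_Hom A P T" "\<zero>\<^bsub>Hom_space P T\<^esub> = (\<lambda>q\<in>carrier P. \<zero>\<^bsub>T\<^esub>)"
  "g \<oplus>\<^bsub>Hom_space P T\<^esub> h = (\<lambda>q\<in>carrier P. g q \<oplus>\<^bsub>T\<^esub> h q)"
  "c \<odot>\<^bsub>Hom_space P T\<^esub> h = (\<lambda>q\<in>carrier P. scal c \<odot>\<^bsub>T\<^esub> h q)"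
  by (simp_all add: Hom_space_def)

text \<open>Scalar multiples of A-linear maps stay A-linear because the elements
  \<open>scal c\<close> are central.\<close>

lemma left_module_Hom_space:
  assumes "left_module A P" "left_module A T"
  shows "left_module K (Hom_space P T)"
proof -
  interpret P: left_module A P by fact
  interpret T: left_module A T by fact
  have c: "h x \<in> carrier T" if "h \<in> module_Hom A P T" "x \<in> carrier P" for h x
    using module_HomD(1)[OF that] .
  have e: "h x = undefined" if "h \<in> module_Hom A P T" "x \<notin> carrier P" for h x
    using module_HomD(4)[OF that(1)] that(2) by (simp add: extensional_def)
  show ?thesis
  proof (rule left_moduleI)
    show "a \<odot>\<^bsub>Hom_space P T\<^esub> h \<in> carrier (Hom_space P T)"
      if a: "a \<in> carrier K" and h: "h \<in> carrier (Hom_space P T)" for a h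
      unfolding Hom_space_simps
    proof (rule module_HomI[OF assms(1)])
      note hD = module_HomD[OF h[unfolded Hom_space_simps]]
      fix r m assume rm: "r \<in> carrier A" "m \<in> carrier P"
      then have "scal a \<odot>\<^bsub>T\<^esub> h (r \<odot>\<^bsub>P\<^esub> m) = (scal a \<otimes> r) \<odot>\<^bsub>T\<^esub> h m"
        using a hD by (simp add: T.smult_assoc1)
      also have "\<dots> = r \<odot>\<^bsub>T\<^esub> (scal a \<odot>\<^bsub>T\<^esub> h m)"
        using a rm hD scal_commute[OF a rm(1)] by (simp flip: T.smult_assoc1)
      finally show "scal a \<odot>\<^bsub>T\<^esub> h (r \<odot>\<^bsub>P\<^esub> m) = r \<odot>\<^bsub>T\<^esub> (scal a \<odot>\<^bsub>T\<^esub> h m)" .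
    qed (use a c h module_HomD(2)[OF h[unfolded Hom_space_simps]] in \<open>auto simp: Hom_space_simps T.smult_r_distr\<close>)
    show "u \<oplus>\<^bsub>Hom_space P T\<^esub> v \<in> carrier (Hom_space P T)"
      if "u \<in> carrier (Hom_space P T)" "v \<in> carrier (Hom_space P T)" for u v
      using module_Hom_add[OF assms] that by (simp add: Hom_space_simps)
    show "\<zero>\<^bsub>Hom_space P T\<^esub> \<in> carrier (Hom_space P T)"
      using module_Hom_zero_map[OF assms] by (simp add: Hom_space_simps)
  qed (auto simp: Hom_space_simps fun_eq_iff restrict_def c e T.M.a_ac T.smult_l_distr T.smult_r_distr T.smult_assoc1
      scal_add scal_mult scal_uminus T.scalar_minus_left T.M.l_neg T.M.r_neg K.ring_axioms)
qed

lemma field_dual_simps: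
  "carrier (field_dual K (opposite A) Q) = module_Hom K (restrict_scalars (opposite A) Q) (regular K)"
  "\<zero>\<^bsub>field_dual K (opposite A) Q\<^esub> = (\<lambda>x\<in>carrier Q. \<zero>\<^bsub>K\<^esub>)"
  "g \<oplus>\<^bsub>field_dual K (opposite A) Q\<^esub> h = (\<lambda>x\<in>carrier Q. g x \<oplus>\<^bsub>K\<^esub> h x)"
  "a \<odot>\<^bsub>field_dual K (opposite A) Q\<^esub> h = (\<lambda>x\<in>carrier Q. h (a \<odot>\<^bsub>Q\<^esub> x))"
  by (simp_all add: field_dual_def)

lemma field_dual_memI:
  assumes "\<And>x. x \<in> carrier Q \<Longrightarrow> h x \<in> carrier K"
    and "\<And>x y. x \<in> carrier Q \<Longrightarrow> y \<in> carrier Q \<Longrightarrow> x \<oplus>\<^bsub>Q\<^esub> y \<in> carrier Q \<and> h (x \<oplus>\<^bsub>Q\<^esub> y) = h x \<oplus>\<^bsub>K\<^esub> h y"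
    and "\<And>c x. c \<in> carrier K \<Longrightarrow> x \<in> carrier Q \<Longrightarrow>
      scal c \<odot>\<^bsub>Q\<^esub> x \<in> carrier Q \<and> h (scal c \<odot>\<^bsub>Q\<^esub> x) = c \<otimes>\<^bsub>K\<^esub> h x"
  shows "restrict h (carrier Q) \<in> carrier (field_dual K (opposite A) Q)"
  using assms by (auto simp: field_dual_simps module_Hom_def scal_def)

lemma field_dual_memD:
  assumes "h \<in> carrier (field_dual K (opposite A) Q)"
  shows "\<And>x. x \<in> carrier Q \<Longrightarrow> h x \<in> carrier K"
    and "\<And>x y. x \<in> carrier Q \<Longrightarrow> y \<in> carrier Q \<Longrightarrow> h (x \<oplus>\<^bsub>Q\<^esub> y) = h x \<oplus>\<^bsub>K\<^esub> h y"
    and "h \<in> extensional (carrier Q)"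
  using assms by (auto simp: field_dual_simps module_Hom_def PiE_def)

definition pullback_image :: "('k, nat \<Rightarrow> 'k) fmod \<Rightarrow> ((nat \<Rightarrow> 'k) \<Rightarrow> nat \<Rightarrow> 'k) \<Rightarrow> ('k, nat \<Rightarrow> 'k) fmod \<Rightarrow>
    ((nat \<Rightarrow> 'k) \<Rightarrow> nat \<Rightarrow> 'k) set" where
  "pullback_image P1 f P0 = (\<lambda>\<phi>. compose (carrier P1) \<phi> f) ` carrier (ring_dual A P0)"

context
  fixes P1 P0 T :: "('k, nat \<Rightarrow> 'k) fmod" and f
  assumes P1: "projective K A P1" and P0: "projective K A P0" and T: "left_module A T"
    and f: "f \<in> module_Hom A P1 P0"
begin

interpretation P1: left_module A P1 by (rule projective_left_module[OF P1])
interpretation P0: left_module A P0 by (rule projective_left_module[OF P0])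
interpretation T: left_module A T by (rule T)

private abbreviation (input) "U \<equiv> pullback_image P1 f P0"
private abbreviation (input) "Q \<equiv> transpose_of A P1 f P0"
private abbreviation (input) "\<tau>T \<equiv> field_dual K (opposite A) Q"
private abbreviation (input) "cls \<phi> \<equiv> U +>\<^bsub>ring_dual A P1\<^esub> \<phi>"

interpretation D1: left_module "opposite A" "ring_dual A P1"
  by (rule left_module_ring_dual[OF P1.left_module_axioms])

private lemma U: "submodule U (opposite A) (ring_dual A P1)"
  unfolding pullback_image_def
  by (rule submodule_ring_dual_image[OF P1.left_module_axioms P0.left_module_axioms f])

private lemma U_iff: "u \<in> U \<longleftrightarrow> (\<exists>\<theta>\<in>module_Hom A P0 (regular A). u = compose (carrier P1) \<theta> f)"
  by (auto simp: pullback_image_def ring_dual_simps)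

private lemma Q_facts:
  "carrier Q = cls ` module_Hom A P1 (regular A)"
  "\<And>x y. x \<in> module_Hom A P1 (regular A) \<Longrightarrow> y \<in> module_Hom A P1 (regular A) \<Longrightarrow>
    cls x \<oplus>\<^bsub>Q\<^esub> cls y = cls (x \<oplus>\<^bsub>ring_dual A P1\<^esub> y)"
  "\<And>a x. a \<in> carrier A \<Longrightarrow> x \<in> module_Hom A P1 (regular A) \<Longrightarrow> a \<odot>\<^bsub>Q\<^esub> cls x = cls (a \<odot>\<^bsub>ring_dual A P1\<^esub> x)"
  unfolding transpose_of_def
  using quotient_module_carrier[OF D1.left_module_axioms U] quotient_module_add[OF D1.left_module_axioms U]
    quotient_module_smult[OF D1.left_module_axioms U]
  by (simp_all add: ring_dual_simps(1) pullback_image_def)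

private lemma dual_closed:
  "x \<in> module_Hom A P1 (regular A) \<Longrightarrow> y \<in> module_Hom A P1 (regular A) \<Longrightarrow>
    x \<oplus>\<^bsub>ring_dual A P1\<^esub> y \<in> module_Hom A P1 (regular A)"
  "a \<in> carrier A \<Longrightarrow> x \<in> module_Hom A P1 (regular A) \<Longrightarrow>
    a \<odot>\<^bsub>ring_dual A P1\<^esub> x \<in> module_Hom A P1 (regular A)"
  using D1.M.a_closed[of x y] D1.smult_closed[of a x] by (simp_all add: ring_dual_simps(1))

private lemma Q_closed:
  "x \<in> carrier Q \<Longrightarrow> y \<in> carrier Q \<Longrightarrow> x \<oplus>\<^bsub>Q\<^esub> y \<in> carrier Q"
  "a \<in> carrier A \<Longrightarrow> x \<in> carrier Q \<Longrightarrow> a \<odot>\<^bsub>Q\<^esub> x \<in> carrier Q"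
  using dual_closed by (auto simp: Q_facts)

private lemma zero_mem: "(\<lambda>x\<in>carrier Q. \<zero>\<^bsub>K\<^esub>) \<in> carrier \<tau>T"
  using Q_closed by (intro field_dual_memI) auto

private lemma zero_Hom: "(\<lambda>m\<in>carrier T. \<zero>\<^bsub>\<tau>T\<^esub>) \<in> module_Hom A T \<tau>T"
  using zero_mem Q_closed
  by (intro module_HomI[OF T]) (auto simp: field_dual_simps fun_eq_iff)

text \<open>A homomorphism \<open>T \<rightarrow> \<tau> T\<close> is a pairing of \<open>T\<close> with \<open>Hom(P1, A)\<close> that vanishes on the image of
  \<open>Hom(P0, A)\<close>. Dual bases turn it into a functional on \<open>Hom(P1, T)\<close> vanishing on the image of
  \<open>Hom(P0, T)\<close>, and conversely.\<close>

lemma factorization_imp_Hom_vanishes: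
  assumes fac: "\<And>h. h \<in> module_Hom A P1 T \<Longrightarrow> \<exists>g\<in>module_Hom A P0 T. \<forall>q\<in>carrier P1. h q = g (f q)"
  shows "Hom_vanishes A T \<tau>T"
proof -
  note fD = module_HomD[OF f]
  obtain n :: nat and \<phi> b where \<phi>: "\<And>i. i < n \<Longrightarrow> \<phi> i \<in> module_Hom A P1 (regular A)"
    and b: "\<And>i. i < n \<Longrightarrow> b i \<in> carrier P1"
    and dual1: "\<And>p. p \<in> carrier P1 \<Longrightarrow> p = (\<Oplus>\<^bsub>P1\<^esub>i\<in>{..<n}. \<phi> i p \<odot>\<^bsub>P1\<^esub> b i)"
    by (rule dual_basis[OF P1]) blast
  obtain k :: nat and \<theta> c where \<theta>: "\<And>i. i < k \<Longrightarrow> \<theta> i \<in> module_Hom A P0 (regular A)"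
    and c: "\<And>i. i < k \<Longrightarrow> c i \<in> carrier P0"
    and dual0: "\<And>p. p \<in> carrier P0 \<Longrightarrow> p = (\<Oplus>\<^bsub>P0\<^esub>i\<in>{..<k}. \<theta> i p \<odot>\<^bsub>P0\<^esub> c i)"
    by (rule dual_basis[OF P0]) blast
  have \<phi>c: "\<phi> i p \<in> carrier A" if "i < n" "p \<in> carrier P1" for i p
    using module_HomD(1)[OF \<phi>[OF that(1)] that(2)] by simp
  have \<theta>c: "\<theta> i p \<in> carrier A" if "i < k" "p \<in> carrier P0" for i p
    using module_HomD(1)[OF \<theta>[OF that(1)] that(2)] by simp
  have "\<psi> = (\<lambda>m\<in>carrier T. \<zero>\<^bsub>\<tau>T\<^esub>)" if \<psi>: "\<psi> \<in> module_Hom A T \<tau>T" for \<psi>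
  proof (rule module_Hom_eqI[OF \<psi> zero_Hom])
    note \<psi>D = module_HomD[OF \<psi>]
    note \<psi>m = field_dual_memD[OF \<psi>D(1)]
    \<comment> \<open>The pairing of T with Hom(P1, A) that belongs to \<open>\<psi>\<close>. By
      \<open>\<beta>b\<close> it is balanced over the algebra.\<close>
    define \<beta> where "\<beta> m \<eta> = \<psi> m (cls \<eta>)" for m \<eta>
    have cls: "cls \<eta> \<in> carrier Q" if "\<eta> \<in> module_Hom A P1 (regular A)" for \<eta>
      using that by (auto simp: Q_facts)
    have \<beta>c: "\<beta> m \<eta> \<in> carrier K" if "m \<in> carrier T" "\<eta> \<in> module_Hom A P1 (regular A)" for m \<eta>
      using \<psi>m(1) cls that by (simp add: \<beta>_def)
    have \<beta>l: "\<beta> (m \<oplus>\<^bsub>T\<^esub> m') \<eta> = \<beta> m \<eta> \<oplus>\<^bsub>K\<^esub> \<beta> m' \<eta>"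
      if "m \<in> carrier T" "m' \<in> carrier T" "\<eta> \<in> module_Hom A P1 (regular A)" for m m' \<eta>
      using that \<psi>D(2) cls by (simp add: \<beta>_def field_dual_simps)
    have \<beta>r: "\<beta> m (\<eta> \<oplus>\<^bsub>ring_dual A P1\<^esub> \<eta>') = \<beta> m \<eta> \<oplus>\<^bsub>K\<^esub> \<beta> m \<eta>'"
      if "m \<in> carrier T" "\<eta> \<in> module_Hom A P1 (regular A)" "\<eta>' \<in> module_Hom A P1 (regular A)" for m \<eta> \<eta>'
      using \<psi>m(2)[OF that(1) cls[OF that(2)] cls[OF that(3)]] that by (simp add: \<beta>_def Q_facts)
    have \<beta>b: "\<beta> (r \<odot>\<^bsub>T\<^esub> m) \<eta> = \<beta> m (r \<odot>\<^bsub>ring_dual A P1\<^esub> \<eta>)"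
      if "m \<in> carrier T" "r \<in> carrier A" "\<eta> \<in> module_Hom A P1 (regular A)" for m r \<eta>
      using that \<psi>D(3) cls by (simp add: \<beta>_def field_dual_simps Q_facts)
    have \<beta>0: "\<beta> \<zero>\<^bsub>T\<^esub> \<eta> = \<zero>\<^bsub>K\<^esub>" if "\<eta> \<in> module_Hom A P1 (regular A)" for \<eta>
      using \<beta>l[of "\<zero>\<^bsub>T\<^esub>" "\<zero>\<^bsub>T\<^esub>" \<eta>] \<beta>c[of "\<zero>\<^bsub>T\<^esub>" \<eta>] that by (metis K.add.r_cancel_one' T.M.l_zero T.M.zero_closed)
    have \<beta>0r: "\<beta> m (\<zero>\<^bsub>ring_dual A P1\<^esub>) = \<zero>\<^bsub>K\<^esub>" if "m \<in> carrier T" for m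
    proof -
      have z: "\<zero>\<^bsub>ring_dual A P1\<^esub> \<in> module_Hom A P1 (regular A)"
        using D1.M.zero_closed by (simp add: ring_dual_simps(1))
      then show ?thesis
        using \<beta>r[OF that z z] \<beta>c[OF that z] by (metis D1.M.l_zero D1.M.zero_closed K.add.r_cancel_one')
    qed
    \<comment> \<open>The functional on Hom(P1, T) sending h to the sum of \<beta> (h (b i)) (\<phi>
      i) is evaluated at the rank-one map of \<open>\<eta>\<close> and \<open>m\<close>. The
      expansion of \<open>\<eta>\<close> with coefficients \<eta> (b i) along the
      \<open>\<phi> i\<close>, together with balancedness, returns \<beta> m \<eta>.\<close>
    have rank1: "(\<Oplus>\<^bsub>K\<^esub>i\<in>{..<n}. \<beta> (\<eta> (b i) \<odot>\<^bsub>T\<^esub> m) (\<phi> i)) = \<beta> m \<eta>"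
      if m: "m \<in> carrier T" and \<eta>: "\<eta> \<in> module_Hom A P1 (regular A)" for m \<eta>
    proof -
      have \<eta>b: "\<eta> (b i) \<in> carrier A" if "i < n" for i using module_HomD(1)[OF \<eta> b[OF that]] by simp
      have sc: "\<eta> (b i) \<odot>\<^bsub>ring_dual A P1\<^esub> \<phi> i \<in> carrier (ring_dual A P1)" if "i < n" for i
        using D1.smult_closed \<phi>[OF that] \<eta>b[OF that] by (simp add: ring_dual_simps(1))
      let ?S = "\<Oplus>\<^bsub>ring_dual A P1\<^esub>i\<in>{..<n}. \<eta> (b i) \<odot>\<^bsub>ring_dual A P1\<^esub> \<phi> i"
      have Sc: "?S \<in> module_Hom A P1 (regular A)"
        using D1.M.finsum_closed[of "\<lambda>i. \<eta> (b i) \<odot>\<^bsub>ring_dual A P1\<^esub> \<phi> i" "{..<n}"] sc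
        by (auto simp: ring_dual_simps(1))
      have "?S = \<eta>"
      proof (rule module_Hom_eqI[OF Sc \<eta>])
        fix p assume p: "p \<in> carrier P1"
        have "?S p = (\<Oplus>i\<in>{..<n}. (\<eta> (b i) \<odot>\<^bsub>ring_dual A P1\<^esub> \<phi> i) p)"
          using sc p module_HomD(1)[OF _ p, of _ A "regular A"]
          by (intro additive_finsum[OF D1.M.abelian_group_axioms A.abelian_group_axioms, where F = "\<lambda>x. x p"])
            (auto simp: ring_dual_simps)
        also have "\<dots> = (\<Oplus>i\<in>{..<n}. \<eta> (\<phi> i p \<odot>\<^bsub>P1\<^esub> b i))"
          using p \<eta>b \<phi>c b module_HomD(3)[OF \<eta>] by (intro A.finsum_cong') (auto simp: ring_dual_simps)
        also have "\<dots> = \<eta> (\<Oplus>\<^bsub>P1\<^esub>i\<in>{..<n}. \<phi> i p \<odot>\<^bsub>P1\<^esub> b i)"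
          using p \<phi>c b module_HomD(1,2)[OF \<eta>]
            module_Hom_zero[OF P1.left_module_axioms left_module_regular[OF A.ring_axioms] \<eta>]
          by (intro additive_finsum[OF P1.M.abelian_group_axioms A.abelian_group_axioms, symmetric]) auto
        also have "\<dots> = \<eta> p" using dual1[OF p] by simp
        finally show "?S p = \<eta> p" .
      qed
      have "(\<Oplus>\<^bsub>K\<^esub>i\<in>{..<n}. \<beta> (\<eta> (b i) \<odot>\<^bsub>T\<^esub> m) (\<phi> i)) =
          (\<Oplus>\<^bsub>K\<^esub>i\<in>{..<n}. \<beta> m (\<eta> (b i) \<odot>\<^bsub>ring_dual A P1\<^esub> \<phi> i))"
        using m \<eta>b \<phi> \<beta>b \<beta>c sc by (intro K.finsum_cong') (auto simp: ring_dual_simps(1))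
      also have "\<dots> = \<beta> m ?S"
        using sc m \<beta>c \<beta>r \<beta>0r
        by (intro additive_finsum[OF D1.M.abelian_group_axioms K.abelian_group_axioms, symmetric])
          (auto simp: ring_dual_simps(1))
      finally show ?thesis using \<open>?S = \<eta>\<close> by simp
    qed
    \<comment> \<open>Maps factoring through \<open>f\<close> represent the zero class of the
      transpose.\<close>
    have \<beta>U: "\<beta> m (compose (carrier P1) \<eta> f) = \<zero>\<^bsub>K\<^esub>"
      if m: "m \<in> carrier T" and \<eta>: "\<eta> \<in> module_Hom A P0 (regular A)" for m \<eta>
    proof -
      have "compose (carrier P1) \<eta> f \<in> U" using \<eta> by (auto simp: U_iff)
      moreover have "\<zero>\<^bsub>ring_dual A P1\<^esub> \<in> U" using D1.submoduleD(2)[OF U] .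
      ultimately have "cls (compose (carrier P1) \<eta> f) = cls \<zero>\<^bsub>ring_dual A P1\<^esub>"
        using coset_of_mem[OF D1.left_module_axioms U] by metis
      then show ?thesis using \<beta>0r[OF m] by (simp add: \<beta>_def)
    qed
    fix m assume m: "m \<in> carrier T"
    have "\<psi> m C = \<zero>\<^bsub>K\<^esub>" if C: "C \<in> carrier Q" for C
    proof -
      obtain \<eta> where \<eta>: "\<eta> \<in> module_Hom A P1 (regular A)" "C = cls \<eta>"
        using C by (auto simp: Q_facts)
      \<comment> \<open>The rank-one map of \<open>\<eta>\<close> and \<open>m\<close> factors
        through P0, so its functional value, which is \<psi> m C, can be computed from
        \<open>g\<close>.\<close>
      obtain g where g: "g \<in> module_Hom A P0 T" "\<And>q. q \<in> carrier P1 \<Longrightarrow> \<eta> q \<odot>\<^bsub>T\<^esub> m = g (f q)"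
        using fac[OF rank_one_Hom[OF P1.left_module_axioms T \<eta>(1) m]] by auto
      note gD = module_HomD[OF g(1)]
      have gdec: "g y = (\<Oplus>\<^bsub>T\<^esub>j\<in>{..<k}. \<theta> j y \<odot>\<^bsub>T\<^esub> g (c j))" if y: "y \<in> carrier P0" for y
      proof -
        have "g y = g (\<Oplus>\<^bsub>P0\<^esub>j\<in>{..<k}. \<theta> j y \<odot>\<^bsub>P0\<^esub> c j)" using dual0[OF y] by simp
        also have "\<dots> = (\<Oplus>\<^bsub>T\<^esub>j\<in>{..<k}. g (\<theta> j y \<odot>\<^bsub>P0\<^esub> c j))"
          using gD(1,2) \<theta>c y c module_Hom_zero[OF P0.left_module_axioms T g(1)]
          by (intro additive_finsum[OF P0.M.abelian_group_axioms T.M.abelian_group_axioms]) auto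
        also have "\<dots> = (\<Oplus>\<^bsub>T\<^esub>j\<in>{..<k}. \<theta> j y \<odot>\<^bsub>T\<^esub> g (c j))"
          using gD \<theta>c y c by (intro T.M.finsum_cong') auto
        finally show ?thesis .
      qed
      \<comment> \<open>The dual basis of P0 decomposes g \<circ> f into the rank-one maps of
        \<theta> j \<circ> f and g (c j). Each has value zero by \<open>rank1\<close> and
        \<open>\<beta>U\<close>; the induction on J interchanges the two sums.\<close>
      have part: "(\<Oplus>\<^bsub>K\<^esub>i\<in>{..<n}. \<beta> (\<Oplus>\<^bsub>T\<^esub>j\<in>J. \<theta> j (f (b i)) \<odot>\<^bsub>T\<^esub> g (c j)) (\<phi> i)) = \<zero>\<^bsub>K\<^esub>"
        if "finite J" "J \<subseteq> {..<k}" for J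
        using that
      proof (induction J)
        case empty
        have "(\<Oplus>\<^bsub>K\<^esub>i\<in>{..<n}. \<beta> \<zero>\<^bsub>T\<^esub> (\<phi> i)) = (\<Oplus>\<^bsub>K\<^esub>i\<in>{..<n}. \<zero>\<^bsub>K\<^esub>)"
          using \<phi> \<beta>0 by (intro K.finsum_cong') auto
        then show ?case by simp
      next
        case (insert j J)
        have jk: "j < k" using insert by auto
        have fb: "f (b i) \<in> carrier P0" if "i < n" for i using fD(1)[OF b[OF that]] .
        have cl: "\<theta> j (f (b i)) \<odot>\<^bsub>T\<^esub> g (c j) \<in> carrier T" if "i < n" "j < k" for i j
          using \<theta>c[OF that(2) fb[OF that(1)]] gD(1)[OF c[OF that(2)]] by simp
        have cJ: "(\<Oplus>\<^bsub>T\<^esub>j\<in>J. \<theta> j (f (b i)) \<odot>\<^bsub>T\<^esub> g (c j)) \<in> carrier T" if "i < n" for i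
          using insert cl[OF that] by (intro T.M.finsum_closed) auto
        have "(\<Oplus>\<^bsub>K\<^esub>i\<in>{..<n}. \<beta> (\<Oplus>\<^bsub>T\<^esub>j\<in>insert j J. \<theta> j (f (b i)) \<odot>\<^bsub>T\<^esub> g (c j)) (\<phi> i)) =
          (\<Oplus>\<^bsub>K\<^esub>i\<in>{..<n}. \<beta> (\<theta> j (f (b i)) \<odot>\<^bsub>T\<^esub> g (c j)) (\<phi> i) \<oplus>\<^bsub>K\<^esub>
            \<beta> (\<Oplus>\<^bsub>T\<^esub>j\<in>J. \<theta> j (f (b i)) \<odot>\<^bsub>T\<^esub> g (c j)) (\<phi> i))"
        proof (rule K.finsum_cong')
          fix i assume "i \<in> {..<n}"
          then have i: "i < n" by simp
          have "(\<Oplus>\<^bsub>T\<^esub>j\<in>insert j J. \<theta> j (f (b i)) \<odot>\<^bsub>T\<^esub> g (c j)) =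
              \<theta> j (f (b i)) \<odot>\<^bsub>T\<^esub> g (c j) \<oplus>\<^bsub>T\<^esub> (\<Oplus>\<^bsub>T\<^esub>j\<in>J. \<theta> j (f (b i)) \<odot>\<^bsub>T\<^esub> g (c j))"
            using insert cl[OF i] jk by (intro T.M.finsum_insert) auto
          then show "\<beta> (\<Oplus>\<^bsub>T\<^esub>j\<in>insert j J. \<theta> j (f (b i)) \<odot>\<^bsub>T\<^esub> g (c j)) (\<phi> i) =
            \<beta> (\<theta> j (f (b i)) \<odot>\<^bsub>T\<^esub> g (c j)) (\<phi> i) \<oplus>\<^bsub>K\<^esub>
            \<beta> (\<Oplus>\<^bsub>T\<^esub>j\<in>J. \<theta> j (f (b i)) \<odot>\<^bsub>T\<^esub> g (c j)) (\<phi> i)"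
            using \<beta>l[OF cl[OF i jk] cJ[OF i] \<phi>[OF i]] by simp
        qed (use \<beta>c \<phi> cl cJ jk in auto)
        also have "\<dots> = (\<Oplus>\<^bsub>K\<^esub>i\<in>{..<n}. \<beta> (\<theta> j (f (b i)) \<odot>\<^bsub>T\<^esub> g (c j)) (\<phi> i)) \<oplus>\<^bsub>K\<^esub>
            (\<Oplus>\<^bsub>K\<^esub>i\<in>{..<n}. \<beta> (\<Oplus>\<^bsub>T\<^esub>j\<in>J. \<theta> j (f (b i)) \<odot>\<^bsub>T\<^esub> g (c j)) (\<phi> i))"
          using \<beta>c \<phi> cl cJ jk by (intro K.finsum_addf) auto
        also have "(\<Oplus>\<^bsub>K\<^esub>i\<in>{..<n}. \<beta> (\<Oplus>\<^bsub>T\<^esub>j\<in>J. \<theta> j (f (b i)) \<odot>\<^bsub>T\<^esub> g (c j)) (\<phi> i)) = \<zero>\<^bsub>K\<^esub>"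
          using insert by simp
        also have "(\<Oplus>\<^bsub>K\<^esub>i\<in>{..<n}. \<beta> (\<theta> j (f (b i)) \<odot>\<^bsub>T\<^esub> g (c j)) (\<phi> i)) = \<zero>\<^bsub>K\<^esub>"
        proof -
          have gc: "g (c j) \<in> carrier T" using gD(1)[OF c[OF jk]] .
          have "compose (carrier P1) (\<theta> j) f \<in> module_Hom A P1 (regular A)"
            using module_Hom_compose[OF P1.left_module_axioms f \<theta>[OF jk]] by (simp add: compose_def)
          from rank1[OF gc this] have "(\<Oplus>\<^bsub>K\<^esub>i\<in>{..<n}. \<beta> (compose (carrier P1) (\<theta> j) f (b i) \<odot>\<^bsub>T\<^esub> g (c j)) (\<phi> i)) = \<zero>\<^bsub>K\<^esub>"
            using \<beta>U[OF gc \<theta>[OF jk]] by simp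
          moreover have "(\<Oplus>\<^bsub>K\<^esub>i\<in>{..<n}. \<beta> (compose (carrier P1) (\<theta> j) f (b i) \<odot>\<^bsub>T\<^esub> g (c j)) (\<phi> i)) =
              (\<Oplus>\<^bsub>K\<^esub>i\<in>{..<n}. \<beta> (\<theta> j (f (b i)) \<odot>\<^bsub>T\<^esub> g (c j)) (\<phi> i))"
            using b \<beta>c cl[OF _ jk] \<phi> by (intro K.finsum_cong') (auto simp: compose_def)
          ultimately show ?thesis by simp
        qed
        finally show ?case by simp
      qed
      have "\<psi> m C = (\<Oplus>\<^bsub>K\<^esub>i\<in>{..<n}. \<beta> (\<eta> (b i) \<odot>\<^bsub>T\<^esub> m) (\<phi> i))"
        using rank1[OF m \<eta>(1)] \<eta>(2) by (simp add: \<beta>_def)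
      also have "\<dots> = (\<Oplus>\<^bsub>K\<^esub>i\<in>{..<n}. \<beta> (\<Oplus>\<^bsub>T\<^esub>j\<in>{..<k}. \<theta> j (f (b i)) \<odot>\<^bsub>T\<^esub> g (c j)) (\<phi> i))"
      proof (rule K.finsum_cong')
        have eq: "\<eta> (b i) \<odot>\<^bsub>T\<^esub> m = (\<Oplus>\<^bsub>T\<^esub>j\<in>{..<k}. \<theta> j (f (b i)) \<odot>\<^bsub>T\<^esub> g (c j))" if "i < n" for i
          using g(2)[OF b[OF that]] gdec[OF fD(1)[OF b[OF that]]] by simp
        then show "\<beta> (\<eta> (b i) \<odot>\<^bsub>T\<^esub> m) (\<phi> i) = \<beta> (\<Oplus>\<^bsub>T\<^esub>j\<in>{..<k}. \<theta> j (f (b i)) \<odot>\<^bsub>T\<^esub> g (c j)) (\<phi> i)"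
          if "i \<in> {..<n}" for i
          using that by simp
        have "(\<Oplus>\<^bsub>T\<^esub>j\<in>{..<k}. \<theta> j (f (b i)) \<odot>\<^bsub>T\<^esub> g (c j)) \<in> carrier T" if "i < n" for i
          using gdec[OF fD(1)[OF b[OF that]]] gD(1)[OF fD(1)[OF b[OF that]]] by simp
        then show "(\<lambda>i. \<beta> (\<Oplus>\<^bsub>T\<^esub>j\<in>{..<k}. \<theta> j (f (b i)) \<odot>\<^bsub>T\<^esub> g (c j)) (\<phi> i)) \<in> {..<n} \<rightarrow> carrier K"
          using \<beta>c \<phi> by auto
      qed simp
      also have "\<dots> = \<zero>\<^bsub>K\<^esub>" by (rule part) auto
      finally show ?thesis .
    qed
    then show "\<psi> m = (\<lambda>m\<in>carrier T. \<zero>\<^bsub>\<tau>T\<^esub>) m"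
      using m \<psi>m(3)[OF m] by (auto simp: field_dual_simps fun_eq_iff extensional_def)
  qed
  note all_zero = this
  show ?thesis
    unfolding Hom_vanishes_def
  proof (intro equalityI subsetI)
    show "\<psi> \<in> {\<lambda>m\<in>carrier T. \<zero>\<^bsub>\<tau>T\<^esub>}" if "\<psi> \<in> module_Hom A T \<tau>T" for \<psi>
      using all_zero[OF that] by (simp only: singleton_iff)
    show "\<psi> \<in> module_Hom A T \<tau>T" if "\<psi> \<in> {\<lambda>m\<in>carrier T. \<zero>\<^bsub>\<tau>T\<^esub>}" for \<psi>
      using zero_Hom that by (simp only: singleton_iff)
  qed
qed

text \<open>If \<open>h\<close> did not factor, some functional \<chi> on Hom(P1, T) would vanish on
  all maps that factor and satisfy \<chi> h = 1. Evaluating \<chi> on rank-one maps gives a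
  homomorphism T \<rightarrow> \<tau> T, which must be zero; but \<open>h\<close> is a sum of
  rank-one maps, so \<chi> h would be zero.\<close>

lemma Hom_vanishes_imp_factorization:
  assumes van: "Hom_vanishes A T \<tau>T" and h: "h \<in> module_Hom A P1 T"
  shows "\<exists>g\<in>module_Hom A P0 T. \<forall>q\<in>carrier P1. h q = g (f q)"
proof (rule ccontr)
  assume no: "\<not> ?thesis"
  let ?H = "Hom_space P1 T"
  note fD = module_HomD[OF f]
  interpret H: left_module K ?H
    by (rule left_module_Hom_space[OF P1.left_module_axioms T])
  define I where "I = (\<lambda>g. \<lambda>q\<in>carrier P1. g (f q)) ` module_Hom A P0 T"
  interpret H0: left_module K "Hom_space P0 T"
    by (rule left_module_Hom_space[OF P0.left_module_axioms T])
  have I: "submodule I K ?H"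
  proof -
    have "restrict (\<lambda>g. \<lambda>q\<in>carrier P1. g (f q)) (carrier (Hom_space P0 T)) \<in> module_Hom K (Hom_space P0 T) ?H"
      using module_Hom_compose[OF P1.left_module_axioms f] fD
      by (intro module_HomI[OF H0.left_module_axioms]) (auto simp: Hom_space_simps fun_eq_iff)
    then have "submodule (restrict (\<lambda>g. \<lambda>q\<in>carrier P1. g (f q)) (carrier (Hom_space P0 T)) ` carrier (Hom_space P0 T)) K ?H"
      by (rule submodule_image[OF H0.left_module_axioms H.left_module_axioms])
        (rule H0.submoduleI, auto)
    then show ?thesis by (simp add: I_def Hom_space_simps)
  qed
  have "h \<notin> I"
    using no by (auto simp: I_def)
  then obtain \<chi> where \<chi>: "\<chi> \<in> module_Hom K ?H (regular K)" "\<And>u. u \<in> I \<Longrightarrow> \<chi> u = \<zero>\<^bsub>K\<^esub>" "\<chi> h = \<one>\<^bsub>K\<^esub>"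
    using exists_linear_functional[OF K.field_axioms H.left_module_axioms I] h by (auto simp: Hom_space_simps)
  note \<chi>D = module_HomD[OF \<chi>(1), unfolded regular_simps]
  define R1 where "R1 \<eta> m = (\<lambda>q\<in>carrier P1. \<eta> q \<odot>\<^bsub>T\<^esub> m)" for \<eta> m
  have R1: "R1 \<eta> m \<in> carrier ?H" if "\<eta> \<in> module_Hom A P1 (regular A)" "m \<in> carrier T" for \<eta> m
    using rank_one_Hom[OF P1.left_module_axioms T that] by (simp add: R1_def Hom_space_simps)
  have mc: "\<eta> q \<in> carrier A" if "\<eta> \<in> module_Hom A P1 (regular A)" "q \<in> carrier P1" for \<eta> q
    using module_HomD(1)[OF that] by simp
  \<comment> \<open>A homomorphism to the dual of the quotient is a function of cosets, so a
    representative is chosen; \<open>\<psi>v\<close> shows that the value does not depend on it,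
    because \<chi> kills maps factoring through \<open>f\<close>.\<close>
  define rep where "rep C = (SOME \<eta>. \<eta> \<in> module_Hom A P1 (regular A) \<and> C = cls \<eta>)" for C
  define \<psi> where "\<psi> = (\<lambda>m\<in>carrier T. \<lambda>C\<in>carrier Q. \<chi> (R1 (rep C) m))"
  have cls: "cls \<eta> \<in> carrier Q" if "\<eta> \<in> module_Hom A P1 (regular A)" for \<eta>
    using that by (auto simp: Q_facts)
  have \<psi>v: "\<psi> m (cls \<eta>) = \<chi> (R1 \<eta> m)" if m: "m \<in> carrier T" and \<eta>: "\<eta> \<in> module_Hom A P1 (regular A)" for m \<eta>
  proof -
    define \<rho> where "\<rho> = rep (cls \<eta>)"
    have "\<rho> \<in> module_Hom A P1 (regular A) \<and> cls \<eta> = cls \<rho>"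
      unfolding \<rho>_def rep_def by (rule someI[of _ \<eta>]) (use \<eta> in simp)
    then have \<rho>: "\<rho> \<in> module_Hom A P1 (regular A)" "\<rho> \<in> cls \<eta>"
      using coset_self[OF D1.left_module_axioms U, of \<rho>] by (simp_all add: ring_dual_simps(1))
    obtain \<theta> where \<theta>: "\<theta> \<in> module_Hom A P0 (regular A)"
      "\<rho> = compose (carrier P1) \<theta> f \<oplus>\<^bsub>ring_dual A P1\<^esub> \<eta>"
      using \<rho>(2) unfolding in_coset[OF D1.left_module_axioms U] by (auto simp: U_iff)
    define u where "u = (\<lambda>q\<in>carrier P1. (\<lambda>y\<in>carrier P0. \<theta> y \<odot>\<^bsub>T\<^esub> m) (f q))"
    have u: "u \<in> I"
      unfolding I_def u_def using rank_one_Hom[OF P0.left_module_axioms T \<theta>(1) m] by blast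
    have \<theta>c: "\<theta> (f q) \<in> carrier A" if "q \<in> carrier P1" for q
      using module_HomD(1)[OF \<theta>(1) fD(1)[OF that]] by simp
    have "R1 \<rho> m = u \<oplus>\<^bsub>?H\<^esub> R1 \<eta> m"
      using m fD \<theta>c mc[OF \<eta>] unfolding R1_def u_def \<theta>(2) Hom_space_simps ring_dual_simps compose_def
      by (auto simp: fun_eq_iff T.smult_l_distr)
    moreover have "u \<in> carrier ?H" using u H.submoduleD(1)[OF I] by blast
    ultimately have "\<chi> (R1 \<rho> m) = \<chi> u \<oplus>\<^bsub>K\<^esub> \<chi> (R1 \<eta> m)"
      using \<chi>D(2) R1[OF \<eta> m] by simp
    also have "\<dots> = \<chi> (R1 \<eta> m)" using \<chi>(2)[OF u] \<chi>D(1)[OF R1[OF \<eta> m]] by simp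
    finally show ?thesis using m cls[OF \<eta>] by (simp add: \<psi>_def \<rho>_def)
  qed
  have \<psi>m: "\<psi> m \<in> carrier \<tau>T" if m: "m \<in> carrier T" for m
  proof -
    have "restrict (\<psi> m) (carrier Q) \<in> carrier \<tau>T"
    proof (rule field_dual_memI)
      fix C assume "C \<in> carrier Q"
      then obtain \<eta> where \<eta>: "\<eta> \<in> module_Hom A P1 (regular A)" "C = cls \<eta>"
        by (auto simp: Q_facts)
      show "\<psi> m C \<in> carrier K" using \<psi>v[OF m \<eta>(1)] \<chi>D(1)[OF R1[OF \<eta>(1) m]] \<eta>(2) by simp
      show "C \<oplus>\<^bsub>Q\<^esub> C' \<in> carrier Q \<and> \<psi> m (C \<oplus>\<^bsub>Q\<^esub> C') = \<psi> m C \<oplus>\<^bsub>K\<^esub> \<psi> m C'" if C': "C' \<in> carrier Q" for C'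
      proof -
        obtain \<eta>' where \<eta>': "\<eta>' \<in> module_Hom A P1 (regular A)" "C' = cls \<eta>'"
          using C' by (auto simp: Q_facts)
        have s: "\<eta> \<oplus>\<^bsub>ring_dual A P1\<^esub> \<eta>' \<in> module_Hom A P1 (regular A)"
          using D1.M.a_closed[of \<eta> \<eta>'] \<eta>(1) \<eta>'(1) by (simp add: ring_dual_simps(1))
        have "R1 (\<eta> \<oplus>\<^bsub>ring_dual A P1\<^esub> \<eta>') m = R1 \<eta> m \<oplus>\<^bsub>?H\<^esub> R1 \<eta>' m"
          using m mc[OF \<eta>(1)] mc[OF \<eta>'(1)] unfolding R1_def Hom_space_simps ring_dual_simps
          by (auto simp: fun_eq_iff T.smult_l_distr)
        then have "\<psi> m (cls (\<eta> \<oplus>\<^bsub>ring_dual A P1\<^esub> \<eta>')) = \<psi> m C \<oplus>\<^bsub>K\<^esub> \<psi> m C'"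
          using \<psi>v[OF m] s \<eta> \<eta>' \<chi>D(2) R1[OF _ m] by simp
        then show ?thesis using Q_closed \<open>C \<in> carrier Q\<close> C' \<eta> \<eta>' by (simp add: Q_facts dual_closed)
      qed
      show "scal c \<odot>\<^bsub>Q\<^esub> C \<in> carrier Q \<and> \<psi> m (scal c \<odot>\<^bsub>Q\<^esub> C) = c \<otimes>\<^bsub>K\<^esub> \<psi> m C" if c: "c \<in> carrier K" for c
      proof -
        have s: "scal c \<odot>\<^bsub>ring_dual A P1\<^esub> \<eta> \<in> module_Hom A P1 (regular A)"
          using D1.smult_closed[of "scal c" \<eta>] \<eta>(1) c by (simp add: ring_dual_simps(1))
        have "R1 (scal c \<odot>\<^bsub>ring_dual A P1\<^esub> \<eta>) m = c \<odot>\<^bsub>?H\<^esub> R1 \<eta> m"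
        proof -
          have "(\<eta> q \<otimes> scal c) \<odot>\<^bsub>T\<^esub> m = scal c \<odot>\<^bsub>T\<^esub> (\<eta> q \<odot>\<^bsub>T\<^esub> m)" if "q \<in> carrier P1" for q
            using scal_commute[OF c mc[OF \<eta>(1) that]] mc[OF \<eta>(1) that] c m by (simp add: T.smult_assoc1)
          then show ?thesis unfolding R1_def Hom_space_simps ring_dual_simps by (auto intro: restrict_ext)
        qed
        then have "\<psi> m (cls (scal c \<odot>\<^bsub>ring_dual A P1\<^esub> \<eta>)) = c \<otimes>\<^bsub>K\<^esub> \<psi> m C"
          using \<psi>v[OF m] s \<eta> \<chi>D(3) c R1[OF _ m] by simp
        then show ?thesis using Q_closed \<open>C \<in> carrier Q\<close> \<eta> c by (simp add: Q_facts dual_closed)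
      qed
    qed
    then show ?thesis using m by (simp add: \<psi>_def)
  qed
  have "restrict \<psi> (carrier T) \<in> module_Hom A T \<tau>T"
  proof (rule module_HomI[OF T])
    fix m m' assume mm: "m \<in> carrier T" "m' \<in> carrier T"
    have "\<psi> (m \<oplus>\<^bsub>T\<^esub> m') C = \<psi> m C \<oplus>\<^bsub>K\<^esub> \<psi> m' C" if C: "C \<in> carrier Q" for C
    proof -
      obtain \<eta> where \<eta>: "\<eta> \<in> module_Hom A P1 (regular A)" "C = cls \<eta>"
        using C by (auto simp: Q_facts)
      have "R1 \<eta> (m \<oplus>\<^bsub>T\<^esub> m') = R1 \<eta> m \<oplus>\<^bsub>?H\<^esub> R1 \<eta> m'"
        using mm mc[OF \<eta>(1)] unfolding R1_def Hom_space_simps by (auto simp: fun_eq_iff T.smult_r_distr)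
      then show ?thesis using \<psi>v \<eta> mm \<chi>D(2) R1 by simp
    qed
    then show "\<psi> (m \<oplus>\<^bsub>T\<^esub> m') = \<psi> m \<oplus>\<^bsub>\<tau>T\<^esub> \<psi> m'"
      using mm by (auto simp: field_dual_simps fun_eq_iff \<psi>_def)
  next
    fix r m assume rm: "r \<in> carrier A" "m \<in> carrier T"
    have "\<psi> (r \<odot>\<^bsub>T\<^esub> m) C = \<psi> m (r \<odot>\<^bsub>Q\<^esub> C)" if C: "C \<in> carrier Q" for C
    proof -
      obtain \<eta> where \<eta>: "\<eta> \<in> module_Hom A P1 (regular A)" "C = cls \<eta>"
        using C by (auto simp: Q_facts)
      have s: "r \<odot>\<^bsub>ring_dual A P1\<^esub> \<eta> \<in> module_Hom A P1 (regular A)"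
        using D1.smult_closed[of r \<eta>] \<eta>(1) rm by (simp add: ring_dual_simps(1))
      have "R1 \<eta> (r \<odot>\<^bsub>T\<^esub> m) = R1 (r \<odot>\<^bsub>ring_dual A P1\<^esub> \<eta>) m"
        using rm mc[OF \<eta>(1)] unfolding R1_def ring_dual_simps by (auto simp: fun_eq_iff T.smult_assoc1)
      then show ?thesis using \<psi>v \<eta> rm s by (simp add: Q_facts dual_closed)
    qed
    then show "\<psi> (r \<odot>\<^bsub>T\<^esub> m) = r \<odot>\<^bsub>\<tau>T\<^esub> \<psi> m"
      using rm by (auto simp: field_dual_simps fun_eq_iff \<psi>_def)
  qed (use \<psi>m in auto)
  then have \<psi>0: "restrict \<psi> (carrier T) = (\<lambda>m\<in>carrier T. \<zero>\<^bsub>\<tau>T\<^esub>)"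
    using van by (simp add: Hom_vanishes_def)
  have zero: "\<chi> (R1 \<eta> m) = \<zero>\<^bsub>K\<^esub>" if "\<eta> \<in> module_Hom A P1 (regular A)" "m \<in> carrier T" for \<eta> m
    using \<psi>v[OF that(2,1)] fun_cong[OF fun_cong[OF \<psi>0, of m], of "cls \<eta>"] that cls
    by (simp add: field_dual_simps)
  obtain n :: nat and \<phi> b where \<phi>: "\<And>i. i < n \<Longrightarrow> \<phi> i \<in> module_Hom A P1 (regular A)"
    and b: "\<And>i. i < n \<Longrightarrow> b i \<in> carrier P1"
    and dual1: "\<And>p. p \<in> carrier P1 \<Longrightarrow> p = (\<Oplus>\<^bsub>P1\<^esub>i\<in>{..<n}. \<phi> i p \<odot>\<^bsub>P1\<^esub> b i)"
    by (rule dual_basis[OF P1]) blast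
  note hD = module_HomD[OF h]
  \<comment> \<open>The expansion of \<open>h\<close> as the sum of the rank-one maps of
    \<open>\<phi> i\<close> and h (b i).\<close>
  let ?S = "\<Oplus>\<^bsub>?H\<^esub>i\<in>{..<n}. R1 (\<phi> i) (h (b i))"
  have cl: "R1 (\<phi> i) (h (b i)) \<in> carrier ?H" if "i < n" for i
    using R1 \<phi> hD(1) b that by simp
  then have Sc: "?S \<in> module_Hom A P1 T"
    using H.M.finsum_closed[of "\<lambda>i. R1 (\<phi> i) (h (b i))" "{..<n}"] by (auto simp: Hom_space_simps(1))
  have "?S = h"
  proof (rule module_Hom_eqI[OF Sc h])
    fix p assume p: "p \<in> carrier P1"
    have "?S p = (\<Oplus>\<^bsub>T\<^esub>i\<in>{..<n}. R1 (\<phi> i) (h (b i)) p)"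
      using cl p module_HomD(1)[OF _ p, of _ A T]
      by (intro additive_finsum[OF H.M.abelian_group_axioms T.M.abelian_group_axioms, where F = "\<lambda>x. x p"])
        (auto simp: Hom_space_simps)
    also have "\<dots> = (\<Oplus>\<^bsub>T\<^esub>i\<in>{..<n}. h (\<phi> i p \<odot>\<^bsub>P1\<^esub> b i))"
      using p mc[OF \<phi>] b hD by (intro T.M.finsum_cong') (auto simp: R1_def)
    also have "\<dots> = h (\<Oplus>\<^bsub>P1\<^esub>i\<in>{..<n}. \<phi> i p \<odot>\<^bsub>P1\<^esub> b i)"
      using p mc[OF \<phi>] b hD(1,2) module_Hom_zero[OF P1.left_module_axioms T h]
      by (intro additive_finsum[OF P1.M.abelian_group_axioms T.M.abelian_group_axioms, symmetric]) auto
    also have "\<dots> = h p" using dual1[OF p] by simp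
    finally show "?S p = h p" .
  qed
  moreover have "\<chi> ?S = (\<Oplus>\<^bsub>K\<^esub>i\<in>{..<n}. \<chi> (R1 (\<phi> i) (h (b i))))"
    using cl \<chi>D(1,2) module_Hom_zero[OF H.left_module_axioms left_module_regular[OF K.ring_axioms] \<chi>(1)]
    by (intro additive_finsum[OF H.M.abelian_group_axioms K.abelian_group_axioms]) auto
  moreover have "\<dots> = (\<Oplus>\<^bsub>K\<^esub>i\<in>{..<n}. \<zero>\<^bsub>K\<^esub>)"
    using zero \<phi> hD(1) b by (intro K.finsum_cong') auto
  ultimately show False using \<chi>(3) by simp
qed

end

text \<open>The presentation obtained here is the one selected inside \<open>tau\<close>, which
  avoids comparing different minimal presentations. Existence of some presentation makes that
  selection meaningful.\<close>

lemma tau_rigid_criterion: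
  assumes "fd_module K A T" "\<exists>P1 f P0 p. minimal_presentation K A T P1 f P0 p"
  obtains P1 f P0 p where "minimal_presentation K A T P1 f P0 p" "f \<in> module_Hom A P1 P0"
    "tau_rigid K A T \<longleftrightarrow> (\<forall>h\<in>module_Hom A P1 T. \<exists>g\<in>module_Hom A P0 T. \<forall>q\<in>carrier P1. h q = g (f q))"
proof -
  define X where "X = (SOME (P1, f, P0). \<exists>p. minimal_presentation K A T P1 f P0 p)"
  have "case X of (P1, f, P0) \<Rightarrow> \<exists>p. minimal_presentation K A T P1 f P0 p"
    unfolding X_def by (rule someI_ex) (use assms(2) in auto)
  then obtain P1 f P0 p where X: "X = (P1, f, P0)" and m: "minimal_presentation K A T P1 f P0 p"
    by (cases X) auto
  note T = fd_left_module[OF assms(1)]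
  have P: "projective K A P0" "projective K A P1" "p \<in> module_Hom A P0 T"
    "f \<in> module_Hom A P1 (P0\<lparr>carrier := a_kernel P0 T p\<rparr>)"
    using m by (auto simp: minimal_presentation_def projective_cover_def)
  have f: "f \<in> module_Hom A P1 P0"
    by (rule module_Hom_from_submodule_codomain[OF P(4)]) (auto simp: in_a_kernel_iff)
  have "tau K A T = field_dual K (opposite A) (transpose_of A P1 f P0)"
    by (simp add: tau_def X flip: X_def)
  then have "tau_rigid K A T \<longleftrightarrow> (\<forall>h\<in>module_Hom A P1 T. \<exists>g\<in>module_Hom A P0 T. \<forall>q\<in>carrier P1. h q = g (f q))"
    unfolding tau_rigid_def
    using factorization_imp_Hom_vanishes[OF P(2,1) T f] Hom_vanishes_imp_factorization[OF P(2,1) T f] assms(1)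
    by auto
  with m f show thesis by (rule that)
qed

end

section \<open>Two vertices, a loop and an arrow with radical square zero\<close>

text \<open>The basis consists of the idempotents \<open>e1\<close>, \<open>e2\<close>, a loop \<open>x\<close> at the first vertex and an
  arrow \<open>a\<close> between the vertices, whose direction is left open here; \<open>c1, \<dots>, c4\<close> are the
  coordinates with respect to this basis.\<close>

locale loop_arrow_algebra = fin_dim_algebra K A
  for K :: "'k ring" and A :: "('k, nat \<Rightarrow> 'k) module" (structure) +
  fixes e1 e2 x a :: "nat \<Rightarrow> 'k" and c1 c2 c3 c4 :: "(nat \<Rightarrow> 'k) \<Rightarrow> 'k"
  assumes basis_closed [simp]: "e1 \<in> carrier A" "e2 \<in> carrier A" "x \<in> carrier A" "a \<in> carrier A"
    and one_eq: "\<one> = e1 \<oplus> e2"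
    and table [simp]: "e1 \<otimes> e1 = e1" "e2 \<otimes> e2 = e2" "e1 \<otimes> e2 = \<zero>" "e2 \<otimes> e1 = \<zero>"
      "e1 \<otimes> x = x" "x \<otimes> e1 = x" "e2 \<otimes> x = \<zero>" "x \<otimes> e2 = \<zero>"
      "x \<otimes> x = \<zero>" "x \<otimes> a = \<zero>" "a \<otimes> x = \<zero>" "a \<otimes> a = \<zero>"
    and coord_closed [simp]: "r \<in> carrier A \<Longrightarrow> c1 r \<in> carrier K" "r \<in> carrier A \<Longrightarrow> c2 r \<in> carrier K"
      "r \<in> carrier A \<Longrightarrow> c3 r \<in> carrier K" "r \<in> carrier A \<Longrightarrow> c4 r \<in> carrier K"
    and basis_expansion: "r \<in> carrier A \<Longrightarrow>
      r = scal (c1 r) \<otimes> e1 \<oplus> scal (c2 r) \<otimes> e2 \<oplus> (scal (c3 r) \<otimes> x \<oplus> scal (c4 r) \<otimes> a)"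
    and coord_basis [simp]: "c1 e1 = \<one>\<^bsub>K\<^esub>" "c1 e2 = \<zero>\<^bsub>K\<^esub>" "c1 x = \<zero>\<^bsub>K\<^esub>" "c1 a = \<zero>\<^bsub>K\<^esub>"
      "c2 e1 = \<zero>\<^bsub>K\<^esub>" "c2 e2 = \<one>\<^bsub>K\<^esub>" "c2 x = \<zero>\<^bsub>K\<^esub>" "c2 a = \<zero>\<^bsub>K\<^esub>"
      "c3 e1 = \<zero>\<^bsub>K\<^esub>" "c3 e2 = \<zero>\<^bsub>K\<^esub>" "c3 x = \<one>\<^bsub>K\<^esub>" "c3 a = \<zero>\<^bsub>K\<^esub>"
      "c4 e1 = \<zero>\<^bsub>K\<^esub>" "c4 e2 = \<zero>\<^bsub>K\<^esub>" "c4 x = \<zero>\<^bsub>K\<^esub>" "c4 a = \<one>\<^bsub>K\<^esub>"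
    and coord_add: "r \<in> carrier A \<Longrightarrow> s \<in> carrier A \<Longrightarrow> c1 (r \<oplus> s) = c1 r \<oplus>\<^bsub>K\<^esub> c1 s"
      "r \<in> carrier A \<Longrightarrow> s \<in> carrier A \<Longrightarrow> c2 (r \<oplus> s) = c2 r \<oplus>\<^bsub>K\<^esub> c2 s"
      "r \<in> carrier A \<Longrightarrow> s \<in> carrier A \<Longrightarrow> c3 (r \<oplus> s) = c3 r \<oplus>\<^bsub>K\<^esub> c3 s"
      "r \<in> carrier A \<Longrightarrow> s \<in> carrier A \<Longrightarrow> c4 (r \<oplus> s) = c4 r \<oplus>\<^bsub>K\<^esub> c4 s"
    and coord_scal: "k \<in> carrier K \<Longrightarrow> r \<in> carrier A \<Longrightarrow> c1 (scal k \<otimes> r) = k \<otimes>\<^bsub>K\<^esub> c1 r"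
      "k \<in> carrier K \<Longrightarrow> r \<in> carrier A \<Longrightarrow> c2 (scal k \<otimes> r) = k \<otimes>\<^bsub>K\<^esub> c2 r"
      "k \<in> carrier K \<Longrightarrow> r \<in> carrier A \<Longrightarrow> c3 (scal k \<otimes> r) = k \<otimes>\<^bsub>K\<^esub> c3 r"
      "k \<in> carrier K \<Longrightarrow> r \<in> carrier A \<Longrightarrow> c4 (scal k \<otimes> r) = k \<otimes>\<^bsub>K\<^esub> c4 r"
    and coord_mult: "r \<in> carrier A \<Longrightarrow> s \<in> carrier A \<Longrightarrow> c1 (r \<otimes> s) = c1 r \<otimes>\<^bsub>K\<^esub> c1 s"
      "r \<in> carrier A \<Longrightarrow> s \<in> carrier A \<Longrightarrow> c2 (r \<otimes> s) = c2 r \<otimes>\<^bsub>K\<^esub> c2 s"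
      "r \<in> carrier A \<Longrightarrow> s \<in> carrier A \<Longrightarrow> c3 (r \<otimes> s) = c1 r \<otimes>\<^bsub>K\<^esub> c3 s \<oplus>\<^bsub>K\<^esub> c3 r \<otimes>\<^bsub>K\<^esub> c1 s"
    and arrow_ends: "e1 \<otimes> a = a \<and> e2 \<otimes> a = \<zero> \<or> e1 \<otimes> a = \<zero> \<and> e2 \<otimes> a = a"
begin

text \<open>The elements \<open>x\<close> and \<open>a\<close> span the Jacobson radical of the
  algebra, so this is the product of that radical with M.\<close>

definition rad :: "(nat \<Rightarrow> 'k, 'm) module \<Rightarrow> 'm set" where
  "rad M = {x \<odot>\<^bsub>M\<^esub> m \<oplus>\<^bsub>M\<^esub> a \<odot>\<^bsub>M\<^esub> m' |m m'. m \<in> carrier M \<and> m' \<in> carrier M}"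

text \<open>An idempotent paired with its coordinate, so that both vertices can be treated by one
  argument.\<close>

definition vertex :: "(nat \<Rightarrow> 'k) \<Rightarrow> ((nat \<Rightarrow> 'k) \<Rightarrow> 'k) \<Rightarrow> bool" where
  "vertex e c \<longleftrightarrow> e = e1 \<and> c = c1 \<or> e = e2 \<and> c = c2"

lemma vertex_facts:
  assumes "vertex e c"
  shows "e \<in> carrier A" "e \<otimes> e = e" "\<And>r. r \<in> carrier A \<Longrightarrow> c r \<in> carrier K" "c e = \<one>\<^bsub>K\<^esub>"
    "\<And>r s. r \<in> carrier A \<Longrightarrow> s \<in> carrier A \<Longrightarrow> c (r \<otimes> s) = c r \<otimes>\<^bsub>K\<^esub> c s"
    "\<And>r s. r \<in> carrier A \<Longrightarrow> s \<in> carrier A \<Longrightarrow> c (r \<oplus> s) = c r \<oplus>\<^bsub>K\<^esub> c s"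
    "c x = \<zero>\<^bsub>K\<^esub>" "c a = \<zero>\<^bsub>K\<^esub>"
  using assms by (auto simp: vertex_def coord_add coord_mult)

lemma vertices: "vertex e1 c1" "vertex e2 c2"
  by (auto simp: vertex_def)

lemma coord_zero [simp]: "c1 \<zero> = \<zero>\<^bsub>K\<^esub>" "c2 \<zero> = \<zero>\<^bsub>K\<^esub>" "c3 \<zero> = \<zero>\<^bsub>K\<^esub>" "c4 \<zero> = \<zero>\<^bsub>K\<^esub>"
  using coord_scal[OF K.zero_closed A.zero_closed] by simp_all

lemma coord_one [simp]: "c1 \<one> = \<one>\<^bsub>K\<^esub>" "c2 \<one> = \<one>\<^bsub>K\<^esub>" "c3 \<one> = \<zero>\<^bsub>K\<^esub>" "c4 \<one> = \<zero>\<^bsub>K\<^esub>"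
  by (simp_all add: one_eq coord_add)

lemma basis_nonzero: "e1 \<noteq> \<zero>" "e2 \<noteq> \<zero>" "x \<noteq> \<zero>" "a \<noteq> \<zero>"
  using coord_basis coord_zero K.one_not_zero by metis+

lemma vertex_left:
  assumes "vertex e c" "r \<in> carrier A"
  shows "e \<otimes> r = scal (c r) \<otimes> e \<oplus> (scal (c3 r) \<otimes> (e \<otimes> x) \<oplus> scal (c4 r) \<otimes> (e \<otimes> a))"
proof -
  have e: "e \<in> carrier A" "e \<otimes> e1 = (if e = e1 then e else \<zero>)" "e \<otimes> e2 = (if e = e1 then \<zero> else e)"
    using assms(1) basis_nonzero table by (auto simp: vertex_def)
  have s: "e \<otimes> (scal k \<otimes> b) = scal k \<otimes> (e \<otimes> b)" if "k \<in> carrier K" "b \<in> carrier A" for k b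
    using that e scal_commute[of k e] by (metis A.m_assoc scal_closed)
  have ne: "e1 \<noteq> e2" using coord_basis(1,2) K.one_not_zero by metis
  have "e \<otimes> r = e \<otimes> (scal (c1 r) \<otimes> e1 \<oplus> scal (c2 r) \<otimes> e2 \<oplus> (scal (c3 r) \<otimes> x \<oplus> scal (c4 r) \<otimes> a))"
    using basis_expansion[OF assms(2)] by simp
  also have "\<dots> = scal (c1 r) \<otimes> (e \<otimes> e1) \<oplus> scal (c2 r) \<otimes> (e \<otimes> e2) \<oplus>
      (scal (c3 r) \<otimes> (e \<otimes> x) \<oplus> scal (c4 r) \<otimes> (e \<otimes> a))"
    using assms(2) e(1) by (simp add: A.r_distr s)
  finally show ?thesis
    using assms e(1) ne by (auto simp: vertex_def)
qed

lemma vertex_right: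
  assumes "vertex e c" "r \<in> carrier A" "r \<otimes> e = r"
  shows "r = scal (c r) \<otimes> e \<oplus> (scal (c3 r) \<otimes> x \<oplus> scal (c4 r) \<otimes> a)"
proof -
  have "c1 r = c1 r \<otimes>\<^bsub>K\<^esub> c1 e" "c2 r = c2 r \<otimes>\<^bsub>K\<^esub> c2 e"
    using coord_mult(1,2)[of r e] assms vertex_facts(1)[OF assms(1)] by simp_all
  then have "e = e1 \<and> c = c1 \<and> c2 r = \<zero>\<^bsub>K\<^esub> \<or> e = e2 \<and> c = c2 \<and> c1 r = \<zero>\<^bsub>K\<^esub>"
    using assms by (auto simp: vertex_def)
  then show ?thesis using basis_expansion[OF assms(2)] assms(2) by auto
qed

context
  fixes M :: "(nat \<Rightarrow> 'k, 'm) module"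
  assumes M: "left_module A M"
begin

interpretation M: left_module A M by (rule M)

lemma act_simps:
  assumes "m \<in> carrier M"
  shows "e1 \<odot>\<^bsub>M\<^esub> (e1 \<odot>\<^bsub>M\<^esub> m) = e1 \<odot>\<^bsub>M\<^esub> m" "e2 \<odot>\<^bsub>M\<^esub> (e2 \<odot>\<^bsub>M\<^esub> m) = e2 \<odot>\<^bsub>M\<^esub> m"
    "e1 \<odot>\<^bsub>M\<^esub> (e2 \<odot>\<^bsub>M\<^esub> m) = \<zero>\<^bsub>M\<^esub>" "e2 \<odot>\<^bsub>M\<^esub> (e1 \<odot>\<^bsub>M\<^esub> m) = \<zero>\<^bsub>M\<^esub>"
    "e1 \<odot>\<^bsub>M\<^esub> (x \<odot>\<^bsub>M\<^esub> m) = x \<odot>\<^bsub>M\<^esub> m" "x \<odot>\<^bsub>M\<^esub> (e1 \<odot>\<^bsub>M\<^esub> m) = x \<odot>\<^bsub>M\<^esub> m"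
    "e2 \<odot>\<^bsub>M\<^esub> (x \<odot>\<^bsub>M\<^esub> m) = \<zero>\<^bsub>M\<^esub>" "x \<odot>\<^bsub>M\<^esub> (e2 \<odot>\<^bsub>M\<^esub> m) = \<zero>\<^bsub>M\<^esub>"
    "x \<odot>\<^bsub>M\<^esub> (x \<odot>\<^bsub>M\<^esub> m) = \<zero>\<^bsub>M\<^esub>" "x \<odot>\<^bsub>M\<^esub> (a \<odot>\<^bsub>M\<^esub> m) = \<zero>\<^bsub>M\<^esub>"
    "a \<odot>\<^bsub>M\<^esub> (x \<odot>\<^bsub>M\<^esub> m) = \<zero>\<^bsub>M\<^esub>" "a \<odot>\<^bsub>M\<^esub> (a \<odot>\<^bsub>M\<^esub> m) = \<zero>\<^bsub>M\<^esub>"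
  using assms by (simp_all flip: M.smult_assoc1)

lemma act_scal:
  assumes "m \<in> carrier M" "r \<in> carrier A" "k \<in> carrier K"
  shows "r \<odot>\<^bsub>M\<^esub> (scal k \<odot>\<^bsub>M\<^esub> m) = scal k \<odot>\<^bsub>M\<^esub> (r \<odot>\<^bsub>M\<^esub> m)"
  using assms scal_commute[of k r] by (simp flip: M.smult_assoc1)

lemma act_expansion:
  assumes "r \<in> carrier A" "m \<in> carrier M"
  shows "r \<odot>\<^bsub>M\<^esub> m = scal (c1 r) \<odot>\<^bsub>M\<^esub> (e1 \<odot>\<^bsub>M\<^esub> m) \<oplus>\<^bsub>M\<^esub> scal (c2 r) \<odot>\<^bsub>M\<^esub> (e2 \<odot>\<^bsub>M\<^esub> m) \<oplus>\<^bsub>M\<^esub>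
    (scal (c3 r) \<odot>\<^bsub>M\<^esub> (x \<odot>\<^bsub>M\<^esub> m) \<oplus>\<^bsub>M\<^esub> scal (c4 r) \<odot>\<^bsub>M\<^esub> (a \<odot>\<^bsub>M\<^esub> m))"
  by (subst basis_expansion[OF assms(1)]) (use assms in \<open>simp add: M.smult_l_distr M.smult_assoc1\<close>)

lemma act_one: "m \<in> carrier M \<Longrightarrow> m = e1 \<odot>\<^bsub>M\<^esub> m \<oplus>\<^bsub>M\<^esub> e2 \<odot>\<^bsub>M\<^esub> m"
  by (simp add: one_eq flip: M.smult_l_distr) (simp flip: one_eq)

lemma act_inverse:
  assumes "k \<in> carrier K" "k \<noteq> \<zero>\<^bsub>K\<^esub>" "m \<in> carrier M"
  shows "scal (inv\<^bsub>K\<^esub> k) \<odot>\<^bsub>M\<^esub> (scal k \<odot>\<^bsub>M\<^esub> m) = m" "inv\<^bsub>K\<^esub> k \<in> carrier K"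
proof -
  have k: "k \<in> Units K" using assms(1,2) by (simp add: K.field_Units)
  then show c: "inv\<^bsub>K\<^esub> k \<in> carrier K" by simp
  show "scal (inv\<^bsub>K\<^esub> k) \<odot>\<^bsub>M\<^esub> (scal k \<odot>\<^bsub>M\<^esub> m) = m"
    using assms c k by (simp add: K.Units_l_inv flip: M.smult_assoc1 scal_mult)
qed

lemma radI: "m \<in> carrier M \<Longrightarrow> m' \<in> carrier M \<Longrightarrow> x \<odot>\<^bsub>M\<^esub> m \<oplus>\<^bsub>M\<^esub> a \<odot>\<^bsub>M\<^esub> m' \<in> rad M"
  by (auto simp: rad_def)

lemma rad_memI:
  assumes "m \<in> carrier M"
  shows "x \<odot>\<^bsub>M\<^esub> m \<in> rad M" "a \<odot>\<^bsub>M\<^esub> m \<in> rad M"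
  using radI[of m "\<zero>\<^bsub>M\<^esub>"] radI[of "\<zero>\<^bsub>M\<^esub>" m] assms by simp_all

lemma radD:
  assumes "j \<in> rad M"
  shows "j \<in> carrier M" "x \<odot>\<^bsub>M\<^esub> j = \<zero>\<^bsub>M\<^esub>" "a \<odot>\<^bsub>M\<^esub> j = \<zero>\<^bsub>M\<^esub>"
  using assms by (auto simp: rad_def M.smult_r_distr act_simps)

lemma submodule_rad: "submodule (rad M) A M"
proof (rule M.submoduleI)
  show "rad M \<subseteq> carrier M" using radD by blast
  show "\<zero>\<^bsub>M\<^esub> \<in> rad M" using radI[of "\<zero>\<^bsub>M\<^esub>" "\<zero>\<^bsub>M\<^esub>"] by simp
next
  fix m n assume "m \<in> rad M" "n \<in> rad M"
  then obtain u u' v v' where *: "m = x \<odot>\<^bsub>M\<^esub> u \<oplus>\<^bsub>M\<^esub> a \<odot>\<^bsub>M\<^esub> u'" "n = x \<odot>\<^bsub>M\<^esub> v \<oplus>\<^bsub>M\<^esub> a \<odot>\<^bsub>M\<^esub> v'"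
    "u \<in> carrier M" "u' \<in> carrier M" "v \<in> carrier M" "v' \<in> carrier M" by (auto simp: rad_def)
  then have "m \<oplus>\<^bsub>M\<^esub> n = x \<odot>\<^bsub>M\<^esub> (u \<oplus>\<^bsub>M\<^esub> v) \<oplus>\<^bsub>M\<^esub> a \<odot>\<^bsub>M\<^esub> (u' \<oplus>\<^bsub>M\<^esub> v')"
    by (simp add: M.smult_r_distr M.M.a_ac)
  then show "m \<oplus>\<^bsub>M\<^esub> n \<in> rad M" using * radI by simp
next
  fix r m assume r: "r \<in> carrier A" and "m \<in> rad M"
  then obtain u u' where *: "m = x \<odot>\<^bsub>M\<^esub> u \<oplus>\<^bsub>M\<^esub> a \<odot>\<^bsub>M\<^esub> u'" "u \<in> carrier M" "u' \<in> carrier M" by (auto simp: rad_def)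
  have "e1 \<odot>\<^bsub>M\<^esub> (a \<odot>\<^bsub>M\<^esub> u') = (e1 \<otimes> a) \<odot>\<^bsub>M\<^esub> u'" "e2 \<odot>\<^bsub>M\<^esub> (a \<odot>\<^bsub>M\<^esub> u') = (e2 \<otimes> a) \<odot>\<^bsub>M\<^esub> u'"
    using * by (simp_all add: M.smult_assoc1)
  \<comment> \<open>The arrow ends at one of the two vertices, so on its image \<open>r\<close> acts
    by the scalar \<open>c1 r\<close> or \<open>c2 r\<close>.\<close>
  then have "r \<odot>\<^bsub>M\<^esub> (a \<odot>\<^bsub>M\<^esub> u') = scal (c1 r) \<odot>\<^bsub>M\<^esub> (a \<odot>\<^bsub>M\<^esub> u') \<or>
      r \<odot>\<^bsub>M\<^esub> (a \<odot>\<^bsub>M\<^esub> u') = scal (c2 r) \<odot>\<^bsub>M\<^esub> (a \<odot>\<^bsub>M\<^esub> u')"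
    using arrow_ends act_expansion[OF r, of "a \<odot>\<^bsub>M\<^esub> u'"] *(3) r by (auto simp: act_simps)
  then obtain k where k: "k \<in> carrier K" "r \<odot>\<^bsub>M\<^esub> (a \<odot>\<^bsub>M\<^esub> u') = scal k \<odot>\<^bsub>M\<^esub> (a \<odot>\<^bsub>M\<^esub> u')"
    using coord_closed(1,2)[OF r] by metis
  have "r \<odot>\<^bsub>M\<^esub> (x \<odot>\<^bsub>M\<^esub> u) = scal (c1 r) \<odot>\<^bsub>M\<^esub> (x \<odot>\<^bsub>M\<^esub> u)"
    using act_expansion[OF r, of "x \<odot>\<^bsub>M\<^esub> u"] * r by (simp add: act_simps)
  then have "r \<odot>\<^bsub>M\<^esub> m = x \<odot>\<^bsub>M\<^esub> (scal (c1 r) \<odot>\<^bsub>M\<^esub> u) \<oplus>\<^bsub>M\<^esub> a \<odot>\<^bsub>M\<^esub> (scal k \<odot>\<^bsub>M\<^esub> u')"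
    using * r k by (simp add: M.smult_r_distr act_scal)
  then show "r \<odot>\<^bsub>M\<^esub> m \<in> rad M" using * radI r k by simp
qed

text \<open>Modulo the radical every element acts on the component at a vertex through the character
  of that vertex.\<close>

lemma vertex_act:
  assumes "vertex e c" "r \<in> carrier A" "m \<in> carrier M"
  obtains j where "j \<in> rad M" "e \<odot>\<^bsub>M\<^esub> (r \<odot>\<^bsub>M\<^esub> m) = scal (c r) \<odot>\<^bsub>M\<^esub> (e \<odot>\<^bsub>M\<^esub> m) \<oplus>\<^bsub>M\<^esub> j"
proof
  note e = vertex_facts[OF assms(1)]
  let ?j = "scal (c3 r) \<odot>\<^bsub>M\<^esub> (e \<odot>\<^bsub>M\<^esub> (x \<odot>\<^bsub>M\<^esub> m)) \<oplus>\<^bsub>M\<^esub> scal (c4 r) \<odot>\<^bsub>M\<^esub> (e \<odot>\<^bsub>M\<^esub> (a \<odot>\<^bsub>M\<^esub> m))"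
  show "?j \<in> rad M"
    using M.submoduleD(3,4)[OF submodule_rad] rad_memI assms e(1) by simp
  have "e \<odot>\<^bsub>M\<^esub> (r \<odot>\<^bsub>M\<^esub> m) = (e \<otimes> r) \<odot>\<^bsub>M\<^esub> m" using assms e(1) by (simp add: M.smult_assoc1)
  also have "\<dots> = scal (c r) \<odot>\<^bsub>M\<^esub> (e \<odot>\<^bsub>M\<^esub> m) \<oplus>\<^bsub>M\<^esub> ?j"
    unfolding vertex_left[OF assms(1,2)] using assms e(1,3) by (simp add: M.smult_l_distr M.smult_assoc1)
  finally show "e \<odot>\<^bsub>M\<^esub> (r \<odot>\<^bsub>M\<^esub> m) = scal (c r) \<odot>\<^bsub>M\<^esub> (e \<odot>\<^bsub>M\<^esub> m) \<oplus>\<^bsub>M\<^esub> ?j" .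
qed

text \<open>The radical has square zero: if M = U + N with N inside \<open>rad M\<close>, then x M =
  x U and a M = a U, so \<open>rad M\<close> is contained in U and hence U is everything.\<close>

lemma nakayama:
  assumes "submodule U A M" "N \<subseteq> rad M" "U <+>\<^bsub>M\<^esub> N = carrier M"
  shows "U = carrier M"
proof -
  note U = M.submoduleD[OF assms(1)] and J = M.submoduleD[OF submodule_rad]
  have dec: "\<exists>u\<in>U. \<exists>j\<in>rad M. m = u \<oplus>\<^bsub>M\<^esub> j" if "m \<in> carrier M" for m
    using assms(2,3) that unfolding set_add_def' by blast
  have sub: "x \<odot>\<^bsub>M\<^esub> m \<in> U" "a \<odot>\<^bsub>M\<^esub> m \<in> U" if m: "m \<in> carrier M" for m
  proof -
    obtain u j where uj: "u \<in> U" "j \<in> rad M" "m = u \<oplus>\<^bsub>M\<^esub> j" using dec[OF m] by blast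
    then have "x \<odot>\<^bsub>M\<^esub> m = x \<odot>\<^bsub>M\<^esub> u" "a \<odot>\<^bsub>M\<^esub> m = a \<odot>\<^bsub>M\<^esub> u"
      using U(1) radD[OF uj(2)] by (auto simp: M.smult_r_distr subset_iff)
    then show "x \<odot>\<^bsub>M\<^esub> m \<in> U" "a \<odot>\<^bsub>M\<^esub> m \<in> U" using U(4) uj(1) by simp_all
  qed
  then have "rad M \<subseteq> U" using U(3) by (auto simp: rad_def)
  then show ?thesis using dec U(1,3) by blast
qed

text \<open>If a vertex component w of an element of N were outside \<open>rad M\<close>, a
  functional \<chi> vanishing on \<open>rad M\<close> with \<chi> w = 1 would define a proper
  submodule U with U + N = M.\<close>

lemma superfluous_subset_rad:
  assumes "submodule N A M"
    and "\<And>U. submodule U A M \<Longrightarrow> U <+>\<^bsub>M\<^esub> N = carrier M \<Longrightarrow> U = carrier M"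
  shows "N \<subseteq> rad M"
proof -
  note N = M.submoduleD[OF assms(1)] and J = M.submoduleD[OF submodule_rad]
  have "e \<odot>\<^bsub>M\<^esub> y \<in> rad M" if y: "y \<in> N" and v: "vertex e c" for e c y
  proof (rule ccontr)
    note e = vertex_facts[OF v]
    define w where "w = e \<odot>\<^bsub>M\<^esub> y"
    have w: "w \<in> N" "w \<in> carrier M" "e \<odot>\<^bsub>M\<^esub> w = w"
      using y N(1,4) e(1,2) by (auto simp: w_def subset_iff simp flip: M.smult_assoc1)
    assume "e \<odot>\<^bsub>M\<^esub> y \<notin> rad M"
    then obtain \<chi> where \<chi>: "\<chi> \<in> module_Hom K (vec M) (regular K)" "\<And>u. u \<in> rad M \<Longrightarrow> \<chi> u = \<zero>\<^bsub>K\<^esub>" "\<chi> w = \<one>\<^bsub>K\<^esub>"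
      using exists_linear_functional[OF K.field_axioms left_module_vec[OF M] submodule_vec[OF M submodule_rad], of w]
        w(2) by (auto simp: w_def)
    note \<chi>D = module_HomD[OF \<chi>(1), unfolded regular_simps restrict_scalars_simps(1,3) vec_smult]
    \<comment> \<open>A hyperplane in the component at \<open>e\<close>, together with the other
      component. It is stable since the algebra acts on the component at \<open>e\<close> by scalars
      modulo \<open>rad M\<close>, where \<chi> vanishes.\<close>
    define U where "U = {u \<in> carrier M. \<chi> (e \<odot>\<^bsub>M\<^esub> u) = \<zero>\<^bsub>K\<^esub>}"
    have "submodule U A M"
    proof (rule M.submoduleI)
      show "\<zero>\<^bsub>M\<^esub> \<in> U" using \<chi>(2)[OF J(2)] e(1) by (simp add: U_def)
      show "m \<oplus>\<^bsub>M\<^esub> n \<in> U" if "m \<in> U" "n \<in> U" for m n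
        using that \<chi>D(2) e(1) by (simp add: U_def M.smult_r_distr)
      show "r \<odot>\<^bsub>M\<^esub> m \<in> U" if r: "r \<in> carrier A" and m: "m \<in> U" for r m
      proof -
        have mc: "m \<in> carrier M" "\<chi> (e \<odot>\<^bsub>M\<^esub> m) = \<zero>\<^bsub>K\<^esub>" using m by (auto simp: U_def)
        obtain j where j: "j \<in> rad M" "e \<odot>\<^bsub>M\<^esub> (r \<odot>\<^bsub>M\<^esub> m) = scal (c r) \<odot>\<^bsub>M\<^esub> (e \<odot>\<^bsub>M\<^esub> m) \<oplus>\<^bsub>M\<^esub> j"
          by (rule vertex_act[OF v r mc(1)])
        then have "\<chi> (e \<odot>\<^bsub>M\<^esub> (r \<odot>\<^bsub>M\<^esub> m)) = \<zero>\<^bsub>K\<^esub>"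
          using \<chi>D(2,3) \<chi>(2) mc e(1,3) r J(1) by (simp add: subset_iff)
        then show ?thesis using r mc by (simp add: U_def)
      qed
    qed (auto simp: U_def)
    moreover have "U <+>\<^bsub>M\<^esub> N = carrier M"
    proof
      show "U <+>\<^bsub>M\<^esub> N \<subseteq> carrier M" using N(1) by (auto simp: set_add_def' U_def)
      show "carrier M \<subseteq> U <+>\<^bsub>M\<^esub> N"
      proof
        fix m assume m: "m \<in> carrier M"
        define k where "k = \<chi> (e \<odot>\<^bsub>M\<^esub> m)"
        have k: "k \<in> carrier K" using \<chi>D(1) m e(1) by (simp add: k_def)
        have kw: "scal k \<odot>\<^bsub>M\<^esub> w \<in> N" "scal k \<odot>\<^bsub>M\<^esub> w \<in> carrier M" using k N(4) w by auto
        have "\<chi> (e \<odot>\<^bsub>M\<^esub> (m \<ominus>\<^bsub>M\<^esub> scal k \<odot>\<^bsub>M\<^esub> w)) = \<chi> (e \<odot>\<^bsub>M\<^esub> m \<oplus>\<^bsub>M\<^esub> scal (\<ominus>\<^bsub>K\<^esub> k) \<odot>\<^bsub>M\<^esub> w)"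
          using M.scalar_diff[of e m "scal k \<odot>\<^bsub>M\<^esub> w"] act_scal[of w e k] m w k kw e(1)
          by (simp add: a_minus_def scal_uminus M.scalar_minus_left)
        also have "\<dots> = \<zero>\<^bsub>K\<^esub>"
          using m w k e(1) \<chi>D(2,3) \<chi>(3) by (simp add: K.r_neg flip: k_def)
        finally have "m \<ominus>\<^bsub>M\<^esub> scal k \<odot>\<^bsub>M\<^esub> w \<in> U" using m kw by (simp add: U_def)
        moreover have "m = (m \<ominus>\<^bsub>M\<^esub> scal k \<odot>\<^bsub>M\<^esub> w) \<oplus>\<^bsub>M\<^esub> scal k \<odot>\<^bsub>M\<^esub> w" using m kw M.diff_add_cancel by simp
        ultimately show "m \<in> U <+>\<^bsub>M\<^esub> N" using kw(1) by (auto simp: set_add_def')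
      qed
    qed
    ultimately have "U = carrier M" by (rule assms(2))
    then have "\<chi> (e \<odot>\<^bsub>M\<^esub> w) = \<zero>\<^bsub>K\<^esub>" using w(2) unfolding U_def by blast
    then show False using w(3) \<chi>(3) by simp
  qed
  then have "e1 \<odot>\<^bsub>M\<^esub> y \<oplus>\<^bsub>M\<^esub> e2 \<odot>\<^bsub>M\<^esub> y \<in> rad M" if "y \<in> N" for y
    using J(3) vertices that by blast
  then show ?thesis using act_one N(1) by (metis subsetD subsetI)
qed

end

lemma rad_Hom:
  assumes "f \<in> module_Hom A M N" "j \<in> rad M" "left_module A M"
  shows "f j \<in> rad N"
proof -
  interpret M: left_module A M by fact
  note f = module_HomD[OF assms(1)]
  obtain m m' where m: "m \<in> carrier M" "m' \<in> carrier M" "j = x \<odot>\<^bsub>M\<^esub> m \<oplus>\<^bsub>M\<^esub> a \<odot>\<^bsub>M\<^esub> m'"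
    using assms(2) by (auto simp: rad_def)
  then have "f j = x \<odot>\<^bsub>N\<^esub> f m \<oplus>\<^bsub>N\<^esub> a \<odot>\<^bsub>N\<^esub> f m'" using f by simp
  then show ?thesis using f(1) m(1,2) unfolding rad_def by blast
qed

lemma module_HomI_basis:
  assumes "left_module A M" "left_module A N" "\<And>m. m \<in> carrier M \<Longrightarrow> f m \<in> carrier N"
    and "\<And>m n. m \<in> carrier M \<Longrightarrow> n \<in> carrier M \<Longrightarrow> f (m \<oplus>\<^bsub>M\<^esub> n) = f m \<oplus>\<^bsub>N\<^esub> f n"
    and "\<And>k m. k \<in> carrier K \<Longrightarrow> m \<in> carrier M \<Longrightarrow> f (scal k \<odot>\<^bsub>M\<^esub> m) = scal k \<odot>\<^bsub>N\<^esub> f m"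
    and "\<And>r m. r \<in> {e1, e2, x, a} \<Longrightarrow> m \<in> carrier M \<Longrightarrow> f (r \<odot>\<^bsub>M\<^esub> m) = r \<odot>\<^bsub>N\<^esub> f m"
  shows "restrict f (carrier M) \<in> module_Hom A M N"
proof (rule module_HomI[OF assms(1,3,4)])
  interpret M: left_module A M by fact
  fix r m assume rm: "r \<in> carrier A" "m \<in> carrier M"
  show "f (r \<odot>\<^bsub>M\<^esub> m) = r \<odot>\<^bsub>N\<^esub> f m"
    unfolding act_expansion[OF assms(1) rm] act_expansion[OF assms(2) rm(1) assms(3)[OF rm(2)]]
    using rm by (simp add: assms(3-6))
qed auto

subsection \<open>The projective modules attached to the vertices\<close>

definition vertex_module :: "(nat \<Rightarrow> 'k) \<Rightarrow> ('k, nat \<Rightarrow> 'k) fmod" where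
  "vertex_module e = cyclic (\<lambda>r. r \<otimes> e)"

lemma cyclic_projection_vertex:
  assumes "vertex e c"
  shows "cyclic_projection (\<lambda>r. r \<otimes> e)"
  using vertex_facts(1,2)[OF assms] by (auto simp: cyclic_projection_def A.l_distr A.m_assoc)

text \<open>Here \<open>1 - e\<close> lies in the kernel of \<open>\<pi>\<close>, so an admissible n
  satisfies n = e n; if m lifts n, then e m is an admissible lift. The formulation with a general
  \<open>\<pi>\<close> also covers \<open>simple_at\<close> and \<open>loop_module\<close> in the
  cases where they coincide with A e.\<close>

lemma projective_cyclic_idempotent:
  assumes \<pi>: "cyclic_projection \<pi>" and e: "e \<in> carrier A" "e \<otimes> e = e" "\<pi> \<one> = e"
    and ker: "\<And>r. r \<in> carrier A \<Longrightarrow> \<pi> r = \<zero> \<Longrightarrow> r \<otimes> e = \<zero>"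
  shows "projective K A (cyclic \<pi>)"
proof (rule projective_cyclicI[OF \<pi>])
  fix M N :: "('k, nat \<Rightarrow> 'k) fmod" and g n
  assume M: "left_module A M" and N: "left_module A N" and g: "g \<in> module_Hom A M N" "g ` carrier M = carrier N"
    and n: "n \<in> carrier N" "\<And>r. r \<in> carrier A \<Longrightarrow> \<pi> r = \<zero> \<Longrightarrow> r \<odot>\<^bsub>N\<^esub> n = \<zero>\<^bsub>N\<^esub>"
  interpret M: left_module A M by fact
  interpret N: left_module A N by fact
  obtain m where m: "m \<in> carrier M" "g m = n" using g(2) n(1) by (metis imageE)
  have "\<pi> \<one> = \<pi> e" using cyclic_projectionD(2)[OF \<pi>, of \<one>] e(3) by simp
  then have "(\<one> \<ominus> e) \<odot>\<^bsub>N\<^esub> n = \<zero>\<^bsub>N\<^esub>"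
    using e(1) cyclic_projection_diff[OF \<pi>] by (intro n(2)) auto
  then have "e \<odot>\<^bsub>N\<^esub> n = n"
    using e n(1) by (simp add: a_minus_def N.smult_l_distr N.scalar_minus_left)
      (metis N.diff_eq_zero_iff N.scalar_closed a_minus_def)
  then have "g (e \<odot>\<^bsub>M\<^esub> m) = n" using m e module_HomD(3)[OF g(1)] by simp
  moreover have "r \<odot>\<^bsub>M\<^esub> (e \<odot>\<^bsub>M\<^esub> m) = \<zero>\<^bsub>M\<^esub>" if "r \<in> carrier A" "\<pi> r = \<zero>" for r
    using ker[OF that] that m e by (simp flip: M.smult_assoc1)
  ultimately show "\<exists>m\<in>carrier M. g m = n \<and> (\<forall>r\<in>carrier A. \<pi> r = \<zero> \<longrightarrow> r \<odot>\<^bsub>M\<^esub> m = \<zero>\<^bsub>M\<^esub>)"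
    using m e by (intro bexI[of _ "e \<odot>\<^bsub>M\<^esub> m"]) auto
qed

lemma projective_vertex_module:
  assumes "vertex e c"
  shows "projective K A (vertex_module e)"
  unfolding vertex_module_def
  by (rule projective_cyclic_idempotent[OF cyclic_projection_vertex[OF assms]])
    (use vertex_facts(1,2)[OF assms] in auto)

subsection \<open>Projective covers\<close>

text \<open>The invariant of the construction: \<open>g : G \<rightarrow> M\<close> is injective modulo radicals. It is kept
  when a generator outside of \<open>g G + rad M\<close> is added.\<close>

definition partial_cover :: "('k, nat \<Rightarrow> 'k) fmod \<Rightarrow> ('k, nat \<Rightarrow> 'k) fmod \<Rightarrow> ((nat \<Rightarrow> 'k) \<Rightarrow> nat \<Rightarrow> 'k) \<Rightarrow> bool" where
  "partial_cover M G g \<longleftrightarrow> projective K A G \<and> g \<in> module_Hom A G M \<and>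
    (\<forall>y\<in>carrier G. g y \<in> rad M \<longrightarrow> y \<in> rad G)"

text \<open>If w = e m is not yet covered, a copy of A e is adjoined and its generator sent to w. An
  element (y, v) mapped into \<open>rad M\<close> has c v = 0, so v is radical, its image is
  radical, and the invariant for y applies.\<close>

lemma partial_cover_step:
  assumes "left_module A M" "partial_cover M G g" "vertex e c" "m \<in> carrier M"
  obtains G' g' where "partial_cover M G' g'" "g ` carrier G <+>\<^bsub>M\<^esub> rad M \<subseteq> g' ` carrier G' <+>\<^bsub>M\<^esub> rad M"
    "e \<odot>\<^bsub>M\<^esub> m \<in> g' ` carrier G' <+>\<^bsub>M\<^esub> rad M"
proof (cases "e \<odot>\<^bsub>M\<^esub> m \<in> g ` carrier G <+>\<^bsub>M\<^esub> rad M")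
  case False
  interpret M: left_module A M by fact
  note J = M.submoduleD[OF submodule_rad[OF assms(1)]] and e = vertex_facts[OF assms(3)]
  have G: "projective K A G" and g: "g \<in> module_Hom A G M"
    and gJ: "\<And>y. y \<in> carrier G \<Longrightarrow> g y \<in> rad M \<Longrightarrow> y \<in> rad G"
    using assms(2) by (auto simp: partial_cover_def)
  note GL = projective_left_module[OF G] and gD = module_HomD[OF g]
  define w where "w = e \<odot>\<^bsub>M\<^esub> m"
  have w: "w \<in> carrier M" "e \<odot>\<^bsub>M\<^esub> w = w" "w \<notin> g ` carrier G <+>\<^bsub>M\<^esub> rad M"
    using False assms(4) e(1,2) by (auto simp: w_def simp flip: M.smult_assoc1)
  let ?V = "vertex_module e"
  have V: "projective K A ?V" by (rule projective_vertex_module[OF assms(3)])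
  note VL = projective_left_module[OF V]
  have Vc: "carrier ?V = (\<lambda>r. r \<otimes> e) ` carrier A" by (simp add: vertex_module_def)
  have "r \<odot>\<^bsub>M\<^esub> w = \<zero>\<^bsub>M\<^esub>" if "r \<in> carrier A" "r \<otimes> e = \<zero>" for r
    using that assms(4) e(1) by (simp add: w_def flip: M.smult_assoc1)
  then have h: "(\<lambda>v\<in>carrier ?V. v \<odot>\<^bsub>M\<^esub> w) \<in> module_Hom A ?V M"
    using cyclic_Hom(1)[OF cyclic_projection_vertex[OF assms(3)] assms(1) w(1)] by (simp add: vertex_module_def)
  let ?D = "direct_sum G ?V"
  obtain i1 i2 p1 p2 where i: "i1 \<in> module_Hom A G ?D" "i2 \<in> module_Hom A ?V ?D"
    and p: "p1 \<in> module_Hom A ?D G" "p2 \<in> module_Hom A ?D ?V"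
    and id: "\<And>m. m \<in> carrier G \<Longrightarrow> p1 (i1 m) = m" "\<And>n. n \<in> carrier ?V \<Longrightarrow> p2 (i2 n) = n"
      "\<And>m. m \<in> carrier G \<Longrightarrow> p2 (i1 m) = \<zero>\<^bsub>?V\<^esub>" "\<And>n. n \<in> carrier ?V \<Longrightarrow> p1 (i2 n) = \<zero>\<^bsub>G\<^esub>"
    and dec: "\<And>u. u \<in> carrier ?D \<Longrightarrow> u = i1 (p1 u) \<oplus>\<^bsub>?D\<^esub> i2 (p2 u)"
    by (rule direct_sum_maps[OF GL VL]) (rule that)
  note D = projective_direct_sum[OF G V]
  note DL = projective_left_module[OF D]
  interpret D: left_module A ?D by (rule DL)
  note iD = module_HomD[OF i(1)] module_HomD[OF i(2)] and pD = module_HomD[OF p(1)] module_HomD[OF p(2)]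
  define g' where "g' = (\<lambda>u\<in>carrier ?D. g (p1 u) \<oplus>\<^bsub>M\<^esub> (\<lambda>v\<in>carrier ?V. v \<odot>\<^bsub>M\<^esub> w) (p2 u))"
  have g': "g' \<in> module_Hom A ?D M"
    unfolding g'_def by (rule module_Hom_direct_sum[OF GL VL assms(1) g h p])
  have "u \<in> rad ?D" if u: "u \<in> carrier ?D" "g' u \<in> rad M" for u
  proof -
    define y v where "y = p1 u" and "v = p2 u"
    have yv: "y \<in> carrier G" "v \<in> carrier ?V" using u pD by (auto simp: y_def v_def)
    then have v: "v \<in> carrier A" "v \<otimes> e = v" using e(1,2) by (auto simp: Vc A.m_assoc)
    have gy: "g y \<in> carrier M" using gD(1)[OF yv(1)] .
    note vx = vertex_right[OF assms(3) v]
    have c: "c v \<in> carrier K" using e(3) v by simp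
    define j where "j = scal (c3 v) \<odot>\<^bsub>M\<^esub> (x \<odot>\<^bsub>M\<^esub> w) \<oplus>\<^bsub>M\<^esub> scal (c4 v) \<odot>\<^bsub>M\<^esub> (a \<odot>\<^bsub>M\<^esub> w)"
    have j: "j \<in> rad M" "j \<in> carrier M"
      using J(1,3,4) rad_memI[OF assms(1) w(1)] v by (auto simp: j_def subset_iff)
    have vw: "v \<odot>\<^bsub>M\<^esub> w = scal (c v) \<odot>\<^bsub>M\<^esub> w \<oplus>\<^bsub>M\<^esub> j"
      by (subst vx) (use v w c e(1) in \<open>simp add: M.smult_l_distr M.smult_assoc1 j_def\<close>)
    have sum: "g y \<oplus>\<^bsub>M\<^esub> v \<odot>\<^bsub>M\<^esub> w \<in> rad M" using u yv by (simp add: g'_def y_def v_def)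
    \<comment> \<open>Modulo \<open>rad M\<close> the element v acts on w as the scalar
      \<open>c v\<close>. Dividing by a nonzero scalar would place w in g G + rad M.\<close>
    have c0: "c v = \<zero>\<^bsub>K\<^esub>"
    proof (rule ccontr)
      assume nz: "c v \<noteq> \<zero>\<^bsub>K\<^esub>"
      define k where "k = inv\<^bsub>K\<^esub> (c v)"
      have k: "k \<in> carrier K" "scal k \<odot>\<^bsub>M\<^esub> (scal (c v) \<odot>\<^bsub>M\<^esub> w) = w"
        using act_inverse[OF assms(1) c nz w(1)] by (auto simp: k_def)
      define s where "s = g y \<oplus>\<^bsub>M\<^esub> v \<odot>\<^bsub>M\<^esub> w"
      have s: "s \<in> rad M" "s \<in> carrier M" using sum J(1) by (auto simp: s_def)
      have "scal (c v) \<odot>\<^bsub>M\<^esub> w = \<ominus>\<^bsub>M\<^esub> g y \<oplus>\<^bsub>M\<^esub> (s \<ominus>\<^bsub>M\<^esub> j)"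
        unfolding s_def vw using gy j c w by (simp add: a_minus_def M.M.a_assoc M.M.r_neg) (simp add: M.M.r_neg1)
      then have "w = scal k \<odot>\<^bsub>M\<^esub> (\<ominus>\<^bsub>M\<^esub> g y) \<oplus>\<^bsub>M\<^esub> scal k \<odot>\<^bsub>M\<^esub> (s \<ominus>\<^bsub>M\<^esub> j)"
        using k gy s j by (metis M.M.a_inv_closed M.M.minus_closed M.smult_r_distr scal_closed)
      moreover have "scal k \<odot>\<^bsub>M\<^esub> (\<ominus>\<^bsub>M\<^esub> g y) = g ((\<ominus> scal k) \<odot>\<^bsub>G\<^esub> y)"
        using gD(3)[of "\<ominus> scal k" y] yv k gy by (simp add: M.scalar_minus_left M.scalar_minus_right)
      moreover have "(\<ominus> scal k) \<odot>\<^bsub>G\<^esub> y \<in> carrier G"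
        using left_module.smult_closed[OF GL] k yv by simp
      moreover have "scal k \<odot>\<^bsub>M\<^esub> (s \<ominus>\<^bsub>M\<^esub> j) \<in> rad M" using J(4,6) s j k by simp
      ultimately show False using w(3) unfolding set_add_def' by blast
    qed
    then have "v \<odot>\<^bsub>M\<^esub> w = j" using vw w j by simp
    then have "g y = (g y \<oplus>\<^bsub>M\<^esub> v \<odot>\<^bsub>M\<^esub> w) \<ominus>\<^bsub>M\<^esub> j" using gy j M.diff_add_cancel by simp
    then have "g y \<in> rad M" using J(6) sum j(1) by metis
    then have y: "y \<in> rad G" using gJ yv by blast
    interpret V: left_module A ?V by (rule VL)
    have ge: "e \<in> carrier ?V" using e(1,2) by (auto simp: Vc intro!: image_eqI[of _ _ e])
    have "v = scal (c3 v) \<otimes> x \<oplus> scal (c4 v) \<otimes> a" using vx c0 v e(1) by simp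
    then have "v \<odot>\<^bsub>?V\<^esub> e = x \<odot>\<^bsub>?V\<^esub> (scal (c3 v) \<odot>\<^bsub>?V\<^esub> e) \<oplus>\<^bsub>?V\<^esub> a \<odot>\<^bsub>?V\<^esub> (scal (c4 v) \<odot>\<^bsub>?V\<^esub> e)"
      using ge v act_scal[OF VL ge] by (metis V.smult_assoc1 V.smult_l_distr coord_closed(3,4) basis_closed(3,4) A.m_closed scal_closed)
    moreover have "v \<odot>\<^bsub>?V\<^esub> e = v" using v e(1,2) by (simp add: vertex_module_def A.m_assoc)
    moreover have "scal (c3 v) \<odot>\<^bsub>?V\<^esub> e \<in> carrier ?V" "scal (c4 v) \<odot>\<^bsub>?V\<^esub> e \<in> carrier ?V"
      using v(1) ge by (intro V.smult_closed; simp)+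
    ultimately have "v \<in> rad ?V" using radI[OF VL] by metis
    then have "i1 y \<oplus>\<^bsub>?D\<^esub> i2 v \<in> rad ?D"
      using D.submoduleD(3)[OF submodule_rad[OF DL]] rad_Hom[OF i(1) y GL] rad_Hom[OF i(2) _ VL] by blast
    then show ?thesis using dec[OF u(1)] by (simp add: y_def v_def)
  qed
  then have pc: "partial_cover M ?D g'" using D g' by (auto simp: partial_cover_def)
  have gg: "g y = g' (i1 y)" if "y \<in> carrier G" for y
  proof -
    have "\<zero>\<^bsub>?V\<^esub> \<in> carrier ?V" using iD pD id(3)[OF that] that by metis
    moreover have "\<zero>\<^bsub>?V\<^esub> \<odot>\<^bsub>M\<^esub> w = \<zero>\<^bsub>M\<^esub>" using w by (simp add: vertex_module_def)
    ultimately show ?thesis using that iD id gD by (simp add: g'_def)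
  qed
  have ge: "e \<in> carrier ?V" using e(1,2) by (auto simp: Vc intro!: image_eqI[of _ _ e])
  have "g' (i2 e) = w"
    using ge iD id(2,4)[OF ge] module_Hom_zero[OF GL assms(1) g] w by (simp add: g'_def)
  then have we: "w \<in> g' ` carrier ?D <+>\<^bsub>M\<^esub> rad M"
    using J(2) w(1) iD(5)[OF ge] unfolding set_add_def' by (force simp: image_iff)
  have "g ` carrier G \<subseteq> g' ` carrier ?D" using gg iD(1) by auto
  then have "g ` carrier G <+>\<^bsub>M\<^esub> rad M \<subseteq> g' ` carrier ?D <+>\<^bsub>M\<^esub> rad M"
    unfolding set_add_def' by blast
  with pc we show thesis by (intro that[of ?D g']) (auto simp: w_def)
qed (use assms that in blast)

lemma exists_projective_cover:
  assumes "fd_module K A M"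
  obtains P p where "projective_cover K A M P p" "a_kernel P M p \<subseteq> rad P"
proof -
  note M = fd_left_module[OF assms]
  interpret M: left_module A M by (rule M)
  note J = M.submoduleD[OF submodule_rad[OF M]]
  have S: "submodule (g ` carrier G <+>\<^bsub>M\<^esub> rad M) A M" if "partial_cover M G g" for G g
  proof -
    have G: "left_module A G" and g: "g \<in> module_Hom A G M"
      using that projective_left_module by (auto simp: partial_cover_def)
    interpret G: left_module A G by (rule G)
    have I: "submodule (g ` carrier G) A M"
      by (rule submodule_image[OF G M g]) (rule G.submoduleI, auto)
    note I = M.submoduleD[OF this]
    have mem: "u \<oplus>\<^bsub>M\<^esub> j \<in> g ` carrier G <+>\<^bsub>M\<^esub> rad M" if "u \<in> g ` carrier G" "j \<in> rad M" for u j
      using that by (auto simp: set_add_def')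
    show ?thesis
    proof (rule M.submoduleI)
      show "g ` carrier G <+>\<^bsub>M\<^esub> rad M \<subseteq> carrier M"
        using I(1) J(1) by (auto simp: set_add_def' subset_iff)
      show "\<zero>\<^bsub>M\<^esub> \<in> g ` carrier G <+>\<^bsub>M\<^esub> rad M" using mem[OF I(2) J(2)] by simp
      fix m n assume "m \<in> g ` carrier G <+>\<^bsub>M\<^esub> rad M" "n \<in> g ` carrier G <+>\<^bsub>M\<^esub> rad M"
      then obtain u j v l where *: "u \<in> g ` carrier G" "j \<in> rad M" "v \<in> g ` carrier G" "l \<in> rad M"
        "m = u \<oplus>\<^bsub>M\<^esub> j" "n = v \<oplus>\<^bsub>M\<^esub> l" unfolding set_add_def' by blast
      then have "m \<oplus>\<^bsub>M\<^esub> n = (u \<oplus>\<^bsub>M\<^esub> v) \<oplus>\<^bsub>M\<^esub> (j \<oplus>\<^bsub>M\<^esub> l)"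
        using I(1) J(1) by (simp only: *(5,6)) (intro M.add_add_swap; blast)
      then show "m \<oplus>\<^bsub>M\<^esub> n \<in> g ` carrier G <+>\<^bsub>M\<^esub> rad M" using mem[OF I(3) J(3)] * by simp
    next
      fix r m assume r: "r \<in> carrier A" "m \<in> g ` carrier G <+>\<^bsub>M\<^esub> rad M"
      then obtain u j where *: "u \<in> g ` carrier G" "j \<in> rad M" "m = u \<oplus>\<^bsub>M\<^esub> j" unfolding set_add_def' by blast
      then have "r \<odot>\<^bsub>M\<^esub> m = r \<odot>\<^bsub>M\<^esub> u \<oplus>\<^bsub>M\<^esub> r \<odot>\<^bsub>M\<^esub> j"
        using I(1) J(1) r(1) by (simp only: *(3)) (intro M.smult_r_distr; blast)
      then show "r \<odot>\<^bsub>M\<^esub> m \<in> g ` carrier G <+>\<^bsub>M\<^esub> rad M" using mem[OF I(4) J(4)] * r by simp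
    qed
  qed
  obtain B where B: "finite B" "B \<subseteq> carrier M" "\<And>U. submodule U A M \<Longrightarrow> B \<subseteq> U \<Longrightarrow> carrier M \<subseteq> U"
    using fd_module_generators[OF assms] by metis
  have "\<exists>G g. partial_cover M G g \<and> C \<subseteq> g ` carrier G <+>\<^bsub>M\<^esub> rad M" if "finite C" "C \<subseteq> carrier M" for C
    using that
  proof (induction C)
    case empty
    let ?Z = "M\<lparr>carrier := {\<zero>\<^bsub>M\<^esub>}\<rparr>"
    have Z: "fd_module K A ?Z" using fd_zero_submodule[OF assms] .
    have "\<zero>\<^bsub>?Z\<^esub> \<in> rad ?Z"
      using left_module.submoduleD(2)[OF fd_left_module[OF Z] submodule_rad[OF fd_left_module[OF Z]]] .
    then have "partial_cover M ?Z (\<lambda>m\<in>carrier ?Z. \<zero>\<^bsub>M\<^esub>)"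
      using projective_zero_module[OF Z] module_Hom_zero_map[OF fd_left_module[OF Z] M]
      by (auto simp: partial_cover_def zero_module_def)
    then show ?case by blast
  next
    case (insert m C)
    then obtain G g where 1: "partial_cover M G g" "C \<subseteq> g ` carrier G <+>\<^bsub>M\<^esub> rad M" by auto
    have m: "m \<in> carrier M" using insert by simp
    obtain G1 g1 where 2: "partial_cover M G1 g1"
      "g ` carrier G <+>\<^bsub>M\<^esub> rad M \<subseteq> g1 ` carrier G1 <+>\<^bsub>M\<^esub> rad M" "e1 \<odot>\<^bsub>M\<^esub> m \<in> g1 ` carrier G1 <+>\<^bsub>M\<^esub> rad M"
      by (rule partial_cover_step[OF M 1(1) vertices(1) m])
    obtain G2 g2 where 3: "partial_cover M G2 g2"
      "g1 ` carrier G1 <+>\<^bsub>M\<^esub> rad M \<subseteq> g2 ` carrier G2 <+>\<^bsub>M\<^esub> rad M" "e2 \<odot>\<^bsub>M\<^esub> m \<in> g2 ` carrier G2 <+>\<^bsub>M\<^esub> rad M"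
      by (rule partial_cover_step[OF M 2(1) vertices(2) m])
    have "e1 \<odot>\<^bsub>M\<^esub> m \<oplus>\<^bsub>M\<^esub> e2 \<odot>\<^bsub>M\<^esub> m \<in> g2 ` carrier G2 <+>\<^bsub>M\<^esub> rad M"
      using M.submoduleD(3)[OF S[OF 3(1)]] 2(3) 3(2,3) by blast
    then have "m \<in> g2 ` carrier G2 <+>\<^bsub>M\<^esub> rad M" using act_one[OF M m] by simp
    then show ?case using 1(2) 2(2) 3 by blast
  qed
  then obtain P p where P: "partial_cover M P p" "B \<subseteq> p ` carrier P <+>\<^bsub>M\<^esub> rad M"
    using B(1,2) by meson
  have "carrier M \<subseteq> p ` carrier P <+>\<^bsub>M\<^esub> rad M" by (rule B(3)[OF S[OF P(1)] P(2)])
  moreover have p: "p \<in> module_Hom A P M" and PP: "projective K A P"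
    and pJ: "\<And>y. y \<in> carrier P \<Longrightarrow> p y \<in> rad M \<Longrightarrow> y \<in> rad P"
    using P(1) by (auto simp: partial_cover_def)
  note PL = projective_left_module[OF PP]
  have I: "submodule (p ` carrier P) A M"
  proof (rule submodule_image[OF PL M p])
    interpret P: left_module A P by (rule PL)
    show "submodule (carrier P) A P" by (rule P.submoduleI) auto
  qed
  ultimately have "p ` carrier P <+>\<^bsub>M\<^esub> rad M = carrier M"
    using M.submoduleD(1)[OF I] J(1) by (auto simp: set_add_def' subset_iff)
  then have onto: "p ` carrier P = carrier M" using nakayama[OF M I subset_refl] by simp
  have ker: "a_kernel P M p \<subseteq> rad P" using pJ J(2) by (auto simp: in_a_kernel_iff)
  then have "projective_cover K A M P p"
    using PP p onto nakayama[OF PL _ ker] by (auto simp: projective_cover_def)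
  with ker show thesis by (intro that)
qed

lemma exists_minimal_presentation:
  assumes "fd_module K A M"
  shows "\<exists>P1 f P0 p. minimal_presentation K A M P1 f P0 p"
proof -
  obtain P0 p where P0: "projective_cover K A M P0 p" by (rule exists_projective_cover[OF assms])
  then have "projective K A P0" "p \<in> module_Hom A P0 M" by (auto simp: projective_cover_def)
  then have "fd_module K A (P0\<lparr>carrier := a_kernel P0 M p\<rparr>)"
    using fd_module_submodule projective_fd submodule_a_kernel fd_left_module assms by blast
  then obtain P1 f where "projective_cover K A (P0\<lparr>carrier := a_kernel P0 M p\<rparr>) P1 f"
    by (rule exists_projective_cover)
  with P0 show ?thesis unfolding minimal_presentation_def by blast
qed

lemma projective_cover_kernel:
  assumes "projective_cover K A M P p" "left_module A M"
  shows "a_kernel P M p \<subseteq> rad P"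
proof -
  have P: "left_module A P" "p \<in> module_Hom A P M"
    using assms(1) projective_left_module by (auto simp: projective_cover_def)
  show ?thesis
    by (rule superfluous_subset_rad[OF P(1) submodule_a_kernel[OF P(1) assms(2) P(2)]])
      (use assms(1) in \<open>auto simp: projective_cover_def\<close>)
qed

end

lemma (in left_module) diff_add_commute:
  assumes "u \<in> carrier M" "v \<in> carrier M" "w \<in> carrier M"
  shows "(u \<ominus>\<^bsub>M\<^esub> v) \<oplus>\<^bsub>M\<^esub> w = u \<oplus>\<^bsub>M\<^esub> (w \<ominus>\<^bsub>M\<^esub> v)"
  using assms by (simp add: a_minus_def M.a_ac)

context fin_dim_algebra
begin

subsection \<open>Sums of two indecomposable modules\<close>

lemma sum_of_two_indecomposablesI:
  assumes "indecomposable K A M" "indecomposable K A N" "\<not> module_iso A M N"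
  shows "sum_of_distinct_indecomposables K A 2 (direct_sum M N)"
proof -
  have L: "left_module A M" "left_module A N"
    using assms(1,2) fd_left_module by (auto simp: indecomposable_def)
  define F where "F i = (if i = 0 then M else N)" for i :: nat
  have "module_iso A (direct_sum M N) (family_sum {..<2} F)"
    using module_iso_trans[OF direct_sum_iso(3)[OF L] _ direct_sum_iso(1)[OF L]]
      module_iso_family_sum_two[of A F] L A.ring_axioms by (simp add: F_def)
  moreover have "\<not> module_iso A N M" using assms(3) module_iso_sym L by blast
  ultimately show ?thesis
    unfolding sum_of_distinct_indecomposables_def using assms
    by (intro exI[of _ F]) (auto simp: F_def less_2_cases_iff)
qed

lemma sum_of_two_indecomposablesE:
  assumes "sum_of_distinct_indecomposables K A 2 T" "left_module A T"
  obtains M N where "indecomposable K A M" "indecomposable K A N" "\<not> module_iso A M N"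
    "module_iso A T (direct_sum M N)" "retract_of A M T" "retract_of A N T"
proof -
  obtain F :: "nat \<Rightarrow> ('k, nat \<Rightarrow> 'k) fmod" where F: "\<And>i. i < 2 \<Longrightarrow> indecomposable K A (F i)"
    "\<not> module_iso A (F 0) (F 1)" "module_iso A T (family_sum {..<2} F)"
    using assms(1) unfolding sum_of_distinct_indecomposables_def by (metis one_less_numeral_iff pos2 semiring_norm(76) zero_neq_one)
  have L: "left_module A (F i)" if "i < 2" for i
    using F(1)[OF that] fd_left_module by (auto simp: indecomposable_def)
  have S: "left_module A (family_sum {..<2} F)"
    by (rule left_module_family_sum[OF A.ring_axioms]) (use L in auto)
  have D: "left_module A (direct_sum (F 0) (F 1))" using direct_sum_iso(1)[OF L L, of 0 1] by simp
  have "module_iso A (binary_sum (F 0) (F 1)) (family_sum {..<2} F)"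
    by (rule module_iso_family_sum_two[OF A.ring_axioms]) (use L in auto)
  then have "module_iso A (family_sum {..<2} F) (binary_sum (F 0) (F 1))"
    using module_iso_sym[OF _ left_module_binary_sum[OF L L] S, of 0 1] by simp
  then have iso: "module_iso A T (direct_sum (F 0) (F 1))"
    using module_iso_trans[OF module_iso_trans[OF F(3)] direct_sum_iso(2)[OF L L], of 0 1] assms(2) by simp
  have r: "retract_of A (F 0) T" "retract_of A (F 1) T"
    using retract_of_trans[OF direct_sum_retracts(1)[OF L L] module_iso_retract(2)[OF iso assms(2) D] L]
      retract_of_trans[OF direct_sum_retracts(2)[OF L L] module_iso_retract(2)[OF iso assms(2) D] L] assms(2)
    by simp_all
  show thesis
    by (rule that[OF F(1) F(1) F(2) iso r]) simp_all
qed

lemma module_iso_direct_sum_cong: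
  assumes "module_iso A M M'" "module_iso A N N'" "left_module A M" "left_module A M'" "left_module A N" "left_module A N'"
  shows "module_iso A (direct_sum M N) (direct_sum M' N')"
  using module_iso_trans[OF module_iso_trans[OF direct_sum_iso(3) module_iso_binary_sum_cong] direct_sum_iso(2)]
    direct_sum_iso(1) assms by blast

lemma module_iso_direct_sum_swap:
  assumes "left_module A M" "left_module A N"
  shows "module_iso A (direct_sum M N) (direct_sum N M)"
  using module_iso_trans[OF module_iso_trans[OF direct_sum_iso(3) module_iso_binary_sum_swap] direct_sum_iso(2)]
    direct_sum_iso(1) assms by blast

text \<open>The two non-isomorphic summands cannot both be isomorphic to X nor both to Y, so they
  are X and Y in some order.\<close>

lemma sum_of_two_indecomposables_unique:
  fixes X Y :: "('k, nat \<Rightarrow> 'k) fmod"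
  assumes "sum_of_distinct_indecomposables K A 2 T" "left_module A T" "left_module A X" "left_module A Y"
    and "\<And>N. indecomposable K A N \<Longrightarrow> retract_of A N T \<Longrightarrow> module_iso A N X \<or> module_iso A N Y"
  shows "module_iso A T (direct_sum X Y)"
proof -
  obtain M N where MN: "indecomposable K A M" "indecomposable K A N" "\<not> module_iso A M N"
    "module_iso A T (direct_sum M N)" "retract_of A M T" "retract_of A N T"
    by (rule sum_of_two_indecomposablesE[OF assms(1,2)])
  have L: "left_module A M" "left_module A N"
    using MN fd_left_module by (auto simp: indecomposable_def)
  have no: "\<not> (module_iso A M Z \<and> module_iso A N Z)" if "left_module A Z" for Z :: "('k, nat \<Rightarrow> 'k) fmod"
    using MN(3) module_iso_trans module_iso_sym L that by blast
  consider "module_iso A M X" "module_iso A N Y" | "module_iso A M Y" "module_iso A N X"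
    using assms(5)[OF MN(1,5)] assms(5)[OF MN(2,6)] no assms(3,4) by blast
  then have "module_iso A (direct_sum M N) (direct_sum X Y)"
  proof cases
    case 1
    then show ?thesis using module_iso_direct_sum_cong L assms by blast
  next
    case 2
    then show ?thesis
      using module_iso_trans[OF module_iso_direct_sum_cong[of M Y N X] module_iso_direct_sum_swap]
        direct_sum_iso(1) L assms by blast
  qed
  then show ?thesis using module_iso_trans MN(4) assms(2) by blast
qed

text \<open>Verifies the clause of \<open>tilting\<close> that counts isomorphism classes of
  indecomposable summands, once the indecomposable retracts are known.\<close>

lemma card_indecomposable_summands_direct_sum:
  assumes "indecomposable K A X" "indecomposable K A Y" "\<not> module_iso A X Y"
    and "\<And>N. indecomposable K A N \<Longrightarrow> retract_of A N (direct_sum X Y) \<Longrightarrow> module_iso A N X \<or> module_iso A N Y"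
  shows "card (iso_classes A {M. indecomposable K A M \<and> direct_summand K A M (direct_sum X Y)}) = 2"
proof (rule card_iso_classes_eq_2)
  have fd: "fd_module K A X" "fd_module K A Y" using assms by (auto simp: indecomposable_def)
  note L = fd(1)[THEN fd_left_module] fd(2)[THEN fd_left_module]
  have "direct_summand K A X (direct_sum X Y)"
    unfolding direct_summand_def using fd direct_sum_iso(3)[OF L] by blast
  then show "X \<in> {M. indecomposable K A M \<and> direct_summand K A M (direct_sum X Y)}"
    using assms by simp
  have "direct_summand K A Y (direct_sum X Y)"
    unfolding direct_summand_def
    using fd module_iso_trans[OF direct_sum_iso(3)[OF L] module_iso_binary_sum_swap[OF L] direct_sum_iso(1)[OF L]]
    by blast
  then show "Y \<in> {M. indecomposable K A M \<and> direct_summand K A M (direct_sum X Y)}"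
    using assms by simp
  show "module_iso A N X \<or> module_iso A N Y"
    if "N \<in> {M. indecomposable K A M \<and> direct_summand K A M (direct_sum X Y)}" for N
    using that assms(4) direct_summand_retract direct_sum_iso(1)[OF L] by blast
qed (use assms(3) fd_left_module in \<open>auto simp: indecomposable_def\<close>)

lemma projective_Ext1_vanishes:
  assumes "projective K A P" "left_module A N"
  shows "Ext1_vanishes K A P N"
proof (rule Ext1_vanishes_if_sections[OF projective_left_module[OF assms(1)] assms(2)])
  fix E i p assume "extension K A P N E i p"
  then show "\<exists>s\<in>module_Hom A P E. \<forall>m\<in>carrier P. p (s m) = m"
    using projective_section[OF assms(1), of E p] unfolding extension_def by metis
qed

end

context loop_arrow_algebra
begin

section \<open>Rigid modules over the loop-arrow algebras\<close>

lemma tau_rigid_presentation: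
  assumes "fd_module K A T"
  obtains P1 P0 :: "('k, nat \<Rightarrow> 'k) fmod" and f p where "projective K A P1" "projective K A P0"
    "p \<in> module_Hom A P0 T" "p ` carrier P0 = carrier T" "f \<in> module_Hom A P1 P0"
    "f ` carrier P1 = a_kernel P0 T p" "a_kernel P0 T p \<subseteq> rad P0"
    "\<And>q. q \<in> carrier P1 \<Longrightarrow> f q = \<zero>\<^bsub>P0\<^esub> \<Longrightarrow> q \<in> rad P1"
    "tau_rigid K A T \<longleftrightarrow> (\<forall>h\<in>module_Hom A P1 T. \<exists>g\<in>module_Hom A P0 T. \<forall>q\<in>carrier P1. h q = g (f q))"
proof -
  obtain P1 f P0 p where m: "minimal_presentation K A T P1 f P0 p" and f: "f \<in> module_Hom A P1 P0"
    and crit: "tau_rigid K A T \<longleftrightarrow> (\<forall>h\<in>module_Hom A P1 T. \<exists>g\<in>module_Hom A P0 T. \<forall>q\<in>carrier P1. h q = g (f q))"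
    by (rule tau_rigid_criterion[OF assms exists_minimal_presentation[OF assms]])
  have c0: "projective_cover K A T P0 p" and c1: "projective_cover K A (P0\<lparr>carrier := a_kernel P0 T p\<rparr>) P1 f"
    using m by (auto simp: minimal_presentation_def)
  note T = fd_left_module[OF assms]
  have P: "projective K A P1" "projective K A P0" "p \<in> module_Hom A P0 T" "p ` carrier P0 = carrier T"
    "f ` carrier P1 = a_kernel P0 T p"
    using c0 c1 by (auto simp: projective_cover_def)
  have N: "left_module A (P0\<lparr>carrier := a_kernel P0 T p\<rparr>)"
    using submodule_left_module submodule_a_kernel[OF _ T P(3)] projective_left_module[OF P(2)] by blast
  show thesis
    using that[OF P(1-4) f P(5) projective_cover_kernel[OF c0 T] _ crit] projective_cover_kernel[OF c1 N]
    by (auto simp: in_a_kernel_iff subset_iff)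
qed

text \<open>If \<open>j y\<close> is a nonzero element of the kernel of the projective cover of a rigid module, then
  it lifts to a top element of the second projective module, which can be mapped
  to any prescribed element of \<open>T\<close>, up to radical terms; factoring this map makes the image divisible by \<open>j\<close>.\<close>

lemma tau_rigid_divisible:
  assumes rigid: "tau_rigid K A T" and T: "fd_module K A T" and v: "vertex e c"
    and j: "j \<in> carrier A" "e \<otimes> j = j"
    and t: "t \<in> carrier T" "j \<odot>\<^bsub>T\<^esub> t = \<zero>\<^bsub>T\<^esub>" "\<And>t'. t' \<in> carrier T \<Longrightarrow> t \<noteq> s \<odot>\<^bsub>T\<^esub> t'"
    and div: "divisible_on (regular A) L s" "L \<subseteq> carrier A" "s \<in> carrier A"
      "\<And>(P :: ('k, nat \<Rightarrow> 'k) fmod) y. left_module A P \<Longrightarrow> y \<in> carrier P \<Longrightarrow> j \<odot>\<^bsub>P\<^esub> y = \<zero>\<^bsub>P\<^esub> \<Longrightarrow> \<forall>r\<in>L. r \<odot>\<^bsub>P\<^esub> (d \<odot>\<^bsub>P\<^esub> y) = \<zero>\<^bsub>P\<^esub>"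
      "d \<in> carrier A" "d \<odot>\<^bsub>T\<^esub> t = t"
    and w: "w \<in> carrier T" "e \<odot>\<^bsub>T\<^esub> w = w"
  shows "\<exists>t'\<in>carrier T. \<exists>k\<in>carrier K. \<exists>k3\<in>carrier K. \<exists>k4\<in>carrier K. k \<noteq> \<zero>\<^bsub>K\<^esub> \<and>
    scal k \<odot>\<^bsub>T\<^esub> w \<oplus>\<^bsub>T\<^esub> (scal k3 \<odot>\<^bsub>T\<^esub> (e \<odot>\<^bsub>T\<^esub> (x \<odot>\<^bsub>T\<^esub> w)) \<oplus>\<^bsub>T\<^esub> scal k4 \<odot>\<^bsub>T\<^esub> (e \<odot>\<^bsub>T\<^esub> (a \<odot>\<^bsub>T\<^esub> w))) = j \<odot>\<^bsub>T\<^esub> t'"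
proof -
  note e = vertex_facts[OF v] and TL = fd_left_module[OF T]
  interpret T: left_module A T by (rule TL)
  obtain P1 P0 f p where P1: "projective K A P1" and P0: "projective K A P0"
    and p: "p \<in> module_Hom A P0 T" "p ` carrier P0 = carrier T" and f: "f \<in> module_Hom A P1 P0"
    and fp: "f ` carrier P1 = a_kernel P0 T p" and pJ: "a_kernel P0 T p \<subseteq> rad P0"
    and fac: "\<And>h. h \<in> module_Hom A P1 T \<Longrightarrow> \<exists>g\<in>module_Hom A P0 T. \<forall>q\<in>carrier P1. h q = g (f q)"
    using tau_rigid_presentation[OF T] rigid by metis
  note L1 = projective_left_module[OF P1] and L0 = projective_left_module[OF P0]
  interpret P1: left_module A P1 by (rule L1)
  interpret P0: left_module A P0 by (rule L0)
  note pD = module_HomD[OF p(1)] and fD = module_HomD[OF f]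
  obtain y where y: "y \<in> carrier P0" "p y = t" using p(2) t(1) by (metis imageE)
  have jy: "j \<odot>\<^bsub>P0\<^esub> y \<in> a_kernel P0 T p" using y j t(2) pD by (simp add: in_a_kernel_iff)
  \<comment> \<open>If j y were zero in P0, then d y would be annihilated by \<open>L\<close> and so
    divisible by \<open>s\<close> in the projective module; applying \<open>p\<close> would make t
    divisible by \<open>s\<close>.\<close>
  have nz: "j \<odot>\<^bsub>P0\<^esub> y \<noteq> \<zero>\<^bsub>P0\<^esub>"
  proof
    assume "j \<odot>\<^bsub>P0\<^esub> y = \<zero>\<^bsub>P0\<^esub>"
    then have "\<forall>r\<in>L. r \<odot>\<^bsub>P0\<^esub> (d \<odot>\<^bsub>P0\<^esub> y) = \<zero>\<^bsub>P0\<^esub>" using div(4)[OF L0 y(1)] by simp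
    moreover have "d \<odot>\<^bsub>P0\<^esub> y \<in> carrier P0" using div(5) y(1) by simp
    ultimately obtain y' where y': "y' \<in> carrier P0" "d \<odot>\<^bsub>P0\<^esub> y = s \<odot>\<^bsub>P0\<^esub> y'"
      using projective_divisible_on[OF P0 div(1-3)] unfolding divisible_on_def by blast
    have "t = p (d \<odot>\<^bsub>P0\<^esub> y)" using pD(3)[OF div(5) y(1)] y(2) div(6) by simp
    also have "\<dots> = s \<odot>\<^bsub>T\<^esub> p y'" using y' pD(3) div(3) by simp
    finally show False using t(3)[OF pD(1)[OF y'(1)]] by simp
  qed
  obtain q' where q': "q' \<in> carrier P1" "f q' = j \<odot>\<^bsub>P0\<^esub> y" using jy fp by (metis imageE)
  define q where "q = e \<odot>\<^bsub>P1\<^esub> q'"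
  have q: "q \<in> carrier P1" "e \<odot>\<^bsub>P1\<^esub> q = q" "f q = j \<odot>\<^bsub>P0\<^esub> y"
    using q' e(1,2) fD(3) j y(1) by (simp_all add: q_def flip: P0.smult_assoc1 P1.smult_assoc1)
  \<comment> \<open>The image of \<open>f\<close> lies in \<open>rad P0\<close>, which
    \<open>x\<close> and \<open>a\<close> annihilate, so \<open>f\<close> kills
    \<open>rad P1\<close>; but f q = j y is nonzero.\<close>
  have "q \<notin> rad P1"
  proof
    assume "q \<in> rad P1"
    then obtain u u' where u: "u \<in> carrier P1" "u' \<in> carrier P1" "q = x \<odot>\<^bsub>P1\<^esub> u \<oplus>\<^bsub>P1\<^esub> a \<odot>\<^bsub>P1\<^esub> u'"
      by (auto simp: rad_def)
    have "f u \<in> rad P0" "f u' \<in> rad P0" using fp pJ u by auto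
    then have "f q = \<zero>\<^bsub>P0\<^esub>" using u fD radD[OF L0] by simp
    then show False using q(3) nz by simp
  qed
  obtain n :: nat and \<phi> b where \<phi>: "\<And>i. i < n \<Longrightarrow> \<phi> i \<in> module_Hom A P1 (regular A)"
    and b: "\<And>i. i < n \<Longrightarrow> b i \<in> carrier P1"
    and dual: "\<And>p. p \<in> carrier P1 \<Longrightarrow> p = (\<Oplus>\<^bsub>P1\<^esub>i\<in>{..<n}. \<phi> i p \<odot>\<^bsub>P1\<^esub> b i)"
    by (rule dual_basis[OF P1]) blast
  have \<phi>q: "\<phi> i q \<in> carrier A" "e \<otimes> \<phi> i q = \<phi> i q" if "i < n" for i
    using module_HomD(1)[OF \<phi>[OF that] q(1)] module_HomD(3)[OF \<phi>[OF that] e(1) q(1)] q(2) by simp_all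
  \<comment> \<open>An element of P1 outside the radical has a coordinate with nonzero scalar part
    at the vertex: otherwise each term of its dual basis expansion would be radical.\<close>
  have "\<exists>i<n. c (\<phi> i q) \<noteq> \<zero>\<^bsub>K\<^esub>"
  proof (rule ccontr)
    assume no: "\<not> ?thesis"
    have "\<phi> i q \<odot>\<^bsub>P1\<^esub> b i \<in> rad P1" if i: "i < n" for i
    proof -
      obtain l where l: "l \<in> rad P1"
        "e \<odot>\<^bsub>P1\<^esub> (\<phi> i q \<odot>\<^bsub>P1\<^esub> b i) = scal (c (\<phi> i q)) \<odot>\<^bsub>P1\<^esub> (e \<odot>\<^bsub>P1\<^esub> b i) \<oplus>\<^bsub>P1\<^esub> l"
        by (rule vertex_act[OF L1 v \<phi>q(1)[OF i] b[OF i]])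
      moreover have "e \<odot>\<^bsub>P1\<^esub> (\<phi> i q \<odot>\<^bsub>P1\<^esub> b i) = \<phi> i q \<odot>\<^bsub>P1\<^esub> b i"
        using \<phi>q[OF i] b[OF i] e(1) by (simp flip: P1.smult_assoc1)
      moreover have "c (\<phi> i q) = \<zero>\<^bsub>K\<^esub>" using no i by blast
      ultimately show ?thesis using b[OF i] e(1) radD(1)[OF L1 l(1)] by simp
    qed
    then have "(\<Oplus>\<^bsub>P1\<^esub>i\<in>{..<n}. \<phi> i q \<odot>\<^bsub>P1\<^esub> b i) \<in> rad P1"
      by (intro finsum_mem_submodule[OF L1 submodule_rad[OF L1]]) auto
    then show False using dual[OF q(1)] \<open>q \<notin> rad P1\<close> by simp
  qed
  then obtain i where i: "i < n" "c (\<phi> i q) \<noteq> \<zero>\<^bsub>K\<^esub>" by blast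
  \<comment> \<open>Rigidity factors the rank-one map of \<open>\<phi> i\<close> and
    \<open>w\<close>. At q it equals j (g y) on one side and, on the other, a nonzero multiple of w
    plus radical terms.\<close>
  obtain g where g: "g \<in> module_Hom A P0 T" "\<And>q. q \<in> carrier P1 \<Longrightarrow> \<phi> i q \<odot>\<^bsub>T\<^esub> w = g (f q)"
    using fac[OF rank_one_Hom[OF L1 TL \<phi>[OF i(1)] w(1)]] by auto
  have r: "\<phi> i q \<in> carrier A" using \<phi>q i by simp
  have "j \<odot>\<^bsub>T\<^esub> g y = g (f q)" using module_HomD(3)[OF g(1) j(1) y(1)] q(3) by simp
  also have "\<dots> = \<phi> i q \<odot>\<^bsub>T\<^esub> w" using g(2)[OF q(1)] by simp
  also have "\<dots> = (e \<otimes> \<phi> i q) \<odot>\<^bsub>T\<^esub> w" using \<phi>q(2)[OF i(1)] by simp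
  also have "\<dots> = scal (c (\<phi> i q)) \<odot>\<^bsub>T\<^esub> w \<oplus>\<^bsub>T\<^esub>
      (scal (c3 (\<phi> i q)) \<odot>\<^bsub>T\<^esub> (e \<odot>\<^bsub>T\<^esub> (x \<odot>\<^bsub>T\<^esub> w)) \<oplus>\<^bsub>T\<^esub> scal (c4 (\<phi> i q)) \<odot>\<^bsub>T\<^esub> (e \<odot>\<^bsub>T\<^esub> (a \<odot>\<^bsub>T\<^esub> w)))"
    unfolding vertex_left[OF v r] using r w e(1,3) by (simp add: T.smult_l_distr T.smult_assoc1)
  finally show ?thesis
    using i(2) r e(3) module_HomD(1)[OF g(1) y(1)] coord_closed(3,4) by metis
qed

text \<open>The projective cover of T splits, and by \<open>nakayama\<close> the section is onto. So
  the kernel is zero, \<open>f\<close> is zero, and minimality gives P1 = rad P1, hence P1 = 0;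
  every homomorphism from P1 then factors trivially.\<close>

lemma projective_tau_rigid:
  assumes "projective K A T"
  shows "tau_rigid K A T"
proof -
  note T = projective_fd[OF assms] and TL = projective_left_module[OF assms]
  obtain P1 P0 f p where P1: "projective K A P1" and P0: "projective K A P0"
    and p: "p \<in> module_Hom A P0 T" "p ` carrier P0 = carrier T" and f: "f \<in> module_Hom A P1 P0"
    and fp: "f ` carrier P1 = a_kernel P0 T p" and pJ: "a_kernel P0 T p \<subseteq> rad P0"
    and fJ: "\<And>q. q \<in> carrier P1 \<Longrightarrow> f q = \<zero>\<^bsub>P0\<^esub> \<Longrightarrow> q \<in> rad P1"
    and crit: "tau_rigid K A T \<longleftrightarrow> (\<forall>h\<in>module_Hom A P1 T. \<exists>g\<in>module_Hom A P0 T. \<forall>q\<in>carrier P1. h q = g (f q))"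
    by (rule tau_rigid_presentation[OF T]) blast
  note L1 = projective_left_module[OF P1] and L0 = projective_left_module[OF P0]
  interpret T: left_module A T by (rule TL)
  interpret P1: left_module A P1 by (rule L1)
  interpret P0: left_module A P0 by (rule L0)
  note pD = module_HomD[OF p(1)] and fD = module_HomD[OF f]
  obtain s where s: "s \<in> module_Hom A T P0" "\<And>t. t \<in> carrier T \<Longrightarrow> p (s t) = t"
    using projective_section[OF assms projective_fd[OF P0] p] by blast
  note sD = module_HomD[OF s(1)]
  have S: "submodule (s ` carrier T) A P0"
    by (rule submodule_image[OF TL L0 s(1)]) (rule T.submoduleI, auto)
  have "s ` carrier T <+>\<^bsub>P0\<^esub> a_kernel P0 T p = carrier P0"
  proof
    show "s ` carrier T <+>\<^bsub>P0\<^esub> a_kernel P0 T p \<subseteq> carrier P0"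
      using sD(1) by (auto simp: set_add_def' in_a_kernel_iff)
    show "carrier P0 \<subseteq> s ` carrier T <+>\<^bsub>P0\<^esub> a_kernel P0 T p"
    proof
      fix y assume y: "y \<in> carrier P0"
      then have "y \<ominus>\<^bsub>P0\<^esub> s (p y) \<in> a_kernel P0 T p"
        using pD sD s(2) module_Hom_diff[OF L0 TL p(1)] by (simp add: in_a_kernel_iff T.diff_eq_zero_iff)
      moreover have "y = s (p y) \<oplus>\<^bsub>P0\<^esub> (y \<ominus>\<^bsub>P0\<^esub> s (p y))"
        using y pD sD P0.diff_add_cancel by simp
      ultimately show "y \<in> s ` carrier T <+>\<^bsub>P0\<^esub> a_kernel P0 T p"
        using pD(1)[OF y] unfolding set_add_def' by blast
    qed
  qed
  then have onto: "s ` carrier T = carrier P0" using nakayama[OF L0 S pJ] by blast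
  have "f q = \<zero>\<^bsub>P0\<^esub>" if "q \<in> carrier P1" for q
  proof -
    have "f q \<in> a_kernel P0 T p" using that fp by blast
    then have "f q \<in> s ` carrier T" "p (f q) = \<zero>\<^bsub>T\<^esub>"
      using onto by (simp_all add: in_a_kernel_iff)
    then obtain t where "t \<in> carrier T" "f q = s t" "p (f q) = \<zero>\<^bsub>T\<^esub>" by blast
    then show ?thesis using s(2) module_Hom_zero[OF TL L0 s(1)] by simp
  qed
  then have "carrier P1 \<subseteq> rad P1" using fJ by blast
  moreover have "{\<zero>\<^bsub>P1\<^esub>} <+>\<^bsub>P1\<^esub> carrier P1 = carrier P1" by (auto simp: set_add_def')
  moreover have "submodule {\<zero>\<^bsub>P1\<^esub>} A P1" by (rule P1.submoduleI) auto
  ultimately have zero: "{\<zero>\<^bsub>P1\<^esub>} = carrier P1" using nakayama[OF L1] by blast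
  have "\<exists>g\<in>module_Hom A P0 T. \<forall>q\<in>carrier P1. h q = g (f q)" if h: "h \<in> module_Hom A P1 T" for h
  proof (rule bexI[OF _ module_Hom_zero_map[OF L0 TL]], intro ballI)
    fix q assume q: "q \<in> carrier P1"
    then have "h q = \<zero>\<^bsub>T\<^esub>" using zero module_Hom_zero[OF L1 TL h] by (metis singletonD)
    then show "h q = (\<lambda>m\<in>carrier P0. \<zero>\<^bsub>T\<^esub>) (f q)" using fD(1)[OF q] by simp
  qed
  then show ?thesis using crit by blast
qed

section \<open>The simple modules\<close>

text \<open>The one-dimensional module on which the algebra acts through the character
  \<open>c\<close>.\<close>

definition simple_at :: "(nat \<Rightarrow> 'k) \<Rightarrow> ((nat \<Rightarrow> 'k) \<Rightarrow> 'k) \<Rightarrow> ('k, nat \<Rightarrow> 'k) fmod" where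
  "simple_at e c = cyclic (\<lambda>r. scal (c r) \<otimes> e)"

lemma coord_scal_vertex:
  assumes "vertex e c" "k \<in> carrier K"
  shows "c (scal k \<otimes> e) = k" "c (scal k) = k"
  using assms coord_scal(1,2)[OF assms(2) basis_closed(1)] coord_scal(1,2)[OF assms(2) basis_closed(2)]
    coord_scal(1,2)[OF assms(2) A.one_closed]
  by (auto simp: vertex_def)

lemma vertex_times_scal:
  assumes "r \<in> carrier A" "s \<in> carrier A" "k \<in> carrier K"
  shows "r \<otimes> (scal k \<otimes> s) = scal k \<otimes> (r \<otimes> s)"
  using assms scal_commute[of k r] by (metis A.m_assoc scal_closed)

lemma cyclic_projection_simple:
  assumes "vertex e c"
  shows "cyclic_projection (\<lambda>r. scal (c r) \<otimes> e)"
  using vertex_facts[OF assms] coord_scal_vertex[OF assms]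
  by (auto simp: cyclic_projection_def scal_add A.l_distr)

lemma simple_at_facts:
  assumes "vertex e c"
  shows "fd_module K A (simple_at e c)" "left_module A (simple_at e c)"
    "carrier (simple_at e c) = {scal k \<otimes> e |k. k \<in> carrier K}" "\<zero>\<^bsub>simple_at e c\<^esub> = \<zero>"
    "\<And>u v. u \<oplus>\<^bsub>simple_at e c\<^esub> v = u \<oplus> v" "\<And>r v. r \<odot>\<^bsub>simple_at e c\<^esub> v = scal (c (r \<otimes> v)) \<otimes> e"
    "e \<in> carrier (simple_at e c)" "e \<noteq> \<zero>"
proof -
  note e = vertex_facts[OF assms] and p = cyclic_projection_simple[OF assms]
  show "fd_module K A (simple_at e c)" "left_module A (simple_at e c)"
    using fd_module_cyclic[OF p] left_module_cyclic[OF p] by (simp_all add: simple_at_def)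
  have "scal k \<otimes> e \<in> (\<lambda>r. scal (c r) \<otimes> e) ` carrier A" if "k \<in> carrier K" for k
    using that coord_scal_vertex[OF assms that] by (intro image_eqI[of _ _ "scal k"]) auto
  then show c: "carrier (simple_at e c) = {scal k \<otimes> e |k. k \<in> carrier K}"
    using e(3) by (auto simp: simple_at_def)
  show "e \<in> carrier (simple_at e c)" unfolding c using e(1) by (auto intro!: exI[of _ "\<one>\<^bsub>K\<^esub>"])
  show "e \<noteq> \<zero>" using assms basis_nonzero by (auto simp: vertex_def)
qed (simp_all add: simple_at_def)

lemma simple_module_simple_at:
  assumes "vertex e c"
  shows "simple_module K A (simple_at e c)"
  unfolding simple_module_def
proof (intro conjI allI impI)
  note S = simple_at_facts[OF assms] and e = vertex_facts[OF assms]
  interpret S: left_module A "simple_at e c" by (rule S(2))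
  show "\<not> zero_module (simple_at e c)"
    using S(4,7,8) by (auto simp: zero_module_def)
  fix U assume U: "submodule U A (simple_at e c)"
  note UD = S.submoduleD[OF U]
  have "U = carrier (simple_at e c)" if "U \<noteq> {\<zero>\<^bsub>simple_at e c\<^esub>}"
  proof -
    have "\<exists>u\<in>U. u \<noteq> \<zero>"
    proof (rule ccontr)
      assume no: "\<not> ?thesis"
      have "\<zero> \<in> U" using UD(2) S(4) by metis
      with no have "U = {\<zero>}" by blast
      then show False using that S(4) by metis
    qed
    then obtain u where u: "u \<in> U" "u \<noteq> \<zero>" by blast
    then obtain k where "k \<in> carrier K" "u = scal k \<otimes> e" using UD(1) unfolding S(3) by blast
    with u e(1) have k: "k \<in> carrier K" "scal k \<otimes> e \<in> U" "k \<noteq> \<zero>\<^bsub>K\<^esub>" by auto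
    have "scal l \<otimes> e \<in> U" if l: "l \<in> carrier K" for l
    proof -
      have k': "inv\<^bsub>K\<^esub> k \<in> carrier K" "inv\<^bsub>K\<^esub> k \<otimes>\<^bsub>K\<^esub> k = \<one>\<^bsub>K\<^esub>"
        using k by (auto simp: K.field_Units intro!: K.Units_inv_closed K.Units_l_inv)
      define r where "r = scal (l \<otimes>\<^bsub>K\<^esub> inv\<^bsub>K\<^esub> k)"
      have "r \<odot>\<^bsub>simple_at e c\<^esub> (scal k \<otimes> e) \<in> U" using UD(4) k k' l by (simp add: r_def)
      moreover have "r \<otimes> (scal k \<otimes> e) = scal l \<otimes> e"
        using k k' l e(1) by (simp add: r_def K.m_assoc flip: A.m_assoc scal_mult)
      ultimately show ?thesis using S(6) coord_scal_vertex(1)[OF assms l] by simp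
    qed
    then have "carrier (simple_at e c) \<subseteq> U" unfolding S(3) by blast
    then show ?thesis using UD(1) by (rule equalityI[rotated])
  qed
  then show "U = {\<zero>\<^bsub>simple_at e c\<^esub>} \<or> U = carrier (simple_at e c)" by blast
qed (use simple_at_facts(1)[OF assms] in simp)

text \<open>For an element fixed by e, only the components of r in A e matter, and those along
  \<open>x\<close> and \<open>a\<close> act as zero.\<close>

lemma simple_at_Hom:
  assumes v: "vertex e c" and M: "left_module A M" and m: "m \<in> carrier M" "e \<odot>\<^bsub>M\<^esub> m = m"
    and J: "\<And>r. r \<in> {x, a} \<Longrightarrow> r \<odot>\<^bsub>M\<^esub> m = \<zero>\<^bsub>M\<^esub>" and r: "r \<in> carrier A"
  shows "r \<odot>\<^bsub>M\<^esub> m = scal (c r) \<odot>\<^bsub>M\<^esub> m"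
proof -
  interpret M: left_module A M by fact
  note e = vertex_facts[OF v]
  have "r \<otimes> e = scal (c (r \<otimes> e)) \<otimes> e \<oplus> (scal (c3 (r \<otimes> e)) \<otimes> x \<oplus> scal (c4 (r \<otimes> e)) \<otimes> a)"
    using e(1,2) r by (intro vertex_right[OF v]) (auto simp: A.m_assoc)
  moreover have "c (r \<otimes> e) = c r" using e r by simp
  ultimately have "(r \<otimes> e) \<odot>\<^bsub>M\<^esub> m = (scal (c r) \<otimes> e \<oplus> (scal (c3 (r \<otimes> e)) \<otimes> x \<oplus> scal (c4 (r \<otimes> e)) \<otimes> a)) \<odot>\<^bsub>M\<^esub> m"
    by simp
  then show ?thesis
    using r m e(1,3) J by (simp add: M.smult_l_distr M.smult_assoc1)
qed

text \<open>By \<open>nakayama\<close> the radical of a simple module S is proper, hence zero. A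
  nonzero vertex component of any element of S then spans a copy of the corresponding
  one-dimensional module, which fills S.\<close>

lemma num_simples_eq_2: "num_simples K A = 2"
  unfolding num_simples_def
proof (rule card_iso_classes_eq_2)
  show "simple_at e1 c1 \<in> {S. simple_module K A S}" "simple_at e2 c2 \<in> {S. simple_module K A S}"
    using simple_module_simple_at vertices by auto
  show "\<not> module_iso A (simple_at e1 c1) (simple_at e2 c2)"
  proof
    assume iso: "module_iso A (simple_at e1 c1) (simple_at e2 c2)"
    note S1 = simple_at_facts[OF vertices(1)] and S2 = simple_at_facts[OF vertices(2)]
    \<comment> \<open>The idempotent \<open>e1\<close> kills the simple module at the second vertex
      but fixes the generator of the one at the first.\<close>
    have "\<forall>m\<in>carrier (simple_at e2 c2). e1 \<odot>\<^bsub>simple_at e2 c2\<^esub> m = \<zero>\<^bsub>simple_at e2 c2\<^esub>"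
      using S2 coord_mult(2)[OF basis_closed(1)] by (auto simp: S2(3))
    then have "e1 \<odot>\<^bsub>simple_at e1 c1\<^esub> e1 = \<zero>\<^bsub>simple_at e1 c1\<^esub>"
      by (rule annihilated_retract[OF module_iso_retract(1)[OF iso S1(2) S2(2)] S2(2) S1(2)]) (use S1(7) in auto)
    then show False using S1 by simp
  qed
  fix S assume "S \<in> {S. simple_module K A S}"
  then have fd: "fd_module K A S" and nz: "\<not> zero_module S"
    and sub: "\<And>U. submodule U A S \<Longrightarrow> U = {\<zero>\<^bsub>S\<^esub>} \<or> U = carrier S"
    by (auto simp: simple_module_def)
  show SL: "left_module A S" using fd_left_module[OF fd] .
  interpret S: left_module A S by (rule SL)
  have "rad S = {\<zero>\<^bsub>S\<^esub>}"
  proof (rule ccontr)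
    assume "rad S \<noteq> {\<zero>\<^bsub>S\<^esub>}"
    then have "rad S = carrier S" using sub submodule_rad[OF SL] by blast
    moreover have "{\<zero>\<^bsub>S\<^esub>} <+>\<^bsub>S\<^esub> carrier S = carrier S" by (auto simp: set_add_def')
    moreover have "submodule {\<zero>\<^bsub>S\<^esub>} A S" by (rule S.submoduleI) auto
    ultimately have "{\<zero>\<^bsub>S\<^esub>} = carrier S" using nakayama[OF SL] by blast
    then show False using nz by (simp add: zero_module_def)
  qed
  then have J: "r \<odot>\<^bsub>S\<^esub> m = \<zero>\<^bsub>S\<^esub>" if "r \<in> {x, a}" "m \<in> carrier S" for r m
    using rad_memI[OF SL that(2)] that(1) by auto
  obtain s where s: "s \<in> carrier S" "s \<noteq> \<zero>\<^bsub>S\<^esub>" using nz by (auto simp: zero_module_def)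
  then have "e1 \<odot>\<^bsub>S\<^esub> s \<noteq> \<zero>\<^bsub>S\<^esub> \<or> e2 \<odot>\<^bsub>S\<^esub> s \<noteq> \<zero>\<^bsub>S\<^esub>" using act_one[OF SL s(1)] by auto
  then obtain e c where v: "vertex e c" and nz': "e \<odot>\<^bsub>S\<^esub> s \<noteq> \<zero>\<^bsub>S\<^esub>" using vertices by blast
  note e = vertex_facts[OF v] and Sa = simple_at_facts[OF v]
  define m where "m = e \<odot>\<^bsub>S\<^esub> s"
  have m: "m \<in> carrier S" "e \<odot>\<^bsub>S\<^esub> m = m" "m \<noteq> \<zero>\<^bsub>S\<^esub>"
    using s nz' e(1,2) by (simp_all add: m_def flip: S.smult_assoc1)
  have act: "r \<odot>\<^bsub>S\<^esub> m = scal (c r) \<odot>\<^bsub>S\<^esub> m" if "r \<in> carrier A" for r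
    by (rule simple_at_Hom[OF v SL m(1,2) J[OF _ m(1)] that])
  have ker: "r \<odot>\<^bsub>S\<^esub> m = \<zero>\<^bsub>S\<^esub>" if r: "r \<in> carrier A" "scal (c r) \<otimes> e = \<zero>" for r
  proof -
    have "scal (c r) \<odot>\<^bsub>S\<^esub> m = (scal (c r) \<otimes> e) \<odot>\<^bsub>S\<^esub> m"
      using r(1) m e(1,3) by (simp add: S.smult_assoc1)
    then show ?thesis using act[OF r(1)] r(2) m by simp
  qed
  define h where "h = (\<lambda>v\<in>carrier (simple_at e c). v \<odot>\<^bsub>S\<^esub> m)"
  have h: "h \<in> module_Hom A (simple_at e c) S"
    using cyclic_Hom(1)[OF cyclic_projection_simple[OF v] SL m(1) ker] by (simp add: h_def simple_at_def)
  have hv: "h (scal k \<otimes> e) = scal k \<odot>\<^bsub>S\<^esub> m" if "k \<in> carrier K" for k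
    using that m e(1) Sa(3) by (auto simp: h_def S.smult_assoc1)
  have "inj_on h (carrier (simple_at e c))"
  proof (rule inj_onI)
    fix u u' assume "u \<in> carrier (simple_at e c)" "u' \<in> carrier (simple_at e c)" and eq: "h u = h u'"
    then obtain k k' where k: "k \<in> carrier K" "u = scal k \<otimes> e" "k' \<in> carrier K" "u' = scal k' \<otimes> e"
      using Sa(3) by auto
    define l where "l = k \<ominus>\<^bsub>K\<^esub> k'"
    have l: "l \<in> carrier K" using k by (simp add: l_def)
    have "scal l \<odot>\<^bsub>S\<^esub> m = \<zero>\<^bsub>S\<^esub>"
      using eq k hv m by (simp add: l_def a_minus_def scal_add scal_uminus S.smult_l_distr S.scalar_minus_left S.M.r_neg)
    then have "l = \<zero>\<^bsub>K\<^esub>" using act_inverse[OF SL l _ m(1)] m(3) by force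
    then show "u = u'" using k K.minus_eq_zero_iff by (simp add: l_def)
  qed
  moreover have "h ` carrier (simple_at e c) = carrier S"
  proof -
    interpret Sa: left_module A "simple_at e c" by (rule Sa(2))
    have "submodule (h ` carrier (simple_at e c)) A S"
      by (rule submodule_image[OF Sa(2) SL h]) (rule Sa.submoduleI, auto)
    moreover have "h e = m" using Sa(7) m by (simp add: h_def)
    then have "m \<in> h ` carrier (simple_at e c)" using Sa(7) by (metis image_eqI)
    ultimately show ?thesis using sub m(3) by blast
  qed
  ultimately have "module_iso A (simple_at e c) S"
    using h by (auto simp: module_iso_def bij_betw_def)
  then have "module_iso A S (simple_at e c)" using module_iso_sym Sa(2) SL by blast
  then show "module_iso A S (simple_at e1 c1) \<or> module_iso A S (simple_at e2 c2)"
    using v by (auto simp: vertex_def)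
qed

section \<open>Indecomposable cyclic modules\<close>

text \<open>The module is a quotient of A e on which \<open>c\<close> is still defined, and an
  element generates it if and only if \<open>c\<close> does not vanish on it. Additivity of
  \<open>c\<close> then makes the module local.\<close>

lemma indecomposable_cyclic:
  assumes \<pi>: "cyclic_projection \<pi>" and v: "vertex e c" and one: "\<pi> \<one> = e"
    and right: "\<And>r. r \<in> carrier A \<Longrightarrow> \<pi> r \<otimes> e = \<pi> r" and c: "\<And>r. r \<in> carrier A \<Longrightarrow> c (\<pi> r) = c r"
  shows "indecomposable K A (cyclic \<pi>)"
proof -
  let ?M = "cyclic \<pi>"
  note e = vertex_facts[OF v] and D = cyclic_projectionD[OF \<pi>]
  note Cyc = left_module_cyclic[OF \<pi>]
  interpret M: left_module A ?M by (rule Cyc)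
  note J = M.submoduleD[OF submodule_rad[OF Cyc]]
  have eM: "e \<in> carrier ?M" using one by (auto simp: image_iff intro!: bexI[of _ \<one>])
  have gen_e: "m = m \<odot>\<^bsub>?M\<^esub> e" "m \<in> carrier A" if "m \<in> carrier ?M" for m
    using cyclic_generator[OF \<pi> that] one that D(1) by auto
  have split: "\<exists>j\<in>rad ?M. m = scal (c m) \<odot>\<^bsub>?M\<^esub> e \<oplus>\<^bsub>?M\<^esub> j" if m: "m \<in> carrier ?M" for m
  proof -
    have mA: "m \<in> carrier A" "m \<otimes> e = m" using m D(1) right by auto
    let ?j = "scal (c3 m) \<odot>\<^bsub>?M\<^esub> (x \<odot>\<^bsub>?M\<^esub> e) \<oplus>\<^bsub>?M\<^esub> scal (c4 m) \<odot>\<^bsub>?M\<^esub> (a \<odot>\<^bsub>?M\<^esub> e)"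
    have "m = (scal (c m) \<otimes> e \<oplus> (scal (c3 m) \<otimes> x \<oplus> scal (c4 m) \<otimes> a)) \<odot>\<^bsub>?M\<^esub> e"
      using vertex_right[OF v mA] gen_e(1)[OF m] by metis
    also have "\<dots> = (scal (c m) \<otimes> e) \<odot>\<^bsub>?M\<^esub> e \<oplus>\<^bsub>?M\<^esub> ?j"
      using mA(1) e(1,3) eM by (simp only: M.smult_l_distr M.smult_assoc1 A.a_closed A.m_closed scal_closed coord_closed basis_closed)
    also have "(scal (c m) \<otimes> e) \<odot>\<^bsub>?M\<^esub> e = scal (c m) \<odot>\<^bsub>?M\<^esub> e"
      using mA(1) e(1-3) by (simp add: A.m_assoc)
    finally have "m = scal (c m) \<odot>\<^bsub>?M\<^esub> e \<oplus>\<^bsub>?M\<^esub> ?j" .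
    moreover have "?j \<in> rad ?M"
      using mA(1) by (intro J(3) J(4) rad_memI[OF Cyc eM]) auto
    ultimately show ?thesis by blast
  qed
  have gen: "generates ?M m \<longleftrightarrow> c m \<noteq> \<zero>\<^bsub>K\<^esub>" if m: "m \<in> carrier ?M" for m
  proof
    assume "generates ?M m"
    then obtain r where r: "r \<in> carrier A" "e = \<pi> (r \<otimes> m)"
      using eM unfolding generates_def by auto
    then have "\<one>\<^bsub>K\<^esub> = c r \<otimes>\<^bsub>K\<^esub> c m" using c[of "r \<otimes> m"] e(4,5) gen_e(2)[OF m] by simp
    then show "c m \<noteq> \<zero>\<^bsub>K\<^esub>" using r(1) e(3) by auto
  next
    assume nz: "c m \<noteq> \<zero>\<^bsub>K\<^esub>"
    have mA: "m \<in> carrier A" using gen_e(2)[OF m] .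
    have cm: "c m \<in> carrier K" using e(3)[OF mA] .
    \<comment> \<open>The submodule generated by m. Since m is a nonzero multiple of e modulo the
      radical, U and the radical together give the whole module, and \<open>nakayama\<close>
      applies.\<close>
    define U where "U = (\<lambda>r. r \<odot>\<^bsub>?M\<^esub> m) ` carrier A"
    have U: "submodule U A ?M"
    proof (rule M.submoduleI)
      show "U \<subseteq> carrier ?M" using m M.smult_closed by (auto simp only: U_def)
      have "\<zero> \<odot>\<^bsub>?M\<^esub> m = \<zero>\<^bsub>?M\<^esub>" using M.scalar_zero_left[OF m] .
      then show "\<zero>\<^bsub>?M\<^esub> \<in> U" unfolding U_def by (metis A.zero_closed image_eqI)
      show "u \<oplus>\<^bsub>?M\<^esub> u' \<in> U" if "u \<in> U" "u' \<in> U" for u u'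
        using that m unfolding U_def by (auto simp only: M.smult_l_distr[symmetric])
      show "r \<odot>\<^bsub>?M\<^esub> u \<in> U" if "r \<in> carrier A" "u \<in> U" for r u
        using that m unfolding U_def by (auto simp only: M.smult_assoc1[symmetric])
    qed
    note UD = M.submoduleD[OF U]
    have mU: "m \<in> U" unfolding U_def using M.smult_one[OF m] by (metis A.one_closed image_eqI)
    obtain j where j: "j \<in> rad ?M" "m = scal (c m) \<odot>\<^bsub>?M\<^esub> e \<oplus>\<^bsub>?M\<^esub> j" using split[OF m] by blast
    define k where "k = inv\<^bsub>K\<^esub> (c m)"
    have k: "k \<in> carrier K" "scal k \<odot>\<^bsub>?M\<^esub> (scal (c m) \<odot>\<^bsub>?M\<^esub> e) = e"
      using act_inverse[OF Cyc cm nz eM] by (auto simp only: k_def)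
    have "carrier ?M \<subseteq> U <+>\<^bsub>?M\<^esub> rad ?M"
    proof
      fix m' assume m': "m' \<in> carrier ?M"
      obtain j' where j': "j' \<in> rad ?M" "m' = scal (c m') \<odot>\<^bsub>?M\<^esub> e \<oplus>\<^bsub>?M\<^esub> j'" using split[OF m'] by blast
      define l where "l = scal (c m')"
      have l: "l \<in> carrier A" using e(3)[OF gen_e(2)[OF m']] by (simp add: l_def)
      have jc: "j \<in> carrier ?M" "j' \<in> carrier ?M" using J(1) j(1) j'(1) by blast+
      have sm: "scal (c m) \<odot>\<^bsub>?M\<^esub> e \<in> carrier ?M" using cm eM by (intro M.smult_closed) auto
      have "scal k \<odot>\<^bsub>?M\<^esub> m = e \<oplus>\<^bsub>?M\<^esub> scal k \<odot>\<^bsub>?M\<^esub> j"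
        using M.smult_r_distr[OF _ sm jc(1), of "scal k"] k j(2) by (metis scal_closed)
      then have "e = scal k \<odot>\<^bsub>?M\<^esub> m \<ominus>\<^bsub>?M\<^esub> scal k \<odot>\<^bsub>?M\<^esub> j"
        using M.diff_add_cancel(3)[OF eM] k(1) jc(1) by (metis M.smult_closed scal_closed)
      then have le: "l \<odot>\<^bsub>?M\<^esub> e = l \<odot>\<^bsub>?M\<^esub> (scal k \<odot>\<^bsub>?M\<^esub> m) \<ominus>\<^bsub>?M\<^esub> l \<odot>\<^bsub>?M\<^esub> (scal k \<odot>\<^bsub>?M\<^esub> j)"
        using M.scalar_diff[OF l] k(1) m jc(1) by (metis M.smult_closed scal_closed)
      define u where "u = l \<odot>\<^bsub>?M\<^esub> (scal k \<odot>\<^bsub>?M\<^esub> m)"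
      define v where "v = l \<odot>\<^bsub>?M\<^esub> (scal k \<odot>\<^bsub>?M\<^esub> j)"
      have uv: "u \<in> U" "v \<in> rad ?M" using UD(4) J(4) mU j(1) l k(1) by (auto simp only: u_def v_def scal_closed)
      have "m' = (u \<ominus>\<^bsub>?M\<^esub> v) \<oplus>\<^bsub>?M\<^esub> j'" using le j'(2) by (simp only: u_def v_def l_def)
      also have "\<dots> = u \<oplus>\<^bsub>?M\<^esub> (j' \<ominus>\<^bsub>?M\<^esub> v)"
        using uv UD(1) J(1) jc(2) by (intro M.diff_add_commute) blast+
      finally show "m' \<in> U <+>\<^bsub>?M\<^esub> rad ?M"
        using uv J(6)[OF j'(1) uv(2)] unfolding set_add_def' by blast
    qed
    then have "U <+>\<^bsub>?M\<^esub> rad ?M = carrier ?M"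
      using M.M.setadd_subset_G[OF UD(1) J(1)] by blast
    then have "U = carrier ?M" using nakayama[OF Cyc U subset_refl] by blast
    then show "generates ?M m" unfolding generates_def U_def by blast
  qed
  show ?thesis
  proof (rule indecomposable_if_local[OF fd_module_cyclic[OF \<pi>] _ eM])
    show "generates ?M e" using gen[OF eM] e(4) by simp
    show "\<not> zero_module ?M"
      using eM v basis_nonzero by (auto simp: zero_module_def vertex_def set_eq_iff)
    show "generates ?M m \<or> generates ?M m'"
      if mm: "m \<in> carrier ?M" "m' \<in> carrier ?M" and g: "generates ?M (m \<oplus>\<^bsub>?M\<^esub> m')" for m m'
    proof -
      have "c (m \<oplus> m') = c m \<oplus>\<^bsub>K\<^esub> c m'" using e(6) gen_e(2) mm by simp
      moreover have "c (m \<oplus> m') \<noteq> \<zero>\<^bsub>K\<^esub>"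
        using gen[OF M.M.a_closed[OF mm]] g by simp
      ultimately show ?thesis using gen mm by auto
    qed
  qed
qed

lemma indecomposable_simple_at:
  assumes "vertex e c"
  shows "indecomposable K A (simple_at e c)"
  unfolding simple_at_def
  by (rule indecomposable_cyclic[OF cyclic_projection_simple[OF assms] assms])
    (use vertex_facts[OF assms] coord_scal_vertex[OF assms] assms in \<open>auto simp: A.m_assoc vertex_def\<close>)

lemma indecomposable_vertex_module:
  assumes "vertex e c"
  shows "indecomposable K A (vertex_module e)"
  unfolding vertex_module_def
  by (rule indecomposable_cyclic[OF cyclic_projection_vertex[OF assms] assms])
    (use vertex_facts[OF assms] in \<open>auto simp: A.m_assoc\<close>)

text \<open>The module \<open>K[x]/(x\<^sup>2)\<close>, on which the arrow and the second vertex act as zero.\<close>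

definition loop_projection :: "(nat \<Rightarrow> 'k) \<Rightarrow> nat \<Rightarrow> 'k" where
  "loop_projection r = scal (c1 r) \<otimes> e1 \<oplus> scal (c3 r) \<otimes> x"

definition loop_module :: "('k, nat \<Rightarrow> 'k) fmod" where
  "loop_module = cyclic loop_projection"

lemma coord_loop:
  assumes "k \<in> carrier K" "l \<in> carrier K"
  shows "c1 (scal k \<otimes> e1 \<oplus> scal l \<otimes> x) = k" "c2 (scal k \<otimes> e1 \<oplus> scal l \<otimes> x) = \<zero>\<^bsub>K\<^esub>"
    "c3 (scal k \<otimes> e1 \<oplus> scal l \<otimes> x) = l" "c4 (scal k \<otimes> e1 \<oplus> scal l \<otimes> x) = \<zero>\<^bsub>K\<^esub>"
  using assms by (simp_all only: coord_add coord_scal coord_basis A.m_closed scal_closed basis_closed) simp_all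

lemma loop_projection_coord:
  assumes "r \<in> carrier A"
  shows "c1 (loop_projection r) = c1 r" "c2 (loop_projection r) = \<zero>\<^bsub>K\<^esub>"
    "c3 (loop_projection r) = c3 r" "c4 (loop_projection r) = \<zero>\<^bsub>K\<^esub>" "loop_projection r \<in> carrier A"
  using assms coord_loop by (simp_all add: loop_projection_def)

text \<open>The product rules of \<open>c1\<close> and \<open>c3\<close> involve only these two
  coordinates, so their common kernel is an ideal for either direction of the arrow.\<close>

lemma cyclic_projection_loop: "cyclic_projection loop_projection"
  unfolding cyclic_projection_def
proof (intro conjI ballI)
  fix r s assume rs: "r \<in> carrier A" "s \<in> carrier A"
  note c = loop_projection_coord
  show "loop_projection r \<in> carrier A" using c(5) rs by blast
  show "loop_projection (loop_projection r) = loop_projection r"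
    unfolding loop_projection_def[of "loop_projection r"] c[OF rs(1)] by (rule loop_projection_def[symmetric])
  show "loop_projection (r \<otimes> loop_projection s) = loop_projection (r \<otimes> s)"
    using rs c[OF rs(2)]
    by (simp add: loop_projection_def[of "r \<otimes> loop_projection s"] loop_projection_def[of "r \<otimes> s"] coord_mult)
  show "loop_projection (r \<oplus> s) = loop_projection r \<oplus> loop_projection s"
    using rs by (simp add: loop_projection_def coord_add scal_add A.l_distr A.a_ac)
qed

lemma loop_projection_one: "loop_projection \<one> = e1"
  by (simp add: loop_projection_def)

lemma loop_projection_right: "r \<in> carrier A \<Longrightarrow> loop_projection r \<otimes> e1 = loop_projection r"
  by (simp add: loop_projection_def A.l_distr A.m_assoc)

lemma indecomposable_loop_module: "indecomposable K A loop_module"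
  unfolding loop_module_def
  by (rule indecomposable_cyclic[OF cyclic_projection_loop vertices(1)])
    (use loop_projection_one loop_projection_right loop_projection_coord in auto)

lemma loop_module_facts:
  "left_module A loop_module" "fd_module K A loop_module"
  "carrier loop_module = {scal k \<otimes> e1 \<oplus> scal l \<otimes> x |k l. k \<in> carrier K \<and> l \<in> carrier K}"
  "\<zero>\<^bsub>loop_module\<^esub> = \<zero>" "\<And>u v. u \<oplus>\<^bsub>loop_module\<^esub> v = u \<oplus> v" "\<And>r v. r \<odot>\<^bsub>loop_module\<^esub> v = loop_projection (r \<otimes> v)"
proof -
  show "left_module A loop_module" "fd_module K A loop_module"
    using left_module_cyclic[OF cyclic_projection_loop] fd_module_cyclic[OF cyclic_projection_loop]
    by (simp_all add: loop_module_def)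
  have "scal k \<otimes> e1 \<oplus> scal l \<otimes> x \<in> loop_projection ` carrier A" if "k \<in> carrier K" "l \<in> carrier K" for k l
    using that coord_loop[OF that] by (intro image_eqI[of _ _ "scal k \<otimes> e1 \<oplus> scal l \<otimes> x"]) (simp_all add: loop_projection_def)
  then show "carrier loop_module = {scal k \<otimes> e1 \<oplus> scal l \<otimes> x |k l. k \<in> carrier K \<and> l \<in> carrier K}"
    by (auto simp: loop_module_def) (metis coord_closed(1,3) loop_projection_def)
qed (simp_all add: loop_module_def)

lemma loop_generator: "e1 \<in> carrier loop_module"
  using loop_projection_one by (auto simp: loop_module_def image_iff intro!: bexI[of _ \<one>])

subsection \<open>Recognising the indecomposable modules\<close>

text \<open>All of N is a sum of copies of the simple module, so a functional equal to one at n is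
  already a homomorphism and splits off the copy spanned by n.\<close>

lemma indecomposable_iso_simple_at:
  assumes N: "indecomposable K A N" and v: "vertex e c" and n: "n \<in> carrier N" "e \<odot>\<^bsub>N\<^esub> n = n" "n \<noteq> \<zero>\<^bsub>N\<^esub>"
    and J: "\<And>r m. r \<in> {x, a} \<Longrightarrow> m \<in> carrier N \<Longrightarrow> r \<odot>\<^bsub>N\<^esub> m = \<zero>\<^bsub>N\<^esub>"
    and E: "\<And>m. m \<in> carrier N \<Longrightarrow> e \<odot>\<^bsub>N\<^esub> m = m"
  shows "module_iso A N (simple_at e c)"
proof -
  have NL: "left_module A N" using N fd_left_module by (auto simp: indecomposable_def)
  interpret N: left_module A N by (rule NL)
  note e = vertex_facts[OF v] and Sa = simple_at_facts[OF v]
  interpret V: left_module K "vec N" by (rule left_module_vec[OF NL])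
  have act: "r \<odot>\<^bsub>N\<^esub> m = scal (c r) \<odot>\<^bsub>N\<^esub> m" if "r \<in> carrier A" "m \<in> carrier N" for r m
    by (rule simple_at_Hom[OF v NL that(2) E[OF that(2)] J[OF _ that(2)] that(1)])
  have "submodule {\<zero>\<^bsub>N\<^esub>} K (vec N)" by (rule V.submoduleI) auto
  then obtain \<chi> where \<chi>: "\<chi> \<in> module_Hom K (vec N) (regular K)" "\<chi> n = \<one>\<^bsub>K\<^esub>"
    using exists_linear_functional[OF K.field_axioms V.left_module_axioms, of "{\<zero>\<^bsub>N\<^esub>}" n] n by auto
  note \<chi>D = module_HomD[OF \<chi>(1), unfolded regular_simps restrict_scalars_simps(1,3) vec_smult]
  have f: "(\<lambda>m\<in>carrier N. scal (\<chi> m) \<otimes> e) \<in> module_Hom A N (simple_at e c)"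
  proof (rule module_HomI[OF NL])
    show "scal (\<chi> m) \<otimes> e \<in> carrier (simple_at e c)" if "m \<in> carrier N" for m
      using Sa(3) \<chi>D(1)[OF that] by blast
    show "scal (\<chi> (m \<oplus>\<^bsub>N\<^esub> m')) \<otimes> e = scal (\<chi> m) \<otimes> e \<oplus>\<^bsub>simple_at e c\<^esub> scal (\<chi> m') \<otimes> e"
      if "m \<in> carrier N" "m' \<in> carrier N" for m m'
      using that \<chi>D e(1) by (simp add: Sa scal_add A.l_distr)
    show "scal (\<chi> (r \<odot>\<^bsub>N\<^esub> m)) \<otimes> e = r \<odot>\<^bsub>simple_at e c\<^esub> (scal (\<chi> m) \<otimes> e)"
      if "r \<in> carrier A" "m \<in> carrier N" for r m
      using that act[OF that] \<chi>D e coord_scal_vertex[OF v] by (simp add: Sa(6))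
  qed
  have ker: "r \<odot>\<^bsub>N\<^esub> n = \<zero>\<^bsub>N\<^esub>" if r: "r \<in> carrier A" "scal (c r) \<otimes> e = \<zero>" for r
  proof -
    have "scal (c r) \<odot>\<^bsub>N\<^esub> n = (scal (c r) \<otimes> e) \<odot>\<^bsub>N\<^esub> n"
      using r(1) n e(1,3) by (simp add: N.smult_assoc1)
    then show ?thesis using act[OF r(1) n(1)] r(2) n by simp
  qed
  have one: "scal (c \<one>) \<otimes> e = e" using v by (auto simp: vertex_def)
  show ?thesis
    using indecomposable_iso_cyclic[OF cyclic_projection_simple[OF v] N n(1) ker] f n(1) \<chi>(2) e(1) Sa(8) one
    by (simp add: simple_at_def)
qed

lemma indecomposable_iso_loop_module:
  assumes N: "indecomposable K A N" and n: "n \<in> carrier N" "x \<odot>\<^bsub>N\<^esub> n \<noteq> \<zero>\<^bsub>N\<^esub>"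
    and a0: "\<And>m. m \<in> carrier N \<Longrightarrow> a \<odot>\<^bsub>N\<^esub> m = \<zero>\<^bsub>N\<^esub>"
  shows "module_iso A N loop_module"
proof -
  have NL: "left_module A N" using N fd_left_module by (auto simp: indecomposable_def)
  interpret N: left_module A N by (rule NL)
  interpret V: left_module K "vec N" by (rule left_module_vec[OF NL])
  note act = act_simps[OF NL] act_scal[OF NL]
  have "submodule {\<zero>\<^bsub>N\<^esub>} K (vec N)" by (rule V.submoduleI) auto
  then obtain \<nu> where \<nu>: "\<nu> \<in> module_Hom K (vec N) (regular K)" "\<nu> (x \<odot>\<^bsub>N\<^esub> n) = \<one>\<^bsub>K\<^esub>"
    using exists_linear_functional[OF K.field_axioms V.left_module_axioms, of "{\<zero>\<^bsub>N\<^esub>}" "x \<odot>\<^bsub>N\<^esub> n"] n by auto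
  note \<nu>D = module_HomD[OF \<nu>(1), unfolded regular_simps restrict_scalars_simps(1,3) vec_smult]
  have \<nu>0: "\<nu> \<zero>\<^bsub>N\<^esub> = \<zero>\<^bsub>K\<^esub>"
    using module_Hom_zero[OF V.left_module_axioms left_module_regular[OF K.ring_axioms] \<nu>(1)] by simp
  define f where "f m = scal (\<nu> (x \<odot>\<^bsub>N\<^esub> m)) \<otimes> e1 \<oplus> scal (\<nu> (e1 \<odot>\<^bsub>N\<^esub> m)) \<otimes> x" for m
  have lp: "loop_projection (scal k \<otimes> e1 \<oplus> scal l \<otimes> x) = scal k \<otimes> e1 \<oplus> scal l \<otimes> x"
    if "k \<in> carrier K" "l \<in> carrier K" for k l
    unfolding loop_projection_def coord_loop[OF that] ..
  have lp1: "loop_projection (e1 \<otimes> u) = u" "loop_projection (e2 \<otimes> u) = \<zero>"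
    "loop_projection (a \<otimes> u) = \<zero>" "loop_projection (x \<otimes> u) = scal (c1 u) \<otimes> x"
    "loop_projection (scal k \<otimes> u) = scal k \<otimes> u"
    if u: "u \<in> carrier loop_module" and k: "k \<in> carrier K" for u k
  proof -
    have uA: "u \<in> carrier A" and lu: "loop_projection u = u"
      using u lp by (auto simp: loop_module_facts(3))
    show "loop_projection (e1 \<otimes> u) = u" "loop_projection (e2 \<otimes> u) = \<zero>"
      "loop_projection (a \<otimes> u) = \<zero>" "loop_projection (x \<otimes> u) = scal (c1 u) \<otimes> x"
      using lu uA by (simp_all add: loop_projection_def coord_mult)
    have "loop_projection (scal k \<otimes> u) = scal k \<otimes> loop_projection u"
      using uA k by (simp add: loop_projection_def coord_scal scal_mult A.r_distr A.m_assoc)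
    then show "loop_projection (scal k \<otimes> u) = scal k \<otimes> u" using lu by simp
  qed
  have fc: "f m \<in> carrier loop_module" if "m \<in> carrier N" for m
    unfolding f_def loop_module_facts(3) by (intro CollectI exI conjI, rule refl) (simp_all add: \<nu>D(1) that)
  have fh: "restrict f (carrier N) \<in> module_Hom A N loop_module"
  proof (rule module_HomI_basis[OF NL loop_module_facts(1) fc])
    show "f (m \<oplus>\<^bsub>N\<^esub> m') = f m \<oplus>\<^bsub>loop_module\<^esub> f m'" if "m \<in> carrier N" "m' \<in> carrier N" for m m'
      using that \<nu>D by (simp add: f_def loop_module_facts(5) N.smult_r_distr scal_add A.l_distr A.a_ac)
    show "f (scal k \<odot>\<^bsub>N\<^esub> m) = scal k \<odot>\<^bsub>loop_module\<^esub> f m" if "k \<in> carrier K" "m \<in> carrier N" for k m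
      using that \<nu>D lp1(5)[OF fc] by (simp add: loop_module_facts(6))
        (simp add: f_def act scal_mult A.r_distr A.m_assoc)
    show "f (r \<odot>\<^bsub>N\<^esub> m) = r \<odot>\<^bsub>loop_module\<^esub> f m" if "r \<in> {e1, e2, x, a}" "m \<in> carrier N" for r m
      using that(1) that(2) lp1(1-4)[OF fc[OF that(2)] K.zero_closed] \<nu>D(1) \<nu>0 coord_loop
      by (auto simp: loop_module_facts(6)) (simp_all add: f_def act a0)
  qed simp_all
  define k where "k = \<nu> (e1 \<odot>\<^bsub>N\<^esub> n)"
  \<comment> \<open>As \<nu> (x n) = 1, subtracting a multiple of x n makes \<nu> vanish, so that
    \<open>f\<close> sends m exactly to the generator.\<close>
  define m where "m = e1 \<odot>\<^bsub>N\<^esub> n \<oplus>\<^bsub>N\<^esub> scal (\<ominus>\<^bsub>K\<^esub> k) \<odot>\<^bsub>N\<^esub> (x \<odot>\<^bsub>N\<^esub> n)"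
  have k: "k \<in> carrier K" using n \<nu>D(1) by (simp add: k_def)
  have m: "m \<in> carrier N" "x \<odot>\<^bsub>N\<^esub> m = x \<odot>\<^bsub>N\<^esub> n" "e1 \<odot>\<^bsub>N\<^esub> m = m" "e2 \<odot>\<^bsub>N\<^esub> m = \<zero>\<^bsub>N\<^esub>"
    using n k by (simp_all add: m_def N.smult_r_distr act)
  have "\<nu> m = \<zero>\<^bsub>K\<^esub>" using n k \<nu>D \<nu>(2) by (simp add: m_def K.r_neg flip: k_def)
  then have fm: "f m = loop_projection \<one>"
    using m \<nu>(2) by (simp add: f_def loop_projection_one)
  have "r \<odot>\<^bsub>N\<^esub> m = \<zero>\<^bsub>N\<^esub>" if r: "r \<in> carrier A" "loop_projection r = \<zero>" for r
  proof -
    have "c1 r = \<zero>\<^bsub>K\<^esub>" "c3 r = \<zero>\<^bsub>K\<^esub>" using loop_projection_coord(1,3)[OF r(1)] r(2) by simp_all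
    then show ?thesis using act_expansion[OF NL r(1) m(1)] m n(1) a0 r by simp
  qed
  then show ?thesis
    unfolding loop_module_def
    using indecomposable_iso_cyclic[OF cyclic_projection_loop N m(1)] fh fm m(1) loop_projection_one basis_nonzero(1)
    by (simp add: loop_module_def)
qed

end

section \<open>Left multiplication as a K-linear map\<close>

context fin_dim_algebra
begin

lemma left_mult_linear:
  assumes "left_module A M" "r \<in> carrier A"
  shows "(\<lambda>m\<in>carrier M. r \<odot>\<^bsub>M\<^esub> m) \<in> module_Hom K (vec M) (vec M)"
proof -
  interpret M: left_module A M by fact
  have "restrict (\<lambda>m. r \<odot>\<^bsub>M\<^esub> m) (carrier (vec M)) \<in> module_Hom K (vec M) (vec M)"
    by (rule module_HomI[OF left_module_vec[OF assms(1)]])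
      (use assms(2) scal_commute[OF _ assms(2)] in \<open>auto simp: M.smult_r_distr simp flip: M.smult_assoc1 scal_def\<close>)
  then show ?thesis by simp
qed

lemma left_mult_generalized_inverse:
  assumes "left_module A M" "r \<in> carrier A"
  obtains s where "s \<in> module_Hom K (vec M) (vec M)" "\<And>m. m \<in> carrier M \<Longrightarrow> r \<odot>\<^bsub>M\<^esub> s (r \<odot>\<^bsub>M\<^esub> m) = r \<odot>\<^bsub>M\<^esub> m"
proof -
  note V = left_module_vec[OF assms(1)]
  obtain s where s: "s \<in> module_Hom K (vec M) (vec M)"
    "\<And>v. v \<in> carrier (vec M) \<Longrightarrow> (\<lambda>m\<in>carrier M. r \<odot>\<^bsub>M\<^esub> m) (s ((\<lambda>m\<in>carrier M. r \<odot>\<^bsub>M\<^esub> m) v)) = (\<lambda>m\<in>carrier M. r \<odot>\<^bsub>M\<^esub> m) v"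
    using exists_linear_generalized_inverse[OF K.field_axioms V V left_mult_linear[OF assms]] by blast
  have c: "r \<odot>\<^bsub>M\<^esub> m \<in> carrier M" if "m \<in> carrier M" for m
    using left_module.smult_closed[OF assms(1,2) that] .
  have "r \<odot>\<^bsub>M\<^esub> s (r \<odot>\<^bsub>M\<^esub> m) = r \<odot>\<^bsub>M\<^esub> m" if "m \<in> carrier M" for m
    using s(2)[of m] that c[OF that] module_HomD(1)[OF s(1), of "r \<odot>\<^bsub>M\<^esub> m"] by simp
  with s(1) show thesis by (rule that)
qed

lemma vec_HomD:
  assumes "f \<in> module_Hom K (vec M) (vec N)" "left_module A M" "left_module A N"
  shows "\<And>m. m \<in> carrier M \<Longrightarrow> f m \<in> carrier N"
    "\<And>m n. m \<in> carrier M \<Longrightarrow> n \<in> carrier M \<Longrightarrow> f (m \<oplus>\<^bsub>M\<^esub> n) = f m \<oplus>\<^bsub>N\<^esub> f n"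
    "\<And>k m. k \<in> carrier K \<Longrightarrow> m \<in> carrier M \<Longrightarrow> f (scal k \<odot>\<^bsub>M\<^esub> m) = scal k \<odot>\<^bsub>N\<^esub> f m"
    "f \<zero>\<^bsub>M\<^esub> = \<zero>\<^bsub>N\<^esub>"
    "\<And>m n. m \<in> carrier M \<Longrightarrow> n \<in> carrier M \<Longrightarrow> f (m \<ominus>\<^bsub>M\<^esub> n) = f m \<ominus>\<^bsub>N\<^esub> f n"
proof -
  note h = module_HomD[OF assms(1), unfolded restrict_scalars_simps(1,3) vec_smult]
  interpret M: left_module A M by fact
  interpret N: left_module A N by fact
  show 1: "\<And>m. m \<in> carrier M \<Longrightarrow> f m \<in> carrier N"
    "\<And>m n. m \<in> carrier M \<Longrightarrow> n \<in> carrier M \<Longrightarrow> f (m \<oplus>\<^bsub>M\<^esub> n) = f m \<oplus>\<^bsub>N\<^esub> f n"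
    "\<And>k m. k \<in> carrier K \<Longrightarrow> m \<in> carrier M \<Longrightarrow> f (scal k \<odot>\<^bsub>M\<^esub> m) = scal k \<odot>\<^bsub>N\<^esub> f m"
    using h by auto
  show "f \<zero>\<^bsub>M\<^esub> = \<zero>\<^bsub>N\<^esub>"
    using module_Hom_zero[OF left_module_vec[OF assms(2)] left_module_vec[OF assms(3)] assms(1)] by simp
  show "f (m \<ominus>\<^bsub>M\<^esub> n) = f m \<ominus>\<^bsub>N\<^esub> f n" if "m \<in> carrier M" "n \<in> carrier M" for m n
  proof -
    have u: "\<ominus>\<^bsub>L\<^esub> u = scal (\<ominus>\<^bsub>K\<^esub> \<one>\<^bsub>K\<^esub>) \<odot>\<^bsub>L\<^esub> u" if "left_module A L" "u \<in> carrier L"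
      for L :: "(nat \<Rightarrow> 'k, 'x) module" and u
      using left_module.minus_eq_scalar[OF that] by (simp add: scal_uminus)
    have "f (\<ominus>\<^bsub>M\<^esub> n) = \<ominus>\<^bsub>N\<^esub> f n"
      using 1(3)[of "\<ominus>\<^bsub>K\<^esub> \<one>\<^bsub>K\<^esub>" n] left_module.minus_eq_scalar[OF assms(2) that(2)]
        left_module.minus_eq_scalar[OF assms(3) 1(1)[OF that(2)]] that(2)
      by (simp add: scal_uminus)
    then show ?thesis using 1(2) that by (simp add: a_minus_def)
  qed
qed

end

section \<open>Computations common to both directions of the arrow\<close>

context loop_arrow_algebra
begin

lemma indecomposable_left_module: "indecomposable K A N \<Longrightarrow> left_module A N"
  using fd_left_module by (auto simp: indecomposable_def)

lemma divide_by_scal: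
  assumes "left_module A M" "k \<in> carrier K" "k \<noteq> \<zero>\<^bsub>K\<^esub>" "m \<in> carrier M" "m' \<in> carrier M" "r \<in> carrier A"
    and "scal k \<odot>\<^bsub>M\<^esub> m = r \<odot>\<^bsub>M\<^esub> m'"
  shows "\<exists>m''\<in>carrier M. m = r \<odot>\<^bsub>M\<^esub> m''"
proof -
  interpret M: left_module A M by fact
  note i = act_inverse[OF assms(1-4)]
  have "m = r \<odot>\<^bsub>M\<^esub> (scal (inv\<^bsub>K\<^esub> k) \<odot>\<^bsub>M\<^esub> m')"
    using i assms act_scal[OF assms(1,5,6) i(2)] by simp
  then show ?thesis using i(2) assms(5) by blast
qed

lemma act_e2_zero:
  assumes "left_module A M" "m \<in> carrier M"
  shows "e2 \<odot>\<^bsub>M\<^esub> m = \<zero>\<^bsub>M\<^esub> \<Longrightarrow> e1 \<odot>\<^bsub>M\<^esub> m = m" "e1 \<odot>\<^bsub>M\<^esub> m = \<zero>\<^bsub>M\<^esub> \<Longrightarrow> e2 \<odot>\<^bsub>M\<^esub> m = m"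
proof -
  interpret M: left_module A M by fact
  show "e2 \<odot>\<^bsub>M\<^esub> m = \<zero>\<^bsub>M\<^esub> \<Longrightarrow> e1 \<odot>\<^bsub>M\<^esub> m = m" "e1 \<odot>\<^bsub>M\<^esub> m = \<zero>\<^bsub>M\<^esub> \<Longrightarrow> e2 \<odot>\<^bsub>M\<^esub> m = m"
    using act_one[OF assms] assms(2) by simp_all
qed

lemma x_left:
  assumes "r \<in> carrier A"
  shows "x \<otimes> r = scal (c1 r) \<otimes> x"
proof -
  have "x \<otimes> r = x \<otimes> (scal (c1 r) \<otimes> e1 \<oplus> scal (c2 r) \<otimes> e2 \<oplus> (scal (c3 r) \<otimes> x \<oplus> scal (c4 r) \<otimes> a))"
    using basis_expansion[OF assms] by simp
  also have "\<dots> = scal (c1 r) \<otimes> x" using assms by (simp add: A.r_distr vertex_times_scal)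
  finally show ?thesis .
qed

lemma scal_basis_eq_zero:
  assumes "k \<in> carrier K" "l \<in> carrier K"
  shows "scal k \<otimes> x \<oplus> scal l \<otimes> a = \<zero> \<Longrightarrow> k = \<zero>\<^bsub>K\<^esub> \<and> l = \<zero>\<^bsub>K\<^esub>" "scal k \<otimes> x = \<zero> \<Longrightarrow> k = \<zero>\<^bsub>K\<^esub>"
    "scal k \<otimes> a = \<zero> \<Longrightarrow> k = \<zero>\<^bsub>K\<^esub>"
proof -
  have "c3 (scal k \<otimes> x \<oplus> scal l \<otimes> a) = k" "c4 (scal k \<otimes> x \<oplus> scal l \<otimes> a) = l"
    "c3 (scal k \<otimes> x) = k" "c4 (scal k \<otimes> a) = k"
    using assms by (simp_all only: coord_add coord_scal coord_basis A.m_closed scal_closed basis_closed) simp_all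
  then show "scal k \<otimes> x \<oplus> scal l \<otimes> a = \<zero> \<Longrightarrow> k = \<zero>\<^bsub>K\<^esub> \<and> l = \<zero>\<^bsub>K\<^esub>"
    "scal k \<otimes> x = \<zero> \<Longrightarrow> k = \<zero>\<^bsub>K\<^esub>" "scal k \<otimes> a = \<zero> \<Longrightarrow> k = \<zero>\<^bsub>K\<^esub>"
    by auto
qed

lemma vertex_module_facts:
  assumes "vertex e c"
  shows "left_module A (vertex_module e)" "fd_module K A (vertex_module e)"
    "carrier (vertex_module e) = (\<lambda>r. r \<otimes> e) ` carrier A" "\<zero>\<^bsub>vertex_module e\<^esub> = \<zero>"
    "\<And>u v. u \<oplus>\<^bsub>vertex_module e\<^esub> v = u \<oplus> v" "\<And>r v. r \<odot>\<^bsub>vertex_module e\<^esub> v = r \<otimes> v \<otimes> e"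
  using projective_vertex_module[OF assms] projective_left_module projective_fd
  by (auto simp: vertex_module_def)

lemma loop_module_act:
  assumes v: "v \<in> carrier loop_module"
  shows "e1 \<odot>\<^bsub>loop_module\<^esub> v = v" "a \<odot>\<^bsub>loop_module\<^esub> v = \<zero>" "e2 \<odot>\<^bsub>loop_module\<^esub> v = \<zero>"
    "c1 (x \<odot>\<^bsub>loop_module\<^esub> v) = \<zero>\<^bsub>K\<^esub>" "v \<in> carrier A"
proof -
  note X = loop_module_facts
  obtain k l where kl: "k \<in> carrier K" "l \<in> carrier K" "v = scal k \<otimes> e1 \<oplus> scal l \<otimes> x"
    using v by (auto simp: X(3))
  then show vA: "v \<in> carrier A" by simp
  have lp: "loop_projection v = v" unfolding kl(3) loop_projection_def coord_loop[OF kl(1,2)] ..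
  have "e1 \<otimes> v = v" using kl by (simp add: A.r_distr vertex_times_scal)
  then show "e1 \<odot>\<^bsub>loop_module\<^esub> v = v" using lp by (simp add: X)
  show "a \<odot>\<^bsub>loop_module\<^esub> v = \<zero>" "e2 \<odot>\<^bsub>loop_module\<^esub> v = \<zero>"
    using vA by (simp_all add: X loop_projection_def coord_mult)
  show "c1 (x \<odot>\<^bsub>loop_module\<^esub> v) = \<zero>\<^bsub>K\<^esub>"
    using vA loop_projection_coord(1)[of "x \<otimes> v"] by (simp add: X coord_mult)
qed

end

section \<open>The algebra with the arrow leaving the loop\<close>

locale arrow_out_algebra = loop_arrow_algebra K A e1 e2 x a c1 c2 c3 c4
  for K :: "'k ring" and A :: "('k, nat \<Rightarrow> 'k) module" (structure)
    and e1 e2 x a :: "nat \<Rightarrow> 'k" and c1 c2 c3 c4 :: "(nat \<Rightarrow> 'k) \<Rightarrow> 'k" +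
  assumes arrow_out [simp]: "a \<otimes> e1 = a" "e2 \<otimes> a = a"
begin

lemma arrow_out_zero [simp]: "e1 \<otimes> a = \<zero>" "a \<otimes> e2 = \<zero>"
proof -
  show "e1 \<otimes> a = \<zero>" using arrow_ends basis_nonzero(4) by auto
  have "a \<otimes> e2 = (a \<otimes> e1) \<otimes> e2" by simp
  also have "\<dots> = \<zero>" by (simp only: A.m_assoc basis_closed table A.r_null)
  finally show "a \<otimes> e2 = \<zero>" .
qed

lemma a_left:
  assumes "r \<in> carrier A"
  shows "a \<otimes> r = scal (c1 r) \<otimes> a"
proof -
  have "a \<otimes> r = a \<otimes> (scal (c1 r) \<otimes> e1 \<oplus> scal (c2 r) \<otimes> e2 \<oplus> (scal (c3 r) \<otimes> x \<oplus> scal (c4 r) \<otimes> a))"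
    using basis_expansion[OF assms] by simp
  also have "\<dots> = scal (c1 r) \<otimes> a" using assms by (simp add: A.r_distr vertex_times_scal)
  finally show ?thesis .
qed

lemma act_arrow:
  assumes "left_module A M" "m \<in> carrier M"
  shows "e1 \<odot>\<^bsub>M\<^esub> (a \<odot>\<^bsub>M\<^esub> m) = \<zero>\<^bsub>M\<^esub>" "e2 \<odot>\<^bsub>M\<^esub> (a \<odot>\<^bsub>M\<^esub> m) = a \<odot>\<^bsub>M\<^esub> m"
    "a \<odot>\<^bsub>M\<^esub> (e1 \<odot>\<^bsub>M\<^esub> m) = a \<odot>\<^bsub>M\<^esub> m" "a \<odot>\<^bsub>M\<^esub> (e2 \<odot>\<^bsub>M\<^esub> m) = \<zero>\<^bsub>M\<^esub>"
proof -
  interpret M: left_module A M by fact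
  show "e1 \<odot>\<^bsub>M\<^esub> (a \<odot>\<^bsub>M\<^esub> m) = \<zero>\<^bsub>M\<^esub>" "e2 \<odot>\<^bsub>M\<^esub> (a \<odot>\<^bsub>M\<^esub> m) = a \<odot>\<^bsub>M\<^esub> m"
    "a \<odot>\<^bsub>M\<^esub> (e1 \<odot>\<^bsub>M\<^esub> m) = a \<odot>\<^bsub>M\<^esub> m" "a \<odot>\<^bsub>M\<^esub> (e2 \<odot>\<^bsub>M\<^esub> m) = \<zero>\<^bsub>M\<^esub>"
    using assms(2) by (simp_all flip: M.smult_assoc1)
qed

text \<open>Freeness of the first vertex space over \<open>K[x]/(x\<^sup>2)\<close>, surjectivity of the arrow,
  and \<open>ker a \<subseteq> im x\<close> on the first vertex space.\<close>

abbreviation loop_free :: "('k, nat \<Rightarrow> 'k) fmod \<Rightarrow> bool" where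
  "loop_free M \<equiv> divisible_on M {e2, x} x"

abbreviation arrow_onto :: "('k, nat \<Rightarrow> 'k) fmod \<Rightarrow> bool" where
  "arrow_onto M \<equiv> divisible_on M {e1} a"

abbreviation arrow_tight :: "('k, nat \<Rightarrow> 'k) fmod \<Rightarrow> bool" where
  "arrow_tight M \<equiv> divisible_on M {e2, a} x"

text \<open>Both x r and a r detect \<open>c1 r\<close>, while e2 r detects \<open>c2 r\<close> and
  \<open>c4 r\<close>. Under either set of conditions only the \<open>x\<close>-coordinate of r
  survives, and that part is a multiple of \<open>x\<close>.\<close>

lemma regular_divisible: "loop_free (regular A)" "arrow_tight (regular A)"
proof -
  have e2: "c2 r = \<zero>\<^bsub>K\<^esub>" "c4 r = \<zero>\<^bsub>K\<^esub>" if r: "r \<in> carrier A" "e2 \<otimes> r = \<zero>" for r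
  proof -
    have "c2 (e2 \<otimes> r) = c2 r" using r(1) by (simp add: coord_mult)
    then show c: "c2 r = \<zero>\<^bsub>K\<^esub>" using r by simp
    have "e2 \<otimes> r = scal (c4 r) \<otimes> a" unfolding vertex_left[OF vertices(2) r(1)] using r(1) c by simp
    then have "scal (c4 r) \<otimes> a = \<zero>" using r(2) by metis
    then show "c4 r = \<zero>\<^bsub>K\<^esub>" by (rule scal_basis_eq_zero(3)[OF coord_closed(4)[OF r(1)] K.zero_closed])
  qed
  have div: "\<exists>r'\<in>carrier A. r = x \<otimes> r'" if r: "r \<in> carrier A" "e2 \<otimes> r = \<zero>" "c1 r = \<zero>\<^bsub>K\<^esub>" for r
  proof -
    have "r = scal (c3 r) \<otimes> x"
      by (subst basis_expansion[OF r(1)]) (use r e2[OF r(1,2)] in simp)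
    also have "\<dots> = x \<otimes> scal (c3 r)" using r(1) scal_commute by simp
    finally have "r = x \<otimes> scal (c3 r)" .
    then show ?thesis by (rule bexI[of "\<lambda>r'. r = x \<otimes> r'"]) (simp add: r(1))
  qed
  have cx: "c1 r = \<zero>\<^bsub>K\<^esub>" if "r \<in> carrier A" "x \<otimes> r = \<zero>" for r
    using scal_basis_eq_zero(2)[OF coord_closed(1)[OF that(1)] K.zero_closed] x_left[OF that(1)] that(2) by metis
  have ca: "c1 r = \<zero>\<^bsub>K\<^esub>" if "r \<in> carrier A" "a \<otimes> r = \<zero>" for r
    using scal_basis_eq_zero(3)[OF coord_closed(1)[OF that(1)] K.zero_closed] a_left[OF that(1)] that(2) by metis
  show "loop_free (regular A)" unfolding divisible_on_def by (auto intro!: div cx)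
  show "arrow_tight (regular A)" unfolding divisible_on_def by (auto intro!: div ca)
qed

lemma projective_divisible:
  assumes "projective K A P"
  shows "loop_free P" "arrow_tight P"
  using projective_divisible_on[OF assms regular_divisible(1)] projective_divisible_on[OF assms regular_divisible(2)]
  by auto

text \<open>\<open>tau_rigid_divisible\<close> is used with j = s = x and with t itself as target.
  Since x t = 0 and e1 a = 0, the radical terms vanish, and a nonzero multiple of t is divisible by
  \<open>x\<close>.\<close>

lemma tau_rigid_loop_free:
  assumes "tau_rigid K A T" "fd_module K A T"
  shows "loop_free T"
  unfolding divisible_on_def
proof (intro ballI impI, rule ccontr)
  note TL = fd_left_module[OF assms(2)]
  interpret T: left_module A T by (rule TL)
  fix t assume t: "t \<in> carrier T" and "\<forall>r\<in>{e2, x}. r \<odot>\<^bsub>T\<^esub> t = \<zero>\<^bsub>T\<^esub>"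
    and no: "\<not> (\<exists>t'\<in>carrier T. t = x \<odot>\<^bsub>T\<^esub> t')"
  then have z: "e2 \<odot>\<^bsub>T\<^esub> t = \<zero>\<^bsub>T\<^esub>" "x \<odot>\<^bsub>T\<^esub> t = \<zero>\<^bsub>T\<^esub>" by auto
  note e1t = act_e2_zero(1)[OF TL t z(1)]
  have "\<exists>t'\<in>carrier T. \<exists>k\<in>carrier K. \<exists>k3\<in>carrier K. \<exists>k4\<in>carrier K. k \<noteq> \<zero>\<^bsub>K\<^esub> \<and>
    scal k \<odot>\<^bsub>T\<^esub> t \<oplus>\<^bsub>T\<^esub> (scal k3 \<odot>\<^bsub>T\<^esub> (e1 \<odot>\<^bsub>T\<^esub> (x \<odot>\<^bsub>T\<^esub> t)) \<oplus>\<^bsub>T\<^esub> scal k4 \<odot>\<^bsub>T\<^esub> (e1 \<odot>\<^bsub>T\<^esub> (a \<odot>\<^bsub>T\<^esub> t))) = x \<odot>\<^bsub>T\<^esub> t'"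
  proof (rule tau_rigid_divisible[OF assms vertices(1) _ _ t z(2) _ regular_divisible(1)])
    show "\<forall>r\<in>{e2, x}. r \<odot>\<^bsub>P\<^esub> (e1 \<odot>\<^bsub>P\<^esub> y) = \<zero>\<^bsub>P\<^esub>"
      if "left_module A P" "y \<in> carrier P" "x \<odot>\<^bsub>P\<^esub> y = \<zero>\<^bsub>P\<^esub>" for P :: "('k, nat \<Rightarrow> 'k) fmod" and y
      using act_simps[OF that(1,2)] that(3) by simp
  qed (use t no e1t in auto)
  then obtain t' k where k: "t' \<in> carrier T" "k \<in> carrier K" "k \<noteq> \<zero>\<^bsub>K\<^esub>" "scal k \<odot>\<^bsub>T\<^esub> t = x \<odot>\<^bsub>T\<^esub> t'"
    using z t act_arrow[OF TL t] by auto
  then show False using divide_by_scal[OF TL k(2,3) t k(1) _ k(4)] no by simp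
qed

text \<open>A witness t against tightness serves for every w at the second vertex: with j = a, s = x
  and d = e1 the radical terms vanish on w, so w is divisible by \<open>a\<close>.\<close>

lemma tau_rigid_onto_or_tight:
  assumes "tau_rigid K A T" "fd_module K A T"
  shows "arrow_onto T \<or> arrow_tight T"
proof (rule disjCI)
  assume "\<not> arrow_tight T"
  note TL = fd_left_module[OF assms(2)]
  interpret T: left_module A T by (rule TL)
  obtain t where t: "t \<in> carrier T" "e2 \<odot>\<^bsub>T\<^esub> t = \<zero>\<^bsub>T\<^esub>" "a \<odot>\<^bsub>T\<^esub> t = \<zero>\<^bsub>T\<^esub>"
    "\<And>t'. t' \<in> carrier T \<Longrightarrow> t \<noteq> x \<odot>\<^bsub>T\<^esub> t'"
    using \<open>\<not> arrow_tight T\<close> by (auto simp: divisible_on_def)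
  note e1t = act_e2_zero(1)[OF TL t(1,2)]
  show "arrow_onto T"
    unfolding divisible_on_def
  proof (intro ballI impI)
    fix w assume w: "w \<in> carrier T" "\<forall>r\<in>{e1}. r \<odot>\<^bsub>T\<^esub> w = \<zero>\<^bsub>T\<^esub>"
    then have e2w: "e2 \<odot>\<^bsub>T\<^esub> w = w" using act_e2_zero(2)[OF TL w(1)] by simp
    have "\<exists>t'\<in>carrier T. \<exists>k\<in>carrier K. \<exists>k3\<in>carrier K. \<exists>k4\<in>carrier K. k \<noteq> \<zero>\<^bsub>K\<^esub> \<and>
      scal k \<odot>\<^bsub>T\<^esub> w \<oplus>\<^bsub>T\<^esub> (scal k3 \<odot>\<^bsub>T\<^esub> (e2 \<odot>\<^bsub>T\<^esub> (x \<odot>\<^bsub>T\<^esub> w)) \<oplus>\<^bsub>T\<^esub> scal k4 \<odot>\<^bsub>T\<^esub> (e2 \<odot>\<^bsub>T\<^esub> (a \<odot>\<^bsub>T\<^esub> w))) = a \<odot>\<^bsub>T\<^esub> t'"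
    proof (rule tau_rigid_divisible[OF assms vertices(2) _ _ t(1,3,4) regular_divisible(2)])
      show "\<forall>r\<in>{e2, a}. r \<odot>\<^bsub>P\<^esub> (e1 \<odot>\<^bsub>P\<^esub> y) = \<zero>\<^bsub>P\<^esub>"
        if "left_module A P" "y \<in> carrier P" "a \<odot>\<^bsub>P\<^esub> y = \<zero>\<^bsub>P\<^esub>" for P :: "('k, nat \<Rightarrow> 'k) fmod" and y
        using act_simps[OF that(1,2)] act_arrow[OF that(1,2)] that(3) by simp
    qed (use e1t e2w w in auto)
    moreover have "e2 \<odot>\<^bsub>T\<^esub> (x \<odot>\<^bsub>T\<^esub> w) = \<zero>\<^bsub>T\<^esub>" "e2 \<odot>\<^bsub>T\<^esub> (a \<odot>\<^bsub>T\<^esub> w) = \<zero>\<^bsub>T\<^esub>"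
      using act_simps[OF TL w(1)] act_arrow[OF TL w(1)] e2w by simp_all
    ultimately obtain t' k where k: "t' \<in> carrier T" "k \<in> carrier K" "k \<noteq> \<zero>\<^bsub>K\<^esub>" "scal k \<odot>\<^bsub>T\<^esub> w = a \<odot>\<^bsub>T\<^esub> t'"
      using w by auto
    then show "\<exists>m'\<in>carrier T. w = a \<odot>\<^bsub>T\<^esub> m'" using divide_by_scal[OF TL k(2,3) w(1) k(1) _ k(4)] by simp
  qed
qed

text \<open>For u = x w + a w' in the kernel, e1 u = x w. The image of e1 w is killed by
  \<open>x\<close>, hence lies in x T, so e1 w can be changed by an element of x P to lie in the
  kernel. The kernel is radical, so \<open>x\<close> kills the changed element, and x w = 0.\<close>

lemma kernel_at_sink:
  assumes P: "projective K A P" and T: "left_module A T" "loop_free T"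
    and p: "p \<in> module_Hom A P T" "p ` carrier P = carrier T" "a_kernel P T p \<subseteq> rad P"
    and u: "u \<in> a_kernel P T p"
  shows "e1 \<odot>\<^bsub>P\<^esub> u = \<zero>\<^bsub>P\<^esub>"
proof -
  note PL = projective_left_module[OF P]
  interpret P: left_module A P by (rule PL)
  interpret T: left_module A T by (rule T(1))
  note pD = module_HomD[OF p(1)] and act = act_simps[OF PL] act_arrow[OF PL] and tact = act_simps[OF T(1)]
  obtain w w' where w: "w \<in> carrier P" "w' \<in> carrier P" "u = x \<odot>\<^bsub>P\<^esub> w \<oplus>\<^bsub>P\<^esub> a \<odot>\<^bsub>P\<^esub> w'"
    using u p(3) by (auto simp: rad_def subset_iff)
  have e1u: "e1 \<odot>\<^bsub>P\<^esub> u = x \<odot>\<^bsub>P\<^esub> w" using w by (simp add: P.smult_r_distr act)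
  define v where "v = e1 \<odot>\<^bsub>P\<^esub> w"
  have v: "v \<in> carrier P" "x \<odot>\<^bsub>P\<^esub> v = x \<odot>\<^bsub>P\<^esub> w" "e2 \<odot>\<^bsub>P\<^esub> v = \<zero>\<^bsub>P\<^esub>" using w by (simp_all add: v_def act)
  have "p (e1 \<odot>\<^bsub>P\<^esub> u) = \<zero>\<^bsub>T\<^esub>" using u pD by (simp add: in_a_kernel_iff)
  then have "x \<odot>\<^bsub>T\<^esub> p v = \<zero>\<^bsub>T\<^esub>" using e1u v pD by (simp flip: pD(3))
  moreover have "e2 \<odot>\<^bsub>T\<^esub> p v = \<zero>\<^bsub>T\<^esub>"
    using pD(3)[OF basis_closed(2) v(1)] v(3) module_Hom_zero[OF PL T(1) p(1)] by simp
  ultimately obtain t where t: "t \<in> carrier T" "p v = x \<odot>\<^bsub>T\<^esub> t"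
    using T(2) pD(1)[OF v(1)] unfolding divisible_on_def by auto
  obtain y where y: "y \<in> carrier P" "p y = t" using p(2) t(1) by (metis imageE)
  have "v \<ominus>\<^bsub>P\<^esub> x \<odot>\<^bsub>P\<^esub> y \<in> a_kernel P T p"
    using v y t pD module_Hom_diff[OF PL T(1) p(1)] by (simp add: in_a_kernel_iff T.diff_eq_zero_iff)
  then have "x \<odot>\<^bsub>P\<^esub> (v \<ominus>\<^bsub>P\<^esub> x \<odot>\<^bsub>P\<^esub> y) = \<zero>\<^bsub>P\<^esub>" using p(3) radD(2)[OF PL] by blast
  then have "x \<odot>\<^bsub>P\<^esub> v = \<zero>\<^bsub>P\<^esub>" using v y w(1) by (simp add: P.scalar_diff act P.diff_eq_zero_iff)
  then show ?thesis using e1u v(2) by simp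
qed

lemma tau_rigid_if_onto:
  assumes T: "fd_module K A T" "loop_free T" "arrow_onto T"
  shows "tau_rigid K A T"
proof -
  note TL = fd_left_module[OF T(1)]
  interpret T: left_module A T by (rule TL)
  obtain Q P f p where Q: "projective K A Q" and P: "projective K A P"
    and p: "p \<in> module_Hom A P T" "p ` carrier P = carrier T" and f: "f \<in> module_Hom A Q P"
    and fp: "f ` carrier Q = a_kernel P T p" and pJ: "a_kernel P T p \<subseteq> rad P"
    and fJ: "\<And>q. q \<in> carrier Q \<Longrightarrow> f q = \<zero>\<^bsub>P\<^esub> \<Longrightarrow> q \<in> rad Q"
    and crit: "tau_rigid K A T \<longleftrightarrow> (\<forall>h\<in>module_Hom A Q T. \<exists>g\<in>module_Hom A P T. \<forall>q\<in>carrier Q. h q = g (f q))"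
    by (rule tau_rigid_presentation[OF T(1)]) blast
  note QL = projective_left_module[OF Q] and PL = projective_left_module[OF P]
  interpret P: left_module A P by (rule PL)
  interpret Q: left_module A Q by (rule QL)
  note fD = module_HomD[OF f]
  note actP = act_simps[OF PL] act_arrow[OF PL] and actQ = act_simps[OF QL] act_arrow[OF QL]
    and actT = act_simps[OF TL] act_arrow[OF TL]
  have e1f: "e1 \<odot>\<^bsub>P\<^esub> f q = \<zero>\<^bsub>P\<^esub>" if "q \<in> carrier Q" for q
    using kernel_at_sink[OF P TL T(2) p pJ] fp that by blast
  \<comment> \<open>f kills e1 Q, so minimality puts e1 Q into \<open>rad Q\<close>, which
    \<open>x\<close> and \<open>a\<close> annihilate. Hence \<open>rad Q\<close> is zero and
    \<open>f\<close> is injective.\<close>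
  have "x \<odot>\<^bsub>Q\<^esub> q = \<zero>\<^bsub>Q\<^esub> \<and> a \<odot>\<^bsub>Q\<^esub> q = \<zero>\<^bsub>Q\<^esub>" if q: "q \<in> carrier Q" for q
  proof -
    have "f (e1 \<odot>\<^bsub>Q\<^esub> q) = \<zero>\<^bsub>P\<^esub>" using fD(3) q e1f by simp
    then have "e1 \<odot>\<^bsub>Q\<^esub> q \<in> rad Q" using fJ q by simp
    then show ?thesis using radD[OF QL] q by (metis actQ(6,15))
  qed
  then have "rad Q \<subseteq> {\<zero>\<^bsub>Q\<^esub>}" by (auto simp: rad_def)
  then have radQ: "rad Q = {\<zero>\<^bsub>Q\<^esub>}" using Q.submoduleD(2)[OF submodule_rad[OF QL]] by blast
  have e2q: "e2 \<odot>\<^bsub>Q\<^esub> q = q" and inj: "f q = \<zero>\<^bsub>P\<^esub> \<Longrightarrow> q = \<zero>\<^bsub>Q\<^esub>" if q: "q \<in> carrier Q" for q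
  proof -
    have "f (e1 \<odot>\<^bsub>Q\<^esub> q) = \<zero>\<^bsub>P\<^esub>" using fD(3) q e1f by simp
    then have "e1 \<odot>\<^bsub>Q\<^esub> q = \<zero>\<^bsub>Q\<^esub>" using fJ[of "e1 \<odot>\<^bsub>Q\<^esub> q"] q radQ by simp
    then show "e2 \<odot>\<^bsub>Q\<^esub> q = q" using act_e2_zero(2)[OF QL q] by simp
    show "f q = \<zero>\<^bsub>P\<^esub> \<Longrightarrow> q = \<zero>\<^bsub>Q\<^esub>" using fJ[OF q] radQ by simp
  qed
  note VQ = left_module_vec[OF QL] and VP = left_module_vec[OF PL] and VT = left_module_vec[OF TL]
  have "\<exists>g\<in>module_Hom A P T. \<forall>q\<in>carrier Q. h q = g (f q)" if h: "h \<in> module_Hom A Q T" for h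
  proof -
    note hD = module_HomD[OF h]
    have "h q = \<zero>\<^bsub>T\<^esub>" if "q \<in> carrier Q" "f q = \<zero>\<^bsub>P\<^esub>" for q
      using inj[OF that] module_Hom_zero[OF QL TL h] by simp
    then obtain g1 where g1: "g1 \<in> module_Hom K (vec P) (vec T)" and g1f: "\<And>q. q \<in> carrier Q \<Longrightarrow> g1 (f q) = h q"
      and g1h: "\<And>v. v \<in> carrier P \<Longrightarrow> g1 v \<in> h ` carrier Q"
      using exists_linear_factorization[OF K.field_axioms VQ VP VT module_Hom_vec[OF f] module_Hom_vec[OF h],
          unfolded restrict_scalars_simps] by metis
    note G1 = vec_HomD[OF g1 PL TL]
    have e2g1: "e2 \<odot>\<^bsub>T\<^esub> g1 v = g1 v" if v: "v \<in> carrier P" for v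
    proof -
      obtain q where "q \<in> carrier Q" "g1 v = h q" using g1h[OF v] by blast
      then show ?thesis using hD(3)[OF basis_closed(2)] e2q by simp
    qed
    have k1: "e1 \<odot>\<^bsub>T\<^esub> g1 v = \<zero>\<^bsub>T\<^esub>" "x \<odot>\<^bsub>T\<^esub> g1 v = \<zero>\<^bsub>T\<^esub>" "a \<odot>\<^bsub>T\<^esub> g1 v = \<zero>\<^bsub>T\<^esub>" if v: "v \<in> carrier P" for v
      using actT(3,8,16)[OF G1(1)[OF v]] e2g1[OF v] by simp_all
    obtain s where s: "s \<in> module_Hom K (vec T) (vec T)"
      "\<And>m. m \<in> carrier T \<Longrightarrow> a \<odot>\<^bsub>T\<^esub> s (a \<odot>\<^bsub>T\<^esub> m) = a \<odot>\<^bsub>T\<^esub> m"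
      using left_mult_generalized_inverse[OF TL basis_closed(4)] by metis
    obtain l where l: "l \<in> module_Hom K (vec P) (vec P)"
      "\<And>m. m \<in> carrier P \<Longrightarrow> x \<odot>\<^bsub>P\<^esub> l (x \<odot>\<^bsub>P\<^esub> m) = x \<odot>\<^bsub>P\<^esub> m"
      using left_mult_generalized_inverse[OF PL basis_closed(3)] by metis
    note S = vec_HomD[OF s(1) TL TL] and Lm = vec_HomD[OF l(1) PL PL]
    define G where "G y = e1 \<odot>\<^bsub>T\<^esub> s (g1 (a \<odot>\<^bsub>P\<^esub> y))" for y
    have G: "\<And>y. y \<in> carrier P \<Longrightarrow> G y \<in> carrier T"
      "\<And>y y'. y \<in> carrier P \<Longrightarrow> y' \<in> carrier P \<Longrightarrow> G (y \<oplus>\<^bsub>P\<^esub> y') = G y \<oplus>\<^bsub>T\<^esub> G y'"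
      "\<And>k y. k \<in> carrier K \<Longrightarrow> y \<in> carrier P \<Longrightarrow> G (scal k \<odot>\<^bsub>P\<^esub> y) = scal k \<odot>\<^bsub>T\<^esub> G y"
      "G \<zero>\<^bsub>P\<^esub> = \<zero>\<^bsub>T\<^esub>"
      using G1 S by (simp_all add: G_def P.smult_r_distr T.smult_r_distr act_scal[OF PL] act_scal[OF TL])
    have aG: "a \<odot>\<^bsub>T\<^esub> G y = g1 (a \<odot>\<^bsub>P\<^esub> y)" if y: "y \<in> carrier P" for y
    proof -
      define w where "w = g1 (a \<odot>\<^bsub>P\<^esub> y)"
      have w: "w \<in> carrier T" "e1 \<odot>\<^bsub>T\<^esub> w = \<zero>\<^bsub>T\<^esub>" using G1(1) k1(1) y by (simp_all add: w_def)
      then obtain m where "m \<in> carrier T" "w = a \<odot>\<^bsub>T\<^esub> m" using T(3) by (auto simp: divisible_on_def)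
      then have "a \<odot>\<^bsub>T\<^esub> s w = w" using s(2) by simp
      then show ?thesis using S(1)[OF w(1)] by (simp add: G_def actT flip: w_def)
    qed
    have e1G: "e1 \<odot>\<^bsub>T\<^esub> G y = G y" "e2 \<odot>\<^bsub>T\<^esub> G y = \<zero>\<^bsub>T\<^esub>" if y: "y \<in> carrier P" for y
      using S(1)[OF G1(1)] y by (simp_all add: G_def actT)
    \<comment> \<open>The part of e1 y in x P: e1 l (x y) is the component of e1 y in a complement
      of x P inside e1 P, since l is a generalized inverse of \<open>x\<close>.\<close>
    define D where "D y = e1 \<odot>\<^bsub>P\<^esub> y \<ominus>\<^bsub>P\<^esub> e1 \<odot>\<^bsub>P\<^esub> l (x \<odot>\<^bsub>P\<^esub> y)" for y
    have D: "\<And>y. y \<in> carrier P \<Longrightarrow> D y \<in> carrier P"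
      "\<And>y y'. y \<in> carrier P \<Longrightarrow> y' \<in> carrier P \<Longrightarrow> D (y \<oplus>\<^bsub>P\<^esub> y') = D y \<oplus>\<^bsub>P\<^esub> D y'"
      "\<And>k y. k \<in> carrier K \<Longrightarrow> y \<in> carrier P \<Longrightarrow> D (scal k \<odot>\<^bsub>P\<^esub> y) = scal k \<odot>\<^bsub>P\<^esub> D y"
      using Lm by (simp_all add: D_def P.smult_r_distr act_scal[OF PL] P.scalar_diff a_minus_def P.M.minus_add P.M.a_ac
          P.scalar_minus_right)
    have Dx: "\<exists>b\<in>carrier P. D y = x \<odot>\<^bsub>P\<^esub> b" if y: "y \<in> carrier P" for y
    proof -
      have "e2 \<odot>\<^bsub>P\<^esub> D y = \<zero>\<^bsub>P\<^esub>" "x \<odot>\<^bsub>P\<^esub> D y = \<zero>\<^bsub>P\<^esub>"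
        using y Lm(1) l(2)[OF y] by (simp_all add: D_def P.scalar_diff actP P.diff_eq_zero_iff)
      then show ?thesis using projective_divisible(1)[OF P] D(1)[OF y] unfolding divisible_on_def by auto
    qed
    have g1D: "g1 (a \<odot>\<^bsub>P\<^esub> y) = g1 (a \<odot>\<^bsub>P\<^esub> l (x \<odot>\<^bsub>P\<^esub> y))" if y: "y \<in> carrier P" for y
    proof -
      have "a \<odot>\<^bsub>P\<^esub> D y = \<zero>\<^bsub>P\<^esub>" using Dx[OF y] actP(11) by auto
      then have "a \<odot>\<^bsub>P\<^esub> y = a \<odot>\<^bsub>P\<^esub> l (x \<odot>\<^bsub>P\<^esub> y)"
        using y Lm(1) by (simp add: D_def P.scalar_diff actP P.diff_eq_zero_iff)
      then show ?thesis by simp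
    qed
    \<comment> \<open>On e1 P, write e1 y as b + x b' up to x P-invisible choices, with b from l (x
      y) and b' from l (D y); the value is G b + x G b'. On e2 P the linear extension
      \<open>g1\<close> is kept.\<close>
    define g where "g y = G (l (x \<odot>\<^bsub>P\<^esub> y)) \<oplus>\<^bsub>T\<^esub> (x \<odot>\<^bsub>T\<^esub> G (l (D y)) \<oplus>\<^bsub>T\<^esub> g1 (e2 \<odot>\<^bsub>P\<^esub> y))" for y
    have z: "D \<zero>\<^bsub>P\<^esub> = \<zero>\<^bsub>P\<^esub>" "D (e1 \<odot>\<^bsub>P\<^esub> y) = D y" "D (e2 \<odot>\<^bsub>P\<^esub> y) = \<zero>\<^bsub>P\<^esub>" "D (x \<odot>\<^bsub>P\<^esub> y) = x \<odot>\<^bsub>P\<^esub> y" "D (a \<odot>\<^bsub>P\<^esub> y) = \<zero>\<^bsub>P\<^esub>"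
      if y: "y \<in> carrier P" for y
      using y Lm(1,4) by (simp_all add: D_def actP a_minus_def)
    have "restrict g (carrier P) \<in> module_Hom A P T"
    proof (rule module_HomI_basis[OF PL TL])
      show "g y \<in> carrier T" if "y \<in> carrier P" for y using that G D Lm G1 by (simp add: g_def)
      show "g (y \<oplus>\<^bsub>P\<^esub> y') = g y \<oplus>\<^bsub>T\<^esub> g y'" if "y \<in> carrier P" "y' \<in> carrier P" for y y'
        using that G D Lm G1 by (simp add: g_def P.smult_r_distr T.smult_r_distr T.M.a_ac)
      show "g (scal k \<odot>\<^bsub>P\<^esub> y) = scal k \<odot>\<^bsub>T\<^esub> g y" if "k \<in> carrier K" "y \<in> carrier P" for k y
        using that G D Lm G1 by (simp add: g_def T.smult_r_distr act_scal[OF PL] act_scal[OF TL])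
      show "g (r \<odot>\<^bsub>P\<^esub> y) = r \<odot>\<^bsub>T\<^esub> g y" if r: "r \<in> {e1, e2, x, a}" and y: "y \<in> carrier P" for r y
      proof -
        have c: "l (x \<odot>\<^bsub>P\<^esub> y) \<in> carrier P" "l (D y) \<in> carrier P" "e2 \<odot>\<^bsub>P\<^esub> y \<in> carrier P"
          using y D Lm by simp_all
        note c' = G(1)[OF c(1)] G(1)[OF c(2)] G1(1)[OF c(3)]
        have "g (e1 \<odot>\<^bsub>P\<^esub> y) = e1 \<odot>\<^bsub>T\<^esub> g y"
          using y c c' e1G k1[OF c(3)] by (simp add: g_def z actP actT G1(4) T.smult_r_distr)
        moreover have "g (e2 \<odot>\<^bsub>P\<^esub> y) = e2 \<odot>\<^bsub>T\<^esub> g y"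
          using y c c' e1G e2g1[OF c(3)] by (simp add: g_def z actP actT G(4) Lm(4) T.smult_r_distr)
        moreover have "g (x \<odot>\<^bsub>P\<^esub> y) = x \<odot>\<^bsub>T\<^esub> g y"
          using y c c' k1[OF c(3)] by (simp add: g_def z actP actT G(4) G1(4) Lm(4) T.smult_r_distr)
        moreover have "g (a \<odot>\<^bsub>P\<^esub> y) = a \<odot>\<^bsub>T\<^esub> g y"
          using y c c' k1[OF c(3)] aG[OF c(1)] g1D[OF y] G1(1)[of "a \<odot>\<^bsub>P\<^esub> l (x \<odot>\<^bsub>P\<^esub> y)"]
          by (simp add: g_def z actP actT G(4) G1(4) Lm(4) T.smult_r_distr)
        ultimately show ?thesis using r by auto
      qed
    qed
    moreover have "h q = g (f q)" if q: "q \<in> carrier Q" for q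
    proof -
      have fq: "f q \<in> carrier P" using fD(1)[OF q] .
      have e2f: "e2 \<odot>\<^bsub>P\<^esub> f q = f q" using act_e2_zero(2)[OF PL fq e1f[OF q]] .
      then have "x \<odot>\<^bsub>P\<^esub> f q = \<zero>\<^bsub>P\<^esub>" using actP(8)[OF fq] by simp
      then have "D (f q) = \<zero>\<^bsub>P\<^esub>" using e1f[OF q] Lm(4) by (simp add: D_def a_minus_def)
      then show ?thesis
        using \<open>x \<odot>\<^bsub>P\<^esub> f q = \<zero>\<^bsub>P\<^esub>\<close> e2f g1f[OF q] hD(1)[OF q] by (simp add: g_def G(4) Lm(4))
    qed
    ultimately show ?thesis using fD(1) by (intro bexI[of _ "restrict g (carrier P)"]) auto
  qed
  then show ?thesis using crit by blast
qed

text \<open>No arrow starts at the second vertex, so A e2 is one-dimensional.\<close>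

lemma projective_simple_at_sink: "projective K A (simple_at e2 c2)"
  unfolding simple_at_def
proof (rule projective_cyclic_idempotent[OF cyclic_projection_simple[OF vertices(2)]])
  fix r assume r: "r \<in> carrier A" "scal (c2 r) \<otimes> e2 = \<zero>"
  have "r \<otimes> e2 = (scal (c1 r) \<otimes> e1 \<oplus> scal (c2 r) \<otimes> e2 \<oplus> (scal (c3 r) \<otimes> x \<oplus> scal (c4 r) \<otimes> a)) \<otimes> e2"
    using basis_expansion[OF r(1)] by simp
  also have "\<dots> = scal (c2 r) \<otimes> e2" using r(1) by (simp add: A.l_distr A.m_assoc)
  finally show "r \<otimes> e2 = \<zero>" using r(2) by simp
qed simp_all

text \<open>On N only \<open>e2\<close> and scalars act nontrivially, and \<open>x\<close> and
  \<open>a\<close> annihilate e2 M. Hence any K-linear lift becomes A-linear after multiplication by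
  \<open>e2\<close>.\<close>

lemma projective_at_sink:
  assumes N: "fd_module K A N" and e1: "\<And>n. n \<in> carrier N \<Longrightarrow> e1 \<odot>\<^bsub>N\<^esub> n = \<zero>\<^bsub>N\<^esub>"
  shows "projective K A N"
  unfolding projective_def
proof (intro conjI allI impI ballI N)
  fix M L :: "('k, nat \<Rightarrow> 'k) fmod" and g f
  assume hML: "fd_module K A M \<and> fd_module K A L" and g: "g \<in> module_Hom A M L" "g ` carrier M = carrier L"
    and f: "f \<in> module_Hom A N L"
  have hML': "left_module A M" "left_module A L" and NL: "left_module A N" using hML N fd_left_module by auto
  interpret M: left_module A M by fact
  interpret N: left_module A N by fact
  note act = act_simps[OF hML'(1)] act_arrow[OF hML'(1)] act_scal[OF hML'(1)]
  note gD = module_HomD[OF g(1)] and fD = module_HomD[OF f]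
  note V = left_module_vec[OF hML'(1)] left_module_vec[OF hML'(2)]
  obtain s where s: "s \<in> module_Hom K (vec L) (vec M)" "\<And>m. m \<in> carrier M \<Longrightarrow> g (s (g m)) = g m"
    using exists_linear_generalized_inverse[OF K.field_axioms V module_Hom_vec[OF g(1)], unfolded restrict_scalars_simps]
    by metis
  note sD = vec_HomD[OF s(1) hML'(2,1)]
  have e2n: "e2 \<odot>\<^bsub>N\<^esub> n = n" if "n \<in> carrier N" for n
    using act_e2_zero(2)[OF NL that e1[OF that]] .
  have ann: "x \<odot>\<^bsub>N\<^esub> n = \<zero>\<^bsub>N\<^esub>" "a \<odot>\<^bsub>N\<^esub> n = \<zero>\<^bsub>N\<^esub>" if n: "n \<in> carrier N" for n
    using act_simps(6)[OF NL n] act_arrow(3)[OF NL n] e1[OF n] N.scalar_zero_right basis_closed(3,4) by metis+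
  have f0: "f \<zero>\<^bsub>N\<^esub> = \<zero>\<^bsub>L\<^esub>" using module_Hom_zero[OF NL hML'(2) f] .
  have h: "(\<lambda>n\<in>carrier N. e2 \<odot>\<^bsub>M\<^esub> s (f n)) \<in> module_Hom A N M"
  proof (rule module_HomI_basis[OF NL hML'(1)])
    show "e2 \<odot>\<^bsub>M\<^esub> s (f (r \<odot>\<^bsub>N\<^esub> n)) = r \<odot>\<^bsub>M\<^esub> (e2 \<odot>\<^bsub>M\<^esub> s (f n))" if r: "r \<in> {e1, e2, x, a}" and n: "n \<in> carrier N" for r n
      using r sD(1)[OF fD(1)[OF n]] e1[OF n] e2n[OF n] ann[OF n] f0 sD(4) by (auto simp: act)
  qed (use fD sD in \<open>simp_all add: M.smult_r_distr act\<close>)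
  show "\<exists>h\<in>module_Hom A N M. \<forall>n\<in>carrier N. g (h n) = f n"
  proof (rule bexI[OF _ h], intro ballI)
    fix n assume n: "n \<in> carrier N"
    obtain m where m: "m \<in> carrier M" "f n = g m" using g(2) fD(1)[OF n] by (metis imageE)
    have "g (e2 \<odot>\<^bsub>M\<^esub> s (f n)) = e2 \<odot>\<^bsub>L\<^esub> f n"
      using gD(3)[OF basis_closed(2) sD(1)[OF fD(1)[OF n]]] s(2)[OF m(1)] m(2) by simp
    also have "\<dots> = f n" using fD(3)[OF basis_closed(2) n] e2n[OF n] by simp
    finally show "g ((\<lambda>n\<in>carrier N. e2 \<odot>\<^bsub>M\<^esub> s (f n)) n) = f n" using n by simp
  qed
qed

lemma projective_dimension_loop_free:
  assumes "fd_module K A T" "loop_free T"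
  shows "projective_dimension K A T \<le> 1"
proof -
  note TL = fd_left_module[OF assms(1)]
  obtain P p where c: "projective_cover K A T P p" and J: "a_kernel P T p \<subseteq> rad P"
    by (rule exists_projective_cover[OF assms(1)])
  then have P: "projective K A P" "p \<in> module_Hom A P T" "p ` carrier P = carrier T"
    by (auto simp: projective_cover_def)
  note PL = projective_left_module[OF P(1)]
  have "fd_module K A (P\<lparr>carrier := a_kernel P T p\<rparr>)"
    using fd_module_submodule[OF projective_fd[OF P(1)] submodule_a_kernel[OF PL TL P(2)]] .
  then have "projective K A (P\<lparr>carrier := a_kernel P T p\<rparr>)"
    by (rule projective_at_sink) (use kernel_at_sink[OF P(1) TL assms(2) P(2,3) J] in simp)
  then show ?thesis by (rule projective_dimension_le_1I[OF P(1) TL P(2,3)])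
qed

text \<open>The coefficient functions of a map to A e1 are \<kappa> composed with \<open>a\<close>,
  some \<nu> on e1 N, and \<kappa> on e2 N, subject to \<nu> (x m) = \<kappa> (a m). Such \<nu>
  exists because freeness and a x = 0 force ker x to lie in ker a.\<close>

lemma indecomposable_iso_source:
  assumes N: "indecomposable K A N" "loop_free N" and n: "n \<in> carrier N" "a \<odot>\<^bsub>N\<^esub> n \<noteq> \<zero>\<^bsub>N\<^esub>"
  shows "module_iso A N (vertex_module e1)"
proof -
  note NL = indecomposable_left_module[OF N(1)]
  interpret N: left_module A N by (rule NL)
  note VN = left_module_vec[OF NL] and W = vertex_module_facts[OF vertices(1)]
  interpret V: left_module K "vec N" by (rule VN)
  note act = act_simps[OF NL] act_arrow[OF NL] act_scal[OF NL]
  have "submodule {\<zero>\<^bsub>N\<^esub>} K (vec N)" by (rule V.submoduleI) auto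
  then obtain \<kappa> where \<kappa>: "\<kappa> \<in> module_Hom K (vec N) (regular K)" "\<kappa> (a \<odot>\<^bsub>N\<^esub> n) = \<one>\<^bsub>K\<^esub>"
    using exists_linear_functional[OF K.field_axioms VN, of "{\<zero>\<^bsub>N\<^esub>}" "a \<odot>\<^bsub>N\<^esub> n"] n by auto
  note RK = left_module_regular[OF K.ring_axioms]
  note \<kappa>D = module_HomD[OF \<kappa>(1), unfolded regular_simps restrict_scalars_simps(1,3) vec_smult]
  have \<kappa>0: "\<kappa> \<zero>\<^bsub>N\<^esub> = \<zero>\<^bsub>K\<^esub>" using module_Hom_zero[OF VN RK \<kappa>(1)] by simp
  have xa: "a \<odot>\<^bsub>N\<^esub> m = \<zero>\<^bsub>N\<^esub>" if m: "m \<in> carrier N" "x \<odot>\<^bsub>N\<^esub> m = \<zero>\<^bsub>N\<^esub>" for m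
  proof -
    have "\<exists>m'\<in>carrier N. e1 \<odot>\<^bsub>N\<^esub> m = x \<odot>\<^bsub>N\<^esub> m'"
      using N(2) m unfolding divisible_on_def by (simp add: act)
    then show ?thesis using act(11) act(15)[OF m(1)] by metis
  qed
  have ax: "(\<lambda>m\<in>carrier N. \<kappa> (a \<odot>\<^bsub>N\<^esub> m)) \<in> module_Hom K (vec N) (regular K)"
    using module_Hom_compose[OF VN left_mult_linear[OF NL basis_closed(4)] \<kappa>(1)] by (simp cong: restrict_cong)
  have "(\<lambda>m\<in>carrier N. \<kappa> (a \<odot>\<^bsub>N\<^esub> m)) m = \<zero>\<^bsub>regular K\<^esub>"
    if "m \<in> carrier (vec N)" "(\<lambda>m\<in>carrier N. x \<odot>\<^bsub>N\<^esub> m) m = \<zero>\<^bsub>vec N\<^esub>" for m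
    using xa that \<kappa>0 by simp
  then obtain \<nu> where \<nu>: "\<nu> \<in> module_Hom K (vec N) (regular K)"
    and \<nu>x: "\<And>m. m \<in> carrier (vec N) \<Longrightarrow> \<nu> ((\<lambda>m\<in>carrier N. x \<odot>\<^bsub>N\<^esub> m) m) = (\<lambda>m\<in>carrier N. \<kappa> (a \<odot>\<^bsub>N\<^esub> m)) m"
    using exists_linear_factorization[OF K.field_axioms VN VN RK left_mult_linear[OF NL basis_closed(3)] ax] by metis
  note \<nu>D = module_HomD[OF \<nu>, unfolded regular_simps restrict_scalars_simps(1,3) vec_smult]
  have \<nu>0: "\<nu> \<zero>\<^bsub>N\<^esub> = \<zero>\<^bsub>K\<^esub>" using module_Hom_zero[OF VN RK \<nu>] by simp
  have \<nu>x: "\<nu> (x \<odot>\<^bsub>N\<^esub> m) = \<kappa> (a \<odot>\<^bsub>N\<^esub> m)" if "m \<in> carrier N" for m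
    using \<nu>x[of m] that by simp
  define f where "f m = scal (\<kappa> (a \<odot>\<^bsub>N\<^esub> m)) \<otimes> e1 \<oplus> (scal (\<nu> (e1 \<odot>\<^bsub>N\<^esub> m)) \<otimes> x \<oplus> scal (\<kappa> (e2 \<odot>\<^bsub>N\<^esub> m)) \<otimes> a)" for m
  have fA: "f m \<in> carrier A" "f m \<otimes> e1 = f m" if "m \<in> carrier N" for m
    using that \<nu>D(1) \<kappa>D(1) by (simp_all add: f_def A.l_distr A.m_assoc)
  have fh: "restrict f (carrier N) \<in> module_Hom A N (vertex_module e1)"
  proof (rule module_HomI_basis[OF NL W(1)])
    show "f m \<in> carrier (vertex_module e1)" if "m \<in> carrier N" for m
      using fA[OF that] unfolding W(3) by (metis image_eqI)
    show "f (m \<oplus>\<^bsub>N\<^esub> m') = f m \<oplus>\<^bsub>vertex_module e1\<^esub> f m'" if "m \<in> carrier N" "m' \<in> carrier N" for m m'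
      using that \<nu>D \<kappa>D by (simp add: f_def W N.smult_r_distr scal_add A.l_distr A.a_ac)
    show "f (scal k \<odot>\<^bsub>N\<^esub> m) = scal k \<odot>\<^bsub>vertex_module e1\<^esub> f m" if k: "k \<in> carrier K" and m: "m \<in> carrier N" for k m
    proof -
      have "f (scal k \<odot>\<^bsub>N\<^esub> m) = scal k \<otimes> f m"
        using k m \<nu>D \<kappa>D by (simp add: f_def act scal_mult A.r_distr A.m_assoc)
      then show ?thesis using fA[OF m] k by (simp add: W A.m_assoc)
    qed
    show "f (r \<odot>\<^bsub>N\<^esub> m) = r \<odot>\<^bsub>vertex_module e1\<^esub> f m" if r: "r \<in> {e1, e2, x, a}" and m: "m \<in> carrier N" for r m
    proof -
      have c: "\<kappa> (a \<odot>\<^bsub>N\<^esub> m) \<in> carrier K" "\<nu> (e1 \<odot>\<^bsub>N\<^esub> m) \<in> carrier K" "\<kappa> (e2 \<odot>\<^bsub>N\<^esub> m) \<in> carrier K"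
        using m \<nu>D(1) \<kappa>D(1) by simp_all
      show ?thesis
        using r m c by (auto simp: W f_def act \<nu>0 \<kappa>0 \<nu>x A.r_distr A.l_distr vertex_times_scal A.m_assoc)
    qed
  qed
  define k where "k = \<nu> (e1 \<odot>\<^bsub>N\<^esub> n)"
  \<comment> \<open>\<nu> (x n) = \<kappa> (a n) = 1, so a multiple of x n removes the
    \<open>x\<close>-coefficient, and f m is the generator \<open>e1\<close>.\<close>
  define m where "m = e1 \<odot>\<^bsub>N\<^esub> n \<oplus>\<^bsub>N\<^esub> scal (\<ominus>\<^bsub>K\<^esub> k) \<odot>\<^bsub>N\<^esub> (x \<odot>\<^bsub>N\<^esub> n)"
  have k: "k \<in> carrier K" using n \<nu>D(1) by (simp add: k_def)
  have m: "m \<in> carrier N" "a \<odot>\<^bsub>N\<^esub> m = a \<odot>\<^bsub>N\<^esub> n" "e1 \<odot>\<^bsub>N\<^esub> m = m" "e2 \<odot>\<^bsub>N\<^esub> m = \<zero>\<^bsub>N\<^esub>"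
    using n k by (simp_all add: m_def N.smult_r_distr act)
  have "\<nu> m = \<zero>\<^bsub>K\<^esub>" using n k \<nu>D \<kappa>(2) \<nu>x[OF n(1)] by (simp add: m_def K.r_neg flip: k_def)
  then have fm: "f m = \<one> \<otimes> e1" using m \<kappa>(2) \<kappa>0 by (simp add: f_def)
  have "r \<odot>\<^bsub>N\<^esub> m = \<zero>\<^bsub>N\<^esub>" if "r \<in> carrier A" "r \<otimes> e1 = \<zero>" for r
  proof -
    have "r \<odot>\<^bsub>N\<^esub> m = (r \<otimes> e1) \<odot>\<^bsub>N\<^esub> m" using that(1) m by (simp add: N.smult_assoc1)
    then show ?thesis using that(2) m(1) by simp
  qed
  then show ?thesis
    unfolding vertex_module_def
    using indecomposable_iso_cyclic[OF cyclic_projection_vertex[OF vertices(1)] N(1) m(1)] fh fm m(1) basis_nonzero(1)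
    by (simp add: vertex_module_def)
qed

lemma loop_free_indecomposable:
  assumes N: "indecomposable K A N" "loop_free N"
  shows "module_iso A N (vertex_module e1) \<or> module_iso A N loop_module \<or> module_iso A N (simple_at e2 c2)"
proof -
  note NL = indecomposable_left_module[OF N(1)]
  interpret N: left_module A N by (rule NL)
  note act = act_simps[OF NL] act_arrow[OF NL]
  obtain n where n: "n \<in> carrier N" "n \<noteq> \<zero>\<^bsub>N\<^esub>"
    using N(1) by (auto simp: indecomposable_def zero_module_def)
  consider m where "m \<in> carrier N" "a \<odot>\<^bsub>N\<^esub> m \<noteq> \<zero>\<^bsub>N\<^esub>"
    | m where "\<And>m. m \<in> carrier N \<Longrightarrow> a \<odot>\<^bsub>N\<^esub> m = \<zero>\<^bsub>N\<^esub>" "m \<in> carrier N" "x \<odot>\<^bsub>N\<^esub> m \<noteq> \<zero>\<^bsub>N\<^esub>"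
    | "\<And>m. m \<in> carrier N \<Longrightarrow> a \<odot>\<^bsub>N\<^esub> m = \<zero>\<^bsub>N\<^esub>" "\<And>m. m \<in> carrier N \<Longrightarrow> x \<odot>\<^bsub>N\<^esub> m = \<zero>\<^bsub>N\<^esub>"
    by blast
  then show ?thesis
  proof cases
    case 1
    then show ?thesis using indecomposable_iso_source[OF N] by blast
  next
    case 2
    then show ?thesis using indecomposable_iso_loop_module[OF N(1)] by blast
  next
    case 3
    have "e1 \<odot>\<^bsub>N\<^esub> m = \<zero>\<^bsub>N\<^esub>" if m: "m \<in> carrier N" for m
    proof -
      have "e1 \<odot>\<^bsub>N\<^esub> m \<in> carrier N" "\<forall>r\<in>{e2, x}. r \<odot>\<^bsub>N\<^esub> (e1 \<odot>\<^bsub>N\<^esub> m) = \<zero>\<^bsub>N\<^esub>"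
        using m 3(2) by (simp_all add: act)
      then have "\<exists>m'\<in>carrier N. e1 \<odot>\<^bsub>N\<^esub> m = x \<odot>\<^bsub>N\<^esub> m'"
        using N(2) unfolding divisible_on_def by blast
      then show ?thesis using 3(2) by auto
    qed
    then have "e2 \<odot>\<^bsub>N\<^esub> m = m" if "m \<in> carrier N" for m
      using act_e2_zero(2)[OF NL that] that by blast
    then have "module_iso A N (simple_at e2 c2)"
      using 3 n by (intro indecomposable_iso_simple_at[OF N(1) vertices(2) n(1)]) auto
    then show ?thesis by blast
  qed
qed

lemma module_properties:
  "arrow_onto (vertex_module e1)" "loop_free loop_module" "arrow_onto loop_module"
  "\<not> arrow_tight loop_module" "\<not> arrow_onto (simple_at e2 c2)"
proof -
  note W = vertex_module_facts[OF vertices(1)] and S = simple_at_facts[OF vertices(2)] and X = loop_module_facts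
  have lp: "loop_projection (scal k \<otimes> e1 \<oplus> scal l \<otimes> x) = scal k \<otimes> e1 \<oplus> scal l \<otimes> x"
    if "k \<in> carrier K" "l \<in> carrier K" for k l
    unfolding loop_projection_def coord_loop[OF that] ..
  show "arrow_onto (vertex_module e1)"
    unfolding divisible_on_def
  proof (intro ballI impI)
    fix v assume v: "v \<in> carrier (vertex_module e1)" "\<forall>r\<in>{e1}. r \<odot>\<^bsub>vertex_module e1\<^esub> v = \<zero>\<^bsub>vertex_module e1\<^esub>"
    then have vA: "v \<in> carrier A" "v \<otimes> e1 = v" by (auto simp: W A.m_assoc)
    have "e1 \<otimes> v = \<zero>" using v(2) vA by (simp add: W A.m_assoc)
    moreover have "c1 (e1 \<otimes> v) = c1 v" "c3 (e1 \<otimes> v) = c3 v" using vA(1) by (simp_all add: coord_mult)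
    ultimately have "c1 v = \<zero>\<^bsub>K\<^esub>" "c3 v = \<zero>\<^bsub>K\<^esub>" by simp_all
    then have "v = scal (c4 v) \<otimes> a" using vertex_right[OF vertices(1) vA] vA(1) by simp
    moreover have "a \<odot>\<^bsub>vertex_module e1\<^esub> (scal (c4 v) \<otimes> e1) = scal (c4 v) \<otimes> a"
      using vA(1) by (simp add: W vertex_times_scal A.m_assoc)
    ultimately have "v = a \<odot>\<^bsub>vertex_module e1\<^esub> (scal (c4 v) \<otimes> e1)" by simp
    moreover have "scal (c4 v) \<otimes> e1 \<in> carrier (vertex_module e1)"
      unfolding W(3) using vA(1) by (intro imageI) simp
    ultimately show "\<exists>m'\<in>carrier (vertex_module e1). v = a \<odot>\<^bsub>vertex_module e1\<^esub> m'"
      by (rule bexI)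
  qed
  show "loop_free loop_module"
    unfolding divisible_on_def
  proof (intro ballI impI)
    fix v assume v: "v \<in> carrier loop_module" "\<forall>r\<in>{e2, x}. r \<odot>\<^bsub>loop_module\<^esub> v = \<zero>\<^bsub>loop_module\<^esub>"
    obtain k l where kl: "k \<in> carrier K" "l \<in> carrier K" "v = scal k \<otimes> e1 \<oplus> scal l \<otimes> x"
      using v(1) by (auto simp: X(3))
    have "x \<otimes> v = scal k \<otimes> x" using kl by (simp add: A.r_distr vertex_times_scal)
    then have "scal k \<otimes> x = \<zero>" using v(2) lp[OF K.zero_closed kl(1)] kl(1) by (simp add: X)
    then have "k = \<zero>\<^bsub>K\<^esub>" using scal_basis_eq_zero(2)[OF kl(1) K.zero_closed] by blast
    then have "v = x \<odot>\<^bsub>loop_module\<^esub> (scal l \<otimes> e1)"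
      using kl lp[OF K.zero_closed kl(2)] by (simp add: X vertex_times_scal)
    moreover have "scal l \<otimes> e1 \<in> carrier loop_module"
      unfolding X(3) using kl(2) by (intro CollectI exI[of _ l] exI[of _ "\<zero>\<^bsub>K\<^esub>"]) simp
    ultimately show "\<exists>m'\<in>carrier loop_module. v = x \<odot>\<^bsub>loop_module\<^esub> m'" by blast
  qed
  note e1v = loop_module_act
  show "arrow_onto loop_module"
    unfolding divisible_on_def
  proof (intro ballI impI)
    fix v assume "v \<in> carrier loop_module" "\<forall>r\<in>{e1}. r \<odot>\<^bsub>loop_module\<^esub> v = \<zero>\<^bsub>loop_module\<^esub>"
    then have "v = \<zero>" "v \<in> carrier loop_module" using e1v(1) by (auto simp: X(4))
    then show "\<exists>m'\<in>carrier loop_module. v = a \<odot>\<^bsub>loop_module\<^esub> m'" using e1v(2) by metis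
  qed
  show "\<not> arrow_tight loop_module"
  proof
    assume "arrow_tight loop_module"
    then obtain v where "v \<in> carrier loop_module" "e1 = x \<odot>\<^bsub>loop_module\<^esub> v"
      using loop_generator e1v unfolding divisible_on_def X(4) by blast
    then have "c1 e1 = \<zero>\<^bsub>K\<^esub>" using e1v(4) by metis
    then show False by simp
  qed
  show "\<not> arrow_onto (simple_at e2 c2)"
  proof
    assume "arrow_onto (simple_at e2 c2)"
    moreover have "\<forall>r\<in>{e1}. r \<odot>\<^bsub>simple_at e2 c2\<^esub> e2 = \<zero>\<^bsub>simple_at e2 c2\<^esub>" by (simp add: S)
    ultimately obtain v where v: "v \<in> carrier (simple_at e2 c2)" "e2 = a \<odot>\<^bsub>simple_at e2 c2\<^esub> v"
      using S(7) unfolding divisible_on_def by blast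
    have "v \<in> carrier A" using v(1) by (auto simp: S(3))
    then have "a \<odot>\<^bsub>simple_at e2 c2\<^esub> v = \<zero>" by (simp add: S coord_mult)
    then show False using v(2) S(8) by simp
  qed
qed

section \<open>The two tau-tilting modules when the arrow leaves the loop, and their tilting
  property\<close>

abbreviation "T_proj \<equiv> direct_sum (vertex_module e1) (simple_at e2 c2)"
abbreviation "T_loop \<equiv> direct_sum (vertex_module e1) loop_module"

lemma summand_properties:
  "projective K A T_proj" "loop_free T_proj" "arrow_tight T_proj" "\<not> arrow_onto T_proj"
  "fd_module K A T_loop" "loop_free T_loop" "arrow_onto T_loop"
proof -
  note W = vertex_module_facts[OF vertices(1)] and S = simple_at_facts[OF vertices(2)] and X = loop_module_facts
  note P1 = projective_vertex_module[OF vertices(1)]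
  show P: "projective K A T_proj"
    by (rule projective_direct_sum[OF P1 projective_simple_at_sink])
  show "loop_free T_proj" "arrow_tight T_proj" using projective_divisible[OF P] by auto
  show "\<not> arrow_onto T_proj"
    using divisible_on_retract[OF direct_sum_retracts(2)[OF W(1) S(2)] projective_left_module[OF P] S(2)]
      module_properties(5) by auto
  show "fd_module K A T_loop" by (rule fd_module_direct_sum[OF W(2) X(2)])
  show "loop_free T_loop"
    by (rule divisible_on_direct_sum[OF W(1) X(1) projective_divisible(1)[OF P1] module_properties(2)]) auto
  show "arrow_onto T_loop"
    by (rule divisible_on_direct_sum[OF W(1) X(1) module_properties(1,3)]) auto
qed

lemma indecomposable_retracts:
  assumes "indecomposable K A N" "retract_of A N T" "left_module A T" "loop_free T"
  shows "arrow_tight T \<Longrightarrow> module_iso A N (vertex_module e1) \<or> module_iso A N (simple_at e2 c2)"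
    "arrow_onto T \<Longrightarrow> module_iso A N (vertex_module e1) \<or> module_iso A N loop_module"
proof -
  note NL = indecomposable_left_module[OF assms(1)]
  note S = simple_at_facts[OF vertices(2)] and X = loop_module_facts
  note cl = loop_free_indecomposable[OF assms(1) divisible_on_retract[OF assms(2,3) NL assms(4)]]
  show "module_iso A N (vertex_module e1) \<or> module_iso A N (simple_at e2 c2)" if "arrow_tight T"
  proof -
    have "arrow_tight N" using divisible_on_retract[OF assms(2,3) NL that] by simp
    then have "\<not> module_iso A N loop_module"
      using divisible_on_retract[OF module_iso_retract(2)[OF _ NL X(1)] NL X(1)] module_properties(4) by auto
    then show ?thesis using cl by auto
  qed
  show "module_iso A N (vertex_module e1) \<or> module_iso A N loop_module" if "arrow_onto T"
  proof -
    have "arrow_onto N" using divisible_on_retract[OF assms(2,3) NL that] by simp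
    then have "\<not> module_iso A N (simple_at e2 c2)"
      using divisible_on_retract[OF module_iso_retract(2)[OF _ NL S(2)] NL S(2)] module_properties(5) by auto
    then show ?thesis using cl by auto
  qed
qed

lemma summands_not_iso:
  "\<not> module_iso A (vertex_module e1) (simple_at e2 c2)" "\<not> module_iso A (vertex_module e1) loop_module"
  "\<not> module_iso A T_proj T_loop"
proof -
  note W = vertex_module_facts[OF vertices(1)] and S = simple_at_facts[OF vertices(2)] and X = loop_module_facts
  show "\<not> module_iso A (vertex_module e1) (simple_at e2 c2)"
    using divisible_on_retract[OF module_iso_retract(2)[OF _ W(1) S(2)] W(1) S(2) module_properties(1)]
      module_properties(5) by auto
  show "\<not> module_iso A (vertex_module e1) loop_module"
    using divisible_on_retract[OF module_iso_retract(2)[OF _ W(1) X(1)] W(1) X(1)]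
      projective_divisible(2)[OF projective_vertex_module[OF vertices(1)]] module_properties(4) by auto
  note L = projective_left_module[OF summand_properties(1)] fd_left_module[OF summand_properties(5)]
  show "\<not> module_iso A T_proj T_loop"
    using divisible_on_retract[OF module_iso_retract(1)[OF _ L] L(2,1) summand_properties(7)]
      summand_properties(4) by auto
qed

lemma T_sums:
  "sum_of_distinct_indecomposables K A 2 T_proj" "sum_of_distinct_indecomposables K A 2 T_loop"
  using sum_of_two_indecomposablesI indecomposable_vertex_module[OF vertices(1)]
    indecomposable_simple_at[OF vertices(2)] indecomposable_loop_module summands_not_iso by auto

lemma card_tau_tilting: "card (iso_classes A {T. tau_tilting K A T}) = 2"
proof (rule card_iso_classes_eq_2)
  note W = vertex_module_facts[OF vertices(1)] and S = simple_at_facts[OF vertices(2)] and X = loop_module_facts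
  show "T_proj \<in> {T. tau_tilting K A T}"
    using projective_tau_rigid[OF summand_properties(1)] T_sums by (simp add: tau_tilting_def num_simples_eq_2)
  show "T_loop \<in> {T. tau_tilting K A T}"
    using tau_rigid_if_onto[OF summand_properties(5-7)] T_sums by (simp add: tau_tilting_def num_simples_eq_2)
  show "\<not> module_iso A T_proj T_loop" by (rule summands_not_iso(3))
  fix T assume "T \<in> {T. tau_tilting K A T}"
  then have T: "tau_rigid K A T" "sum_of_distinct_indecomposables K A 2 T" "fd_module K A T"
    by (auto simp: tau_tilting_def num_simples_eq_2 tau_rigid_def)
  show TL: "left_module A T" using fd_left_module[OF T(3)] .
  note free = tau_rigid_loop_free[OF T(1,3)]
  show "module_iso A T T_proj \<or> module_iso A T T_loop"
    using tau_rigid_onto_or_tight[OF T(1,3)]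
      sum_of_two_indecomposables_unique[OF T(2) TL W(1) S(2)] indecomposable_retracts(1)[OF _ _ TL free]
      sum_of_two_indecomposables_unique[OF T(2) TL W(1) X(1)] indecomposable_retracts(2)[OF _ _ TL free]
    by blast
qed

lemma basic_tilting_T_proj: "basic_tilting K A T_proj"
proof -
  note P = summand_properties(1)
  note L = projective_left_module[OF P]
  have "card (iso_classes A {M. indecomposable K A M \<and> direct_summand K A M T_proj}) = 2"
    by (rule card_indecomposable_summands_direct_sum)
      (use indecomposable_vertex_module[OF vertices(1)] indecomposable_simple_at[OF vertices(2)] summands_not_iso
        indecomposable_retracts(1)[OF _ _ L summand_properties(2,3)] in auto)
  then show ?thesis
    unfolding basic_tilting_def tilting_def partial_tilting_def num_simples_eq_2
    using projective_fd[OF P] projective_dimension_le_1_projective[OF P] projective_Ext1_vanishes[OF P L] T_sums(1)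
    by blast
qed

lemma Ext1_vanishes_T_loop: "Ext1_vanishes K A T_loop T_loop"
proof -
  note W = vertex_module_facts[OF vertices(1)] and X = loop_module_facts
  note T = summand_properties(5) and TL = fd_left_module[OF summand_properties(5)]
  interpret T: left_module A T_loop by (rule TL)
  show ?thesis
  proof (rule Ext1_vanishes_if_sections[OF TL TL])
    fix E i p assume ext: "extension K A T_loop T_loop E i p"
    then have Efd: "fd_module K A E" and i: "i \<in> module_Hom A T_loop E" and inj: "inj_on i (carrier T_loop)"
      and p: "p \<in> module_Hom A E T_loop" "p ` carrier E = carrier T_loop"
      and ex: "i ` carrier T_loop = a_kernel E T_loop p"
      by (auto simp: extension_def)
    note E = fd_left_module[OF Efd]
    interpret E: left_module A E by (rule E)
    note iD = module_HomD[OF i] and pD = module_HomD[OF p(1)]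
    obtain i1 i2 p1 p2 where m: "i1 \<in> module_Hom A (vertex_module e1) T_loop" "i2 \<in> module_Hom A loop_module T_loop"
      "p1 \<in> module_Hom A T_loop (vertex_module e1)" "p2 \<in> module_Hom A T_loop loop_module"
      and dec: "\<And>u. u \<in> carrier T_loop \<Longrightarrow> u = i1 (p1 u) \<oplus>\<^bsub>T_loop\<^esub> i2 (p2 u)"
      by (rule direct_sum_maps[OF W(1) X(1)]) (rule that)
    note mD = module_HomD[OF m(1)] module_HomD[OF m(2)] module_HomD[OF m(3)] module_HomD[OF m(4)]
    obtain s1 where s1: "s1 \<in> module_Hom A (vertex_module e1) E" "\<And>v. v \<in> carrier (vertex_module e1) \<Longrightarrow> p (s1 v) = i1 v"
      using projective_lift[OF projective_vertex_module[OF vertices(1)] Efd T p(1) m(1) p(2)] by blast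
    define t where "t = i2 e1"
    have t: "t \<in> carrier T_loop" using mD(5)[OF loop_generator] by (simp add: t_def)
    have gen: "r \<odot>\<^bsub>loop_module\<^esub> e1 = loop_projection r" if "r \<in> carrier A" for r
      using that by (simp add: X(6) loop_projection_def coord_mult)
    have "a \<odot>\<^bsub>loop_module\<^esub> e1 = \<zero>\<^bsub>loop_module\<^esub>" "e1 \<odot>\<^bsub>loop_module\<^esub> e1 = e1"
      using gen[of a] gen[of e1] by (simp_all add: X(4) loop_projection_def)
    then have at: "a \<odot>\<^bsub>T_loop\<^esub> t = \<zero>\<^bsub>T_loop\<^esub>" "e1 \<odot>\<^bsub>T_loop\<^esub> t = t"
      using mD(7)[OF basis_closed(4) loop_generator] mD(7)[OF basis_closed(1) loop_generator]
        module_Hom_zero[OF X(1) TL m(2)] by (simp_all add: t_def)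
    obtain y where y: "y \<in> carrier E" "p y = t" using p(2) t by (metis imageE)
    \<comment> \<open>The obstruction a y lies in the kernel of p, at the second vertex.\<close>
    have "a \<odot>\<^bsub>E\<^esub> y \<in> i ` carrier T_loop" unfolding ex using y pD at by (simp add: in_a_kernel_iff)
    then obtain u where u: "u \<in> carrier T_loop" "i u = a \<odot>\<^bsub>E\<^esub> y" by (metis imageE)
    have "i (e1 \<odot>\<^bsub>T_loop\<^esub> u) = i \<zero>\<^bsub>T_loop\<^esub>"
      using iD(3)[OF basis_closed(1) u(1)] u(2) act_arrow(1)[OF E y(1)] module_Hom_zero[OF TL E i] by simp
    then have "e1 \<odot>\<^bsub>T_loop\<^esub> u = \<zero>\<^bsub>T_loop\<^esub>" using inj u(1) by (simp add: inj_on_def)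
    then obtain w where w: "w \<in> carrier T_loop" "u = a \<odot>\<^bsub>T_loop\<^esub> w"
      using summand_properties(7) u(1) unfolding divisible_on_def by auto
    have iw: "i w \<in> carrier E" "p (i w) = \<zero>\<^bsub>T_loop\<^esub>" using w(1) iD ex by (auto simp: in_a_kernel_iff set_eq_iff)
    \<comment> \<open>Since a y = i (a w), subtracting i w removes the obstruction;
      \<open>e1\<close> removes the component at the second vertex and does not change the image
      t.\<close>
    define m where "m = e1 \<odot>\<^bsub>E\<^esub> (y \<ominus>\<^bsub>E\<^esub> i w)"
    have mE: "m \<in> carrier E" using y iw by (simp add: m_def)
    have "a \<odot>\<^bsub>E\<^esub> m = a \<odot>\<^bsub>E\<^esub> y \<ominus>\<^bsub>E\<^esub> i u"
      using y iw w iD(3)[OF basis_closed(4) w(1)] by (simp add: m_def act_arrow[OF E] E.scalar_diff)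
    then have am: "a \<odot>\<^bsub>E\<^esub> m = \<zero>\<^bsub>E\<^esub>" using u y by (simp add: E.diff_eq_zero_iff)
    have e2m: "e2 \<odot>\<^bsub>E\<^esub> m = \<zero>\<^bsub>E\<^esub>" using y iw by (simp add: m_def act_simps[OF E])
    have pm: "p m = t"
      using pD(3)[OF basis_closed(1), of "y \<ominus>\<^bsub>E\<^esub> i w"] y iw at t module_Hom_diff[OF E TL p(1) y(1) iw(1)]
        T.diff_add_cancel(3)[OF t T.M.zero_closed] T.M.r_zero[OF t]
      by (simp add: m_def del: T.M.minus_eq)
    have ker: "r \<odot>\<^bsub>E\<^esub> m = \<zero>\<^bsub>E\<^esub>" if r: "r \<in> carrier A" "loop_projection r = \<zero>" for r
    proof -
      have "c1 r = \<zero>\<^bsub>K\<^esub>" "c3 r = \<zero>\<^bsub>K\<^esub>" using loop_projection_coord(1,3)[OF r(1)] r(2) by simp_all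
      then show ?thesis using act_expansion[OF E r(1) mE] mE am e2m r by simp
    qed
    have s2: "(\<lambda>v\<in>carrier loop_module. v \<odot>\<^bsub>E\<^esub> m) \<in> module_Hom A loop_module E"
      using cyclic_Hom(1)[OF cyclic_projection_loop E mE ker] by (simp add: loop_module_def)
    have ps2: "p (v \<odot>\<^bsub>E\<^esub> m) = i2 v" if v: "v \<in> carrier loop_module" for v
    proof -
      have vA: "v \<in> carrier A" "loop_projection v = v"
        using v cyclic_projectionD(2)[OF cyclic_projection_loop] loop_projection_coord(5) by (auto simp: loop_module_def)
      have "p (v \<odot>\<^bsub>E\<^esub> m) = v \<odot>\<^bsub>T_loop\<^esub> i2 e1" using pD(3)[OF vA(1) mE] pm by (simp add: t_def)
      also have "\<dots> = i2 (v \<odot>\<^bsub>loop_module\<^esub> e1)" using mD(7)[OF vA(1) loop_generator] by simp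
      also have "\<dots> = i2 v" using gen[OF vA(1)] vA(2) by simp
      finally show ?thesis .
    qed
    show "\<exists>s\<in>module_Hom A T_loop E. \<forall>u\<in>carrier T_loop. p (s u) = u"
    proof (rule bexI[OF _ module_Hom_direct_sum[OF W(1) X(1) E s1(1) s2 m(3) m(4)]], intro ballI)
      fix u assume u: "u \<in> carrier T_loop"
      have c: "p1 u \<in> carrier (vertex_module e1)" "p2 u \<in> carrier loop_module" using mD(9,13) u by auto
      have vA: "p2 u \<in> carrier A" by (rule loop_module_act(5)[OF c(2)])
      have "p (s1 (p1 u) \<oplus>\<^bsub>E\<^esub> p2 u \<odot>\<^bsub>E\<^esub> m) = i1 (p1 u) \<oplus>\<^bsub>T_loop\<^esub> i2 (p2 u)"
        using pD(2)[OF module_HomD(1)[OF s1(1) c(1)] E.smult_closed[OF vA mE]] s1(2)[OF c(1)] ps2[OF c(2)] by simp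
      then show "p ((\<lambda>u\<in>carrier T_loop. s1 (p1 u) \<oplus>\<^bsub>E\<^esub> (\<lambda>v\<in>carrier loop_module. v \<odot>\<^bsub>E\<^esub> m) (p2 u)) u) = u"
        using u c(2) dec[OF u] by simp
    qed
  qed
qed

lemma basic_tilting_T_loop: "basic_tilting K A T_loop"
proof -
  note T = summand_properties(5)
  note L = fd_left_module[OF T]
  have "card (iso_classes A {M. indecomposable K A M \<and> direct_summand K A M T_loop}) = 2"
    by (rule card_indecomposable_summands_direct_sum)
      (use indecomposable_vertex_module[OF vertices(1)] indecomposable_loop_module summands_not_iso
        indecomposable_retracts(2)[OF _ _ L summand_properties(6,7)] in auto)
  then show ?thesis
    unfolding basic_tilting_def tilting_def partial_tilting_def num_simples_eq_2
    using T projective_dimension_loop_free[OF T summand_properties(6)] Ext1_vanishes_T_loop T_sums(2)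
    by blast
qed

end

section \<open>From the number of summand classes to the number of summands\<close>

context fin_dim_algebra
begin

text \<open>A basic tilting module comes with an unspecified number m of summands. Three or more
  cannot be pairwise non-isomorphic when only X and Y are available; at most one summand yields at
  most one class of indecomposable retracts. So m = 2.\<close>

lemma sum_of_distinct_indecomposables_two:
  fixes X Y :: "('k, nat \<Rightarrow> 'k) fmod"
  assumes S: "sum_of_distinct_indecomposables K A m T" "left_module A T" "left_module A X" "left_module A Y"
    and cls: "\<And>N. indecomposable K A N \<Longrightarrow> retract_of A N T \<Longrightarrow> module_iso A N X \<or> module_iso A N Y"
    and card: "card (iso_classes A {M. indecomposable K A M \<and> direct_summand K A M T}) = 2"
  shows "module_iso A T (direct_sum X Y)"
proof -
  obtain F :: "nat \<Rightarrow> ('k, nat \<Rightarrow> 'k) fmod" where F: "\<And>i. i < m \<Longrightarrow> indecomposable K A (F i)"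
    "\<And>i j. i < m \<Longrightarrow> j < m \<Longrightarrow> i \<noteq> j \<Longrightarrow> \<not> module_iso A (F i) (F j)" "module_iso A T (family_sum {..<m} F)"
    using S(1) unfolding sum_of_distinct_indecomposables_def by metis
  have IL: "left_module A N" if "indecomposable K A N" for N
    using that fd_left_module by (auto simp: indecomposable_def)
  have FL: "left_module A (F i)" if "i \<in> {..<m}" for i using IL F(1) that by simp
  have SL: "left_module A (family_sum {..<m} F)" by (rule left_module_family_sum[OF A.ring_axioms FL])
  note T_S = module_iso_retract[OF F(3) S(2) SL]
  have "\<not> 2 < m"
  proof
    assume "2 < m"
    then have i: "0 < m" "1 < m" "2 < m" by auto
    have c: "module_iso A (F i) X \<or> module_iso A (F i) Y" if "i < m" for i
      using cls[OF F(1)[OF that]] retract_of_trans[OF retract_of_family_sum[OF A.ring_axioms FL] T_S(2) FL S(2)] that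
      by simp
    have n: "\<not> (module_iso A (F i) Z \<and> module_iso A (F j) Z)" if "i < m" "j < m" "i \<noteq> j" "left_module A Z"
      for i j and Z :: "('k, nat \<Rightarrow> 'k) fmod"
      using F(2)[OF that(1-3)] module_iso_trans module_iso_sym FL that by (metis lessThan_iff)
    show False
      using c[OF i(1)] c[OF i(2)] c[OF i(3)] n[OF i(1,2) _ S(3)] n[OF i(1,3) _ S(3)] n[OF i(2,3) _ S(3)]
        n[OF i(1,2) _ S(4)] n[OF i(1,3) _ S(4)] n[OF i(2,3) _ S(4)] by auto
  qed
  moreover have "\<not> m < 2"
  proof
    assume "m < 2"
    define R where "R = {M. indecomposable K A M \<and> direct_summand K A M T}"
    have RS: "retract_of A N (family_sum {..<m} F)" if "N \<in> R" for N
      using retract_of_trans[OF direct_summand_retract[of K A N T, OF _ S(2)] T_S(1) IL SL] that by (simp add: R_def)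
    have "\<exists>Z :: ('k, nat \<Rightarrow> 'k) fmod. left_module A Z \<and> (\<forall>N\<in>R. module_iso A N Z)"
    proof (cases "m = 0")
      case True
      have "R = {}"
      proof (rule ccontr)
        assume "R \<noteq> {}"
        then obtain N where N: "N \<in> R" by blast
        then have NI: "indecomposable K A N" by (simp add: R_def)
        interpret N: left_module A N by (rule IL[OF NI])
        \<comment> \<open>The empty sum is zero, so the unit acts as zero on it and on each of its
          retracts.\<close>
        have "\<forall>u\<in>carrier (family_sum {..<m} F). \<one> \<odot>\<^bsub>family_sum {..<m} F\<^esub> u = \<zero>\<^bsub>family_sum {..<m} F\<^esub>"
          by (simp add: True family_sum_def restrict_def)
        then have "n = \<zero>\<^bsub>N\<^esub>" if "n \<in> carrier N" for n
          using annihilated_retract[OF RS[OF N] SL IL[OF NI], of \<one> n] that by simp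
        then have "zero_module N" unfolding zero_module_def using N.M.zero_closed by blast
        then show False using NI by (simp add: indecomposable_def)
      qed
      then show ?thesis using S(3) by blast
    next
      case False
      then have m: "m = 1" using \<open>m < 2\<close> by simp
      define g where "g = (\<lambda>u\<in>carrier (family_sum {..<m} F). u 0)"
      have "module_iso A (family_sum {..<m} F) (F 0)"
        unfolding module_iso_def
      proof (rule bexI[of _ g])
        show "g \<in> module_Hom A (family_sum {..<m} F) (F 0)"
          unfolding g_def by (rule module_HomI[OF SL]) (auto simp: m family_sum_def)
        show "bij_betw g (carrier (family_sum {..<m} F)) (carrier (F 0))"
          by (rule bij_betw_byWitness[where f' = "\<lambda>v. \<lambda>i\<in>{..<m}. v"])
            (auto simp: g_def m family_sum_def fun_eq_iff PiE_def extensional_def)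
      qed
      note r = module_iso_retract(1)[OF this SL FL]
      have "module_iso A N (F 0)" if N: "N \<in> R" for N
      proof -
        have NI: "indecomposable K A N" using N by (simp add: R_def)
        have "module_iso A (F 0) N"
          using indecomposable_retract_iso[OF F(1) _ retract_of_trans[OF RS[OF N] r IL[OF NI] FL]] NI m
          by (simp add: indecomposable_def)
        then show ?thesis using module_iso_sym[OF _ FL IL[OF NI]] m by simp
      qed
      then show ?thesis using FL m by auto
    qed
    then obtain Z :: "('k, nat \<Rightarrow> 'k) fmod" where Z: "left_module A Z" "\<And>N. N \<in> R \<Longrightarrow> module_iso A N Z" by blast
    have "\<exists>C. iso_classes A R \<subseteq> {C}"
      by (rule iso_classes_subset_singleton[OF _ Z(2,1)]) (use IL in \<open>auto simp: R_def\<close>)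
    then obtain C where "iso_classes A R \<subseteq> {C}" by blast
    then have "card (iso_classes A R) \<le> 1" using card_mono[of "{C}"] by fastforce
    then show False using card by (simp add: R_def)
  qed
  ultimately have "m = 2" by simp
  then show ?thesis using sum_of_two_indecomposables_unique[OF _ S(2-4) cls] S(1) by simp
qed

end

section \<open>The algebra with the arrow entering the loop\<close>

locale arrow_in_algebra = loop_arrow_algebra K A e1 e2 x a c1 c2 c3 c4
  for K :: "'k ring" and A :: "('k, nat \<Rightarrow> 'k) module" (structure)
    and e1 e2 x a :: "nat \<Rightarrow> 'k" and c1 c2 c3 c4 :: "(nat \<Rightarrow> 'k) \<Rightarrow> 'k" +
  assumes arrow_in [simp]: "a \<otimes> e2 = a" "e1 \<otimes> a = a"
begin

lemma arrow_in_zero [simp]: "e2 \<otimes> a = \<zero>" "a \<otimes> e1 = \<zero>"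
proof -
  show "e2 \<otimes> a = \<zero>" using arrow_ends basis_nonzero(4) by auto
  have "a \<otimes> e1 = (a \<otimes> e2) \<otimes> e1" by simp
  also have "\<dots> = \<zero>" by (simp only: A.m_assoc basis_closed table A.r_null)
  finally show "a \<otimes> e1 = \<zero>" .
qed

text \<open>The radical of a projective module is both the image and the kernel of this element.\<close>

abbreviation "z \<equiv> x \<oplus> a"

lemma z_left:
  assumes "r \<in> carrier A"
  shows "z \<otimes> r = scal (c1 r) \<otimes> x \<oplus> scal (c2 r) \<otimes> a"
proof -
  have "a \<otimes> r = a \<otimes> (scal (c1 r) \<otimes> e1 \<oplus> scal (c2 r) \<otimes> e2 \<oplus> (scal (c3 r) \<otimes> x \<oplus> scal (c4 r) \<otimes> a))"
    using basis_expansion[OF assms] by simp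
  also have "\<dots> = scal (c2 r) \<otimes> a" using assms by (simp add: A.r_distr vertex_times_scal)
  finally show ?thesis using assms by (simp add: A.l_distr x_left)
qed

lemma act_arrow:
  assumes "left_module A M" "m \<in> carrier M"
  shows "e1 \<odot>\<^bsub>M\<^esub> (a \<odot>\<^bsub>M\<^esub> m) = a \<odot>\<^bsub>M\<^esub> m" "e2 \<odot>\<^bsub>M\<^esub> (a \<odot>\<^bsub>M\<^esub> m) = \<zero>\<^bsub>M\<^esub>"
    "a \<odot>\<^bsub>M\<^esub> (e1 \<odot>\<^bsub>M\<^esub> m) = \<zero>\<^bsub>M\<^esub>" "a \<odot>\<^bsub>M\<^esub> (e2 \<odot>\<^bsub>M\<^esub> m) = a \<odot>\<^bsub>M\<^esub> m"
    "z \<odot>\<^bsub>M\<^esub> m = x \<odot>\<^bsub>M\<^esub> m \<oplus>\<^bsub>M\<^esub> a \<odot>\<^bsub>M\<^esub> m"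
proof -
  interpret M: left_module A M by fact
  show "e1 \<odot>\<^bsub>M\<^esub> (a \<odot>\<^bsub>M\<^esub> m) = a \<odot>\<^bsub>M\<^esub> m" "e2 \<odot>\<^bsub>M\<^esub> (a \<odot>\<^bsub>M\<^esub> m) = \<zero>\<^bsub>M\<^esub>"
    "a \<odot>\<^bsub>M\<^esub> (e1 \<odot>\<^bsub>M\<^esub> m) = \<zero>\<^bsub>M\<^esub>" "a \<odot>\<^bsub>M\<^esub> (e2 \<odot>\<^bsub>M\<^esub> m) = a \<odot>\<^bsub>M\<^esub> m"
    using assms(2) by (simp_all flip: M.smult_assoc1)
  show "z \<odot>\<^bsub>M\<^esub> m = x \<odot>\<^bsub>M\<^esub> m \<oplus>\<^bsub>M\<^esub> a \<odot>\<^bsub>M\<^esub> m" using assms(2) by (simp add: M.smult_l_distr)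
qed

lemma act_z:
  assumes "left_module A M" "m \<in> carrier M"
  shows "x \<odot>\<^bsub>M\<^esub> (z \<odot>\<^bsub>M\<^esub> m) = \<zero>\<^bsub>M\<^esub>" "a \<odot>\<^bsub>M\<^esub> (z \<odot>\<^bsub>M\<^esub> m) = \<zero>\<^bsub>M\<^esub>" "z \<odot>\<^bsub>M\<^esub> (z \<odot>\<^bsub>M\<^esub> m) = \<zero>\<^bsub>M\<^esub>"
    "e1 \<odot>\<^bsub>M\<^esub> (z \<odot>\<^bsub>M\<^esub> m) = z \<odot>\<^bsub>M\<^esub> m" "e2 \<odot>\<^bsub>M\<^esub> (z \<odot>\<^bsub>M\<^esub> m) = \<zero>\<^bsub>M\<^esub>"
    "z \<odot>\<^bsub>M\<^esub> (e1 \<odot>\<^bsub>M\<^esub> m) = x \<odot>\<^bsub>M\<^esub> m" "z \<odot>\<^bsub>M\<^esub> (e2 \<odot>\<^bsub>M\<^esub> m) = a \<odot>\<^bsub>M\<^esub> m" "z \<odot>\<^bsub>M\<^esub> m \<in> carrier M"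
proof -
  interpret M: left_module A M by fact
  note act = act_simps[OF assms] act_arrow[OF assms]
  show "x \<odot>\<^bsub>M\<^esub> (z \<odot>\<^bsub>M\<^esub> m) = \<zero>\<^bsub>M\<^esub>" "a \<odot>\<^bsub>M\<^esub> (z \<odot>\<^bsub>M\<^esub> m) = \<zero>\<^bsub>M\<^esub>"
    "e1 \<odot>\<^bsub>M\<^esub> (z \<odot>\<^bsub>M\<^esub> m) = z \<odot>\<^bsub>M\<^esub> m" "e2 \<odot>\<^bsub>M\<^esub> (z \<odot>\<^bsub>M\<^esub> m) = \<zero>\<^bsub>M\<^esub>" "z \<odot>\<^bsub>M\<^esub> m \<in> carrier M"
    using assms(2) by (simp_all add: act M.smult_r_distr)
  then show "z \<odot>\<^bsub>M\<^esub> (z \<odot>\<^bsub>M\<^esub> m) = \<zero>\<^bsub>M\<^esub>" using act_arrow(5)[OF assms(1), of "z \<odot>\<^bsub>M\<^esub> m"] by simp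
  show "z \<odot>\<^bsub>M\<^esub> (e1 \<odot>\<^bsub>M\<^esub> m) = x \<odot>\<^bsub>M\<^esub> m" "z \<odot>\<^bsub>M\<^esub> (e2 \<odot>\<^bsub>M\<^esub> m) = a \<odot>\<^bsub>M\<^esub> m"
    using assms(2) act_arrow(5)[OF assms(1)] by (simp_all add: act)
qed

text \<open>On e1 M the element \<open>z\<close> acts as \<open>x\<close>, on e2 M as
  \<open>a\<close>, and its square is zero. So this condition says that the kernel and the image of
  \<open>z\<close> agree.\<close>

abbreviation radical_exact :: "('k, nat \<Rightarrow> 'k) fmod \<Rightarrow> bool" where
  "radical_exact M \<equiv> divisible_on M {z} z"

text \<open>The elements killed by \<open>e2\<close> form e1 M, which contains z M in any case; the
  condition makes the two equal.\<close>

abbreviation radical_onto :: "('k, nat \<Rightarrow> 'k) fmod \<Rightarrow> bool" where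
  "radical_onto M \<equiv> divisible_on M {e2} z"

text \<open>Left multiplication by \<open>z\<close> sends r to c1 r x + c2 r a, so its kernel is
  spanned by x = z e1 and a = z e2.\<close>

lemma radical_exact_regular: "radical_exact (regular A)"
  unfolding divisible_on_def
proof (intro ballI impI)
  fix r assume "r \<in> carrier (regular A)" "\<forall>s\<in>{z}. s \<odot>\<^bsub>regular A\<^esub> r = \<zero>\<^bsub>regular A\<^esub>"
  then have r: "r \<in> carrier A" "z \<otimes> r = \<zero>" by auto
  then have c: "c1 r = \<zero>\<^bsub>K\<^esub>" "c2 r = \<zero>\<^bsub>K\<^esub>"
    using scal_basis_eq_zero(1)[of "c1 r" "c2 r"] z_left[OF r(1)] by auto
  have "r = scal (c3 r) \<otimes> x \<oplus> scal (c4 r) \<otimes> a"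
    by (subst basis_expansion[OF r(1)]) (use r(1) c in simp)
  also have "\<dots> = z \<otimes> (scal (c3 r) \<otimes> e1 \<oplus> scal (c4 r) \<otimes> e2)"
    using r(1) by (simp add: A.r_distr A.l_distr vertex_times_scal)
  finally have "r = z \<otimes> (scal (c3 r) \<otimes> e1 \<oplus> scal (c4 r) \<otimes> e2)" .
  then show "\<exists>s\<in>carrier (regular A). r = z \<odot>\<^bsub>regular A\<^esub> s"
    unfolding regular_simps by (rule bexI[of "\<lambda>s. r = z \<otimes> s"]) (simp add: r(1))
qed

lemma projective_radical_exact: "projective K A P \<Longrightarrow> radical_exact P"
  using projective_divisible_on[OF _ radical_exact_regular] by auto

text \<open>As \<open>z\<close> has square zero, it is a differential on every module, and
  \<open>radical_exact\<close> is the vanishing of its homology. Homology vanishes on P0 and P1,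
  hence on M, by the long exact sequence of 0 \<rightarrow> P1 \<rightarrow> P0 \<rightarrow> M
  \<rightarrow> 0; the proof is the corresponding diagram chase.\<close>

lemma projective_dimension_radical_exact:
  assumes "projective_dimension K A M \<le> 1" "left_module A M"
  shows "radical_exact M"
  unfolding divisible_on_def
proof (intro ballI impI)
  obtain P0 P1 :: "('k, nat \<Rightarrow> 'k) fmod" and d e where P: "projective K A P0" "projective K A P1"
    and e: "e \<in> module_Hom A P0 M" "e ` carrier P0 = carrier M" and d: "d \<in> module_Hom A P1 P0"
    and ex: "d ` carrier P1 = a_kernel P0 M e" and inj: "\<And>q. q \<in> carrier P1 \<Longrightarrow> d q = \<zero>\<^bsub>P0\<^esub> \<Longrightarrow> q = \<zero>\<^bsub>P1\<^esub>"
    by (rule projective_dimension_le_1E[OF assms]) (rule that)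
  note L0 = projective_left_module[OF P(1)] and L1 = projective_left_module[OF P(2)]
  interpret M: left_module A M by fact
  interpret P0: left_module A P0 by (rule L0)
  interpret P1: left_module A P1 by (rule L1)
  have zA: "z \<in> carrier A" by simp
  note eD = module_HomD[OF e(1)] and dD = module_HomD[OF d]
  fix m assume m: "m \<in> carrier M" "\<forall>r\<in>{z}. r \<odot>\<^bsub>M\<^esub> m = \<zero>\<^bsub>M\<^esub>"
  obtain p where p: "p \<in> carrier P0" "e p = m" using e(2) m(1) by (metis imageE)
  have "z \<odot>\<^bsub>P0\<^esub> p \<in> d ` carrier P1"
    unfolding ex using p m(2) eD(3)[OF zA p(1)] act_z(8)[OF L0 p(1)] by (simp add: in_a_kernel_iff)
  then obtain q where q: "q \<in> carrier P1" "d q = z \<odot>\<^bsub>P0\<^esub> p" by (metis imageE)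
  have "d (z \<odot>\<^bsub>P1\<^esub> q) = \<zero>\<^bsub>P0\<^esub>" using dD(3)[OF zA q(1)] q(2) act_z(3)[OF L0 p(1)] by simp
  then have "z \<odot>\<^bsub>P1\<^esub> q = \<zero>\<^bsub>P1\<^esub>" using inj act_z(8)[OF L1 q(1)] by blast
  then obtain q' where q': "q' \<in> carrier P1" "q = z \<odot>\<^bsub>P1\<^esub> q'"
    using projective_radical_exact[OF P(2)] q(1) unfolding divisible_on_def by blast
  have dq': "d q' \<in> carrier P0" "e (d q') = \<zero>\<^bsub>M\<^esub>"
    using dD(1)[OF q'(1)] ex q'(1) by (auto simp: in_a_kernel_iff set_eq_iff)
  have "z \<odot>\<^bsub>P0\<^esub> (p \<ominus>\<^bsub>P0\<^esub> d q') = \<zero>\<^bsub>P0\<^esub>"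
    using P0.scalar_diff[OF zA p(1) dq'(1)] dD(3)[OF zA q'(1)] q(2) q'(2) P0.diff_eq_zero_iff act_z(8)[OF L0] p(1) by metis
  then obtain r where r: "r \<in> carrier P0" "p \<ominus>\<^bsub>P0\<^esub> d q' = z \<odot>\<^bsub>P0\<^esub> r"
    using projective_radical_exact[OF P(1)] p(1) dq'(1) unfolding divisible_on_def
    by (metis P0.M.minus_closed singletonD)
  have "p = z \<odot>\<^bsub>P0\<^esub> r \<oplus>\<^bsub>P0\<^esub> d q'" using P0.diff_add_cancel(1)[OF p(1) dq'(1)] r(2) by simp
  then have "m = e (z \<odot>\<^bsub>P0\<^esub> r \<oplus>\<^bsub>P0\<^esub> d q')" using p(2) by simp
  also have "\<dots> = z \<odot>\<^bsub>M\<^esub> e r"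
    using eD(2)[OF act_z(8)[OF L0 r(1)] dq'(1)] eD(3)[OF zA r(1)] dq'(2) act_z(8)[OF assms(2) eD(1)[OF r(1)]] by simp
  finally show "\<exists>m'\<in>carrier M. m = z \<odot>\<^bsub>M\<^esub> m'" using eD(1)[OF r(1)] by blast
qed

text \<open>\<open>tau_rigid_divisible\<close> is used with j = s = z and d = 1: one element
  violating exactness makes every element of e1 T divisible by \<open>z\<close>.\<close>

lemma tau_rigid_onto_or_exact:
  assumes "tau_rigid K A T" "fd_module K A T"
  shows "radical_onto T \<or> radical_exact T"
proof (rule disjCI)
  assume "\<not> radical_exact T"
  note TL = fd_left_module[OF assms(2)]
  interpret T: left_module A T by (rule TL)
  have zA: "z \<in> carrier A" by simp
  obtain t where t: "t \<in> carrier T" "z \<odot>\<^bsub>T\<^esub> t = \<zero>\<^bsub>T\<^esub>" "\<And>t'. t' \<in> carrier T \<Longrightarrow> t \<noteq> z \<odot>\<^bsub>T\<^esub> t'"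
    using \<open>\<not> radical_exact T\<close> unfolding divisible_on_def by blast
  show "radical_onto T"
    unfolding divisible_on_def
  proof (intro ballI impI)
    fix w assume w: "w \<in> carrier T" "\<forall>r\<in>{e2}. r \<odot>\<^bsub>T\<^esub> w = \<zero>\<^bsub>T\<^esub>"
    then have e1w: "e1 \<odot>\<^bsub>T\<^esub> w = w" using act_e2_zero(1)[OF TL w(1)] by simp
    have "\<exists>t'\<in>carrier T. \<exists>k\<in>carrier K. \<exists>k3\<in>carrier K. \<exists>k4\<in>carrier K. k \<noteq> \<zero>\<^bsub>K\<^esub> \<and>
      scal k \<odot>\<^bsub>T\<^esub> w \<oplus>\<^bsub>T\<^esub> (scal k3 \<odot>\<^bsub>T\<^esub> (e1 \<odot>\<^bsub>T\<^esub> (x \<odot>\<^bsub>T\<^esub> w)) \<oplus>\<^bsub>T\<^esub> scal k4 \<odot>\<^bsub>T\<^esub> (e1 \<odot>\<^bsub>T\<^esub> (a \<odot>\<^bsub>T\<^esub> w))) = z \<odot>\<^bsub>T\<^esub> t'"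
    proof (rule tau_rigid_divisible[OF assms vertices(1) zA _ t radical_exact_regular])
      show "\<forall>r\<in>{z}. r \<odot>\<^bsub>P\<^esub> (\<one> \<odot>\<^bsub>P\<^esub> y) = \<zero>\<^bsub>P\<^esub>"
        if "left_module A P" "y \<in> carrier P" "z \<odot>\<^bsub>P\<^esub> y = \<zero>\<^bsub>P\<^esub>" for P :: "('k, nat \<Rightarrow> 'k) fmod" and y
        using left_module.smult_one[OF that(1,2)] that(3) by simp
      show "e1 \<otimes> z = z" by (simp add: A.r_distr)
      show "\<one> \<odot>\<^bsub>T\<^esub> t = t" using t(1) by simp
    qed (use e1w w in simp_all)
    moreover have "a \<odot>\<^bsub>T\<^esub> w = \<zero>\<^bsub>T\<^esub>" "z \<odot>\<^bsub>T\<^esub> w = x \<odot>\<^bsub>T\<^esub> w" "e1 \<odot>\<^bsub>T\<^esub> (x \<odot>\<^bsub>T\<^esub> w) = x \<odot>\<^bsub>T\<^esub> w"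
      using act_arrow(3)[OF TL w(1)] act_z(6)[OF TL w(1)] act_simps(5)[OF TL w(1)] e1w by simp_all
    ultimately obtain t' k k3 where k: "t' \<in> carrier T" "k \<in> carrier K" "k \<noteq> \<zero>\<^bsub>K\<^esub>" "k3 \<in> carrier K"
      "scal k \<odot>\<^bsub>T\<^esub> w \<oplus>\<^bsub>T\<^esub> scal k3 \<odot>\<^bsub>T\<^esub> (z \<odot>\<^bsub>T\<^esub> w) = z \<odot>\<^bsub>T\<^esub> t'"
      using w by auto
    \<comment> \<open>The surviving radical term is a multiple of z w and can be moved to the
      divisible side.\<close>
    have "scal k \<odot>\<^bsub>T\<^esub> w = z \<odot>\<^bsub>T\<^esub> t' \<ominus>\<^bsub>T\<^esub> scal k3 \<odot>\<^bsub>T\<^esub> (z \<odot>\<^bsub>T\<^esub> w)"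
      using T.diff_add_cancel(3)[of "scal k \<odot>\<^bsub>T\<^esub> w" "scal k3 \<odot>\<^bsub>T\<^esub> (z \<odot>\<^bsub>T\<^esub> w)"] k(5)
        T.smult_closed[OF scal_closed] k(2,4) w(1) act_z(8)[OF TL w(1)] by simp
    also have "\<dots> = z \<odot>\<^bsub>T\<^esub> (t' \<ominus>\<^bsub>T\<^esub> scal k3 \<odot>\<^bsub>T\<^esub> w)"
      using T.scalar_diff[OF zA k(1) T.smult_closed[OF scal_closed[OF k(4)] w(1)]] act_scal[OF TL w(1) zA k(4)] by simp
    finally have eq: "scal k \<odot>\<^bsub>T\<^esub> w = z \<odot>\<^bsub>T\<^esub> (t' \<ominus>\<^bsub>T\<^esub> scal k3 \<odot>\<^bsub>T\<^esub> w)" .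
    show "\<exists>m'\<in>carrier T. w = z \<odot>\<^bsub>T\<^esub> m'"
      by (rule divide_by_scal[OF TL k(2,3) w(1) _ zA eq]) (use k(1,4) w(1) in simp)
  qed
qed

text \<open>From e1 M = z M and x z = 0 it follows that \<open>x\<close> kills e1 M, hence all of M;
  then \<open>z\<close> and \<open>a\<close> act alike and e1 M = a M.\<close>

lemma radical_onto_D:
  assumes "left_module A M" "radical_onto M" "m \<in> carrier M"
  shows "x \<odot>\<^bsub>M\<^esub> m = \<zero>\<^bsub>M\<^esub>" "\<exists>m'\<in>carrier M. e1 \<odot>\<^bsub>M\<^esub> m = a \<odot>\<^bsub>M\<^esub> m'"
proof -
  interpret M: left_module A M by fact
  have *: "\<exists>m'\<in>carrier M. e1 \<odot>\<^bsub>M\<^esub> m = z \<odot>\<^bsub>M\<^esub> m'" if "m \<in> carrier M" for m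
    using assms(2) that act_simps(4)[OF assms(1) that] unfolding divisible_on_def by simp
  have x: "x \<odot>\<^bsub>M\<^esub> m = \<zero>\<^bsub>M\<^esub>" if m: "m \<in> carrier M" for m
  proof -
    obtain m' where "m' \<in> carrier M" "e1 \<odot>\<^bsub>M\<^esub> m = z \<odot>\<^bsub>M\<^esub> m'" using *[OF m] by blast
    then show ?thesis using act_simps(6)[OF assms(1) m] act_z(1)[OF assms(1)] by metis
  qed
  show "x \<odot>\<^bsub>M\<^esub> m = \<zero>\<^bsub>M\<^esub>" using x assms(3) .
  obtain m' where m': "m' \<in> carrier M" "e1 \<odot>\<^bsub>M\<^esub> m = z \<odot>\<^bsub>M\<^esub> m'" using *[OF assms(3)] by blast
  then have "e1 \<odot>\<^bsub>M\<^esub> m = a \<odot>\<^bsub>M\<^esub> m'" using act_arrow(5)[OF assms(1) m'(1)] x[OF m'(1)] by simp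
  then show "\<exists>m'\<in>carrier M. e1 \<odot>\<^bsub>M\<^esub> m = a \<odot>\<^bsub>M\<^esub> m'" using m'(1) by blast
qed

text \<open>The loop acts as zero on T and even on the projective cover P, while Q is concentrated
  at the first vertex. A linear extension of Q \<rightarrow> T to P then only has to be completed on
  e2 P, where divisibility by \<open>a\<close> in T supplies the values.\<close>

lemma tau_rigid_if_onto:
  assumes T: "fd_module K A T" "radical_onto T"
  shows "tau_rigid K A T"
proof -
  note TL = fd_left_module[OF T(1)]
  interpret T: left_module A T by (rule TL)
  note xT = radical_onto_D(1)[OF TL T(2)]
  obtain Q P f p where Q: "projective K A Q" and P: "projective K A P"
    and p: "p \<in> module_Hom A P T" "p ` carrier P = carrier T" and f: "f \<in> module_Hom A Q P"
    and fp: "f ` carrier Q = a_kernel P T p" and pJ: "a_kernel P T p \<subseteq> rad P"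
    and fJ: "\<And>q. q \<in> carrier Q \<Longrightarrow> f q = \<zero>\<^bsub>P\<^esub> \<Longrightarrow> q \<in> rad Q"
    and crit: "tau_rigid K A T \<longleftrightarrow> (\<forall>h\<in>module_Hom A Q T. \<exists>g\<in>module_Hom A P T. \<forall>q\<in>carrier Q. h q = g (f q))"
    by (rule tau_rigid_presentation[OF T(1)]) blast
  note QL = projective_left_module[OF Q] and PL = projective_left_module[OF P]
  interpret P: left_module A P by (rule PL)
  interpret Q: left_module A Q by (rule QL)
  note pD = module_HomD[OF p(1)] and fD = module_HomD[OF f]
  note actP = act_simps[OF PL] act_arrow(1-4)[OF PL] and actQ = act_simps[OF QL] act_arrow(1-4)[OF QL]
    and actT = act_simps[OF TL] act_arrow(1-4)[OF TL]
  have f_rad: "f q \<in> rad P" if "q \<in> carrier Q" for q using that fp pJ by blast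
  have e2rad: "e2 \<odot>\<^bsub>M\<^esub> u = \<zero>\<^bsub>M\<^esub>" if "left_module A M" "u \<in> rad M" for M :: "('k, nat \<Rightarrow> 'k) fmod" and u
  proof -
    interpret M: left_module A M by fact
    show ?thesis using that(2) act_simps(7)[OF that(1)] act_arrow(2)[OF that(1)] by (auto simp: rad_def M.smult_r_distr)
  qed
  \<comment> \<open>Modulo the kernel, e1 y agrees with an element of a P; the kernel lies in the
    radical, so \<open>x\<close> annihilates both parts.\<close>
  have xP: "x \<odot>\<^bsub>P\<^esub> y = \<zero>\<^bsub>P\<^esub>" if y: "y \<in> carrier P" for y
  proof -
    obtain t where t: "t \<in> carrier T" "e1 \<odot>\<^bsub>T\<^esub> p y = a \<odot>\<^bsub>T\<^esub> t" using radical_onto_D(2)[OF TL T(2) pD(1)[OF y]] by blast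
    obtain y' where y': "y' \<in> carrier P" "p y' = t" using p(2) t(1) by (metis imageE)
    have "p (e1 \<odot>\<^bsub>P\<^esub> y) = p (a \<odot>\<^bsub>P\<^esub> y')"
      using pD(3)[OF basis_closed(1) y] pD(3)[OF basis_closed(4) y'(1)] t(2) y'(2) by simp
    then have "e1 \<odot>\<^bsub>P\<^esub> y \<ominus>\<^bsub>P\<^esub> a \<odot>\<^bsub>P\<^esub> y' \<in> a_kernel P T p"
      using y y'(1) pD(1) module_Hom_diff[OF PL TL p(1)] by (simp add: in_a_kernel_iff T.diff_eq_zero_iff)
    then have "x \<odot>\<^bsub>P\<^esub> (e1 \<odot>\<^bsub>P\<^esub> y \<ominus>\<^bsub>P\<^esub> a \<odot>\<^bsub>P\<^esub> y') = \<zero>\<^bsub>P\<^esub>" using pJ radD(2)[OF PL] by blast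
    then show ?thesis using y y'(1) by (simp add: P.scalar_diff actP P.diff_eq_zero_iff)
  qed
  \<comment> \<open>The radical of P lies at the first vertex, so \<open>f\<close> kills e2 Q.
    Minimality puts e2 Q into \<open>rad Q\<close>, which again lies at the first vertex.\<close>
  have e2Q: "e2 \<odot>\<^bsub>Q\<^esub> q = \<zero>\<^bsub>Q\<^esub>" if q: "q \<in> carrier Q" for q
  proof -
    have "f (e2 \<odot>\<^bsub>Q\<^esub> q) = \<zero>\<^bsub>P\<^esub>" using fD(3)[OF basis_closed(2) q] e2rad[OF PL f_rad[OF q]] by simp
    then have "e2 \<odot>\<^bsub>Q\<^esub> (e2 \<odot>\<^bsub>Q\<^esub> q) = \<zero>\<^bsub>Q\<^esub>" using e2rad[OF QL fJ] q by simp
    then show ?thesis using actQ(2)[OF q] by simp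
  qed
  note VQ = left_module_vec[OF QL] and VP = left_module_vec[OF PL] and VT = left_module_vec[OF TL]
  have "\<exists>g\<in>module_Hom A P T. \<forall>q\<in>carrier Q. h q = g (f q)" if h: "h \<in> module_Hom A Q T" for h
  proof -
    note hD = module_HomD[OF h]
    \<comment> \<open>The kernel of \<open>f\<close> lies in \<open>rad Q\<close> = x Q, and
      \<open>h\<close> sends x Q into x T = 0.\<close>
    have "h q = \<zero>\<^bsub>T\<^esub>" if q: "q \<in> carrier Q" "f q = \<zero>\<^bsub>P\<^esub>" for q
    proof -
      obtain m m' where m: "m \<in> carrier Q" "m' \<in> carrier Q" "q = x \<odot>\<^bsub>Q\<^esub> m \<oplus>\<^bsub>Q\<^esub> a \<odot>\<^bsub>Q\<^esub> m'"
        using fJ[OF q] by (auto simp: rad_def)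
      have "a \<odot>\<^bsub>Q\<^esub> m' = \<zero>\<^bsub>Q\<^esub>" using actQ(16)[OF m(2)] e2Q[OF m(2)] by simp
      then have "h q = x \<odot>\<^bsub>T\<^esub> h m" using m hD(3)[OF basis_closed(3) m(1)] by simp
      then show ?thesis using xT hD(1)[OF m(1)] by simp
    qed
    then obtain g1 where g1: "g1 \<in> module_Hom K (vec P) (vec T)" and g1f: "\<And>q. q \<in> carrier Q \<Longrightarrow> g1 (f q) = h q"
      and g1h: "\<And>v. v \<in> carrier P \<Longrightarrow> g1 v \<in> h ` carrier Q"
      using exists_linear_factorization[OF K.field_axioms VQ VP VT module_Hom_vec[OF f] module_Hom_vec[OF h],
          unfolded restrict_scalars_simps] by metis
    note G1 = vec_HomD[OF g1 PL TL]
    have e1g1: "e1 \<odot>\<^bsub>T\<^esub> g1 v = g1 v" "e2 \<odot>\<^bsub>T\<^esub> g1 v = \<zero>\<^bsub>T\<^esub>" "a \<odot>\<^bsub>T\<^esub> g1 v = \<zero>\<^bsub>T\<^esub>" if v: "v \<in> carrier P" for v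
    proof -
      obtain q where q: "q \<in> carrier Q" "g1 v = h q" using g1h[OF v] by blast
      show e2: "e2 \<odot>\<^bsub>T\<^esub> g1 v = \<zero>\<^bsub>T\<^esub>"
        using hD(3)[OF basis_closed(2) q(1)] e2Q[OF q(1)] q(2) module_Hom_zero[OF QL TL h] by simp
      show e1: "e1 \<odot>\<^bsub>T\<^esub> g1 v = g1 v" by (rule act_e2_zero(1)[OF TL G1(1)[OF v] e2])
      show "a \<odot>\<^bsub>T\<^esub> g1 v = \<zero>\<^bsub>T\<^esub>" using actT(15)[OF G1(1)[OF v]] e1 by simp
    qed
    obtain s where s: "s \<in> module_Hom K (vec T) (vec T)"
      "\<And>m. m \<in> carrier T \<Longrightarrow> a \<odot>\<^bsub>T\<^esub> s (a \<odot>\<^bsub>T\<^esub> m) = a \<odot>\<^bsub>T\<^esub> m"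
      using left_mult_generalized_inverse[OF TL basis_closed(4)] by metis
    note S = vec_HomD[OF s(1) TL TL]
    have as: "a \<odot>\<^bsub>T\<^esub> s (g1 v) = g1 v" if v: "v \<in> carrier P" for v
      using radical_onto_D(2)[OF TL T(2) G1(1)[OF v]] e1g1(1)[OF v] s(2) by auto
    \<comment> \<open>On e1 P this is the linear extension; on e2 P the generalized inverse
      \<open>s\<close> of \<open>a\<close> chooses values with a (g y) = g1 (a y).\<close>
    define g where "g y = e2 \<odot>\<^bsub>T\<^esub> s (g1 (a \<odot>\<^bsub>P\<^esub> y)) \<oplus>\<^bsub>T\<^esub> g1 (e1 \<odot>\<^bsub>P\<^esub> y)" for y
    have "restrict g (carrier P) \<in> module_Hom A P T"
    proof (rule module_HomI_basis[OF PL TL])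
      show "g y \<in> carrier T" if "y \<in> carrier P" for y using that G1 S by (simp add: g_def)
      show "g (y \<oplus>\<^bsub>P\<^esub> y') = g y \<oplus>\<^bsub>T\<^esub> g y'" if "y \<in> carrier P" "y' \<in> carrier P" for y y'
        using that G1 S by (simp add: g_def P.smult_r_distr T.smult_r_distr T.M.a_ac)
      show "g (scal k \<odot>\<^bsub>P\<^esub> y) = scal k \<odot>\<^bsub>T\<^esub> g y" if "k \<in> carrier K" "y \<in> carrier P" for k y
        using that G1 S by (simp add: g_def T.smult_r_distr act_scal[OF PL] act_scal[OF TL])
      show "g (r \<odot>\<^bsub>P\<^esub> y) = r \<odot>\<^bsub>T\<^esub> g y" if r: "r \<in> {e1, e2, x, a}" and y: "y \<in> carrier P" for r y
      proof -
        have c: "a \<odot>\<^bsub>P\<^esub> y \<in> carrier P" "e1 \<odot>\<^bsub>P\<^esub> y \<in> carrier P" using y by simp_all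
        note c' = S(1)[OF G1(1)[OF c(1)]] G1(1)[OF c(2)]
        have "g (e1 \<odot>\<^bsub>P\<^esub> y) = e1 \<odot>\<^bsub>T\<^esub> g y"
          using y c c' e1g1[OF c(2)] by (simp add: g_def actP actT G1(4) S(4) T.smult_r_distr)
        moreover have "g (e2 \<odot>\<^bsub>P\<^esub> y) = e2 \<odot>\<^bsub>T\<^esub> g y"
          using y c c' e1g1[OF c(2)] by (simp add: g_def actP actT G1(4) S(4) T.smult_r_distr)
        moreover have "g (x \<odot>\<^bsub>P\<^esub> y) = x \<odot>\<^bsub>T\<^esub> g y"
          using y c c' xP[OF y] xT by (simp add: g_def actP actT G1(4) S(4) T.smult_r_distr)
        moreover have "g (a \<odot>\<^bsub>P\<^esub> y) = a \<odot>\<^bsub>T\<^esub> g y"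
          using y c c' e1g1[OF c(2)] as[OF c(1)] G1(1)[OF c(1)] by (simp add: g_def actP actT G1(4) S(4) T.smult_r_distr)
        ultimately show ?thesis using r by auto
      qed
    qed
    moreover have "h q = g (f q)" if q: "q \<in> carrier Q" for q
    proof -
      have fq: "f q \<in> carrier P" using fD(1)[OF q] .
      have "a \<odot>\<^bsub>P\<^esub> f q = \<zero>\<^bsub>P\<^esub>" using radD(3)[OF PL f_rad[OF q]] .
      moreover have "e1 \<odot>\<^bsub>P\<^esub> f q = f q" by (rule act_e2_zero(1)[OF PL fq e2rad[OF PL f_rad[OF q]]])
      ultimately show ?thesis using g1f[OF q] hD(1)[OF q] by (simp add: g_def G1(4) S(4))
    qed
    ultimately show ?thesis using fD(1) by (intro bexI[of _ "restrict g (carrier P)"]) auto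
  qed
  then show ?thesis using crit by blast
qed

lemma projective_loop_module: "projective K A loop_module"
  unfolding loop_module_def
proof (rule projective_cyclic_idempotent[OF cyclic_projection_loop])
  fix r assume r: "r \<in> carrier A" "loop_projection r = \<zero>"
  have "r \<otimes> e1 = (scal (c1 r) \<otimes> e1 \<oplus> scal (c2 r) \<otimes> e2 \<oplus> (scal (c3 r) \<otimes> x \<oplus> scal (c4 r) \<otimes> a)) \<otimes> e1"
    using basis_expansion[OF r(1)] by simp
  also have "\<dots> = loop_projection r"
    using r(1) by (simp add: loop_projection_def A.l_distr A.m_assoc)
  finally show "r \<otimes> e1 = \<zero>" using r(2) by simp
qed (simp_all add: loop_projection_one)

text \<open>A functional \<chi> vanishing on x N with \<chi> (a n) = 1 gives the map m \<mapsto>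
  \<chi> (a m) e2 + \<chi> (e1 m) a to A e2; vanishing on x N is what compatibility with the loop
  demands. It sends e2 n to the generator.\<close>

lemma indecomposable_iso_source:
  assumes N: "indecomposable K A N" and n: "n \<in> carrier N" "\<And>m. m \<in> carrier N \<Longrightarrow> a \<odot>\<^bsub>N\<^esub> n \<noteq> x \<odot>\<^bsub>N\<^esub> m"
  shows "module_iso A N (vertex_module e2)"
proof -
  note NL = indecomposable_left_module[OF N(1)]
  interpret N: left_module A N by (rule NL)
  note VN = left_module_vec[OF NL] and W = vertex_module_facts[OF vertices(2)]
  interpret V: left_module K "vec N" by (rule VN)
  note act = act_simps[OF NL] act_arrow(1-4)[OF NL] act_scal[OF NL]
  have xN: "submodule ((\<lambda>m. x \<odot>\<^bsub>N\<^esub> m) ` carrier N) K (vec N)"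
  proof (rule V.submoduleI)
    show "\<zero>\<^bsub>vec N\<^esub> \<in> (\<lambda>m. x \<odot>\<^bsub>N\<^esub> m) ` carrier N" by (rule image_eqI[of _ _ "\<zero>\<^bsub>N\<^esub>"]) simp_all
    show "u \<oplus>\<^bsub>vec N\<^esub> v \<in> (\<lambda>m. x \<odot>\<^bsub>N\<^esub> m) ` carrier N"
      if uv: "u \<in> (\<lambda>m. x \<odot>\<^bsub>N\<^esub> m) ` carrier N" "v \<in> (\<lambda>m. x \<odot>\<^bsub>N\<^esub> m) ` carrier N" for u v
    proof -
      obtain m m' where "m \<in> carrier N" "u = x \<odot>\<^bsub>N\<^esub> m" "m' \<in> carrier N" "v = x \<odot>\<^bsub>N\<^esub> m'" using uv by blast
      then show ?thesis by (intro image_eqI[of _ _ "m \<oplus>\<^bsub>N\<^esub> m'"]) (simp_all add: N.smult_r_distr)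
    qed
    show "k \<odot>\<^bsub>vec N\<^esub> u \<in> (\<lambda>m. x \<odot>\<^bsub>N\<^esub> m) ` carrier N"
      if "k \<in> carrier K" and u: "u \<in> (\<lambda>m. x \<odot>\<^bsub>N\<^esub> m) ` carrier N" for k u
    proof -
      obtain m where "m \<in> carrier N" "u = x \<odot>\<^bsub>N\<^esub> m" using u by blast
      then show ?thesis using that(1) by (intro image_eqI[of _ _ "scal k \<odot>\<^bsub>N\<^esub> m"]) (simp_all add: act, simp only: scal_def)
    qed
  qed auto
  have "a \<odot>\<^bsub>N\<^esub> n \<in> carrier (vec N)" "a \<odot>\<^bsub>N\<^esub> n \<notin> (\<lambda>m. x \<odot>\<^bsub>N\<^esub> m) ` carrier N" using n by auto
  then obtain \<chi> where \<chi>: "\<chi> \<in> module_Hom K (vec N) (regular K)" "\<chi> (a \<odot>\<^bsub>N\<^esub> n) = \<one>\<^bsub>K\<^esub>"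
    and \<chi>x: "\<And>u. u \<in> (\<lambda>m. x \<odot>\<^bsub>N\<^esub> m) ` carrier N \<Longrightarrow> \<chi> u = \<zero>\<^bsub>K\<^esub>"
    using exists_linear_functional[OF K.field_axioms VN xN, of "a \<odot>\<^bsub>N\<^esub> n"] by metis
  have \<chi>x: "\<chi> (x \<odot>\<^bsub>N\<^esub> m) = \<zero>\<^bsub>K\<^esub>" if "m \<in> carrier N" for m using \<chi>x[OF imageI[OF that]] .
  note \<chi>D = module_HomD[OF \<chi>(1), unfolded regular_simps restrict_scalars_simps(1,3) vec_smult]
  have \<chi>0: "\<chi> \<zero>\<^bsub>N\<^esub> = \<zero>\<^bsub>K\<^esub>" using \<chi>x[OF N.M.zero_closed] by simp
  define f where "f m = scal (\<chi> (a \<odot>\<^bsub>N\<^esub> m)) \<otimes> e2 \<oplus> scal (\<chi> (e1 \<odot>\<^bsub>N\<^esub> m)) \<otimes> a" for m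
  have fA: "f m \<in> carrier A" "f m \<otimes> e2 = f m" if "m \<in> carrier N" for m
    using that \<chi>D(1) by (simp_all add: f_def A.l_distr A.m_assoc)
  have fh: "restrict f (carrier N) \<in> module_Hom A N (vertex_module e2)"
  proof (rule module_HomI_basis[OF NL W(1)])
    show "f m \<in> carrier (vertex_module e2)" if "m \<in> carrier N" for m
      using fA[OF that] unfolding W(3) by (metis image_eqI)
    show "f (m \<oplus>\<^bsub>N\<^esub> m') = f m \<oplus>\<^bsub>vertex_module e2\<^esub> f m'" if "m \<in> carrier N" "m' \<in> carrier N" for m m'
      using that \<chi>D by (simp add: f_def W N.smult_r_distr scal_add A.l_distr A.a_ac)
    show "f (scal k \<odot>\<^bsub>N\<^esub> m) = scal k \<odot>\<^bsub>vertex_module e2\<^esub> f m" if k: "k \<in> carrier K" and m: "m \<in> carrier N" for k m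
    proof -
      have "f (scal k \<odot>\<^bsub>N\<^esub> m) = scal k \<otimes> f m"
        using k m \<chi>D by (simp add: f_def act scal_mult A.r_distr A.m_assoc)
      then show ?thesis using fA[OF m] k by (simp add: W A.m_assoc)
    qed
    show "f (r \<odot>\<^bsub>N\<^esub> m) = r \<odot>\<^bsub>vertex_module e2\<^esub> f m" if r: "r \<in> {e1, e2, x, a}" and m: "m \<in> carrier N" for r m
    proof -
      have c: "\<chi> (a \<odot>\<^bsub>N\<^esub> m) \<in> carrier K" "\<chi> (e1 \<odot>\<^bsub>N\<^esub> m) \<in> carrier K"
        using m \<chi>D(1) by simp_all
      show ?thesis
        using r m c by (auto simp: W f_def act \<chi>0 \<chi>x A.r_distr A.l_distr vertex_times_scal A.m_assoc)
    qed
  qed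
  have m: "e2 \<odot>\<^bsub>N\<^esub> n \<in> carrier N" "f (e2 \<odot>\<^bsub>N\<^esub> n) = \<one> \<otimes> e2"
    using n(1) \<chi>(2) \<chi>0 by (simp_all add: f_def act)
  have "r \<odot>\<^bsub>N\<^esub> (e2 \<odot>\<^bsub>N\<^esub> n) = \<zero>\<^bsub>N\<^esub>" if "r \<in> carrier A" "r \<otimes> e2 = \<zero>" for r
    using that n(1) by (simp flip: N.smult_assoc1)
  then show ?thesis
    unfolding vertex_module_def
    using indecomposable_iso_cyclic[OF cyclic_projection_vertex[OF vertices(2)] N m(1)] fh m basis_nonzero(2)
    by (simp add: vertex_module_def)
qed

lemma radical_exact_indecomposable:
  assumes N: "indecomposable K A N" "radical_exact N"
  shows "module_iso A N loop_module \<or> module_iso A N (vertex_module e2)"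
proof (rule disjCI, rule ccontr)
  assume no: "\<not> module_iso A N (vertex_module e2)" "\<not> module_iso A N loop_module"
  note NL = indecomposable_left_module[OF N(1)]
  interpret N: left_module A N by (rule NL)
  note act = act_simps[OF NL] act_arrow[OF NL]
  have a0: "a \<odot>\<^bsub>N\<^esub> m = \<zero>\<^bsub>N\<^esub>" if m: "m \<in> carrier N" for m
  proof -
    obtain n where n: "n \<in> carrier N" "a \<odot>\<^bsub>N\<^esub> m = x \<odot>\<^bsub>N\<^esub> n"
      using indecomposable_iso_source[OF N(1) m] no(1) by blast
    \<comment> \<open>Chosen so that z u = a m - x n = 0. By exactness u lies in z N, which has no
      component at the second vertex, so e2 m = 0.\<close>
    define u where "u = e2 \<odot>\<^bsub>N\<^esub> m \<ominus>\<^bsub>N\<^esub> e1 \<odot>\<^bsub>N\<^esub> n"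
    have u: "u \<in> carrier N" using m n(1) by (simp add: u_def)
    have "z \<odot>\<^bsub>N\<^esub> u = a \<odot>\<^bsub>N\<^esub> m \<ominus>\<^bsub>N\<^esub> x \<odot>\<^bsub>N\<^esub> n"
      using N.scalar_diff[of z "e2 \<odot>\<^bsub>N\<^esub> m" "e1 \<odot>\<^bsub>N\<^esub> n"] act_z(6)[OF NL n(1)] act_z(7)[OF NL m] m n(1) by (simp add: u_def)
    then have "z \<odot>\<^bsub>N\<^esub> u = \<zero>\<^bsub>N\<^esub>" using n m by (simp add: N.diff_eq_zero_iff)
    then obtain y where y: "y \<in> carrier N" "u = z \<odot>\<^bsub>N\<^esub> y"
      using N(2) u unfolding divisible_on_def by blast
    have "e2 \<odot>\<^bsub>N\<^esub> u = \<zero>\<^bsub>N\<^esub>" using act_z(5)[OF NL y(1)] y(2) by simp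
    then have "e2 \<odot>\<^bsub>N\<^esub> m = \<zero>\<^bsub>N\<^esub>"
      using m n(1) by (simp add: u_def N.scalar_diff act N.diff_eq_zero_iff)
    then show ?thesis using act(16)[OF m] by simp
  qed
  moreover have "x \<odot>\<^bsub>N\<^esub> m = \<zero>\<^bsub>N\<^esub>" if "m \<in> carrier N" for m
    using indecomposable_iso_loop_module[OF N(1) that _ a0] no(2) by blast
  ultimately have z0: "z \<odot>\<^bsub>N\<^esub> m = \<zero>\<^bsub>N\<^esub>" if "m \<in> carrier N" for m
    using act(17)[OF that] that by simp
  then have "m = \<zero>\<^bsub>N\<^esub>" if "m \<in> carrier N" for m
    using N(2) that unfolding divisible_on_def by (metis singletonD)
  then have "zero_module N" unfolding zero_module_def using N.M.zero_closed by blast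
  then show False using N(1) by (simp add: indecomposable_def)
qed

text \<open>The loop acts as zero. If P(2) does not split off, the arrow acts as zero as well, so e1
  N = a N = 0 and N is the simple module at the second vertex.\<close>

lemma radical_onto_indecomposable:
  assumes N: "indecomposable K A N" "radical_onto N"
  shows "module_iso A N (vertex_module e2) \<or> module_iso A N (simple_at e2 c2)"
proof (rule disjCI, rule ccontr)
  assume no: "\<not> module_iso A N (simple_at e2 c2)" "\<not> module_iso A N (vertex_module e2)"
  note NL = indecomposable_left_module[OF N(1)]
  interpret N: left_module A N by (rule NL)
  note x0 = radical_onto_D(1)[OF NL N(2)]
  have a0: "a \<odot>\<^bsub>N\<^esub> m = \<zero>\<^bsub>N\<^esub>" if m: "m \<in> carrier N" for m
    using indecomposable_iso_source[OF N(1) m] no(2) x0 by metis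
  have e2: "e2 \<odot>\<^bsub>N\<^esub> m = m" if m: "m \<in> carrier N" for m
    using radical_onto_D(2)[OF NL N(2) m] a0 act_e2_zero(2)[OF NL m] by auto
  obtain n where n: "n \<in> carrier N" "n \<noteq> \<zero>\<^bsub>N\<^esub>"
    using N(1) by (auto simp: indecomposable_def zero_module_def)
  have "module_iso A N (simple_at e2 c2)"
    by (rule indecomposable_iso_simple_at[OF N(1) vertices(2) n(1) e2[OF n(1)] n(2)]) (use x0 a0 e2 in auto)
  then show False using no(1) by blast
qed

lemma module_properties:
  "radical_onto (vertex_module e2)" "radical_onto (simple_at e2 c2)" "\<not> radical_onto loop_module"
  "\<not> radical_exact (simple_at e2 c2)"
proof -
  note W = vertex_module_facts[OF vertices(2)] and S = simple_at_facts[OF vertices(2)] and X = loop_module_facts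
  have c2z: "c2 (z \<otimes> v) = \<zero>\<^bsub>K\<^esub>" "c1 (z \<otimes> v) = c1 (x \<otimes> v)" if "v \<in> carrier A" for v
    using that by (simp_all add: coord_mult coord_add)
  have Sz: "z \<odot>\<^bsub>simple_at e2 c2\<^esub> v = \<zero>" if "v \<in> carrier A" for v
    using c2z(1)[OF that] by (simp add: S(6))
  show "radical_onto (vertex_module e2)"
    unfolding divisible_on_def
  proof (intro ballI impI)
    fix v assume v: "v \<in> carrier (vertex_module e2)" "\<forall>r\<in>{e2}. r \<odot>\<^bsub>vertex_module e2\<^esub> v = \<zero>\<^bsub>vertex_module e2\<^esub>"
    then have vA: "v \<in> carrier A" "v \<otimes> e2 = v" by (auto simp: W A.m_assoc)
    have "e2 \<otimes> v = \<zero>" using v(2) vA by (simp add: W A.m_assoc)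
    moreover have "c2 (e2 \<otimes> v) = c2 v" using vA(1) by (simp add: coord_mult)
    ultimately have "c2 v = \<zero>\<^bsub>K\<^esub>" by simp
    moreover have "c3 v = \<zero>\<^bsub>K\<^esub>" using coord_mult(3)[OF vA(1) basis_closed(2)] vA by simp
    ultimately have "v = scal (c4 v) \<otimes> a" using vertex_right[OF vertices(2) vA] vA(1) by simp
    moreover have "z \<odot>\<^bsub>vertex_module e2\<^esub> (scal (c4 v) \<otimes> e2) = scal (c4 v) \<otimes> a"
      using vA(1) by (simp add: W vertex_times_scal A.m_assoc A.l_distr)
    ultimately have "v = z \<odot>\<^bsub>vertex_module e2\<^esub> (scal (c4 v) \<otimes> e2)" by simp
    moreover have "scal (c4 v) \<otimes> e2 \<in> carrier (vertex_module e2)"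
      unfolding W(3) using vA(1) by (intro imageI) simp
    ultimately show "\<exists>m'\<in>carrier (vertex_module e2). v = z \<odot>\<^bsub>vertex_module e2\<^esub> m'"
      by (rule bexI)
  qed
  show "radical_onto (simple_at e2 c2)"
    unfolding divisible_on_def
  proof (intro ballI impI)
    fix v assume v: "v \<in> carrier (simple_at e2 c2)" "\<forall>r\<in>{e2}. r \<odot>\<^bsub>simple_at e2 c2\<^esub> v = \<zero>\<^bsub>simple_at e2 c2\<^esub>"
    obtain k where k: "k \<in> carrier K" "v = scal k \<otimes> e2" using v(1) by (auto simp: S(3))
    then have vA: "v \<in> carrier A" by simp
    have "e2 \<odot>\<^bsub>simple_at e2 c2\<^esub> v = v" using k by (simp add: S(6) vertex_times_scal coord_scal)
    then have "v = \<zero>" using v(2) S(4) by simp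
    then have "v = z \<odot>\<^bsub>simple_at e2 c2\<^esub> v" using Sz[OF vA] by simp
    then show "\<exists>m'\<in>carrier (simple_at e2 c2). v = z \<odot>\<^bsub>simple_at e2 c2\<^esub> m'" using v(1) by blast
  qed
  show "\<not> radical_onto loop_module"
  proof
    assume "radical_onto loop_module"
    then obtain v where v: "v \<in> carrier loop_module" "e1 = z \<odot>\<^bsub>loop_module\<^esub> v"
      using loop_generator loop_module_act(3)[OF loop_generator] unfolding divisible_on_def X(4) by blast
    have "c1 (z \<odot>\<^bsub>loop_module\<^esub> v) = \<zero>\<^bsub>K\<^esub>"
      using loop_module_act(5)[OF v(1)] by (simp add: X(6) loop_projection_coord(1) coord_mult coord_add)
    then show False using v(2) coord_basis(1) by simp
  qed
  show "\<not> radical_exact (simple_at e2 c2)"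
  proof
    assume "radical_exact (simple_at e2 c2)"
    moreover have "z \<odot>\<^bsub>simple_at e2 c2\<^esub> e2 = \<zero>\<^bsub>simple_at e2 c2\<^esub>" using Sz[OF basis_closed(2)] S(4) by simp
    ultimately obtain v where v: "v \<in> carrier (simple_at e2 c2)" "e2 = z \<odot>\<^bsub>simple_at e2 c2\<^esub> v"
      using S(7) unfolding divisible_on_def by blast
    have "v \<in> carrier A" using v(1) by (auto simp: S(3))
    then show False using Sz v(2) S(8) by simp
  qed
qed

section \<open>The two tau-tilting modules when the arrow enters the loop, and the only basic
  tilting module\<close>

abbreviation "T_proj \<equiv> direct_sum loop_module (vertex_module e2)"
abbreviation "T_simple \<equiv> direct_sum (vertex_module e2) (simple_at e2 c2)"

lemma summand_properties:
  "projective K A T_proj" "radical_exact T_proj" "\<not> radical_onto T_proj"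
  "fd_module K A T_simple" "radical_onto T_simple"
proof -
  note W = vertex_module_facts[OF vertices(2)] and S = simple_at_facts[OF vertices(2)] and X = loop_module_facts
  show P: "projective K A T_proj"
    by (rule projective_direct_sum[OF projective_loop_module projective_vertex_module[OF vertices(2)]])
  show "radical_exact T_proj" by (rule projective_radical_exact[OF P])
  show "\<not> radical_onto T_proj"
    using divisible_on_retract[OF direct_sum_retracts(1)[OF X(1) W(1)] projective_left_module[OF P] X(1)]
      module_properties(3) by auto
  show "fd_module K A T_simple" by (rule fd_module_direct_sum[OF W(2) S(1)])
  show "radical_onto T_simple"
    by (rule divisible_on_direct_sum[OF W(1) S(2) module_properties(1,2)]) auto
qed

lemma indecomposable_retracts:
  assumes "indecomposable K A N" "retract_of A N T" "left_module A T"
  shows "radical_exact T \<Longrightarrow> module_iso A N loop_module \<or> module_iso A N (vertex_module e2)"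
    "radical_onto T \<Longrightarrow> module_iso A N (vertex_module e2) \<or> module_iso A N (simple_at e2 c2)"
  using radical_exact_indecomposable[OF assms(1)] radical_onto_indecomposable[OF assms(1)]
    divisible_on_retract[OF assms(2,3) indecomposable_left_module[OF assms(1)]] by auto

lemma summands_not_iso:
  "\<not> module_iso A loop_module (vertex_module e2)" "\<not> module_iso A (vertex_module e2) (simple_at e2 c2)"
  "\<not> module_iso A T_proj T_simple"
proof -
  note W = vertex_module_facts[OF vertices(2)] and S = simple_at_facts[OF vertices(2)] and X = loop_module_facts
  show "\<not> module_iso A loop_module (vertex_module e2)"
    using divisible_on_retract[OF module_iso_retract(1)[OF _ X(1) W(1)] W(1) X(1) module_properties(1)]
      module_properties(3) by auto
  show "\<not> module_iso A (vertex_module e2) (simple_at e2 c2)"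
    using divisible_on_retract[OF module_iso_retract(2)[OF _ W(1) S(2)] W(1) S(2)
        projective_radical_exact[OF projective_vertex_module[OF vertices(2)]]] module_properties(4) by auto
  note L = projective_left_module[OF summand_properties(1)] fd_left_module[OF summand_properties(4)]
  show "\<not> module_iso A T_proj T_simple"
    using divisible_on_retract[OF module_iso_retract(1)[OF _ L] L(2,1) summand_properties(5)]
      summand_properties(3) by auto
qed

lemma card_tau_tilting: "card (iso_classes A {T. tau_tilting K A T}) = 2"
proof (rule card_iso_classes_eq_2)
  note W = vertex_module_facts[OF vertices(2)] and S = simple_at_facts[OF vertices(2)] and X = loop_module_facts
  note ind = indecomposable_vertex_module[OF vertices(2)] indecomposable_simple_at[OF vertices(2)] indecomposable_loop_module
  show "T_proj \<in> {T. tau_tilting K A T}"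
    using projective_tau_rigid[OF summand_properties(1)] sum_of_two_indecomposablesI[OF ind(3,1) summands_not_iso(1)]
    by (simp add: tau_tilting_def num_simples_eq_2)
  show "T_simple \<in> {T. tau_tilting K A T}"
    using tau_rigid_if_onto[OF summand_properties(4,5)] sum_of_two_indecomposablesI[OF ind(1,2) summands_not_iso(2)]
    by (simp add: tau_tilting_def num_simples_eq_2)
  show "\<not> module_iso A T_proj T_simple" by (rule summands_not_iso(3))
  fix T assume "T \<in> {T. tau_tilting K A T}"
  then have T: "tau_rigid K A T" "sum_of_distinct_indecomposables K A 2 T" "fd_module K A T"
    by (auto simp: tau_tilting_def num_simples_eq_2 tau_rigid_def)
  show TL: "left_module A T" using fd_left_module[OF T(3)] .
  show "module_iso A T T_proj \<or> module_iso A T T_simple"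
    using tau_rigid_onto_or_exact[OF T(1,3)]
      sum_of_two_indecomposables_unique[OF T(2) TL X(1) W(1)] indecomposable_retracts(1)[OF _ _ TL]
      sum_of_two_indecomposables_unique[OF T(2) TL W(1) S(2)] indecomposable_retracts(2)[OF _ _ TL]
    by blast
qed

text \<open>Projective dimension at most one makes T \<open>radical_exact\<close>, which limits its
  indecomposable summands to the two projective ones; the count of summand classes then forces both
  to occur, each once.\<close>

lemma basic_tilting_unique: "\<exists>C. iso_classes A {T. basic_tilting K A T} \<subseteq> {C}"
proof (rule iso_classes_subset_singleton)
  note W = vertex_module_facts[OF vertices(2)] and X = loop_module_facts
  show "left_module A T_proj" using projective_left_module[OF summand_properties(1)] .
  fix T assume "T \<in> {T. basic_tilting K A T}"
  then obtain m where T: "fd_module K A T" "projective_dimension K A T \<le> 1"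
    "card (iso_classes A {M. indecomposable K A M \<and> direct_summand K A M T}) = 2"
    "sum_of_distinct_indecomposables K A m T"
    by (auto simp: basic_tilting_def tilting_def partial_tilting_def num_simples_eq_2)
  show TL: "left_module A T" using fd_left_module[OF T(1)] .
  show "module_iso A T T_proj"
    by (rule sum_of_distinct_indecomposables_two[OF T(4) TL X(1) W(1) _ T(3)])
      (rule indecomposable_retracts(1)[OF _ _ TL projective_dimension_radical_exact[OF T(2) TL]])
qed

end

section \<open>Passage to the opposite algebra\<close>

lemma (in arrow_out_algebra) arrow_in_algebra_opposite: "arrow_in_algebra K (opposite A) e1 e2 x a c1 c2 c3 c4"
proof -
  interpret O: fin_dim_algebra K "opposite A"
    by unfold_locales (rule fd_algebra_opposite[OF fd_algebra])
  \<comment> \<open>The unit and the scalar action are unchanged, so both algebras have the same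
    embedded scalars and the same coordinates.\<close>
  have s: "fin_dim_algebra.scal (opposite A) = scal" by (simp add: fun_eq_iff O.scal_def scal_def)
  have c: "c1 (scal k) = k" "c2 (scal k) = k" "c3 (scal k) = \<zero>\<^bsub>K\<^esub>" if "k \<in> carrier K" for k
    using that coord_scal[OF that A.one_closed] by simp_all
  show ?thesis
    by unfold_locales (unfold s, (simp_all add: one_eq coord_add coord_mult coord_scal(4) c scal_commute K.m_comm K.a_comm),
      (erule basis_expansion)?)
qed

section \<open>The theorem\<close>

text \<open>The coordinates \<open>0, \<dots>, 3\<close> belong to the basis \<open>e1\<close>, \<open>e2\<close>, \<open>x\<close>, \<open>a\<close>.\<close>

definition loop_arrow :: "'k ring \<Rightarrow> ('k, nat \<Rightarrow> 'k) module" where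
  "loop_arrow K =
    \<lparr>carrier = {f. (\<forall>i<4. f i \<in> carrier K) \<and> (\<forall>i\<ge>4. f i = \<zero>\<^bsub>K\<^esub>)},
     monoid.mult = (\<lambda>f g i. if i = 0 then f 0 \<otimes>\<^bsub>K\<^esub> g 0 else if i = 1 then f 1 \<otimes>\<^bsub>K\<^esub> g 1
       else if i = 2 then f 0 \<otimes>\<^bsub>K\<^esub> g 2 \<oplus>\<^bsub>K\<^esub> f 2 \<otimes>\<^bsub>K\<^esub> g 0
       else if i = 3 then f 1 \<otimes>\<^bsub>K\<^esub> g 3 \<oplus>\<^bsub>K\<^esub> f 3 \<otimes>\<^bsub>K\<^esub> g 0 else \<zero>\<^bsub>K\<^esub>),
     one = (\<lambda>i. if i < 2 then \<one>\<^bsub>K\<^esub> else \<zero>\<^bsub>K\<^esub>), ring.zero = (\<lambda>i. \<zero>\<^bsub>K\<^esub>),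
     add = (\<lambda>f g i. f i \<oplus>\<^bsub>K\<^esub> g i), smult = (\<lambda>k f i. k \<otimes>\<^bsub>K\<^esub> f i)\<rparr>"

context
  fixes K :: "'k ring" (structure)
  assumes field: "field K"
begin

interpretation field K by (rule field)

private abbreviation (input) L :: "('k, nat \<Rightarrow> 'k) module" where
  "L \<equiv> loop_arrow K"

abbreviation unit_vector :: "nat \<Rightarrow> nat \<Rightarrow> 'k" where
  "unit_vector j \<equiv> \<lambda>i. if i = j then \<one> else \<zero>"

lemma loop_arrow_memD: "f \<in> carrier L \<Longrightarrow> f i \<in> carrier K"
  by (cases "i < 4") (auto simp: loop_arrow_def)

lemma loop_arrow_eqI:
  assumes "f \<in> carrier L" "g \<in> carrier L" "f 0 = g 0" "f 1 = g 1" "f 2 = g 2" "f 3 = g 3"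
  shows "f = g"
proof
  fix i
  show "f i = g i"
  proof (cases "i < 4")
    case True
    then have "i = 0 \<or> i = 1 \<or> i = 2 \<or> i = 3" by linarith
    then show ?thesis using assms(3-6) by blast
  qed (use assms(1,2) in \<open>simp add: loop_arrow_def\<close>)
qed

lemma loop_arrow_simps [simp]:
  "\<zero>\<^bsub>L\<^esub> = (\<lambda>i. \<zero>)" "\<one>\<^bsub>L\<^esub> = (\<lambda>i. if i < 2 then \<one> else \<zero>)"
  "f \<oplus>\<^bsub>L\<^esub> g = (\<lambda>i. f i \<oplus> g i)" "k \<odot>\<^bsub>L\<^esub> f = (\<lambda>i. k \<otimes> f i)"
  "f \<otimes>\<^bsub>L\<^esub> g = (\<lambda>i. if i = 0 then f 0 \<otimes> g 0 else if i = 1 then f 1 \<otimes> g 1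
    else if i = 2 then f 0 \<otimes> g 2 \<oplus> f 2 \<otimes> g 0 else if i = 3 then f 1 \<otimes> g 3 \<oplus> f 3 \<otimes> g 0 else \<zero>)"
  by (simp_all add: loop_arrow_def)

lemma loop_arrow_closed:
  "(\<lambda>i. \<zero>) \<in> carrier L" "(\<lambda>i. if i < 2 then \<one> else \<zero>) \<in> carrier L"
  "j < 4 \<Longrightarrow> unit_vector j \<in> carrier L"
  "f \<in> carrier L \<Longrightarrow> g \<in> carrier L \<Longrightarrow> f \<oplus>\<^bsub>L\<^esub> g \<in> carrier L"
  "f \<in> carrier L \<Longrightarrow> g \<in> carrier L \<Longrightarrow> f \<otimes>\<^bsub>L\<^esub> g \<in> carrier L"
  "k \<in> carrier K \<Longrightarrow> f \<in> carrier L \<Longrightarrow> k \<odot>\<^bsub>L\<^esub> f \<in> carrier L"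
  by (auto simp: loop_arrow_def)

lemma abelian_group_loop_arrow: "abelian_group L"
proof (rule abelian_groupI)
  fix f assume f: "f \<in> carrier L"
  have "(\<lambda>i. \<ominus> f i) \<in> carrier L" using f by (auto simp: loop_arrow_def)
  then show "\<exists>g\<in>carrier L. g \<oplus>\<^bsub>L\<^esub> f = \<zero>\<^bsub>L\<^esub>"
    using loop_arrow_memD[OF f] by (intro bexI) (auto simp: l_neg)
qed (use loop_arrow_closed loop_arrow_memD in \<open>auto simp: a_ac fun_eq_iff\<close>)

lemma ring_loop_arrow: "ring L"
proof (rule ringI[OF abelian_group_loop_arrow])
  show "monoid L"
  proof (rule monoidI)
    fix f g h assume fgh: "f \<in> carrier L" "g \<in> carrier L" "h \<in> carrier L"
    show "f \<otimes>\<^bsub>L\<^esub> g \<otimes>\<^bsub>L\<^esub> h = f \<otimes>\<^bsub>L\<^esub> (g \<otimes>\<^bsub>L\<^esub> h)"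
      by (rule loop_arrow_eqI[OF loop_arrow_closed(5)[OF loop_arrow_closed(5)] loop_arrow_closed(5)[OF _ loop_arrow_closed(5)]])
        (use fgh[THEN loop_arrow_memD] fgh in \<open>simp_all add: m_assoc l_distr r_distr a_ac\<close>)
  qed (use loop_arrow_closed loop_arrow_memD in \<open>auto intro!: loop_arrow_eqI simp del: loop_arrow_simps(5)\<close>, auto simp: loop_arrow_memD)
qed (use loop_arrow_closed loop_arrow_memD in \<open>auto simp: l_distr r_distr a_ac fun_eq_iff\<close>)

lemma fd_algebra_loop_arrow: "fd_algebra K L"
  unfolding fd_algebra_def finite_dimensional_iff[OF cring_axioms]
proof (intro conjI ballI)
  show "left_module K L"
    by (intro left_module.intro left_module_axioms.intro ring_axioms abelian_group_loop_arrow)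
      (use loop_arrow_closed(6) loop_arrow_memD in \<open>auto simp: l_distr r_distr m_assoc fun_eq_iff\<close>)
  define B where "B = unit_vector ` {..<4}"
  show "\<exists>B. finite B \<and> B \<subseteq> carrier L \<and>
    (\<forall>U. submodule U K L \<and> B \<subseteq> U \<longrightarrow> carrier L \<subseteq> U)"
  proof (intro exI[of _ B] conjI allI impI subsetI)
    fix U f assume U: "submodule U K L \<and> B \<subseteq> U" and f: "f \<in> carrier L"
    have add: "u \<oplus>\<^bsub>L\<^esub> v \<in> U" if "u \<in> U" "v \<in> U" for u v
      using U left_module.submoduleD(3)[OF \<open>left_module K _\<close>] that by blast
    have sm: "f i \<odot>\<^bsub>L\<^esub> unit_vector i \<in> U" if "i < 4" for i
      using U left_module.submoduleD(4)[OF \<open>left_module K _\<close>] that loop_arrow_memD[OF f] by (auto simp: B_def)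
    have "f = f 0 \<odot>\<^bsub>L\<^esub> unit_vector 0 \<oplus>\<^bsub>L\<^esub> f 1 \<odot>\<^bsub>L\<^esub> unit_vector 1 \<oplus>\<^bsub>L\<^esub>
      (f 2 \<odot>\<^bsub>L\<^esub> unit_vector 2 \<oplus>\<^bsub>L\<^esub> f 3 \<odot>\<^bsub>L\<^esub> unit_vector 3)"
      by (rule loop_arrow_eqI[OF f], intro loop_arrow_closed(4,6) loop_arrow_memD[OF f] loop_arrow_closed(3))
        (use loop_arrow_memD[OF f] in simp_all)
    also have "\<dots> \<in> U" by (intro add sm) simp_all
    finally show "f \<in> U" .
  qed (auto simp: B_def intro!: loop_arrow_closed)
qed (use ring_loop_arrow field_axioms in \<open>auto simp: m_ac l_distr r_distr fun_eq_iff loop_arrow_memD\<close>)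

lemma arrow_out_algebra_loop_arrow:
  "arrow_out_algebra K L (unit_vector 0) (unit_vector 1) (unit_vector 2) (unit_vector 3)
    (\<lambda>f. f 0) (\<lambda>f. f 1) (\<lambda>f. f 2) (\<lambda>f. f 3)"
proof -
  interpret P: fin_dim_algebra K L
    by unfold_locales (rule fd_algebra_loop_arrow)
  have sc: "P.scal k \<otimes>\<^bsub>L\<^esub> f = (\<lambda>i. k \<otimes> f i)" if "k \<in> carrier K" "f \<in> carrier L" for k f
    using P.scal_mult_left[OF that] by simp
  note u = loop_arrow_closed(3)
  have expand: "r = P.scal (r 0) \<otimes>\<^bsub>L\<^esub> unit_vector 0 \<oplus>\<^bsub>L\<^esub> P.scal (r 1) \<otimes>\<^bsub>L\<^esub> unit_vector 1
    \<oplus>\<^bsub>L\<^esub> (P.scal (r 2) \<otimes>\<^bsub>L\<^esub> unit_vector 2 \<oplus>\<^bsub>L\<^esub> P.scal (r 3) \<otimes>\<^bsub>L\<^esub> unit_vector 3)"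
    if r: "r \<in> carrier L" for r
    by (rule loop_arrow_eqI[OF r], intro P.A.a_closed P.A.m_closed P.scal_closed loop_arrow_memD[OF r] u)
      (use loop_arrow_memD[OF r] in \<open>simp_all add: sc u del: loop_arrow_simps(5)\<close>)
  show ?thesis
    by unfold_locales
      ((erule expand | simp add: sc u loop_arrow_memD fun_eq_iff less_2_cases_iff del: loop_arrow_simps(5)
        | simp add: u loop_arrow_memD fun_eq_iff less_2_cases_iff)+)
qed

end

lemma two_iso_classes:
  assumes "M \<in> S" "N \<in> S" "left_module R M" "left_module R N" "\<not> module_iso R M N"
  shows "\<not> iso_classes R S \<subseteq> {C}"
proof
  define r where "r = {(M, N). M \<in> S \<and> N \<in> S \<and> module_iso R M N}"
  assume "iso_classes R S \<subseteq> {C}"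
  then have "r `` {M} = r `` {N}"
    using assms(1,2) by (auto simp: iso_classes_def quotient_def simp flip: r_def)
  moreover have "N \<in> r `` {N}" using assms(2) module_iso_refl[OF assms(4)] by (simp add: r_def)
  ultimately show False using assms(5) by (auto simp: r_def)
qed

theorem mainTheorem3:
  fixes K :: "'k ring"
  assumes "field K"
  shows "\<exists>A :: ('k, nat \<Rightarrow> 'k) module. fd_algebra K A \<and>
    iso_classes A {T. tau_tilting K A T} \<approx>
      iso_classes (opposite A) {T. tau_tilting K (opposite A) T} \<and>
    \<not> iso_classes A {T. basic_tilting K A T} \<approx>
      iso_classes (opposite A) {T. basic_tilting K (opposite A) T}"
proof (intro exI[of _ "loop_arrow K"] conjI notI)
  interpret K: field K by fact
  interpret A: arrow_out_algebra K "loop_arrow K" "unit_vector K 0" "unit_vector K 1" "unit_vector K 2" "unit_vector K 3"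
    "\<lambda>f. f 0" "\<lambda>f. f 1" "\<lambda>f. f 2" "\<lambda>f. f 3"
    by (rule arrow_out_algebra_loop_arrow[OF assms])
  note B = A.arrow_in_algebra_opposite
  show "fd_algebra K (loop_arrow K)" by (rule A.fd_algebra)
  show "iso_classes (loop_arrow K) {T. tau_tilting K (loop_arrow K) T} \<approx>
    iso_classes (opposite (loop_arrow K)) {T. tau_tilting K (opposite (loop_arrow K)) T}"
    \<comment> \<open>Both cardinalities are two; being positive, they also provide the finiteness
      that turns equal cardinality into equipotence.\<close>
    using A.card_tau_tilting arrow_in_algebra.card_tau_tilting[OF B]
    by (subst eqpoll_iff_card) (auto intro: card_ge_0_finite)
  let ?S = "iso_classes (loop_arrow K) {T. basic_tilting K (loop_arrow K) T}"
  assume "?S \<approx> iso_classes (opposite (loop_arrow K)) {T. basic_tilting K (opposite (loop_arrow K)) T}"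
  then obtain g where g: "inj_on g ?S"
    "g ` ?S = iso_classes (opposite (loop_arrow K)) {T. basic_tilting K (opposite (loop_arrow K)) T}"
    unfolding eqpoll_def bij_betw_def by blast
  obtain C where C: "iso_classes (opposite (loop_arrow K)) {T. basic_tilting K (opposite (loop_arrow K)) T} \<subseteq> {C}"
    using arrow_in_algebra.basic_tilting_unique[OF B] by blast
  \<comment> \<open>An equipotence would transfer the bound of one class from the opposite algebra,
    while \<open>T_proj\<close> and \<open>T_loop\<close> give two classes.\<close>
  have "u = v" if "u \<in> ?S" "v \<in> ?S" for u v
    using inj_onD[OF g(1) _ that] g(2) C that by blast
  then have "\<exists>D. ?S \<subseteq> {D}" by (cases "?S = {}") blast+
  then show False
    using two_iso_classes[of A.T_proj "{T. basic_tilting K (loop_arrow K) T}" A.T_loop "loop_arrow K"]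
      A.basic_tilting_T_proj A.basic_tilting_T_loop A.summands_not_iso(3)
      A.projective_left_module[OF A.summand_properties(1)] A.fd_left_module[OF A.summand_properties(5)] by auto
qed

end
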